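(* Let $m \geq 1$, $n \geq 1$, and $N_x \in \mathbb{Z}$ be integers. Let $u_0,u_1:[0,\infty)\to\mathbb{R}$ be functions ($m+2$ and $m+1$ times weakly differentiable, respectively) satisfying $$\begin{cases} (1+x)^{n} (u_0(x) - 2\pi N_x) \in L^1([0,\infty)),\\ (1+x)^{n}\partial^i u_0(x) \in L^1([0,\infty)), \quad i = 1, \dots, m+2,\\ (1+x)^{n}\partial^i u_1(x) \in L^1([0,\infty)), \quad i = 0,1, \dots, m+1. \end{cases}$$ Then, as $k \to 0$, $X$ and $Y$ coincide to order $m$ with $G_0\hat{X}_{formal}$ and $G_0\hat{Y}_{formal} e^{-i\theta_1 x \hat{\sigma}_3}G_0^{-1}(0)$ respectively in the following sense: there is a constant $C>0$ (independent of $x$ and $k$) such that for each $j = 0, 1, \dots, n$, and for $k\neq0$, $$\bigg|\frac{\partial^j}{\partial k^j}\big(X - G_0\hat{X}_p\big) \bigg| \leq \frac{C|k|^{m+1-2j}}{(1+x)^{n-j}}, \qquad x \geq 0, \ k \in (\bar{D}_3, \bar{D}_2),$$ $$\bigg|\frac{\partial^j}{\partial k^j}\big(Y - G_0\hat{Y}_p e^{-i\theta_1 x \hat{\sigma}_3}G_0^{-1}(0)\big) \bigg| \leq C(1 + x)^{j+2}|k|^{m+1-2j}e^{Cx|k|^{m+1}}, \qquad x \geq 0, \ k \in (\bar{D}_2, \bar{D}_3),$$ $$\bigg|\frac{\partial^j}{\partial k^j}\Big(\big(Y - G_0\hat{Y}_p e^{-i\theta_1 x \hat{\sigma}_3}G_0^{-1}(0)\big)e^{-2i\theta_1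 x\sigma_3}\Big) \bigg| \leq C(1 + x)^{j+2} |k|^{m+1-2j} e^{Cx|k|^{m+1}}, \qquad x \geq 0, \ k \in (\bar{D}_3, \bar{D}_2).$$ In particular, for each $x \geq 0$, it holds (for $k\ne 0$) that $X(x,\cdot)$ is bounded for $k \in (\bar{\mathbb{C}}_-, \bar{\mathbb{C}}_+)$; $Y(x,\cdot)$ is bounded for $k \in (\bar{\mathbb{C}}_+, \bar{\mathbb{C}}_-)$; and $Y(x,\cdot)e^{-2i\theta_1 x\sigma_3}$ is bounded for $k \in (\bar{\mathbb{C}}_-, \bar{\mathbb{C}}_+)$.
   Context: Pauli matrices: $\sigma_1=\begin{pmatrix}0&1\\1&0\end{pmatrix}$, $\sigma_2=\begin{pmatrix}0&-i\\i&0\end{pmatrix}$, $\sigma_3=\begin{pmatrix}1&0\\0&-1\end{pmatrix}$. $e^{\alpha\hat\sigma_3}A=e^{\alpha\sigma_3}Ae^{-\alpha\sigma_3}$ for a $2\times2$ matrix $A$. $|A|^2=\sum_{i,j}|A_{ij}|^2$. $A^{(d)}$ and $A^{(o)}$ are the diagonal and off-diagonal parts of $A$. $\theta_1=\theta_1(k)=\frac14(k-\frac1k)$ and $$\mathsf{U}(x,k)=-\frac{i(u_{0x}+u_1)}{4}\sigma_2+\frac1k\Big(\frac{i\sin u_0}{4}\sigma_1+\frac{i(\cos u_0-1)}{4}\sigma_3\Big).$$ $X,Y$ are the solutions of $X_x+i\theta_1[\sigma_3,X]=\mathsf{U}X$ defined by the Volterra equations $$X(x,k)=I+\int_\infty^xe^{i\theta_1(x'-x)\hat\sigma_3}(\mathsf{U}X)(x',k)dx',\qquad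 Y(x,k)=I+\int_0^xe^{i\theta_1(x'-x)\hat\sigma_3}(\mathsf{U}Y)(x',k)dx',$$ $X$ being defined for $k\in(\bar{\mathbb{C}}_-,\bar{\mathbb{C}}_+)\setminus\{0\}$ (columnwise) and $Y$ for $k\in\mathbb{C}\setminus\{0\}$. Here $\bar{\mathbb{C}}_\pm$ are the closed upper/lower half-planes. $$G_0(x)=(-1)^{N_x}\begin{pmatrix}\cos\frac{u_0(x)}2&-\sin\frac{u_0(x)}2\\ \sin\frac{u_0(x)}2&\cos\frac{u_0(x)}2\end{pmatrix}.$$ The expression $G_0\hat Y_pe^{-i\theta_1x\hat\sigma_3}G_0^{-1}(0)$ means $G_0(x)\hat Y_p(x,k)\big(e^{-i\theta_1x\sigma_3}G_0(0)^{-1}e^{i\theta_1x\sigma_3}\big)$, and similarly with $\hat Y_{formal}$. Domains: $D_2=\{\operatorname{Im}k>0,|k|<1\}$, $D_3=\{\operatorname{Im}k<0,|k|<1\}$; bars denote closures. For a statement about a $2\times2$ matrix, "$k\in(A,B)$" means it holds for the first column when $k\in A$ and for the second column when $k\in B$. Derivatives at boundary points are continuous extensions from the interior. Set $\hat{\mathsf{U}}_0=\frac{i(u_{0x}-u_1)}{4}\sigma_2$ and $\hat{\mathsf{U}}_1=\frac{i\sin u_0}{4}\sigma_1-\frac{i(\cos u_0-1)}{4}\sigma_3$. The formal series $$\hat X_{formal}=I+\hat X_1(x)k+\hat X_2(x)k^2+\cdots,\qquad \hat Y_{formal}=I+\hat Z_1(x)k+\cdots+\big(\hat W_1(x)k+\hat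 W_2(x)k^2+\cdots\big)e^{2i\theta_1x\sigma_3}$$ have coefficients determined recursively from $\hat X_{-1}=\hat Z_{-1}=0$, $\hat X_0=\hat Z_0=I$, $\hat W_{-1}=\hat W_0=0$, the normalizations $\lim_{x\to\infty}\hat X_j(x)=0$, $\hat Z_j(0)+\hat W_j(0)=0$ for $j\ge1$, and, for $j\ge0$, the relations $$\hat X_{j+1}^{(o)}=2i\sigma_3\big(-\partial_x\hat X_j^{(o)}-\tfrac i2\sigma_3\hat X_{j-1}^{(o)}+\hat{\mathsf{U}}_0\hat X_j^{(d)}+\hat{\mathsf{U}}_1^{(o)}\hat X_{j-1}^{(d)}+\hat{\mathsf{U}}_1^{(d)}\hat X_{j-1}^{(o)}\big),$$ $$\partial_x\hat X_{j+1}^{(d)}=\hat{\mathsf{U}}_0\hat X_{j+1}^{(o)}+\hat{\mathsf{U}}_1^{(o)}\hat X_j^{(o)}+\hat{\mathsf{U}}_1^{(d)}\hat X_j^{(d)},$$ the same two relations with every $\hat X_i$ replaced by $\hat Z_i$, and $$\hat W_{j+1}^{(d)}=2i\sigma_3\big(-\partial_x\hat W_j^{(d)}-\tfrac i2\sigma_3\hat W_{j-1}^{(d)}+\hat{\mathsf{U}}_0\hat W_j^{(o)}+\hat{\mathsf{U}}_1^{(o)}\hat W_{j-1}^{(o)}+\hat{\mathsf{U}}_1^{(d)}\hat W_{j-1}^{(d)}\big),$$ $$\partial_x\hat W_{j+1}^{(o)}=\hat{\mathsf{U}}_0\hat W_{j+1}^{(d)}+\hat{\mathsf{U}}_1^{(o)}\hat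 W_j^{(d)}+\hat{\mathsf{U}}_1^{(d)}\hat W_j^{(o)}.$$ The truncations are $\hat X_p=I+\hat X_1k+\cdots+\hat X_{m+1}k^{m+1}$ and $\hat Y_p=I+\hat Z_1k+\cdots+\hat Z_{m+1}k^{m+1}+\big(\hat W_1k+\cdots+\hat W_{m+1}k^{m+1}\big)e^{2i\theta_1x\sigma_3}$. *)

theory Defs
  imports "HOL-Analysis.Analysis"
begin

section \<open>Weak derivatives on the half-line\<close>

text \<open>The test functions are the smooth functions with compact support in \<open>(0,\<infinity>)\<close>.\<close>
definition test_function :: "(real \<Rightarrow> real) \<Rightarrow> bool" where
  "test_function \<phi> \<longleftrightarrow>
     (\<forall>j x. (deriv ^^ j) \<phi> field_differentiable (at x)) \<and>
     (\<exists>a b. 0 < a \<and> (\<forall>x. x \<notin> {a..b} \<longrightarrow> \<phi> x = 0))"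

definition weak_deriv :: "nat \<Rightarrow> (real \<Rightarrow> real) \<Rightarrow> (real \<Rightarrow> real) \<Rightarrow> bool" where
  "weak_deriv i f g \<longleftrightarrow>
     (\<forall>a b. 0 < a \<longrightarrow> f absolutely_integrable_on {a..b} \<and> g absolutely_integrable_on {a..b}) \<and>
     (\<forall>\<phi>. test_function \<phi> \<longrightarrow>
        integral {0<..} (\<lambda>x. f x * (deriv ^^ i) \<phi> x)
          = (-1) ^ i * integral {0<..} (\<lambda>x. g x * \<phi> x))"

definition weighted_L1 :: "nat \<Rightarrow> (real \<Rightarrow> real) \<Rightarrow> bool" where
  "weighted_L1 n f \<longleftrightarrow> (\<lambda>x. (1 + x) ^ n * f x) absolutely_integrable_on {0..}"

definition weak_deriv_weighted_L1 :: "nat \<Rightarrow> nat \<Rightarrow> (real \<Rightarrow> real) \<Rightarrow> bool" where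
  "weak_deriv_weighted_L1 n i f \<longleftrightarrow> (\<exists>g. weak_deriv i f g \<and> weighted_L1 n g)"

section \<open>Matrices\<close>

type_synonym cmat = "complex^2^2"

definition mat_scale :: "complex \<Rightarrow> cmat \<Rightarrow> cmat" (infixr "*k" 75) where
  "c *k A = (\<chi> i j. c * A $ i $ j)"

definition sigma1 :: cmat where "sigma1 = vector [vector [0, 1], vector [1, 0]]"
definition sigma2 :: cmat where "sigma2 = vector [vector [0, -\<i>], vector [\<i>, 0]]"
definition sigma3 :: cmat where "sigma3 = vector [vector [1, 0], vector [0, -1]]"

text \<open>The matrix exponential of \<open>\<alpha> \<sigma>\<^sub>3\<close>, which is diagonal.\<close>
definition exp_s3 :: "complex \<Rightarrow> cmat" where
  "exp_s3 \<alpha> = vector [vector [exp \<alpha>, 0], vector [0, exp (-\<alpha>)]]"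

definition exp_s3_hat :: "complex \<Rightarrow> cmat \<Rightarrow> cmat" where
  "exp_s3_hat \<alpha> A = exp_s3 \<alpha> ** A ** exp_s3 (-\<alpha>)"

definition diag_part :: "cmat \<Rightarrow> cmat" where
  "diag_part A = (\<chi> i j. if i = j then A $ i $ j else 0)"

definition offdiag_part :: "cmat \<Rightarrow> cmat" where
  "offdiag_part A = (\<chi> i j. if i = j then 0 else A $ i $ j)"

section \<open>The Lax pair data\<close>

definition theta1 :: "complex \<Rightarrow> complex" where
  "theta1 k = (k - 1 / k) / 4"

text \<open>One-sided at \<open>x = 0\<close>: the values of \<open>f\<close> on the negative axis play no role. It is applied to the
  continuous representative of a function with integrable weak derivatives of orders 1 and 2 (at
  least), for which this classical derivative exists on \<open>[0,\<infinity>)\<close> and is the weak one.\<close>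
definition dx :: "(real \<Rightarrow> real) \<Rightarrow> real \<Rightarrow> real" where
  "dx f x = vector_derivative f (at x within {0..})"

definition U :: "(real \<Rightarrow> real) \<Rightarrow> (real \<Rightarrow> real) \<Rightarrow> real \<Rightarrow> complex \<Rightarrow> cmat" where
  "U u0 u1 x k =
     (- \<i> * of_real (dx u0 x + u1 x) / 4) *k sigma2
     + (1 / k) *k ((\<i> * of_real (sin (u0 x)) / 4) *k sigma1
                  + (\<i> * of_real (cos (u0 x) - 1) / 4) *k sigma3)"

definition U0_hat :: "(real \<Rightarrow> real) \<Rightarrow> (real \<Rightarrow> real) \<Rightarrow> real \<Rightarrow> cmat" where
  "U0_hat u0 u1 x = (\<i> * of_real (dx u0 x - u1 x) / 4) *k sigma2"

definition U1_hat :: "(real \<Rightarrow> real) \<Rightarrow> real \<Rightarrow> cmat" where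
  "U1_hat u0 x =
     (\<i> * of_real (sin (u0 x)) / 4) *k sigma1 - (\<i> * of_real (cos (u0 x) - 1) / 4) *k sigma3"

definition G0 :: "int \<Rightarrow> (real \<Rightarrow> real) \<Rightarrow> real \<Rightarrow> cmat" where
  "G0 N u0 x = ((-1) powi N) *k
     vector [vector [of_real (cos (u0 x / 2)), of_real (- sin (u0 x / 2))],
             vector [of_real (sin (u0 x / 2)), of_real (cos (u0 x / 2))]]"

section \<open>Domains of the spectral parameter\<close>

definition C_upper :: "complex set" where "C_upper = {k. Im k \<ge> 0}"
definition C_lower :: "complex set" where "C_lower = {k. Im k \<le> 0}"

definition D2 :: "complex set" where "D2 = {k. Im k > 0 \<and> cmod k < 1}"
definition D3 :: "complex set" where "D3 = {k. Im k < 0 \<and> cmod k < 1}"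

text \<open>The set over which \<open>k\<close> ranges in the \<open>c\<close>-th column when ``\<open>k \<in> (A, B)\<close>'', with
  the origin always left out.\<close>
definition col_dom :: "complex set \<Rightarrow> complex set \<Rightarrow> 2 \<Rightarrow> complex set" where
  "col_dom A B c = (if c = 1 then A else B) - {0}"

section \<open>The Volterra equations\<close>

definition volterra_integrand ::
  "(real \<Rightarrow> real) \<Rightarrow> (real \<Rightarrow> real) \<Rightarrow> (real \<Rightarrow> complex \<Rightarrow> cmat) \<Rightarrow> real \<Rightarrow> complex \<Rightarrow> real \<Rightarrow> cmat"
  where
  "volterra_integrand u0 u1 A x k x' =
     exp_s3_hat (\<i> * theta1 k * of_real (x' - x)) (U u0 u1 x' k ** A x' k)"

text \<open>The \<open>c\<close>-th column of the integrand involves only the \<open>c\<close>-th column of \<open>X\<close>, so the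
  equation makes sense column by column; \<open>X\<close> is unconstrained where it is not defined.\<close>
definition volterra_X ::
  "(real \<Rightarrow> real) \<Rightarrow> (real \<Rightarrow> real) \<Rightarrow> (real \<Rightarrow> complex \<Rightarrow> cmat) \<Rightarrow> bool" where
  "volterra_X u0 u1 X \<longleftrightarrow>
     (\<forall>c. \<forall>k\<in>col_dom C_lower C_upper c. \<forall>x\<ge>0.
        (\<lambda>x'. column c (volterra_integrand u0 u1 X x k x')) absolutely_integrable_on {x..} \<and>
        column c (X x k) =
          column c (mat 1) - integral {x..} (\<lambda>x'. column c (volterra_integrand u0 u1 X x k x')))"

definition volterra_Y ::
  "(real \<Rightarrow> real) \<Rightarrow> (real \<Rightarrow> real) \<Rightarrow> (real \<Rightarrow> complex \<Rightarrow> cmat) \<Rightarrow> bool" where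
  "volterra_Y u0 u1 Y \<longleftrightarrow>
     (\<forall>k. k \<noteq> 0 \<longrightarrow> (\<forall>x\<ge>0.
        volterra_integrand u0 u1 Y x k absolutely_integrable_on {0..x} \<and>
        Y x k = mat 1 + integral {0..x} (volterra_integrand u0 u1 Y x k)))"

section \<open>The coefficients of the formal solutions\<close>

text \<open>Only the relations with \<open>j \<le> m\<close> are imposed. They determine the coefficients of order at
  most \<open>m + 1\<close>, which are the only ones that enter the truncations; the data are not smooth
  enough for all the later relations to make sense.\<close>

definition recursion_XZ ::
  "nat \<Rightarrow> (real \<Rightarrow> real) \<Rightarrow> (real \<Rightarrow> real) \<Rightarrow> (int \<Rightarrow> real \<Rightarrow> cmat) \<Rightarrow> bool" where
  "recursion_XZ m u0 u1 A \<longleftrightarrow>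
     (\<forall>x\<ge>0. A (-1) x = 0 \<and> A 0 x = mat 1) \<and>
     (\<forall>j\<in>{0..int m}. \<forall>x\<ge>0.
        (\<exists>D. ((\<lambda>y. offdiag_part (A j y)) has_vector_derivative D) (at x within {0..}) \<and>
             offdiag_part (A (j + 1) x) =
               ((2 * \<i>) *k sigma3) **
                 (- D - (\<i> / 2) *k (sigma3 ** offdiag_part (A (j - 1) x))
                  + U0_hat u0 u1 x ** diag_part (A j x)
                  + offdiag_part (U1_hat u0 x) ** diag_part (A (j - 1) x)
                  + diag_part (U1_hat u0 x) ** offdiag_part (A (j - 1) x))) \<and>
        ((\<lambda>y. diag_part (A (j + 1) y)) has_vector_derivative
            (U0_hat u0 u1 x ** offdiag_part (A (j + 1) x)
             + offdiag_part (U1_hat u0 x) ** offdiag_part (A j x)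
             + diag_part (U1_hat u0 x) ** diag_part (A j x))) (at x within {0..}))"

definition recursion_W ::
  "nat \<Rightarrow> (real \<Rightarrow> real) \<Rightarrow> (real \<Rightarrow> real) \<Rightarrow> (int \<Rightarrow> real \<Rightarrow> cmat) \<Rightarrow> bool" where
  "recursion_W m u0 u1 W \<longleftrightarrow>
     (\<forall>x\<ge>0. W (-1) x = 0 \<and> W 0 x = 0) \<and>
     (\<forall>j\<in>{0..int m}. \<forall>x\<ge>0.
        (\<exists>D. ((\<lambda>y. diag_part (W j y)) has_vector_derivative D) (at x within {0..}) \<and>
             diag_part (W (j + 1) x) =
               ((2 * \<i>) *k sigma3) **
                 (- D - (\<i> / 2) *k (sigma3 ** diag_part (W (j - 1) x))
                  + U0_hat u0 u1 x ** offdiag_part (W j x)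
                  + offdiag_part (U1_hat u0 x) ** offdiag_part (W (j - 1) x)
                  + diag_part (U1_hat u0 x) ** diag_part (W (j - 1) x))) \<and>
        ((\<lambda>y. offdiag_part (W (j + 1) y)) has_vector_derivative
            (U0_hat u0 u1 x ** diag_part (W (j + 1) x)
             + offdiag_part (U1_hat u0 x) ** diag_part (W j x)
             + diag_part (U1_hat u0 x) ** offdiag_part (W j x))) (at x within {0..}))"

definition X_formal_coeffs ::
  "nat \<Rightarrow> (real \<Rightarrow> real) \<Rightarrow> (real \<Rightarrow> real) \<Rightarrow> (int \<Rightarrow> real \<Rightarrow> cmat) \<Rightarrow> bool" where
  "X_formal_coeffs m u0 u1 Xh \<longleftrightarrow>
     recursion_XZ m u0 u1 Xh \<and> (\<forall>j\<in>{1..int m + 1}. (Xh j \<longlongrightarrow> 0) at_top)"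

definition Y_formal_coeffs ::
  "nat \<Rightarrow> (real \<Rightarrow> real) \<Rightarrow> (real \<Rightarrow> real) \<Rightarrow> (int \<Rightarrow> real \<Rightarrow> cmat) \<Rightarrow> (int \<Rightarrow> real \<Rightarrow> cmat) \<Rightarrow> bool"
  where
  "Y_formal_coeffs m u0 u1 Zh Wh \<longleftrightarrow>
     recursion_XZ m u0 u1 Zh \<and> recursion_W m u0 u1 Wh \<and>
     (\<forall>j\<in>{1..int m + 1}. Zh j 0 + Wh j 0 = 0)"

definition X_trunc :: "nat \<Rightarrow> (int \<Rightarrow> real \<Rightarrow> cmat) \<Rightarrow> real \<Rightarrow> complex \<Rightarrow> cmat" where
  "X_trunc m Xh x k = mat 1 + (\<Sum>j=1..m+1. (k ^ j) *k Xh (int j) x)"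

definition Y_trunc ::
  "nat \<Rightarrow> (int \<Rightarrow> real \<Rightarrow> cmat) \<Rightarrow> (int \<Rightarrow> real \<Rightarrow> cmat) \<Rightarrow> real \<Rightarrow> complex \<Rightarrow> cmat" where
  "Y_trunc m Zh Wh x k =
     mat 1 + (\<Sum>j=1..m+1. (k ^ j) *k Zh (int j) x)
     + (\<Sum>j=1..m+1. (k ^ j) *k Wh (int j) x) ** exp_s3 (2 * \<i> * theta1 k * of_real x)"

definition X_error ::
  "nat \<Rightarrow> int \<Rightarrow> (real \<Rightarrow> real) \<Rightarrow> (real \<Rightarrow> complex \<Rightarrow> cmat) \<Rightarrow> (int \<Rightarrow> real \<Rightarrow> cmat)
     \<Rightarrow> real \<Rightarrow> complex \<Rightarrow> cmat" where
  "X_error m N u0 X Xh x k = X x k - G0 N u0 x ** X_trunc m Xh x k"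

definition Y_error ::
  "nat \<Rightarrow> int \<Rightarrow> (real \<Rightarrow> real) \<Rightarrow> (real \<Rightarrow> complex \<Rightarrow> cmat) \<Rightarrow> (int \<Rightarrow> real \<Rightarrow> cmat)
     \<Rightarrow> (int \<Rightarrow> real \<Rightarrow> cmat) \<Rightarrow> real \<Rightarrow> complex \<Rightarrow> cmat" where
  "Y_error m N u0 Y Zh Wh x k =
     Y x k - G0 N u0 x ** Y_trunc m Zh Wh x k
               ** exp_s3_hat (- \<i> * theta1 k * of_real x) (matrix_inv (G0 N u0 0))"

section \<open>Derivatives in the spectral parameter, up to the boundary\<close>

text \<open>\<open>F j\<close>, for \<open>j \<le> n\<close>, is the \<open>j\<close>-th complex derivative of \<open>f\<close> in the interior of \<open>S\<close> and its
  continuous extension on the rest of \<open>S\<close>. For the sets \<open>S\<close> in use, which lie in the closure of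
  their interior, this determines \<open>F j\<close> on \<open>S\<close>.\<close>
definition derivs_upto_boundary ::
  "complex set \<Rightarrow> nat \<Rightarrow> (complex \<Rightarrow> complex^2) \<Rightarrow> (nat \<Rightarrow> complex \<Rightarrow> complex^2) \<Rightarrow> bool" where
  "derivs_upto_boundary S n f F \<longleftrightarrow>
     (\<forall>k\<in>S. F 0 k = f k) \<and>
     (\<forall>j\<le>n. continuous_on S (F j)) \<and>
     (\<forall>j<n. \<forall>k\<in>interior S. \<forall>i.
        ((\<lambda>z. F j z $ i) has_field_derivative F (Suc j) k $ i) (at k))"

text \<open>The norm on \<^typ>\<open>complex^2\<close> is the Euclidean one, i.e. the Frobenius norm of the column.\<close>
definition column_derivs_bounded ::
  "complex set \<Rightarrow> complex set \<Rightarrow> nat \<Rightarrow> (complex \<Rightarrow> cmat) \<Rightarrow> (nat \<Rightarrow> complex \<Rightarrow> real) \<Rightarrow> bool" where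
  "column_derivs_bounded A B n E b \<longleftrightarrow>
     (\<forall>c. \<exists>F. derivs_upto_boundary (col_dom A B c) n (\<lambda>k. column c (E k)) F \<and>
          (\<forall>j\<le>n. \<forall>k\<in>col_dom A B c. norm (F j k) \<le> b j k))"

definition columns_bounded :: "complex set \<Rightarrow> complex set \<Rightarrow> (complex \<Rightarrow> cmat) \<Rightarrow> bool" where
  "columns_bounded A B E \<longleftrightarrow> (\<forall>c. bounded ((\<lambda>k. column c (E k)) ` col_dom A B c))"

end

theory Submission
  imports Defs "HOL-Complex_Analysis.Complex_Analysis"
begin

text \<open>
  Why the expansions hold. A column \<open>c\<close> of a solution of \<open>X\<^sub>x + i \<theta>\<^sub>1 [\<sigma>\<^sub>3, X] = U X\<close> is a pair of scalar
  functions: the diagonal entry \<open>p\<close>, whose exponent is zero, and the other entry \<open>q\<close>, which carries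
  the exponent \<open>rate k = \<plusminus> i (k - 1/k) / 2\<close>. The matrix \<open>U\<close> is singular at \<open>k = 0\<close>, but multiplication
  of the column by \<open>G\<^sub>0\<^sup>-\<^sup>1\<close> turns the system into one whose coefficients are affine in \<open>k\<close>
  (\<open>gauge_transform\<close>); only the exponent stays singular. All four systems in play (two columns,
  each in the original gauge with the parameter \<open>1/k\<close> and in the new gauge with the parameter \<open>k\<close>)
  have the same shape, and the analysis is done once, in the locale \<open>lax_system\<close>.

  In such a system the formal recursion produces coefficients that lose one derivative per order
  (\<open>formal_regular\<close>). Their truncation at order \<open>m + 1\<close> therefore solves the system up to a residual
  \<open>k^(m+1) \<rho>(x)\<close> with \<open>(1 + x)^n \<rho>\<close> integrable (\<open>formal_trunc\<close>). The difference between a true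
  solution and the truncation solves the same system with that residual as source, and a Gronwall
  estimate bounds it as long as the exponential kernel stays bounded (\<open>solves_bound\<close>). Forward in
  \<open>x\<close> this is the case for \<open>Re (rate k) \<le> 0\<close>, backward for \<open>Re (rate k) \<ge> 0\<close>.

  The derivatives in \<open>k\<close> come from the Cauchy estimates, not from differentiated Volterra
  equations. The rate changes by less than \<open>1 / (1 + x)\<close> on the disc of radius
  \<open>|k|^2 / (2 (1 + x))\<close> around \<open>k\<close>, so on this disc the kernel over an interval of length \<open>x\<close> is at
  most \<open>3\<close> even where the disc leaves the half-plane of decay (\<open>rate_disc\<close>). Hence the bound on the
  error extends to the disc and every \<open>k\<close>-derivative costs a factor \<open>(1 + x) / |k|^2\<close>, which is the
  loss in the theorem.

  For \<open>Y\<close>, given by initial values at \<open>x = 0\<close>, this applies directly, because \<open>Y\<close> is holomorphic in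
  \<open>k \<noteq> 0\<close> (\<open>forward_expansion\<close>). The part of \<open>Y_formal\<close> with the factor \<open>e^{2 i \<theta>\<^sub>1 x \<sigma>\<^sub>3}\<close> is a formal
  solution of the system of the other column, and so is \<open>Y e^{-2 i \<theta>\<^sub>1 x \<sigma>\<^sub>3}\<close>; exchanging the two
  components thus gives the third estimate from the second. The bound obtained is
  \<open>C (1 + x)^j |k|^(m+1-2j)\<close>, which implies the stated one.

  For \<open>X\<close>, given by its values at \<open>x = \<infinity>\<close>, no disc around a boundary point is available, because
  the solution exists only in a closed half-plane. Instead the error is decomposed dyadically:
  let \<open>X\<^sub>l\<close> be the solution that agrees with the truncation at the point \<open>L\<^sub>l\<close>, where
  \<open>1 + L\<^sub>l = 2^l (1 + x)\<close>. Every \<open>X\<^sub>l\<close> is holomorphic in \<open>k \<noteq> 0\<close>, so that the Cauchy estimate applies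
  to \<open>X\<^sub>l\<^sub>+\<^sub>1 - X\<^sub>l\<close> with the radius \<open>|k|^2 / (2 (1 + L\<^sub>l\<^sub>+\<^sub>1))\<close>, and this difference is controlled by the
  integral of \<open>\<rho>\<close> over \<open>[L\<^sub>l, L\<^sub>l\<^sub>+\<^sub>1]\<close>. The factor \<open>(1 + L\<^sub>l\<^sub>+\<^sub>1)^j\<close> is absorbed by the weight
  \<open>(1 + t)^n\<close>, which leaves the decay \<open>(1 + x)^(j-n)\<close>, and the series of the derivatives converges
  uniformly up to the boundary (\<open>backward_expansion\<close>).

  The hypotheses speak of weak derivatives. The lemma of du Bois-Reymond turns them into classical
  absolutely continuous representatives (\<open>weak_derivs_imp_wsob\<close>), and everything after that uses only
  the relation ``\<open>g\<close> is integrable and \<open>f\<close> is its primitive'' (\<open>ac_deriv\<close>). Boundedness of the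
  solutions follows from the same Gronwall estimates, in the new gauge for \<open>|k| \<le> 1\<close> and in the
  original gauge for \<open>|k| \<ge> 1\<close>.
\<close>

(* The notation for coefficients of power series would make every matrix entry ambiguous. *)
no_notation fps_nth (infixl \<open>$\<close> 75)

section \<open>Absolutely continuous functions on the half-line\<close>

text \<open>An increment inequality that holds on all short intervals adds up along a partition. It serves as a
  substitute for differentiation where derivatives exist only almost everywhere.\<close>
lemma local_increment_bound:
  fixes F G :: "real \<Rightarrow> real"
  assumes "a \<le> b" "\<delta> > 0"
    and loc: "\<And>c d. \<lbrakk>a \<le> c; c \<le> d; d \<le> b; d - c < \<delta>\<rbrakk> \<Longrightarrow> F d - F c \<le> G d - G c"
  shows "F b - F a \<le> G b - G a"
proof -
  obtain N :: nat where N: "(b - a) / \<delta> < real N"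
    using reals_Archimedean2 by blast
  have Npos: "N > 0"
    using N assms(1,2) by (metis diff_ge_0_iff_ge divide_nonneg_pos gr0I linorder_not_le of_nat_0)
  define t where "t i = a + (b - a) * real i / real N" for i
  have tab: "a \<le> t i" "t i \<le> b" if "i \<le> N" for i
  proof -
    have "(b - a) * real i / real N \<le> (b - a) * 1"
      using that Npos assms(1) by (simp add: divide_le_eq mult_left_mono)
    then show "t i \<le> b" by (simp add: t_def)
    show "a \<le> t i" using assms(1) by (simp add: t_def)
  qed
  have step: "t (Suc i) - t i = (b - a) / real N" for i
    by (simp add: t_def add_divide_distrib[symmetric] algebra_simps)
  have small: "(b - a) / real N < \<delta>"
    using N assms(2) Npos by (simp add: field_simps)
  have "F (t i) - F a \<le> G (t i) - G a" if "i \<le> N" for i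
    using that
  proof (induction i)
    case 0
    show ?case by (simp add: t_def)
  next
    case (Suc i)
    have "F (t (Suc i)) - F (t i) \<le> G (t (Suc i)) - G (t i)"
    proof (rule loc)
      show "a \<le> t i" "t (Suc i) \<le> b" using tab Suc.prems by auto
      show "t i \<le> t (Suc i)" "t (Suc i) - t i < \<delta>" using step[of i] small divide_nonneg_nonneg[of "b - a" "real N"] assms(1)
        by (linarith | simp)+
    qed
    then show ?case using Suc by simp
  qed
  from this[of N] show ?thesis using Npos by (simp add: t_def)
qed

text \<open>The function \<open>f\<close> is locally absolutely continuous on \<open>[0,\<infinity>)\<close> with derivative \<open>g\<close> almost
  everywhere. The integrated form avoids null sets altogether.\<close>
definition ac_deriv :: "(real \<Rightarrow> 'a::{real_normed_field,euclidean_space}) \<Rightarrow> (real \<Rightarrow> 'a) \<Rightarrow> bool" where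
  "ac_deriv f g \<longleftrightarrow> (\<forall>x\<ge>0. g absolutely_integrable_on {0..x} \<and> integral {0..x} g = f x - f 0)"

lemma ac_deriv_increment:
  assumes "ac_deriv f g" "0 \<le> a" "a \<le> b"
  shows "g absolutely_integrable_on {a..b}" "f b - f a = integral {a..b} g"
proof -
  have ai: "g absolutely_integrable_on {0..b}" using assms by (auto simp: ac_deriv_def)
  show "g absolutely_integrable_on {a..b}"
    by (rule absolutely_integrable_on_subinterval[OF ai]) (use assms in auto)
  have "integral {0..a} g + integral {a..b} g = integral {0..b} g"
    using ai assms by (intro Henstock_Kurzweil_Integration.integral_combine)
      (auto simp: absolutely_integrable_on_def)
  moreover have "integral {0..b} g = f b - f 0" "integral {0..a} g = f a - f 0"
    using assms by (auto simp: ac_deriv_def)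
  ultimately show "f b - f a = integral {a..b} g" by (simp add: algebra_simps)
qed

lemma at_within_nonneg:
  assumes "0 \<le> x" "x < B"
  shows "at x within {0..} = at x within {0..B::real}"
  by (rule at_within_nhd[of x "{..<B}"]) (use assms in auto)

lemma continuous_on_atLeast0I:
  fixes f :: "real \<Rightarrow> 'a::topological_space"
  assumes "\<And>B. 0 \<le> B \<Longrightarrow> continuous_on {0..B} f"
  shows "continuous_on {0..} f"
  unfolding continuous_on_eq_continuous_within
proof
  fix x :: real assume x: "x \<in> {0..}"
  then have "continuous (at x within {0..x+1}) f"
    using assms[of "x+1"] by (auto simp: continuous_on_eq_continuous_within)
  then show "continuous (at x within {0..}) f"
    using at_within_nonneg[of x "x+1"] x by simp
qed

lemma ac_deriv_continuous:
  assumes "ac_deriv f g"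
  shows "continuous_on {0..} f"
proof (rule continuous_on_atLeast0I)
  fix B :: real assume "0 \<le> B"
  then have "g integrable_on {0..B}" using assms by (auto simp: ac_deriv_def absolutely_integrable_on_def)
  then have "continuous_on {0..B} (\<lambda>x. f 0 + integral {0..x} g)"
    by (intro continuous_intros indefinite_integral_continuous_1) auto
  then show "continuous_on {0..B} f"
    by (rule continuous_on_eq) (use assms in \<open>auto simp: ac_deriv_def\<close>)
qed

lemma ac_deriv_cong:
  assumes "\<And>x. 0 \<le> x \<Longrightarrow> f x = f' x" "\<And>x. 0 \<le> x \<Longrightarrow> g x = g' x"
  shows "ac_deriv f g \<longleftrightarrow> ac_deriv f' g'"
proof -
  have "g absolutely_integrable_on {0..x} \<longleftrightarrow> g' absolutely_integrable_on {0..x}"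
    "integral {0..x} g = integral {0..x} g'" if "0 \<le> x" for x
    using assms(2) by (intro set_integrable_cong integral_cong; force)+
  then show ?thesis using assms(1) by (simp add: ac_deriv_def)
qed

lemma ac_deriv_const: "ac_deriv (\<lambda>x. c) (\<lambda>x. 0)"
  by (simp add: ac_deriv_def)

lemma ac_deriv_add:
  assumes "ac_deriv f g" "ac_deriv h l"
  shows "ac_deriv (\<lambda>x. f x + h x) (\<lambda>x. g x + l x)"
  unfolding ac_deriv_def
proof (intro allI impI conjI)
  fix x :: real assume x: "0 \<le> x"
  have ai: "g absolutely_integrable_on {0..x}" "l absolutely_integrable_on {0..x}"
    using assms x by (auto simp: ac_deriv_def)
  then show "(\<lambda>x. g x + l x) absolutely_integrable_on {0..x}" by (rule set_integral_add)
  show "integral {0..x} (\<lambda>x. g x + l x) = f x + h x - (f 0 + h 0)"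
    using ai assms x by (subst integral_add) (auto simp: ac_deriv_def absolutely_integrable_on_def)
qed

lemma ac_deriv_cmult:
  assumes "ac_deriv f g"
  shows "ac_deriv (\<lambda>x. c * f x) (\<lambda>x. c * g x)"
  unfolding ac_deriv_def
proof (intro allI impI conjI)
  fix x :: real assume x: "0 \<le> x"
  have ai: "g absolutely_integrable_on {0..x}" "integral {0..x} g = f x - f 0"
    using assms x by (auto simp: ac_deriv_def)
  show "(\<lambda>x. c * g x) absolutely_integrable_on {0..x}"
    using ai(1) by (rule set_integrable_mult_right)
  show "integral {0..x} (\<lambda>x. c * g x) = c * f x - c * f 0"
    by (simp add: ai(2) right_diff_distrib)
qed

lemma ac_deriv_diff:
  assumes "ac_deriv f g" "ac_deriv h l"
  shows "ac_deriv (\<lambda>x. f x - h x) (\<lambda>x. g x - l x)"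
  using ac_deriv_add[OF assms(1) ac_deriv_cmult[OF assms(2), of "-1"]] by simp

lemma ac_deriv_sum:
  assumes "\<And>i. i \<in> A \<Longrightarrow> ac_deriv (f i) (g i)"
  shows "ac_deriv (\<lambda>x. \<Sum>i\<in>A. f i x) (\<lambda>x. \<Sum>i\<in>A. g i x)"
  using assms
  by (induction A rule: infinite_finite_induct) (auto intro: ac_deriv_const ac_deriv_add)

lemma ac_derivI_continuous:
  assumes "\<And>x. 0 \<le> x \<Longrightarrow> (f has_vector_derivative g x) (at x within {0..})"
    and "continuous_on {0..} g"
  shows "ac_deriv f g"
  unfolding ac_deriv_def
proof (intro allI impI conjI)
  fix x :: real assume x: "0 \<le> x"
  show "g absolutely_integrable_on {0..x}"
    by (rule absolutely_integrable_continuous_real) (rule continuous_on_subset[OF assms(2)], auto)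
  have "(g has_integral (f x - f 0)) {0..x}"
    by (rule fundamental_theorem_of_calculus[OF x])
      (rule has_vector_derivative_within_subset[OF assms(1)], auto)
  then show "integral {0..x} g = f x - f 0" by (simp add: integral_unique)
qed

lemma ac_deriv_imp_has_vector_derivative:
  assumes "ac_deriv f g" "continuous_on {0..} g" "0 \<le> x"
  shows "(f has_vector_derivative g x) (at x within {0..})"
proof -
  have "((\<lambda>u. f 0 + integral {0..u} g) has_vector_derivative g x) (at x within {0..x+1})"
    by (rule has_vector_derivative_eq_rhs, rule has_vector_derivative_add,
        rule has_vector_derivative_const, rule integral_has_vector_derivative[where b = "x+1"])
      (use assms in \<open>auto intro: continuous_on_subset\<close>)
  then have "((\<lambda>u. f 0 + integral {0..u} g) has_vector_derivative g x) (at x within {0..})"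
    using at_within_nonneg[of x "x+1"] assms by simp
  then show ?thesis
    by (rule has_vector_derivative_transform[rotated 2]) (use assms in \<open>auto simp: ac_deriv_def\<close>)
qed

lemma ai_mult_continuous:
  fixes f g :: "real \<Rightarrow> 'a::{real_normed_field,euclidean_space}"
  assumes "continuous_on S f" "\<And>x. x \<in> S \<Longrightarrow> norm (f x) \<le> C" "g absolutely_integrable_on S"
    "S \<in> sets lebesgue"
  shows "(\<lambda>x. f x * g x) absolutely_integrable_on S"
  by (rule absolutely_integrable_bounded_measurable_product[where h = "(*)"])
    (use assms in \<open>auto intro: bilinear_times continuous_imp_measurable_on_sets_lebesgue simp: bounded_iff\<close>)

lemma ai_mult_continuous_Icc:
  fixes f g :: "real \<Rightarrow> 'a::{real_normed_field,euclidean_space}"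
  assumes "continuous_on {a..b} f" "g absolutely_integrable_on {a..b}"
  shows "(\<lambda>x. f x * g x) absolutely_integrable_on {a..b}"
proof -
  have "bounded (f ` {a..b})" using assms(1) compact_continuous_image compact_imp_bounded compact_Icc by blast
  then obtain C where "\<And>x. x \<in> {a..b} \<Longrightarrow> norm (f x) \<le> C"
    unfolding bounded_iff by blast
  then show ?thesis using assms by (intro ai_mult_continuous) auto
qed

lemma integral_norm_le:
  fixes f :: "real \<Rightarrow> 'a::euclidean_space"
  assumes "f absolutely_integrable_on S"
  shows "norm (integral S f) \<le> integral S (\<lambda>x. norm (f x))"
  using assms by (intro integral_norm_bound_integral) (auto simp: absolutely_integrable_on_def)

text \<open>The product rule. The defect \<open>F\<close> of the product rule has increments on short intervals that are
  smaller than \<open>\<epsilon>\<close> times the increments of \<open>\<integral> |g| + |l|\<close>, by uniform continuity of \<open>f\<close> and \<open>h\<close>;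
  since \<open>\<epsilon>\<close> is arbitrary, \<open>F\<close> is constant.\<close>
lemma ac_deriv_mult:
  assumes fg: "ac_deriv f g" and hl: "ac_deriv h l"
  shows "ac_deriv (\<lambda>x. f x * h x) (\<lambda>x. g x * h x + f x * l x)"
  unfolding ac_deriv_def
proof (intro allI impI conjI)
  fix x :: real assume x: "0 \<le> x"
  have cont: "continuous_on {a..b} f" "continuous_on {a..b} h" if "0 \<le> a" for a b
    using ac_deriv_continuous[OF fg] ac_deriv_continuous[OF hl] that
    by (auto elim: continuous_on_subset)
  have ai: "g absolutely_integrable_on {a..b}" "l absolutely_integrable_on {a..b}"
    if "0 \<le> a" "a \<le> b" for a b
    using ac_deriv_increment fg hl that by auto
  have aih: "(\<lambda>x. h x * g x) absolutely_integrable_on {a..b}" "(\<lambda>x. f x * l x) absolutely_integrable_on {a..b}"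
    if "0 \<le> a" "a \<le> b" for a b
    using that by (auto intro!: ai_mult_continuous_Icc cont ai)
  then have aiD: "(\<lambda>x. g x * h x + f x * l x) absolutely_integrable_on {a..b}"
    if "0 \<le> a" "a \<le> b" for a b
    using that by (auto intro!: set_integral_add simp: mult.commute)
  show "(\<lambda>x. g x * h x + f x * l x) absolutely_integrable_on {0..x}" using aiD x by auto
  define F where "F t = f t * h t - integral {0..t} (\<lambda>x. g x * h x + f x * l x)" for t
  define M where "M t = integral {0..t} (\<lambda>t. norm (g t)) + integral {0..t} (\<lambda>t. norm (l t))" for t
  have split: "integral {0..d} \<phi> - integral {0..c} \<phi> = integral {c..d} \<phi>"
    if "\<phi> integrable_on {0..d}" "0 \<le> c" "c \<le> d" for c d and \<phi> :: "real \<Rightarrow> 'e::euclidean_space"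
    using Henstock_Kurzweil_Integration.integral_combine[of 0 c d \<phi>] that by (simp add: algebra_simps)
  have "norm (F x - F 0) \<le> \<epsilon> * M x" if "\<epsilon> > 0" for \<epsilon>
  proof -
    have "uniformly_continuous_on {0..x} f" "uniformly_continuous_on {0..x} h"
      using cont[of 0 x] by (auto intro: compact_uniformly_continuous)
    then obtain d1 d2 where d: "d1 > 0" "d2 > 0"
      "\<And>s t. \<lbrakk>s \<in> {0..x}; t \<in> {0..x}; dist s t < d1\<rbrakk> \<Longrightarrow> dist (f s) (f t) < \<epsilon>"
      "\<And>s t. \<lbrakk>s \<in> {0..x}; t \<in> {0..x}; dist s t < d2\<rbrakk> \<Longrightarrow> dist (h s) (h t) < \<epsilon>"
      using \<open>\<epsilon> > 0\<close> unfolding uniformly_continuous_on_def by metis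
    have "norm (F x - F 0) - norm (F 0 - F 0) \<le> \<epsilon> * M x - \<epsilon> * M 0"
    proof (rule local_increment_bound[where \<delta> = "min d1 d2" and F = "\<lambda>t. norm (F t - F 0)"])
      fix c e assume ce: "0 \<le> c" "c \<le> e" "e \<le> x" "e - c < min d1 d2"
      have "f e * h e - f c * h c = integral {c..e} g * h e + f c * integral {c..e} l"
        using ac_deriv_increment(2)[OF fg ce(1,2)] ac_deriv_increment(2)[OF hl ce(1,2)]
        by (simp flip: \<open>f e - f c = integral {c..e} g\<close>) (simp add: algebra_simps)
      also have "\<dots> = integral {c..e} (\<lambda>t. g t * h e + f c * l t)"
        using ai[OF ce(1,2)]
        by (subst integral_add) (auto simp: absolutely_integrable_on_def intro: integrable_on_mult_left integrable_on_mult_right)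
      finally have 1: "f e * h e - f c * h c = \<dots>" .
      have 2: "integral {0..e} (\<lambda>x. g x * h x + f x * l x) - integral {0..c} (\<lambda>x. g x * h x + f x * l x)
          = integral {c..e} (\<lambda>x. g x * h x + f x * l x)"
        using aiD[of 0 e] ce by (intro split) (auto simp: absolutely_integrable_on_def)
      have aiE: "(\<lambda>t. g t * h e + f c * l t) absolutely_integrable_on {c..e}"
        using ai[OF ce(1,2)] by (intro set_integral_add set_integrable_mult_left set_integrable_mult_right)
      have "F e - F c = integral {c..e} (\<lambda>t. g t * h e + f c * l t) - integral {c..e} (\<lambda>x. g x * h x + f x * l x)"
        unfolding F_def 1[symmetric] 2[symmetric] by (simp add: algebra_simps)
      also have "\<dots> = integral {c..e} (\<lambda>t. (g t * h e + f c * l t) - (g t * h t + f t * l t))"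
        using aiE aiD[OF ce(1,2)] by (subst integral_diff) (auto simp: absolutely_integrable_on_def)
      finally have 3: "F e - F c = \<dots>" .
      have nint: "(\<lambda>t. norm (g t)) integrable_on {c..e}" "(\<lambda>t. norm (l t)) integrable_on {c..e}"
        if "0 \<le> c" "c \<le> e" for c e using ai[OF that] by (auto simp: absolutely_integrable_on_def)
      have "norm (F e - F c) \<le> integral {c..e} (\<lambda>t. \<epsilon> * (norm (g t) + norm (l t)))"
        unfolding 3
      proof (rule integral_norm_bound_integral)
        show "(\<lambda>t. g t * h e + f c * l t - (g t * h t + f t * l t)) integrable_on {c..e}"
          using aiE aiD[OF ce(1,2)] by (intro integrable_diff) (auto simp: absolutely_integrable_on_def)
        show "(\<lambda>t. \<epsilon> * (norm (g t) + norm (l t))) integrable_on {c..e}"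
          using nint[OF ce(1,2)] by (intro integrable_on_mult_right integrable_add)
        fix t assume t: "t \<in> {c..e}"
        have "norm (g t * h e + f c * l t - (g t * h t + f t * l t)) =
            norm (g t * (h e - h t) + (f c - f t) * l t)" by (simp add: algebra_simps)
        also have "\<dots> \<le> norm (g t) * norm (h e - h t) + norm (f c - f t) * norm (l t)"
          by (metis norm_mult norm_triangle_ineq)
        also have "\<dots> \<le> norm (g t) * \<epsilon> + \<epsilon> * norm (l t)"
          using d(3)[of c t] d(4)[of e t] t ce
          by (intro add_mono mult_left_mono mult_right_mono) (auto simp: dist_norm)
        finally show "norm (g t * h e + f c * l t - (g t * h t + f t * l t)) \<le> \<epsilon> * (norm (g t) + norm (l t))"
          by (simp add: algebra_simps)
      qed
      also have "\<dots> = \<epsilon> * (integral {c..e} (\<lambda>t. norm (g t)) + integral {c..e} (\<lambda>t. norm (l t)))"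
        using nint[OF ce(1,2)] by (simp add: integral_add)
      also have "\<dots> = \<epsilon> * M e - \<epsilon> * M c"
        using split[OF nint(1)[of 0 e], of c] split[OF nint(2)[of 0 e], of c] ce
        by (simp add: M_def algebra_simps)
      finally show "norm (F e - F 0) - norm (F c - F 0) \<le> \<epsilon> * M e - \<epsilon> * M c"
        by (smt (verit) diff_diff_eq2 diff_add_cancel norm_triangle_ineq2)
    qed (use x d in auto)
    then show ?thesis by (simp add: M_def)
  qed
  note bound = this
  have "F x = F 0"
  proof (rule ccontr)
    assume "F x \<noteq> F 0"
    then have pos: "norm (F x - F 0) > 0" by simp
    have M0: "M x \<ge> 0" unfolding M_def using ai[of 0 x] x
      by (intro add_nonneg_nonneg integral_nonneg) (auto simp: absolutely_integrable_on_def)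
    have "norm (F x - F 0) \<le> norm (F x - F 0) / (2 * (M x + 1)) * M x"
      by (rule bound) (use pos M0 in auto)
    also have "\<dots> < norm (F x - F 0)"
    proof -
      have "M x / (2 * (M x + 1)) < 1" using M0 by (simp add: divide_less_eq)
      then show ?thesis using mult_strict_left_mono[OF _ pos, of "M x / (2 * (M x + 1))" 1] by simp
    qed
    finally show False by simp
  qed
  then show "integral {0..x} (\<lambda>x. g x * h x + f x * l x) = f x * h x - f 0 * h 0"
    by (simp add: F_def algebra_simps)
qed

section \<open>Weighted Sobolev classes\<close>

definition weighted_L1c :: "nat \<Rightarrow> (real \<Rightarrow> complex) \<Rightarrow> bool" where
  "weighted_L1c n f \<longleftrightarrow> (\<lambda>x. of_real ((1 + x) ^ n) * f x) absolutely_integrable_on {0..}"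

lemma weighted_L1c_cong:
  assumes "\<And>x. 0 \<le> x \<Longrightarrow> f x = g x"
  shows "weighted_L1c n f \<longleftrightarrow> weighted_L1c n g"
  unfolding weighted_L1c_def using assms by (intro set_integrable_cong) auto

lemma weighted_L1c_zero [simp]: "weighted_L1c n (\<lambda>x. 0)"
  by (simp add: weighted_L1c_def)

lemma weighted_L1c_add:
  "weighted_L1c n f \<Longrightarrow> weighted_L1c n g \<Longrightarrow> weighted_L1c n (\<lambda>x. f x + g x)"
  unfolding weighted_L1c_def distrib_left by (rule set_integral_add)

lemma weighted_L1c_cmult: 
  assumes "weighted_L1c n f" shows "weighted_L1c n (\<lambda>x. c * f x)"
proof -
  have "(\<lambda>x. c * (of_real ((1 + x) ^ n) * f x)) absolutely_integrable_on {0..}"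
    using assms unfolding weighted_L1c_def by (rule set_integrable_mult_right)
  then show ?thesis unfolding weighted_L1c_def by (simp add: mult.left_commute)
qed

lemma weighted_L1c_norm:
  assumes "weighted_L1c n f" shows "weighted_L1c n (\<lambda>x. of_real (norm (f x)))"
proof -
  have "(\<lambda>x. norm (of_real ((1 + x) ^ n) * f x)) absolutely_integrable_on {0..}"
    using assms unfolding weighted_L1c_def by (rule set_integrable_norm)
  from absolutely_integrable_linear[OF this bounded_linear_of_real[where 'a = complex]]
  have 1: "(\<lambda>x. complex_of_real (norm (of_real ((1 + x) ^ n) * f x))) absolutely_integrable_on {0..}"
    unfolding o_def .
  have 2: "complex_of_real (norm (of_real ((1 + x) ^ n) * f x)) = of_real ((1 + x) ^ n) * complex_of_real (norm (f x))"
    if "x \<in> {0..}" for x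
  proof -
    have "norm (of_real ((1 + x) ^ n) * f x) = (1 + x) ^ n * norm (f x)"
      using that unfolding norm_mult norm_of_real by simp
    then show ?thesis by (simp only: of_real_mult)
  qed
  show ?thesis unfolding weighted_L1c_def
    by (rule iffD1[OF set_integrable_cong 1]) (use 2 in auto)
qed

lemma weighted_L1c_mult_bounded:
  assumes "continuous_on {0..} f" "\<And>x. 0 \<le> x \<Longrightarrow> norm (f x) \<le> C" "weighted_L1c n h"
  shows "weighted_L1c n (\<lambda>x. f x * h x)"
proof -
  have "(\<lambda>x. f x * (of_real ((1 + x) ^ n) * h x)) absolutely_integrable_on {0..}"
    using assms unfolding weighted_L1c_def by (intro ai_mult_continuous[where C = C and f = f]) auto
  then show ?thesis unfolding weighted_L1c_def by (simp add: mult.left_commute)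
qed

lemma weighted_L1c_mono:
  assumes "weighted_L1c n f" "i \<le> n" shows "weighted_L1c i f"
proof -
  have 1: "(\<lambda>x. complex_of_real (1 / (1 + x) ^ (n - i)) * (of_real ((1 + x) ^ n) * f x)) absolutely_integrable_on {0..}"
  proof (rule ai_mult_continuous[where C = 1])
    show "continuous_on {0..} (\<lambda>x::real. complex_of_real (1 / (1 + x) ^ (n - i)))"
      by (intro continuous_intros) auto
    show "norm (complex_of_real (1 / (1 + x) ^ (n - i))) \<le> 1" if "x \<in> {0..}" for x
    proof -
      have "norm (complex_of_real (1 / (1 + x) ^ (n - i))) = 1 / (1 + x) ^ (n - i)"
        using that by (subst norm_of_real) simp
      also have "\<dots> \<le> 1" using that by (simp add: divide_le_eq)
      finally show ?thesis .
    qed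
  qed (use assms in \<open>auto simp: weighted_L1c_def\<close>)
  have "complex_of_real (1 / (1 + x) ^ (n - i)) * (of_real ((1 + x) ^ n) * f x) = of_real ((1 + x) ^ i) * f x"
    if "x \<in> {0..}" for x
  proof -
    have "(1 + x) ^ n = (1 + x) ^ (n - i) * (1 + x) ^ i" using assms(2) by (simp flip: power_add)
    then have "1 / (1 + x) ^ (n - i) * (1 + x) ^ n = (1 + x) ^ i" using that by simp
    then show ?thesis by (metis mult.assoc of_real_mult)
  qed
  note 2 = this
  show ?thesis unfolding weighted_L1c_def
    by (rule iffD1[OF set_integrable_cong 1]) (use 2 in auto)
qed

lemma weighted_L1c_imp_L1:
  assumes "weighted_L1c n f" shows "f absolutely_integrable_on {0..}"
  using weighted_L1c_mono[OF assms, of 0] by (simp add: weighted_L1c_def)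

lemma weighted_L1c_imp_Icc:
  assumes "weighted_L1c n f" "0 \<le> a" shows "f absolutely_integrable_on {a..b}"
  using weighted_L1c_imp_L1[OF assms(1)] by (rule set_integrable_subset) (use assms in auto)

text \<open>Functions with \<open>p\<close> derivatives such that the function and all these derivatives are integrable with
  the weight \<open>(1 + x)^n\<close>.\<close>
primrec wsob :: "nat \<Rightarrow> nat \<Rightarrow> (real \<Rightarrow> complex) \<Rightarrow> bool" where
  "wsob n 0 f \<longleftrightarrow> weighted_L1c n f"
| "wsob n (Suc p) f \<longleftrightarrow> weighted_L1c n f \<and> (\<exists>g. wsob n p g \<and> ac_deriv f g)"

text \<open>The same condition on the derivative of \<open>f\<close> only. Such functions are bounded but need not decay;
  the diagonal coefficients of the formal solutions are of this kind.\<close>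
definition bsob :: "nat \<Rightarrow> nat \<Rightarrow> (real \<Rightarrow> complex) \<Rightarrow> bool" where
  "bsob n p f \<longleftrightarrow> (\<exists>g. wsob n p g \<and> ac_deriv f g)"

lemma wsob_imp_weighted_L1c: "wsob n p f \<Longrightarrow> weighted_L1c n f"
  by (cases p) auto

lemma wsob_Suc_iff: "wsob n (Suc p) f \<longleftrightarrow> weighted_L1c n f \<and> bsob n p f"
  by (simp add: bsob_def)

lemma wsob_SucI: "weighted_L1c n f \<Longrightarrow> wsob n p g \<Longrightarrow> ac_deriv f g \<Longrightarrow> wsob n (Suc p) f"
  by auto

lemma wsob_SucD: "wsob n (Suc p) f \<Longrightarrow> wsob n p f"
proof (induction p arbitrary: f)
  case (Suc p)
  then obtain g where "weighted_L1c n f" "wsob n (Suc p) g" "ac_deriv f g" by auto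
  then show ?case using Suc.IH[of g] wsob_SucI by blast
qed simp

lemma wsob_mono: 
  assumes "wsob n p f" "q \<le> p" shows "wsob n q f"
  using assms(2,1)
proof (induction rule: inc_induct)
  case (step k) then show ?case using wsob_SucD by blast
qed

lemma bsob_mono: "bsob n p f \<Longrightarrow> q \<le> p \<Longrightarrow> bsob n q f"
  unfolding bsob_def using wsob_mono by blast

lemma wsob_cong:
  assumes "\<And>x. 0 \<le> x \<Longrightarrow> f x = f' x" shows "wsob n p f \<longleftrightarrow> wsob n p f'"
proof (cases p)
  case 0
  show ?thesis unfolding 0 wsob.simps by (rule weighted_L1c_cong[OF assms])
next
  case (Suc q)
  have "ac_deriv f g \<longleftrightarrow> ac_deriv f' g" for g by (rule ac_deriv_cong[OF assms]) simp_all
  moreover have "weighted_L1c n f \<longleftrightarrow> weighted_L1c n f'" by (rule weighted_L1c_cong[OF assms])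
  ultimately show ?thesis unfolding Suc wsob.simps by simp
qed

lemma bsob_cong:
  assumes "\<And>x. 0 \<le> x \<Longrightarrow> f x = f' x" shows "bsob n p f \<longleftrightarrow> bsob n p f'"
proof -
  have "ac_deriv f g \<longleftrightarrow> ac_deriv f' g" for g by (rule ac_deriv_cong[OF assms]) simp_all
  then show ?thesis unfolding bsob_def by simp
qed

lemma bsob_continuous: "bsob n p f \<Longrightarrow> continuous_on {0..} f"
  unfolding bsob_def using ac_deriv_continuous by blast

lemma wsob_Suc_continuous: "wsob n (Suc p) f \<Longrightarrow> continuous_on {0..} f"
  using wsob_Suc_iff bsob_continuous by blast

lemma bsob_bounded:
  assumes "bsob n p f" obtains C where "\<And>x. 0 \<le> x \<Longrightarrow> norm (f x) \<le> C"
proof -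
  obtain g where g: "wsob n p g" "ac_deriv f g" using assms unfolding bsob_def by blast
  have L1: "g absolutely_integrable_on {0..}"
    by (rule weighted_L1c_imp_L1[OF wsob_imp_weighted_L1c[OF g(1)]])
  have "norm (f x) \<le> norm (f 0) + integral {0..} (\<lambda>x. norm (g x))" if x: "0 \<le> x" for x
  proof -
    have ai: "g absolutely_integrable_on {0..x}" and "integral {0..x} g = f x - f 0"
      using g(2) x unfolding ac_deriv_def by blast+
    then have "norm (f x) \<le> norm (f 0) + norm (integral {0..x} g)"
      using norm_triangle_ineq[of "f 0" "f x - f 0"] by (metis add.commute diff_add_cancel)
    moreover have "norm (integral {0..x} g) \<le> integral {0..x} (\<lambda>x. norm (g x))"
      by (rule integral_norm_le[OF ai])
    moreover have "integral {0..x} (\<lambda>x. norm (g x)) \<le> integral {0..} (\<lambda>x. norm (g x))"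
      by (rule integral_subset_le) (use ai L1 in \<open>auto simp: absolutely_integrable_on_def\<close>)
    ultimately show ?thesis by linarith
  qed
  then show thesis by (rule that)
qed

lemma wsob_zero [simp]: "wsob n p (\<lambda>x. 0)"
proof (induction p)
  case (Suc p) then show ?case by (rule wsob_SucI[OF weighted_L1c_zero _ ac_deriv_const])
qed simp

lemma wsob_add: "wsob n p f \<Longrightarrow> wsob n p h \<Longrightarrow> wsob n p (\<lambda>x. f x + h x)"
proof (induction p arbitrary: f h)
  case (Suc p)
  then obtain g l where "wsob n p g" "ac_deriv f g" "wsob n p l" "ac_deriv h l" by auto
  then have "wsob n p (\<lambda>x. g x + l x)" "ac_deriv (\<lambda>x. f x + h x) (\<lambda>x. g x + l x)"
    using Suc.IH ac_deriv_add by blast+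
  with weighted_L1c_add[of n f h] Suc.prems show ?case
    by (intro wsob_SucI[of n _ p "\<lambda>x. g x + l x"]) auto
qed (simp add: weighted_L1c_add)

lemma wsob_cmult: "wsob n p f \<Longrightarrow> wsob n p (\<lambda>x. c * f x)"
proof (induction p arbitrary: f)
  case (Suc p)
  then obtain g where "wsob n p g" "ac_deriv f g" by auto
  then have "wsob n p (\<lambda>x. c * g x)" "ac_deriv (\<lambda>x. c * f x) (\<lambda>x. c * g x)"
    using Suc.IH ac_deriv_cmult by blast+
  with weighted_L1c_cmult[of n f c] Suc.prems show ?case
    by (intro wsob_SucI[of n _ p "\<lambda>x. c * g x"]) auto
qed (simp add: weighted_L1c_cmult)

lemma wsob_diff: "wsob n p f \<Longrightarrow> wsob n p h \<Longrightarrow> wsob n p (\<lambda>x. f x - h x)"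
  using wsob_add[OF _ wsob_cmult[of n p h "-1"], of f] by simp

lemma bsob_const [simp]: "bsob n p (\<lambda>x. c)"
  unfolding bsob_def using wsob_zero ac_deriv_const by blast

lemma bsob_add: "bsob n p f \<Longrightarrow> bsob n p h \<Longrightarrow> bsob n p (\<lambda>x. f x + h x)"
  unfolding bsob_def using wsob_add ac_deriv_add by blast

lemma weighted_L1c_bsob_mult: "bsob n p f \<Longrightarrow> weighted_L1c n h \<Longrightarrow> weighted_L1c n (\<lambda>x. f x * h x)"
  by (metis bsob_bounded bsob_continuous weighted_L1c_mult_bounded)

declare wsob.simps(2) [simp del]

text \<open>The class of decaying functions is a module over the class of bounded ones: in
  \<open>(f h)' = f' h + f h'\<close> every summand has a decaying factor.\<close>
lemma wsob_Suc_bsob_mult: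
  assumes "bsob n p f" "wsob n (Suc p) h"
  shows "wsob n (Suc p) (\<lambda>x. f x * h x)"
  using assms
proof (induction p arbitrary: f h)
  case 0
  then obtain g l where g: "weighted_L1c n g" "ac_deriv f g" and l: "weighted_L1c n l" "ac_deriv h l"
    unfolding bsob_def wsob.simps by blast
  have "bsob n 0 h" using 0(2) unfolding wsob_Suc_iff by blast
  then have "weighted_L1c n (\<lambda>x. h x * g x)" using weighted_L1c_bsob_mult g by blast
  then have "weighted_L1c n (\<lambda>x. g x * h x)" by (simp add: mult.commute)
  moreover have "weighted_L1c n (\<lambda>x. f x * l x)" using weighted_L1c_bsob_mult 0 l by blast
  ultimately have "weighted_L1c n (\<lambda>x. g x * h x + f x * l x)" by (rule weighted_L1c_add)
  then have "wsob n 0 (\<lambda>x. g x * h x + f x * l x)" by simp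
  from wsob_SucI[OF weighted_L1c_bsob_mult[OF 0(1) wsob_imp_weighted_L1c[OF 0(2)]]
      this ac_deriv_mult[OF g(2) l(2)]]
  show ?case .
next
  case (Suc p)
  then obtain g l where g: "wsob n (Suc p) g" "ac_deriv f g" and l: "wsob n (Suc p) l" "ac_deriv h l"
    unfolding bsob_def wsob.simps(2)[of n "Suc p"] by blast
  have h: "wsob n (Suc p) h" using Suc.prems(2) wsob_SucD by blast
  have "wsob n (Suc p) (\<lambda>x. h x * g x)"
  proof (rule Suc.IH)
    show "bsob n p h" using h unfolding wsob_Suc_iff by blast
  qed (fact g)
  then have "wsob n (Suc p) (\<lambda>x. g x * h x)" by (simp only: mult.commute)
  moreover have "wsob n (Suc p) (\<lambda>x. f x * l x)"
  proof (rule Suc.IH)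
    show "bsob n p f" using Suc.prems(1) by (rule bsob_mono) simp
  qed (fact l)
  ultimately have "wsob n (Suc p) (\<lambda>x. g x * h x + f x * l x)" by (rule wsob_add)
  from wsob_SucI[OF weighted_L1c_bsob_mult[OF Suc.prems(1) wsob_imp_weighted_L1c[OF Suc.prems(2)]]
      this ac_deriv_mult[OF g(2) l(2)]]
  show ?case .
qed

lemma wsob_bsob_mult:
  assumes "bsob n p f" "wsob n p h"
  shows "wsob n p (\<lambda>x. f x * h x)"
proof (cases p)
  case 0
  then have "weighted_L1c n h" using assms(2) by simp
  then show ?thesis unfolding 0 wsob.simps(1) by (rule weighted_L1c_bsob_mult[OF assms(1)])
next
  case (Suc q)
  have "bsob n q f" by (rule bsob_mono[OF assms(1)]) (simp add: Suc)
  moreover have "wsob n (Suc q) h" using assms(2) Suc by simp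
  ultimately show ?thesis unfolding Suc by (rule wsob_Suc_bsob_mult)
qed

lemma wsob_wsob_mult:
  assumes "wsob n (Suc p) f" "wsob n (Suc p) h"
  shows "wsob n (Suc p) (\<lambda>x. f x * h x)"
proof (rule wsob_Suc_bsob_mult[OF _ assms(2)])
  show "bsob n p f" using assms(1) unfolding wsob_Suc_iff by simp
qed

lemma ac_deriv_of_real:
  assumes "ac_deriv f g" 
  shows "ac_deriv (\<lambda>x. complex_of_real (f x)) (\<lambda>x. complex_of_real (g x))"
  unfolding ac_deriv_def
proof (intro allI impI conjI)
  fix x :: real assume "0 \<le> x"
  then have g: "g absolutely_integrable_on {0..x}" "integral {0..x} g = f x - f 0"
    using assms unfolding ac_deriv_def by blast+
  from absolutely_integrable_linear[OF g(1) bounded_linear_of_real[where 'a = complex]]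
  show "(\<lambda>x. complex_of_real (g x)) absolutely_integrable_on {0..x}" unfolding o_def .
  have "g integrable_on {0..x}" using g(1) unfolding absolutely_integrable_on_def by blast
  from integral_linear[OF this bounded_linear_of_real[where 'a = complex]]
  show "integral {0..x} (\<lambda>x. complex_of_real (g x)) = complex_of_real (f x) - complex_of_real (f 0)"
    unfolding o_def g(2) by simp
qed

section \<open>From weak derivatives to absolutely continuous representatives\<close>

text \<open>Differentiability of order \<open>j\<close> with explicit derivatives, which is easier to propagate through sums,
  products and compositions than the iterates of \<^const>\<open>deriv\<close>.\<close>
primrec diffn :: "nat \<Rightarrow> (real \<Rightarrow> real) \<Rightarrow> bool" where
  "diffn 0 f \<longleftrightarrow> True"
| "diffn (Suc j) f \<longleftrightarrow> (\<exists>f'. (\<forall>x. (f has_field_derivative f' x) (at x)) \<and> diffn j f')"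

lemma diffn_SucI: "(\<And>x. (f has_field_derivative f' x) (at x)) \<Longrightarrow> diffn j f' \<Longrightarrow> diffn (Suc j) f"
  by auto

lemma diffn_imp_higher_deriv:
  assumes "diffn (Suc j) f" shows "(deriv ^^ j) f field_differentiable (at x)"
  using assms
proof (induction j arbitrary: f)
  case 0
  then show ?case by (auto simp: field_differentiable_def)
next
  case (Suc j)
  then obtain f' where f': "\<And>x. (f has_field_derivative f' x) (at x)" "diffn (Suc j) f'"
    by (subst (asm) diffn.simps(2)) blast
  then have "deriv f = f'" by (intro ext DERIV_imp_deriv)
  then show ?case using Suc.IH[OF f'(2)] by (simp add: funpow_swap1)
qed

lemma diffn_Suc_mono: "diffn (Suc j) f \<Longrightarrow> diffn j f"
proof (induction j arbitrary: f)
  case (Suc j)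
  then obtain f' where f': "\<And>x. (f has_field_derivative f' x) (at x)" "diffn (Suc j) f'"
    by (subst (asm) diffn.simps(2)) blast
  show ?case by (rule diffn_SucI[OF f'(1) Suc.IH[OF f'(2)]])
qed simp

lemma diffn_add: "diffn j f \<Longrightarrow> diffn j g \<Longrightarrow> diffn j (\<lambda>x. f x + g x)"
proof (induction j arbitrary: f g)
  case (Suc j)
  from Suc.prems obtain f' g' where "\<And>x. (f has_field_derivative f' x) (at x)" "diffn j f'"
    "\<And>x. (g has_field_derivative g' x) (at x)" "diffn j g'" by (subst (asm) (1 2) diffn.simps(2)) blast
  then show ?case by (intro diffn_SucI[where f' = "\<lambda>x. f' x + g' x"] DERIV_add Suc.IH)
qed simp

lemma diffn_cmult: "diffn j f \<Longrightarrow> diffn j (\<lambda>x. c * f x)"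
proof (induction j arbitrary: f)
  case (Suc j)
  from Suc.prems obtain f' where "\<And>x. (f has_field_derivative f' x) (at x)" "diffn j f'"
    by (subst (asm) diffn.simps(2)) blast
  then show ?case by (intro diffn_SucI[where f' = "\<lambda>x. c * f' x"] DERIV_cmult Suc.IH)
qed simp

lemma diffn_mult: "diffn j f \<Longrightarrow> diffn j g \<Longrightarrow> diffn j (\<lambda>x. f x * g x)"
proof (induction j arbitrary: f g)
  case (Suc j)
  from Suc.prems obtain f' g' where f: "\<And>x. (f has_field_derivative f' x) (at x)" "diffn j f'" and
    g: "\<And>x. (g has_field_derivative g' x) (at x)" "diffn j g'" by (subst (asm) (1 2) diffn.simps(2)) blast
  have fg: "diffn j f" "diffn j g" using Suc.prems diffn_Suc_mono by blast+
  show ?case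
  proof (rule diffn_SucI)
    show "((\<lambda>x. f x * g x) has_field_derivative (f' x * g x + f x * g' x)) (at x)" for x
      by (rule derivative_eq_intros f g refl)+ simp
    show "diffn j (\<lambda>x. f' x * g x + f x * g' x)"
      by (intro diffn_add Suc.IH f g fg)
  qed
qed simp

lemma diffn_affine: "diffn j f \<Longrightarrow> diffn j (\<lambda>x. f (a * x + b))"
proof (induction j arbitrary: f)
  case (Suc j)
  from Suc.prems obtain f' where f: "\<And>x. (f has_field_derivative f' x) (at x)" "diffn j f'"
    by (subst (asm) diffn.simps(2)) blast
  show ?case
  proof (rule diffn_SucI)
    show "((\<lambda>x. f (a * x + b)) has_field_derivative (a * f' (a * x + b))) (at x)" for x
    proof -
      have "((\<lambda>x. a * x + b) has_field_derivative a) (at x)" by (auto intro!: derivative_eq_intros)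
      from DERIV_chain2[OF f(1) this] show ?thesis by (simp add: mult.commute)
    qed
    show "diffn j (\<lambda>x. a * f' (a * x + b))"
      by (intro diffn_cmult Suc.IH f)
  qed
qed simp

text \<open>The functions \<open>x^(-i) exp (-1/x)\<close>, extended by zero. The derivative of one of them is a linear
  combination of two others, so that their smoothness at the origin needs a single limit.\<close>
definition flat_exp :: "nat \<Rightarrow> real \<Rightarrow> real" where
  "flat_exp i x = (if x \<le> 0 then 0 else inverse x ^ i * exp (- inverse x))"

lemma has_derivative_flat_exp:
  "(flat_exp i has_field_derivative (flat_exp (i + 2) x - real i * flat_exp (i + 1) x)) (at x)"
proof -
  consider "x < 0" | "x > 0" | "x = 0" by linarith
  then show ?thesis
  proof cases
    case 1
    have "((\<lambda>x. 0) has_field_derivative 0) (at x)" by simp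
    then have "(flat_exp i has_field_derivative 0) (at x)"
      by (rule has_field_derivative_transform_within_open[where S = "{..<0}"])
        (use 1 in \<open>auto simp: flat_exp_def\<close>)
    then show ?thesis using 1 by (simp add: flat_exp_def)
  next
    case 2
    have "((\<lambda>x. inverse x ^ i * exp (- inverse x)) has_field_derivative
       (flat_exp (i + 2) x - real i * flat_exp (i + 1) x)) (at x)"
    proof (cases i)
      case 0
      then show ?thesis using 2
        by (auto intro!: derivative_eq_intros simp: flat_exp_def power2_eq_square)
    next
      case (Suc l)
      have inv: "(inverse has_field_derivative - (inverse x * inverse x)) (at x)"
        using 2 by (auto intro!: derivative_eq_intros simp: power2_eq_square)
      have e: "((\<lambda>x. exp (- inverse x)) has_field_derivative exp (- inverse x) * (inverse x * inverse x)) (at x)"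
        by (rule derivative_eq_intros inv refl)+ simp
      from DERIV_mult[OF DERIV_power_Suc[OF inv, of l] e] show ?thesis
        unfolding Suc using 2 by (simp add: flat_exp_def algebra_simps)
    qed
    then show ?thesis
      by (rule has_field_derivative_transform_within_open[where S = "{0<..}"])
        (use 2 in \<open>auto simp: flat_exp_def\<close>)
  next
    case 3
    have lim: "((\<lambda>h. flat_exp (Suc i) h) \<longlongrightarrow> 0) (at 0)"
    proof -
      have "((\<lambda>h. inverse h ^ Suc i / exp (inverse h)) \<longlongrightarrow> (0::real)) (at_right 0)"
        by (rule filterlim_compose[OF tendsto_power_div_exp_0 filterlim_inverse_at_top_right])
      then have "((\<lambda>h. flat_exp (Suc i) h) \<longlongrightarrow> 0) (at_right 0)"
        by (rule Lim_transform_eventually)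
          (auto simp: eventually_at_filter flat_exp_def exp_minus field_simps)
      moreover have "((\<lambda>h. flat_exp (Suc i) h) \<longlongrightarrow> 0) (at_left 0)"
        by (rule Lim_transform_eventually[OF tendsto_const])
          (auto simp: eventually_at_filter flat_exp_def)
      ultimately show ?thesis by (simp add: filterlim_at_split)
    qed
    have "((\<lambda>h. (flat_exp i (0 + h) - flat_exp i 0) / h) \<longlongrightarrow> 0) (at 0)"
      by (rule Lim_transform_eventually[OF lim])
        (auto simp: eventually_at_filter flat_exp_def field_simps)
    then have "(flat_exp i has_field_derivative 0) (at 0)" by (simp add: DERIV_def)
    then show ?thesis using 3 by (simp add: flat_exp_def)
  qed
qed

lemma diffn_flat_exp: "diffn j (flat_exp i)"
proof (induction j arbitrary: i)
  case (Suc j)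
  have "diffn j (\<lambda>x. flat_exp (i + 2) x + (- real i) * flat_exp (i + 1) x)"
    by (intro diffn_add diffn_cmult Suc.IH)
  then show ?case
    by (intro diffn_SucI[OF has_derivative_flat_exp]) simp
qed simp

text \<open>Smooth functions supported in \<open>[y, y + h]\<close> that increase to the indicator of the open interval as
  \<open>N \<rightarrow> \<infinity>\<close>.\<close>
definition plateau :: "real \<Rightarrow> real \<Rightarrow> nat \<Rightarrow> real \<Rightarrow> real" where
  "plateau y h N x = flat_exp 0 (real (Suc N) * (x - y)) * flat_exp 0 (real (Suc N) * (y + h - x))"

lemma diffn_plateau: "diffn j (plateau y h N)"
proof -
  have "diffn j (\<lambda>x. flat_exp 0 (real (Suc N) * x + (- real (Suc N) * y)) *
      flat_exp 0 (- real (Suc N) * x + real (Suc N) * (y + h)))"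
    by (intro diffn_mult diffn_affine diffn_flat_exp)
  also have "(\<lambda>x. flat_exp 0 (real (Suc N) * x + (- real (Suc N) * y)) *
      flat_exp 0 (- real (Suc N) * x + real (Suc N) * (y + h))) = plateau y h N"
    unfolding plateau_def by (intro ext arg_cong2[where f = "(*)"] arg_cong[where f = "flat_exp 0"])
      (simp_all add: algebra_simps)
  finally show ?thesis .
qed

lemma plateau_continuous: "continuous_on S (plateau y h N)"
proof -
  obtain f' where "\<And>x. (plateau y h N has_field_derivative f' x) (at x)"
    using diffn_plateau[of "Suc 0" y h N] by auto
  then have "isCont (plateau y h N) x" for x by (rule DERIV_isCont)
  then show ?thesis by (simp add: continuous_at_imp_continuous_on)
qed

lemma flat_exp_0: "0 \<le> flat_exp 0 x" "flat_exp 0 x \<le> 1" by (auto simp: flat_exp_def)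

lemma plateau_bounds: "0 \<le> plateau y h N x" "plateau y h N x \<le> 1"
  unfolding plateau_def using flat_exp_0 by (auto intro: mult_le_one)

lemma plateau_outside: "x \<notin> {y<..<y+h} \<Longrightarrow> plateau y h N x = 0"
  by (auto simp: plateau_def flat_exp_def not_less mult_le_0_iff zero_le_mult_iff) 

lemma plateau_tendsto: "(\<lambda>N. plateau y h N x) \<longlonglongrightarrow> indicator {y<..<y+h} x"
proof (cases "x \<in> {y<..<y+h}")
  case True
  have "(\<lambda>N. flat_exp 0 (real (Suc N) * t)) \<longlonglongrightarrow> 1" if "t > 0" for t
  proof -
    have "(\<lambda>N. exp (- (inverse (real (Suc N)) * inverse t))) \<longlonglongrightarrow> exp (- (0 * inverse t))"
      by (intro tendsto_intros LIMSEQ_inverse_real_of_nat)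
    then show ?thesis using that by (simp add: flat_exp_def mult_le_0_iff)
  qed
  from tendsto_mult[OF this[of "x - y"] this[of "y + h - x"]] True
  show ?thesis unfolding plateau_def by simp
next
  case False
  then show ?thesis using plateau_outside[OF False] by simp
qed

lemma integral_plateau_tendsto:
  assumes f: "f absolutely_integrable_on {y..y+h}"
  shows "(\<lambda>N. integral {y..y+h} (\<lambda>x. f x * plateau y h N x)) \<longlonglongrightarrow> integral {y..y+h} f"
    (is ?lim)
proof -
  have ai: "(\<lambda>x. f x * plateau y h N x) absolutely_integrable_on {y..y+h}" for N
    using ai_mult_continuous_Icc[OF plateau_continuous f] by (simp add: mult.commute)
  have "(\<lambda>N. integral {y..y+h} (\<lambda>x. f x * plateau y h N x)) \<longlonglongrightarrow>
     integral {y..y+h} (\<lambda>x. f x * indicator {y<..<y+h} x)"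
  proof (rule dominated_convergence(2))
    show "(\<lambda>x. f x * plateau y h N x) integrable_on {y..y+h}" for N
      using ai[of N] by (auto simp: absolutely_integrable_on_def)
    show "(\<lambda>x. norm (f x)) integrable_on {y..y+h}" using f by (auto simp: absolutely_integrable_on_def)
    show "norm (f x * plateau y h N x) \<le> norm (f x)" for N x
      using plateau_bounds[of y h N x] by (simp add: abs_mult mult_left_le)
    show "(\<lambda>N. f x * plateau y h N x) \<longlonglongrightarrow> f x * indicator {y<..<y+h} x" for x
      by (intro tendsto_intros plateau_tendsto)
  qed
  also have "integral {y..y+h} (\<lambda>x. f x * indicator {y<..<y+h} x) = integral {y..y+h} f"
    by (rule integral_spike[of "{y, y+h}"]) (auto simp: indicator_def)
  finally show ?lim .
qed

text \<open>To the left of \<open>a\<close> the integral extends over the empty interval, in accordance with the vanishing of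
  \<open>f\<close> there; so the formula holds on the whole line.\<close>
lemma diffn_antiderivative:
  fixes f :: "real \<Rightarrow> real"
  assumes cont: "continuous_on UNIV f" and zero: "\<And>x. x \<le> a \<Longrightarrow> f x = 0"
  shows "((\<lambda>x. integral {a..x} f) has_field_derivative f x) (at x)"
proof -
  define c d where "c = min a x - 1" and "d = max a x + 1"
  have int: "f integrable_on {s..t}" for s t
    by (rule integrable_continuous_real) (rule continuous_on_subset[OF cont], simp)
  have eq: "integral {c..u} f = integral {a..u} f" for u
  proof (cases "u \<le> a")
    case True
    have "integral {c..u} f = integral {c..u} (\<lambda>x. 0)" by (rule integral_cong) (use True zero in auto)
    moreover have "integral {a..u} f = integral {a..u} (\<lambda>x. 0)" by (rule integral_cong) (use True zero in auto)
    ultimately show ?thesis by simp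
  next
    case False
    have "integral {c..a} f + integral {a..u} f = integral {c..u} f"
      using False by (intro Henstock_Kurzweil_Integration.integral_combine int) (auto simp: c_def)
    moreover have "integral {c..a} f = integral {c..a} (\<lambda>x. 0)" by (rule integral_cong) (use zero in auto)
    ultimately show ?thesis by simp
  qed
  have "((\<lambda>u. integral {c..u} f) has_vector_derivative f x) (at x within {c..d})"
    by (rule integral_has_vector_derivative) (auto simp: c_def d_def intro: continuous_on_subset[OF cont])
  moreover have "x \<in> interior {c..d}" by (auto simp: c_def d_def)
  ultimately have "((\<lambda>u. integral {c..u} f) has_vector_derivative f x) (at x)"
    using at_within_interior by metis
  then show ?thesis unfolding eq has_real_derivative_iff_has_vector_derivative .
qed

text \<open>For disjoint intervals the difference of two normalised plateau functions has integral zero, hence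
  a primitive that is a test function. Testing with this primitive shows that the averages of \<open>f\<close>
  over the two intervals agree, in the limit \<open>N \<rightarrow> \<infinity>\<close>. So \<open>f\<close> has the same average over all
  intervals in \<open>(0,\<infinity>)\<close>.\<close>
lemma du_bois_reymond_const:
  fixes f :: "real \<Rightarrow> real"
  assumes f: "\<And>b. f absolutely_integrable_on {0..b}"
    and weak: "\<And>\<phi>. test_function \<phi> \<Longrightarrow> integral {0<..} (\<lambda>x. f x * deriv \<phi> x) = 0"
  shows "\<exists>c. \<forall>x\<ge>0. integral {0..x} f = c * x"
proof -
  have fab: "f absolutely_integrable_on {a..b}" if "0 \<le> a" for a b
    by (rule set_integrable_subset[OF f[of b]]) (use that in auto)
  have fint: "f integrable_on {a..b}" if "0 \<le> a" for a b
    using fab[OF that] by (auto simp: absolutely_integrable_on_def)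
  define c where "c y h N = integral {y..y+h} (plateau y h N)" for y h N
  define I where "I y h N = integral {y..y+h} (\<lambda>x. f x * plateau y h N x)" for y h N
  have c_lim: "c y h \<longlonglongrightarrow> h" if "h > 0" for y h
    using integral_plateau_tendsto[where f = "\<lambda>x. 1" and y = y and h = h] that by (simp add: c_def[abs_def])
  have I_lim: "I y h \<longlonglongrightarrow> integral {y..y+h} f" if "y \<ge> 0" for y h
    unfolding I_def[abs_def] by (rule integral_plateau_tendsto[OF fab[OF that]])
  have key: "I y h N / c y h N = I z l N / c z l N"
    if y: "0 < y" "0 < h" and z: "y + h \<le> z" "0 < l" and nz: "c y h N \<noteq> 0" "c z l N \<noteq> 0" for y h z l N
  proof -
    define \<psi> where "\<psi> x = inverse (c y h N) * plateau y h N x + - inverse (c z l N) * plateau z l N x" for x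
    define \<phi> where "\<phi> x = integral {y..x} \<psi>" for x
    have \<psi>cont: "continuous_on S \<psi>" for S
      unfolding \<psi>_def[abs_def] by (intro continuous_intros plateau_continuous)
    have \<psi>int: "\<psi> integrable_on {a..b}" for a b by (rule integrable_continuous_real[OF \<psi>cont])
    have pint: "plateau a b N integrable_on {s..t}" for a b s t by (rule integrable_continuous_real[OF plateau_continuous])
    have der: "(\<phi> has_field_derivative \<psi> x) (at x)" for x
      unfolding \<phi>_def[abs_def]
      by (rule diffn_antiderivative[OF \<psi>cont]) (use y z in \<open>auto simp: \<psi>_def plateau_outside\<close>)
    have sm: "diffn j \<psi>" for j
      unfolding \<psi>_def[abs_def] by (intro diffn_add diffn_cmult diffn_plateau)
    have restrict: "integral {s..t} (\<lambda>x. g x * plateau a b N x) = integral {a..a+b} (\<lambda>x. g x * plateau a b N x)"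
      if "s \<le> a" "a + b \<le> t" for g :: "real \<Rightarrow> real" and s t a b
    proof -
      have "integral {s..t} (\<lambda>x. g x * plateau a b N x) =
          integral {s..t} (\<lambda>x. if x \<in> {a..a+b} then g x * plateau a b N x else 0)"
        by (rule integral_cong) (auto simp: plateau_outside)
      also have "\<dots> = integral ({a..a+b} \<inter> {s..t}) (\<lambda>x. g x * plateau a b N x)"
        by (rule integral_restrict_Int)
      also have "{a..a+b} \<inter> {s..t} = {a..a+b}" using that by auto
      finally show ?thesis .
    qed
    have total: "integral {y..x} \<psi> = 0" if "x \<ge> z + l" for x
    proof -
      have "integral {y..x} \<psi> = inverse (c y h N) * integral {y..x} (plateau y h N)
          + - inverse (c z l N) * integral {y..x} (plateau z l N)"
        unfolding \<psi>_def[abs_def] by (subst integral_add) (auto intro!: integrable_on_mult_right integrable_neg pint)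
      also have "integral {y..x} (plateau y h N) = c y h N"
        using restrict[of y y h x "\<lambda>x. 1"] y z that by (simp add: c_def)
      also have "integral {y..x} (plateau z l N) = c z l N"
        using restrict[of y z l x "\<lambda>x. 1"] y z that by (simp add: c_def)
      finally show ?thesis using nz by simp
    qed
    have "test_function \<phi>"
      unfolding test_function_def
    proof (rule conjI, intro allI, goal_cases)
      case (1 j x)
      show "(deriv ^^ j) \<phi> field_differentiable (at x)"
        by (rule diffn_imp_higher_deriv) (rule diffn_SucI[OF der sm])
    next
      case 2
      have "\<phi> x = 0" if "x \<notin> {y..z + l}" for x
      proof -
        from that consider "x < y" | "x > z + l" by fastforce
        then show ?thesis by cases (use total in \<open>auto simp: \<phi>_def\<close>)
      qed
      then show ?case using y(1) by blast
    qed
    from weak[OF this] have 0: "integral {0<..} (\<lambda>x. f x * \<psi> x) = 0"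
      using DERIV_imp_deriv[OF der] by simp
    have psi0: "\<psi> x = 0" if "x \<notin> {y..z+l}" for x using that y z by (auto simp: \<psi>_def plateau_outside)
    have "integral {0<..} (\<lambda>x. if x \<in> {y..z+l} then f x * \<psi> x else 0) = integral {0<..} (\<lambda>x. f x * \<psi> x)"
      by (rule integral_cong) (use psi0 in auto)
    moreover have "integral {0<..} (\<lambda>x. if x \<in> {y..z+l} then f x * \<psi> x else 0) =
        integral ({y..z+l} \<inter> {0<..}) (\<lambda>x. f x * \<psi> x)"
      by (rule integral_restrict_Int)
    moreover have "{y..z+l} \<inter> {0<..} = {y..z+l}" using y by auto
    ultimately have 1: "integral {y..z+l} (\<lambda>x. f x * \<psi> x) = 0" using 0 by simp
    have fp: "(\<lambda>x. f x * plateau a b N x) integrable_on {y..z+l}" for a b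
      using ai_mult_continuous_Icc[OF plateau_continuous fab[of y], of "z+l" a b N] y
      by (simp add: mult.commute absolutely_integrable_on_def)
    have "integral {y..z+l} (\<lambda>x. f x * \<psi> x) = integral {y..z+l} (\<lambda>x. inverse (c y h N) * (f x * plateau y h N x)
        + - inverse (c z l N) * (f x * plateau z l N x))"
      by (rule integral_cong) (simp add: \<psi>_def algebra_simps)
    also have "\<dots> = inverse (c y h N) * integral {y..z+l} (\<lambda>x. f x * plateau y h N x)
        + - inverse (c z l N) * integral {y..z+l} (\<lambda>x. f x * plateau z l N x)"
      by (subst integral_add) (auto intro!: integrable_on_mult_right integrable_neg fp)
    also have "integral {y..z+l} (\<lambda>x. f x * plateau y h N x) = I y h N"
      unfolding I_def by (rule restrict) (use y z in auto)
    also have "integral {y..z+l} (\<lambda>x. f x * plateau z l N x) = I z l N"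
      unfolding I_def by (rule restrict) (use y z in auto)
    finally show ?thesis using 1 by (simp add: divide_inverse mult.commute)
  qed
  have slope: "integral {y..y+h} f / h = integral {z..z+l} f / l"
    if y: "0 < y" "0 < h" and z: "y + h \<le> z" "0 < l" for y h z l
  proof (rule LIMSEQ_unique)
    have ev: "\<forall>\<^sub>F N in sequentially. c a b N \<noteq> 0" if "b > 0" for a b
      by (rule tendsto_imp_eventually_ne[OF c_lim[OF that]]) (use that in simp)
    show "(\<lambda>N. I y h N / c y h N) \<longlonglongrightarrow> integral {y..y+h} f / h"
      using y by (intro tendsto_divide I_lim c_lim) auto
    have "(\<lambda>N. I z l N / c z l N) \<longlonglongrightarrow> integral {z..z+l} f / l"
      using y z by (intro tendsto_divide I_lim c_lim) auto
    then show "(\<lambda>N. I y h N / c y h N) \<longlonglongrightarrow> integral {z..z+l} f / l"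
      by (rule Lim_transform_eventually)
        (use ev[OF y(2), of y] ev[OF z(2), of z] in \<open>eventually_elim, use key[OF y z] in auto\<close>)
  qed
  define k where "k = integral {1..2} f"
  have lin: "integral {y..y+h} f = k * h" if y: "0 < y" "0 < h" for y h
  proof -
    define z where "z = max 2 (y + h)"
    have "integral {y..y+h} f / h = integral {z..z+1} f / 1"
      by (rule slope) (use y in \<open>auto simp: z_def\<close>)
    also have "\<dots> = integral {1..1+1} f / 1"
      by (rule slope[symmetric]) (auto simp: z_def)
    finally show ?thesis using y by (simp add: k_def field_simps)
  qed
  have "integral {0..x} f = k * x" if x: "0 \<le> x" for x
  proof (cases "x = 0")
    case False
    then have x0: "x > 0" using x by simp
    have split: "integral {0..x} f = integral {0..t} f + k * (x - t)" if t: "0 < t" "t < x" for t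
    proof -
      have "integral {0..t} f + integral {t..x} f = integral {0..x} f"
        by (rule Henstock_Kurzweil_Integration.integral_combine[OF _ _ fint]) (use t in auto)
      then show ?thesis using lin[of t "x - t"] t by simp
    qed
    have "continuous_on {0..x} (\<lambda>t. integral {0..t} f)" by (rule indefinite_integral_continuous_1[OF fint]) simp
    then have "((\<lambda>t. integral {0..t} f) \<longlongrightarrow> integral {0..0} f) (at 0 within {0..x})"
      unfolding continuous_on_def by (rule bspec) (use x in simp)
    then have "((\<lambda>t. integral {0..t} f) \<longlongrightarrow> 0) (at_right 0)"
      using at_within_Icc_at_right[OF x0] by simp
    then have 1: "((\<lambda>t. integral {0..t} f + k * (x - t)) \<longlongrightarrow> 0 + k * (x - 0)) (at_right 0)"
      by (intro tendsto_intros) auto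
    have 2: "\<forall>\<^sub>F t in at_right 0. integral {0..t} f + k * (x - t) = integral {0..x} f"
      unfolding eventually_at_right_field by (rule exI[of _ x]) (use x0 split in simp)
    have "((\<lambda>t. integral {0..x} f) \<longlongrightarrow> k * x) (at_right (0::real))"
      using Lim_transform_eventually[OF 1 2] by simp
    then show ?thesis by (simp add: tendsto_const_iff)
  qed simp
  then show ?thesis by blast
qed

lemma test_function_has_deriv: "test_function \<phi> \<Longrightarrow> (\<phi> has_field_derivative deriv \<phi> x) (at x)"
  unfolding test_function_def by (metis funpow_0 field_differentiable_derivI)

lemma test_function_deriv:
  assumes "test_function \<phi>" shows "test_function (deriv \<phi>)"
proof -
  have sm: "(deriv ^^ j) (deriv \<phi>) field_differentiable (at x)" for j x
  proof -
    have "(deriv ^^ Suc j) \<phi> field_differentiable (at x)" using assms unfolding test_function_def by blast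
    then show ?thesis by (simp add: funpow_swap1)
  qed
  obtain a b where ab: "0 < a" "\<And>x. x \<notin> {a..b} \<Longrightarrow> \<phi> x = 0"
    using assms unfolding test_function_def by blast
  have "deriv \<phi> x = 0" if "x \<notin> {a..b}" for x
  proof (rule DERIV_imp_deriv)
    have "((\<lambda>x. 0) has_field_derivative 0) (at x)" by simp
    then show "(\<phi> has_field_derivative 0) (at x)"
      by (rule has_field_derivative_transform_within_open[where S = "- {a..b}"]) (use that ab in auto)
  qed
  then show ?thesis unfolding test_function_def using sm ab(1) by blast
qed

lemma integral_test_function:
  fixes f \<phi> :: "real \<Rightarrow> real"
  assumes \<phi>: "\<And>x. x \<notin> {a..b} \<Longrightarrow> \<phi> x = 0" and "0 < a" "b \<le> c"
  shows "integral {0<..} (\<lambda>x. f x * \<phi> x) = integral {0..c} (\<lambda>x. f x * \<phi> x :: real)"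
proof -
  have 1: "integral S (\<lambda>x. f x * \<phi> x) = integral {a..b} (\<lambda>x. f x * \<phi> x)" if "{a..b} \<subseteq> S" for S
  proof -
    have "integral S (\<lambda>x. f x * \<phi> x) = integral S (\<lambda>x. if x \<in> {a..b} then f x * \<phi> x else 0)"
      by (rule integral_cong) (use \<phi> in auto)
    also have "\<dots> = integral ({a..b} \<inter> S) (\<lambda>x. f x * \<phi> x)" by (rule integral_restrict_Int)
    also have "{a..b} \<inter> S = {a..b}" using that by auto
    finally show ?thesis .
  qed
  have "integral {0<..} (\<lambda>x. f x * \<phi> x) = integral {a..b} (\<lambda>x. f x * \<phi> x)"
    by (rule 1) (use \<open>0 < a\<close> in auto)
  moreover have "integral {0..c} (\<lambda>x. f x * \<phi> x) = integral {a..b} (\<lambda>x. f x * \<phi> x)"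
    by (rule 1) (use \<open>0 < a\<close> \<open>b \<le> c\<close> in auto)
  ultimately show ?thesis by simp
qed

lemma test_function_continuous: "test_function \<phi> \<Longrightarrow> continuous_on S \<phi>"
  by (rule continuous_at_imp_continuous_on) (auto intro: DERIV_isCont[OF test_function_has_deriv])

lemma ac_deriv_indefinite:
  assumes "\<And>b. g absolutely_integrable_on {0..b}"
  shows "ac_deriv (\<lambda>x. c + integral {0..x} g) g"
  using assms by (simp add: ac_deriv_def)

text \<open>Subtracting a primitive of \<open>g\<close> reduces the claim to \<open>g = 0\<close>.\<close>
lemma du_bois_reymond:
  fixes f g :: "real \<Rightarrow> real"
  assumes f: "\<And>b. f absolutely_integrable_on {0..b}" and g: "\<And>b. g absolutely_integrable_on {0..b}"
    and weak: "\<And>\<phi>. test_function \<phi> \<Longrightarrow>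
      integral {0<..} (\<lambda>x. f x * deriv \<phi> x) = - integral {0<..} (\<lambda>x. g x * \<phi> x)"
  shows "\<exists>c. \<forall>x\<ge>0. integral {0..x} f = integral {0..x} (\<lambda>s. c + integral {0..s} g)"
proof -
  define G where "G x = 0 + integral {0..x} g" for x
  have acG: "ac_deriv G g" unfolding G_def[abs_def] by (rule ac_deriv_indefinite[OF g])
  have Gcont: "continuous_on {0..b} G" for b
    by (rule continuous_on_subset[OF ac_deriv_continuous[OF acG]]) auto
  have Gai: "G absolutely_integrable_on {0..b}" for b by (rule absolutely_integrable_continuous_real[OF Gcont])
  have hai: "(\<lambda>x. f x - G x) absolutely_integrable_on {0..b}" for b by (rule set_integral_diff(1)[OF f Gai])
  have "integral {0<..} (\<lambda>x. (f x - G x) * deriv \<phi> x) = 0" if \<phi>: "test_function \<phi>" for \<phi>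
  proof -
    obtain a b where ab: "0 < a" "\<And>x. x \<notin> {a..b} \<Longrightarrow> \<phi> x = 0"
      using \<phi> unfolding test_function_def by blast
    obtain a' b' where ab': "0 < a'" "\<And>x. x \<notin> {a'..b'} \<Longrightarrow> deriv \<phi> x = 0"
      using test_function_deriv[OF \<phi>] unfolding test_function_def by blast
    define c where "c = Max {b + 1, b', 0}"
    have c: "b < c" "b' \<le> c" "0 \<le> c" by (auto simp: c_def)
    note dcont = test_function_continuous[OF test_function_deriv[OF \<phi>]]
    note pcont = test_function_continuous[OF \<phi>]
    have ac\<phi>: "ac_deriv \<phi> (deriv \<phi>)"
    proof (rule ac_derivI_continuous[OF _ dcont])
      show "(\<phi> has_vector_derivative deriv \<phi> x) (at x within {0..})" for x
        using test_function_has_deriv[OF \<phi>, of x]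
        unfolding has_real_derivative_iff_has_vector_derivative by (rule has_vector_derivative_at_within)
    qed
    have "integral {0..c} (\<lambda>x. g x * \<phi> x + G x * deriv \<phi> x) = G c * \<phi> c - G 0 * \<phi> 0"
      using ac_deriv_mult[OF acG ac\<phi>] c unfolding ac_deriv_def by blast
    also have "\<phi> c = 0" by (rule ab(2)) (use c in auto)
    also have "\<phi> 0 = 0" by (rule ab(2)) (use ab(1) in auto)
    finally have 0: "integral {0..c} (\<lambda>x. g x * \<phi> x + G x * deriv \<phi> x) = 0" by simp
    have int: "(\<lambda>x. g x * \<phi> x) integrable_on {0..c}" "(\<lambda>x. G x * deriv \<phi> x) integrable_on {0..c}"
       "(\<lambda>x. f x * deriv \<phi> x) integrable_on {0..c}"
      using ai_mult_continuous_Icc[OF pcont g] ai_mult_continuous_Icc[OF dcont Gai]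
        ai_mult_continuous_Icc[OF dcont f]
      by (simp_all add: mult.commute absolutely_integrable_on_def)
    have parts: "integral {0..c} (\<lambda>x. g x * \<phi> x) + integral {0..c} (\<lambda>x. G x * deriv \<phi> x) = 0"
      using 0 integral_add[OF int(1,2)] by simp
    have "integral {0<..} (\<lambda>x. (f x - G x) * deriv \<phi> x) = integral {0..c} (\<lambda>x. (f x - G x) * deriv \<phi> x)"
      by (rule integral_test_function[OF ab'(2) ab'(1) c(2)])
    also have "\<dots> = integral {0..c} (\<lambda>x. f x * deriv \<phi> x) - integral {0..c} (\<lambda>x. G x * deriv \<phi> x)"
      unfolding left_diff_distrib by (rule integral_diff[OF int(3,2)])
    also have "integral {0..c} (\<lambda>x. f x * deriv \<phi> x) = integral {0<..} (\<lambda>x. f x * deriv \<phi> x)"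
      by (rule integral_test_function[OF ab'(2) ab'(1) c(2), symmetric])
    also have "\<dots> = - integral {0<..} (\<lambda>x. g x * \<phi> x)" by (rule weak[OF \<phi>])
    also have "integral {0<..} (\<lambda>x. g x * \<phi> x) = integral {0..c} (\<lambda>x. g x * \<phi> x)"
      by (rule integral_test_function[where b = b, OF ab(2) ab(1)]) (use c in auto)
    finally show ?thesis using parts by simp
  qed
  from du_bois_reymond_const[OF hai this] obtain k where
    k: "\<And>x. 0 \<le> x \<Longrightarrow> integral {0..x} (\<lambda>x. f x - G x) = k * x" by blast
  have "integral {0..x} f = integral {0..x} (\<lambda>s. k + integral {0..s} g)" if "0 \<le> x" for x
  proof -
    have i: "f integrable_on {0..x}" "G integrable_on {0..x}"
      using f Gai by (auto simp: absolutely_integrable_on_def)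
    have "integral {0..x} (\<lambda>s. k + G s) = k * x + integral {0..x} G"
      using that i by (subst integral_add) auto
    moreover have "integral {0..x} f - integral {0..x} G = k * x"
      using k[OF that] integral_diff[OF i] by simp
    ultimately show ?thesis by (simp add: G_def)
  qed
  then show ?thesis by blast
qed

lemma integrable_atLeast0I:
  fixes f :: "real \<Rightarrow> real"
  assumes cont: "continuous_on {0..} f" and nn: "\<And>x. 0 \<le> x \<Longrightarrow> 0 \<le> f x"
    and bd: "\<And>B. 0 \<le> B \<Longrightarrow> integral {0..B} f \<le> C"
  shows "f integrable_on {0..}"
proof -
  have int: "f integrable_on {0..B}" for B
    by (rule integrable_continuous_real) (rule continuous_on_subset[OF cont], auto)
  define h where "h k x = (if x \<in> {0..real k} then f x else 0)" for k :: nat and x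
  have eq: "{0..} \<inter> {0..real k} = {0..real k}" "{0..real k} \<inter> {0..} = {0..real k}" for k by auto
  have hi: "h k integrable_on {0..}" for k
    unfolding h_def[abs_def] integrable_restrict_Int eq by (rule int)
  have hv: "integral {0..} (h k) = integral {0..real k} f" for k
    unfolding h_def[abs_def] by (subst integral_restrict_Int) (simp only: eq)
  have "f integrable_on {0..} \<and> (\<lambda>k. integral {0..} (h k)) \<longlonglongrightarrow> integral {0..} f"
  proof (rule monotone_convergence_increasing)
    show "h k integrable_on {0..}" for k by (rule hi)
    show "h k x \<le> h (Suc k) x" if "x \<in> {0..}" for k x using that nn by (auto simp: h_def)
    show "(\<lambda>k. h k x) \<longlonglongrightarrow> f x" if "x \<in> {0..}" for x
    proof (rule tendsto_eventually)
      obtain N where "x \<le> real N" using real_arch_simple by blast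
      then show "\<forall>\<^sub>F k in sequentially. h k x = f x"
        using that by (intro eventually_sequentiallyI[of N]) (auto simp: h_def)
    qed
    have "\<bar>integral {0..} (h k)\<bar> \<le> C" for k
      unfolding hv using bd[of "real k"] integral_nonneg[OF int[of "real k"]] nn by auto
    then show "bounded (range (\<lambda>k. integral {0..} (h k)))" by (auto simp: bounded_iff)
  qed
  then show ?thesis by blast
qed

text \<open>Functions with equal primitives agree almost everywhere. As \<open>w\<close> is continuous, the bound on its
  weighted integral follows on short intervals, where \<open>w\<close> is almost constant.\<close>
lemma weighted_L1_of_equal_primitive:
  fixes f w :: "real \<Rightarrow> real"
  assumes f: "weighted_L1 n f" and fl: "\<And>b. f absolutely_integrable_on {0..b}" and w: "continuous_on {0..} w"
    and eq: "\<And>x. 0 \<le> x \<Longrightarrow> integral {0..x} f = integral {0..x} w"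
  shows "weighted_L1 n w"
proof -
  define p where "p x = (1 + x) ^ n" for x :: real
  have p1: "1 \<le> p x" if "0 \<le> x" for x using that by (simp add: p_def)
  have pmono: "p x \<le> p y" if "0 \<le> x" "x \<le> y" for x y using that by (auto simp: p_def intro: power_mono)
  have pcont: "continuous_on S p" for S unfolding p_def[abs_def] by (intro continuous_intros)
  have pwcont: "continuous_on {0..} (\<lambda>x. p x * \<bar>w x\<bar>)" by (intro continuous_intros pcont w)
  have fl': "f integrable_on {a..b}" "(\<lambda>x. \<bar>f x\<bar>) integrable_on {a..b}" if "0 \<le> a" for a b
    using set_integrable_subset[OF fl[of b], of "{a..b}"] that by (auto simp: absolutely_integrable_on_def)
  have wl: "w integrable_on {a..b}" if "0 \<le> a" for a b
    by (rule integrable_continuous_real) (rule continuous_on_subset[OF w], use that in auto)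
  have pwl: "(\<lambda>x. p x * \<bar>w x\<bar>) integrable_on {a..b}" if "0 \<le> a" for a b
    by (rule integrable_continuous_real) (rule continuous_on_subset[OF pwcont], use that in auto)
  have pf: "(\<lambda>x. p x * \<bar>f x\<bar>) integrable_on {0..}"
  proof (rule integrable_eq)
    show "(\<lambda>x. norm ((1 + x) ^ n * f x)) integrable_on {0..}"
      using f unfolding weighted_L1_def absolutely_integrable_on_def by blast
  qed (auto simp: abs_mult p_def)
  have pfl: "(\<lambda>x. p x * \<bar>f x\<bar>) integrable_on {a..b}" if "0 \<le> a" for a b
    by (rule integrable_on_subinterval[OF pf]) (use that in auto)
  define C where "C = integral {0..} (\<lambda>x. p x * \<bar>f x\<bar>)"
  have bound: "integral {0..B} (\<lambda>x. p x * \<bar>w x\<bar>) \<le> C" if B: "0 \<le> B" for B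
  proof (rule field_le_epsilon)
    fix e :: real assume e: "0 < e"
    define \<epsilon> where "\<epsilon> = e / (2 * (B + 1))"
    have \<epsilon>: "\<epsilon> > 0" using e B by (simp add: \<epsilon>_def)
    have pB: "p B > 0" using p1[OF B] by simp
    have "uniformly_continuous_on {0..B} (\<lambda>x. p x * \<bar>w x\<bar>)"
      by (rule compact_uniformly_continuous) (auto intro: continuous_on_subset[OF pwcont])
    then obtain d1 where d1: "d1 > 0"
      "\<And>s t. \<lbrakk>s \<in> {0..B}; t \<in> {0..B}; dist s t < d1\<rbrakk> \<Longrightarrow> dist (p s * \<bar>w s\<bar>) (p t * \<bar>w t\<bar>) < \<epsilon>"
      using \<epsilon> unfolding uniformly_continuous_on_def by metis
    have "uniformly_continuous_on {0..B} w"
      by (rule compact_uniformly_continuous) (auto intro: continuous_on_subset[OF w])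
    moreover have "\<epsilon> / p B > 0" using \<epsilon> pB by simp
    ultimately obtain d2 where d2: "d2 > 0"
      "\<And>s t. \<lbrakk>s \<in> {0..B}; t \<in> {0..B}; dist s t < d2\<rbrakk> \<Longrightarrow> dist (w s) (w t) < \<epsilon> / p B"
      unfolding uniformly_continuous_on_def by metis
    define F where "F t = integral {0..t} (\<lambda>x. p x * \<bar>w x\<bar>)" for t
    define G where "G t = integral {0..t} (\<lambda>x. p x * \<bar>f x\<bar>) + 2 * \<epsilon> * t" for t
    have "F B - F 0 \<le> G B - G 0"
    proof (rule local_increment_bound[where \<delta> = "min d1 d2"])
      fix c d assume cd: "0 \<le> c" "c \<le> d" "d \<le> B" "d - c < min d1 d2"
      have split: "integral {0..d} \<phi> - integral {0..c} \<phi> = integral {c..d} \<phi>"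
        if "\<phi> integrable_on {0..d}" for \<phi> :: "real \<Rightarrow> real"
        using Henstock_Kurzweil_Integration.integral_combine[of 0 c d \<phi>] that cd by (simp add: algebra_simps)
      have near: "p x * \<bar>w x\<bar> \<le> p c * \<bar>w c\<bar> + \<epsilon>" "\<bar>w x - w c\<bar> \<le> \<epsilon> / p B" if "x \<in> {c..d}" for x
        using d1(2)[of x c] d2(2)[of x c] that cd by (auto simp: dist_real_def)
      have "F d - F c = integral {c..d} (\<lambda>x. p x * \<bar>w x\<bar>)" unfolding F_def by (rule split[OF pwl]) simp
      also have "\<dots> \<le> integral {c..d} (\<lambda>x. p c * \<bar>w c\<bar> + \<epsilon>)"
        by (rule integral_le[OF pwl]) (use near cd in auto)
      also have "\<dots> = (d - c) * (p c * \<bar>w c\<bar> + \<epsilon>)" using cd by simp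
      finally have 1: "F d - F c \<le> (d - c) * (p c * \<bar>w c\<bar> + \<epsilon>)" .
      have "norm (integral {c..d} (\<lambda>x. w x - w c)) \<le> integral {c..d} (\<lambda>x. \<epsilon> / p B)"
        by (rule integral_norm_bound_integral) (use near(2) wl cd in \<open>auto intro!: integrable_diff\<close>)
      also have "integral {c..d} (\<lambda>x. w x - w c) = integral {c..d} w - (d - c) * w c"
        using wl[of c d] cd by (subst integral_diff) auto
      finally have "\<bar>integral {c..d} w - (d - c) * w c\<bar> \<le> (d - c) * (\<epsilon> / p B)"
        using cd by simp
      moreover have "\<bar>(d - c) * w c\<bar> = (d - c) * \<bar>w c\<bar>" using cd by (simp add: abs_mult)
      ultimately have 2: "(d - c) * \<bar>w c\<bar> \<le> \<bar>integral {c..d} w\<bar> + (d - c) * (\<epsilon> / p B)"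
        by linarith
      have "integral {c..d} w = integral {c..d} f"
        using split[OF wl[of 0 d]] split[OF fl'(1)[of 0 d]] eq[of c] eq[of d] cd by simp
      moreover have "\<bar>integral {c..d} f\<bar> \<le> integral {c..d} (\<lambda>x. \<bar>f x\<bar>)"
        using integral_norm_bound_integral[OF fl'(1)[of c d] fl'(2)[of c d]] cd by simp
      ultimately have "p c * ((d - c) * \<bar>w c\<bar>) \<le> p c * (integral {c..d} (\<lambda>x. \<bar>f x\<bar>) + (d - c) * (\<epsilon> / p B))"
        using 2 p1[OF cd(1)] by (intro mult_left_mono) auto
      also have "\<dots> = integral {c..d} (\<lambda>x. p c * \<bar>f x\<bar>) + (d - c) * \<epsilon> * (p c / p B)"
        by (simp add: distrib_left ac_simps)
      also have "(d - c) * \<epsilon> * (p c / p B) \<le> (d - c) * \<epsilon> * 1"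
        using pmono[of c B] cd \<epsilon> pB by (intro mult_left_mono) (auto simp: divide_le_eq)
      also have "integral {c..d} (\<lambda>x. p c * \<bar>f x\<bar>) \<le> integral {c..d} (\<lambda>x. p x * \<bar>f x\<bar>)"
      proof (rule integral_le)
        show "(\<lambda>x. p c * \<bar>f x\<bar>) integrable_on {c..d}" using fl'(2) cd by (intro integrable_on_mult_right)
      qed (use pfl cd pmono in \<open>auto intro: mult_right_mono\<close>)
      also have "integral {c..d} (\<lambda>x. p x * \<bar>f x\<bar>) = integral {0..d} (\<lambda>x. p x * \<bar>f x\<bar>) - integral {0..c} (\<lambda>x. p x * \<bar>f x\<bar>)"
        by (rule split[OF pfl, symmetric]) simp
      finally show "F d - F c \<le> G d - G c"
        using 1 unfolding G_def by (simp add: algebra_simps)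
    qed (use B d1 d2 in auto)
    then have "F B \<le> integral {0..B} (\<lambda>x. p x * \<bar>f x\<bar>) + 2 * \<epsilon> * B" by (simp add: F_def G_def)
    also have "integral {0..B} (\<lambda>x. p x * \<bar>f x\<bar>) \<le> C"
      unfolding C_def by (rule integral_subset_le) (use pf pfl p1 in \<open>auto simp: p_def\<close>)
    also have "2 * \<epsilon> * B \<le> e" using e B by (simp add: \<epsilon>_def field_simps)
    finally show "integral {0..B} (\<lambda>x. p x * \<bar>w x\<bar>) \<le> C + e" by (simp add: F_def)
  qed
  have "(\<lambda>x. p x * \<bar>w x\<bar>) integrable_on {0..}"
    by (rule integrable_atLeast0I[OF pwcont _ bound]) (simp_all add: p_def)
  then show ?thesis unfolding weighted_L1_def p_def[symmetric]
    by (intro measurable_bounded_by_integrable_imp_absolutely_integrable[where g = "\<lambda>x. p x * \<bar>w x\<bar>"])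
      (auto simp: abs_mult p_def intro!: continuous_imp_measurable_on_sets_lebesgue continuous_intros w)
qed

lemma has_vector_derivative_unique_nonneg:
  fixes f :: "real \<Rightarrow> 'a::real_normed_vector"
  assumes f: "(f has_vector_derivative a) (at x within {0..})" "(f has_vector_derivative b) (at x within {0..})"
    and x: "0 \<le> x"
  shows "a = b"
proof (rule vector_derivative_unique_within[OF _ f])
  have "at x within {0..x+1} \<noteq> bot"
    using x by (simp add: trivial_limit_within islimpt_Icc)
  then show "at x within {0..} \<noteq> bot" using at_within_nonneg[of x "x+1"] x by simp
qed

lemma continuous_eq_of_equal_primitive:
  fixes u v :: "real \<Rightarrow> real"
  assumes "continuous_on {0..} u" "continuous_on {0..} v"
    and eq: "\<And>x. 0 \<le> x \<Longrightarrow> integral {0..x} u = integral {0..x} v" and x: "0 \<le> x"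
  shows "u x = v x"
proof -
  have ai: "w absolutely_integrable_on {0..b}" if "continuous_on {0..} w" for w :: "real \<Rightarrow> real" and b
    by (rule absolutely_integrable_continuous_real) (rule continuous_on_subset[OF that], auto)
  have "ac_deriv (\<lambda>x. 0 + integral {0..x} u) u" "ac_deriv (\<lambda>x. 0 + integral {0..x} v) v"
    by (rule ac_deriv_indefinite[OF ai[OF assms(1)]], rule ac_deriv_indefinite[OF ai[OF assms(2)]])
  moreover have "ac_deriv (\<lambda>x. 0 + integral {0..x} v) v \<longleftrightarrow> ac_deriv (\<lambda>x. 0 + integral {0..x} u) v"
    by (rule ac_deriv_cong) (simp_all add: eq)
  ultimately have "ac_deriv (\<lambda>x. 0 + integral {0..x} u) u" "ac_deriv (\<lambda>x. 0 + integral {0..x} u) v"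
    by blast+
  from has_vector_derivative_unique_nonneg[OF ac_deriv_imp_has_vector_derivative[OF this(1) assms(1) x]
    ac_deriv_imp_has_vector_derivative[OF this(2) assms(2) x] x]
  show ?thesis .
qed

lemma weighted_L1_of_real:
  assumes "weighted_L1 n f" shows "weighted_L1c n (\<lambda>x. of_real (f x))"
  using absolutely_integrable_linear[OF assms[unfolded weighted_L1_def] bounded_linear_of_real[where 'a = complex]]
  unfolding weighted_L1c_def o_def of_real_mult .

lemma weighted_L1_imp_Icc:
  assumes "weighted_L1 n f" shows "f absolutely_integrable_on {0..b}"
proof -
  have "(\<lambda>x. complex_of_real (f x)) absolutely_integrable_on {0..b}"
    by (rule weighted_L1c_imp_Icc[OF weighted_L1_of_real[OF assms]]) simp
  from absolutely_integrable_linear[OF this bounded_linear_Re] show ?thesis by (simp add: o_def)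
qed

text \<open>Downward induction on the order of the derivative: the highest weak derivative is only integrable,
  and each lower one is a primitive of the representative of the next.\<close>
lemma weak_deriv_regular_representative:
  assumes g: "\<And>i. i \<in> {1..M} \<Longrightarrow> weak_deriv i u (g i) \<and> weighted_L1 n (g i)"
    and j: "j < M"
  shows "\<exists>w. wsob n j (\<lambda>x. of_real (w x)) \<and> (\<forall>b. w absolutely_integrable_on {0..b}) \<and>
           (\<forall>x\<ge>0. integral {0..x} (g (M - j)) = integral {0..x} w)"
  using j
proof (induction j)
  case 0
  then show ?case using g[of M] weighted_L1_of_real weighted_L1_imp_Icc by (intro exI[of _ "g M"]) auto
next
  case (Suc j)
  then obtain w where w: "wsob n j (\<lambda>x. of_real (w x))" "\<And>b. w absolutely_integrable_on {0..b}"
    "\<And>x. 0 \<le> x \<Longrightarrow> integral {0..x} (g (M - j)) = integral {0..x} w" by auto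
  define i where "i = M - Suc j"
  have i: "i \<in> {1..M}" "Suc i \<in> {1..M}" "M - j = Suc i" "M - Suc j = i" using Suc.prems by (auto simp: i_def)
  note gi = g[OF i(1)] and gS = g[OF i(2)]
  have "\<exists>c. \<forall>x\<ge>0. integral {0..x} (g i) = integral {0..x} (\<lambda>s. c + integral {0..s} (g (Suc i)))"
  proof (rule du_bois_reymond)
    show "g i absolutely_integrable_on {0..b}" "g (Suc i) absolutely_integrable_on {0..b}" for b
      using gi gS weighted_L1_imp_Icc by auto
    fix \<phi> assume \<phi>: "test_function \<phi>"
    have "integral {0<..} (\<lambda>x. u x * (deriv ^^ i) (deriv \<phi>) x) = (-1) ^ i * integral {0<..} (\<lambda>x. g i x * deriv \<phi> x)"
      using gi test_function_deriv[OF \<phi>] unfolding weak_deriv_def by blast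
    moreover have "integral {0<..} (\<lambda>x. u x * (deriv ^^ Suc i) \<phi> x) = (-1) ^ Suc i * integral {0<..} (\<lambda>x. g (Suc i) x * \<phi> x)"
      using gS \<phi> unfolding weak_deriv_def by blast
    ultimately have "(-1) ^ i * integral {0<..} (\<lambda>x. g i x * deriv \<phi> x) = (-1) ^ Suc i * integral {0<..} (\<lambda>x. g (Suc i) x * \<phi> x)"
      by (simp add: funpow_swap1)
    then have "(-1) ^ i * ((-1) ^ i * integral {0<..} (\<lambda>x. g i x * deriv \<phi> x)) = (-1) ^ i * ((-1) ^ Suc i * integral {0<..} (\<lambda>x. g (Suc i) x * \<phi> x))"
      by (rule arg_cong)
    then show "integral {0<..} (\<lambda>x. g i x * deriv \<phi> x) = - integral {0<..} (\<lambda>x. g (Suc i) x * \<phi> x)"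
      by (simp flip: mult.assoc power_add)
  qed
  then obtain c where c: "\<And>x. 0 \<le> x \<Longrightarrow> integral {0..x} (g i) = integral {0..x} (\<lambda>s. c + integral {0..s} (g (Suc i)))"
    by blast
  define v where "v x = c + integral {0..x} w" for x
  have ac: "ac_deriv v w" unfolding v_def[abs_def] by (rule ac_deriv_indefinite[OF w(2)])
  have vcont: "continuous_on {0..} v" by (rule ac_deriv_continuous[OF ac])
  have eq: "integral {0..x} (g i) = integral {0..x} v" if "0 \<le> x" for x
    unfolding c[OF that] by (rule integral_cong) (use w(3) i(3) in \<open>simp add: v_def\<close>)
  have "weighted_L1 n v"
    by (rule weighted_L1_of_equal_primitive[where f = "g i"])
      (use gi weighted_L1_imp_Icc eq vcont in auto)
  then have "wsob n (Suc j) (\<lambda>x. of_real (v x))"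
    by (rule wsob_SucI[OF weighted_L1_of_real w(1) ac_deriv_of_real[OF ac]])
  moreover have "v absolutely_integrable_on {0..b}" for b
    by (rule absolutely_integrable_continuous_real) (rule continuous_on_subset[OF vcont], auto)
  ultimately show ?case unfolding i(4) using eq by blast
qed

lemma weak_derivs_imp_wsob:
  assumes u: "continuous_on {0..} u" and L: "weighted_L1 n (\<lambda>x. u x - a)" and M: "M \<ge> 1"
    and wd: "\<And>i. i \<in> {1..M} \<Longrightarrow> weak_deriv_weighted_L1 n i u"
  shows "wsob n M (\<lambda>x. of_real (u x - a))"
proof -
  obtain g where g: "\<And>i. i \<in> {1..M} \<Longrightarrow> weak_deriv i u (g i) \<and> weighted_L1 n (g i)"
    using wd unfolding weak_deriv_weighted_L1_def by metis
  have g1: "weak_deriv 1 u (g 1)" "weighted_L1 n (g 1)" using g[of 1] M by auto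
  have "M - 1 < M" "M - (M - 1) = 1" using M by auto
  with weak_deriv_regular_representative[where M = M and j = "M - 1" and u = u and n = n and g = g, OF g]
  obtain w where w: "wsob n (M - 1) (\<lambda>x. of_real (w x))" "\<And>b. w absolutely_integrable_on {0..b}"
    "\<And>x. 0 \<le> x \<Longrightarrow> integral {0..x} (g 1) = integral {0..x} w" by (metis (no_types, lifting))
  have "\<exists>c. \<forall>x\<ge>0. integral {0..x} u = integral {0..x} (\<lambda>s. c + integral {0..s} (g 1))"
  proof (rule du_bois_reymond)
    show "u absolutely_integrable_on {0..b}" for b
      by (rule absolutely_integrable_continuous_real) (rule continuous_on_subset[OF u], auto)
    show "g 1 absolutely_integrable_on {0..b}" for b by (rule weighted_L1_imp_Icc[OF g1(2)])
    show "integral {0<..} (\<lambda>x. u x * deriv \<phi> x) = - integral {0<..} (\<lambda>x. g 1 x * \<phi> x)"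
      if "test_function \<phi>" for \<phi> using g1(1) that unfolding weak_deriv_def by simp
  qed
  then obtain c where c: "\<And>x. 0 \<le> x \<Longrightarrow> integral {0..x} u = integral {0..x} (\<lambda>s. c + integral {0..s} (g 1))"
    by blast
  define v where "v x = c + integral {0..x} w" for x
  have ac: "ac_deriv v w" unfolding v_def[abs_def] by (rule ac_deriv_indefinite[OF w(2)])
  have eq: "u x = v x" if "0 \<le> x" for x
  proof (rule continuous_eq_of_equal_primitive[OF u ac_deriv_continuous[OF ac] _ that])
    show "integral {0..x} u = integral {0..x} v" if "0 \<le> x" for x
      unfolding c[OF that] by (rule integral_cong) (use w(3) in \<open>simp add: v_def\<close>)
  qed
  have "ac_deriv (\<lambda>x. u x - a) (\<lambda>x. w x - 0)"
    by (rule ac_deriv_diff[OF _ ac_deriv_const], rule iffD2[OF ac_deriv_cong ac]) (use eq in auto)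
  then have "ac_deriv (\<lambda>x. u x - a) w" by simp
  from wsob_SucI[OF weighted_L1_of_real[OF L] w(1) ac_deriv_of_real[OF this]] M
  show ?thesis by simp
qed

section \<open>The model system and its Gronwall estimates\<close>

text \<open>The function \<open>\<Phi> exp (-\<integral> \<omega>)\<close> with \<open>\<Phi>\<close> the right-hand side of the inequality decreases.\<close>
lemma gronwall_forward:
  fixes f \<omega> :: "real \<Rightarrow> real"
  assumes ab: "a \<le> b" and f: "continuous_on {a..b} f" and \<omega>: "continuous_on {a..b} \<omega>"
    and nn: "\<And>t. t \<in> {a..b} \<Longrightarrow> 0 \<le> \<omega> t"
    and le: "\<And>t. t \<in> {a..b} \<Longrightarrow> f t \<le> C + integral {a..t} (\<lambda>x. \<omega> x * f x)"
  shows "f b \<le> C * exp (integral {a..b} \<omega>)"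
proof -
  define \<Phi> where "\<Phi> t = C + integral {a..t} (\<lambda>x. \<omega> x * f x)" for t
  define W where "W t = integral {a..t} \<omega>" for t
  have d\<Phi>: "(\<Phi> has_real_derivative \<omega> t * f t) (at t within {a..b})" if "t \<in> {a..b}" for t
    unfolding \<Phi>_def[abs_def] using integral_has_real_derivative[OF continuous_on_mult[OF \<omega> f] that]
    by (auto intro!: derivative_eq_intros)
  have dW: "(W has_real_derivative \<omega> t) (at t within {a..b})" if "t \<in> {a..b}" for t
    unfolding W_def[abs_def] by (rule integral_has_real_derivative[OF \<omega> that])
  have "((\<lambda>t. - (\<omega> t * f t * exp (- W t) - \<Phi> t * (\<omega> t * exp (- W t)))) has_integral
      (- (\<Phi> b * exp (- W b)) - - (\<Phi> a * exp (- W a)))) {a..b}"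
  proof (rule fundamental_theorem_of_calculus[OF ab])
    show "((\<lambda>t. - (\<Phi> t * exp (- W t))) has_vector_derivative
        - (\<omega> t * f t * exp (- W t) - \<Phi> t * (\<omega> t * exp (- W t)))) (at t within {a..b})"
      if "t \<in> {a..b}" for t
      unfolding has_real_derivative_iff_has_vector_derivative[symmetric]
      by (rule derivative_eq_intros d\<Phi>[OF that] dW[OF that] refl)+ simp
  qed
  moreover have "0 \<le> - (\<omega> t * f t * exp (- W t) - \<Phi> t * (\<omega> t * exp (- W t)))" if "t \<in> {a..b}" for t
  proof -
    have "\<omega> t * exp (- W t) * f t \<le> \<omega> t * exp (- W t) * \<Phi> t"
      using le[OF that] nn[OF that] by (intro mult_left_mono) (auto simp: \<Phi>_def)
    then show ?thesis by (simp add: algebra_simps)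
  qed
  ultimately have "0 \<le> - (\<Phi> b * exp (- W b)) - - (\<Phi> a * exp (- W a))"
    by (rule has_integral_nonneg)
  then have "\<Phi> b * exp (- W b) \<le> C" by (simp add: \<Phi>_def W_def)
  then have "\<Phi> b \<le> C * exp (W b)" by (simp add: exp_minus field_simps)
  then show ?thesis using le[of b] ab by (simp add: \<Phi>_def W_def)
qed

lemma gronwall_backward:
  fixes f \<omega> :: "real \<Rightarrow> real"
  assumes ab: "a \<le> b" and f: "continuous_on {a..b} f" and \<omega>: "continuous_on {a..b} \<omega>"
    and nn: "\<And>t. t \<in> {a..b} \<Longrightarrow> 0 \<le> \<omega> t"
    and le: "\<And>t. t \<in> {a..b} \<Longrightarrow> f t \<le> C + integral {t..b} (\<lambda>x. \<omega> x * f x)"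
  shows "f a \<le> C * exp (integral {a..b} \<omega>)"
proof -
  have cont: "continuous_on {-b..-a} (\<lambda>t. g (-t))" if "continuous_on {a..b} g" for g :: "real \<Rightarrow> real"
    by (rule continuous_on_compose2[OF that]) (auto intro!: continuous_intros)
  have "(\<lambda>t. f (-t)) (-a) \<le> C * exp (integral {-b..-a} (\<lambda>t. \<omega> (-t)))"
  proof (rule gronwall_forward)
    fix t assume "t \<in> {-b..-a}"
    then have "f (-t) \<le> C + integral {-t..b} (\<lambda>x. \<omega> x * f x)" by (intro le) auto
    also have "integral {-t..b} (\<lambda>x. \<omega> x * f x) = integral {-b..- (- t)} (\<lambda>x. \<omega> (-x) * f (-x))"
      by (rule Henstock_Kurzweil_Integration.integral_reflect_real[symmetric])
    finally show "f (-t) \<le> C + integral {-b..t} (\<lambda>x. \<omega> (-x) * f (-x))" by simp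
  qed (use ab nn cont[OF f] cont[OF \<omega>] in auto)
  then show ?thesis by simp
qed

text \<open>The pair \<open>(p, q)\<close> consists of the entries of one column: \<open>p\<close> the diagonal and \<open>q\<close> the off-diagonal
  one. A coefficient is named after the equation and the unknown that it multiplies, followed by
  the power of \<open>k\<close> with which it occurs. The sign \<open>s\<close> distinguishes the two columns.\<close>
locale lax_system =
  fixes n m :: nat and s :: complex and pq0 pq1 pp1 qp0 qp1 qq1 :: "real \<Rightarrow> complex"
  assumes s: "s = 1 \<or> s = -1"
    and coeffs: "wsob n (Suc m) pq0" "wsob n (Suc m) pq1" "wsob n (Suc m) pp1"
      "wsob n (Suc m) qp0" "wsob n (Suc m) qp1" "wsob n (Suc m) qq1"
begin

definition rate :: "complex \<Rightarrow> complex" where "rate k = - (\<i> * s / 2) * (k - 1 / k)"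

text \<open>The sources \<open>r1\<close>, \<open>r2\<close> are the residuals of approximate solutions.\<close>
definition solves :: "complex \<Rightarrow> (real \<Rightarrow> complex) \<Rightarrow> (real \<Rightarrow> complex) \<Rightarrow> (real \<Rightarrow> complex) \<Rightarrow> (real \<Rightarrow> complex) \<Rightarrow> bool"
  where "solves k p q r1 r2 \<longleftrightarrow>
    ac_deriv p (\<lambda>x. (pq0 x + k * pq1 x) * q x + k * pp1 x * p x + r1 x) \<and>
    ac_deriv q (\<lambda>x. rate k * q x + ((qp0 x + k * qp1 x) * p x + k * qq1 x * q x + r2 x))"

text \<open>A bound on the size of all coefficients together for \<open>|k| \<le> 2\<close>. The range of \<open>k\<close> exceeds the unit
  disc because the Cauchy estimates are applied on discs around points of the unit disc.\<close>
definition load :: "real \<Rightarrow> real" where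
  "load x = norm (pq0 x) + norm (qp0 x) + 2 * (norm (pq1 x) + norm (pp1 x) + norm (qp1 x) + norm (qq1 x))"

lemma coeffs_continuous: "continuous_on {0..} pq0" "continuous_on {0..} pq1" "continuous_on {0..} pp1"
   "continuous_on {0..} qp0" "continuous_on {0..} qp1" "continuous_on {0..} qq1"
  by (rule wsob_Suc_continuous, rule coeffs)+

lemma load_continuous: "0 \<le> a \<Longrightarrow> continuous_on {a..b} load"
  unfolding load_def[abs_def]
  by (intro continuous_intros; rule continuous_on_subset[OF coeffs_continuous(1)]
      continuous_on_subset[OF coeffs_continuous(2)] continuous_on_subset[OF coeffs_continuous(3)]
      continuous_on_subset[OF coeffs_continuous(4)] continuous_on_subset[OF coeffs_continuous(5)]
      continuous_on_subset[OF coeffs_continuous(6)]; auto)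

lemma load_nonneg: "0 \<le> load x" by (simp add: load_def)

lemma load_integrable: "load integrable_on {0..}"
proof -
  have "(\<lambda>x. norm (f x)) integrable_on {0..}" if "wsob n (Suc m) f" for f
    using weighted_L1c_imp_L1[OF wsob_imp_weighted_L1c[OF that]] unfolding absolutely_integrable_on_def by blast
  from this[OF coeffs(1)] this[OF coeffs(2)] this[OF coeffs(3)] this[OF coeffs(4)] this[OF coeffs(5)] this[OF coeffs(6)]
  show ?thesis unfolding load_def[abs_def] by (intro integrable_add integrable_on_mult_right)
qed

definition total_load :: real where "total_load = integral {0..} load"

lemma load_integral_le: "0 \<le> a \<Longrightarrow> integral {a..b} load \<le> total_load"
  unfolding total_load_def
  by (rule integral_subset_le)
    (auto intro: load_integrable load_nonneg integrable_continuous_real load_continuous)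

lemma solves_diff:
  assumes "solves k p q r1 r2" "solves k p' q' r1' r2'"
  shows "solves k (\<lambda>x. p x - p' x) (\<lambda>x. q x - q' x) (\<lambda>x. r1 x - r1' x) (\<lambda>x. r2 x - r2' x)"
proof -
  have "ac_deriv (\<lambda>x. p x - p' x) (\<lambda>x. ((pq0 x + k * pq1 x) * q x + k * pp1 x * p x + r1 x) -
      ((pq0 x + k * pq1 x) * q' x + k * pp1 x * p' x + r1' x))"
    "ac_deriv (\<lambda>x. q x - q' x) (\<lambda>x. (rate k * q x + ((qp0 x + k * qp1 x) * p x + k * qq1 x * q x + r2 x)) -
       (rate k * q' x + ((qp0 x + k * qp1 x) * p' x + k * qq1 x * q' x + r2' x)))"
    by (rule ac_deriv_diff[OF conjunct1[OF assms(1)[unfolded solves_def]] conjunct1[OF assms(2)[unfolded solves_def]]],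
        rule ac_deriv_diff[OF conjunct2[OF assms(1)[unfolded solves_def]] conjunct2[OF assms(2)[unfolded solves_def]]])
  then show ?thesis unfolding solves_def
    by (rule_tac conjI; erule_tac iffD1[OF ac_deriv_cong, rotated 2]; simp add: algebra_simps)
qed

lemma solves_continuous:
  assumes "solves k p q r1 r2" "0 \<le> a"
  shows "continuous_on {a..b} p" "continuous_on {a..b} q"
proof -
  have "continuous_on {0..} p" by (rule ac_deriv_continuous[OF conjunct1[OF assms(1)[unfolded solves_def]]])
  then show "continuous_on {a..b} p" by (rule continuous_on_subset) (use assms(2) in auto)
  have "continuous_on {0..} q" by (rule ac_deriv_continuous[OF conjunct2[OF assms(1)[unfolded solves_def]]])
  then show "continuous_on {a..b} q" by (rule continuous_on_subset) (use assms(2) in auto)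
qed

text \<open>One step of the variation of constants formula, in either direction: \<open>b\<close> is the end of the
  interval where the data are given and \<open>t\<close> the other end.\<close>
lemma solves_step_bound:
  assumes sol: "solves k p q r1 r2" and k: "norm k \<le> 2"
    and cd: "0 \<le> c" "c \<le> d" and tb: "t = d \<and> b = c \<or> t = c \<and> b = d"
    and K: "1 \<le> K" "\<And>\<tau>. \<tau> \<in> {c..d} \<Longrightarrow> norm (exp (rate k * of_real (t - \<tau>))) \<le> K"
    and r: "\<And>x. x \<in> {c..d} \<Longrightarrow> norm (r1 x) + norm (r2 x) \<le> \<rho> x" and \<rho>: "\<rho> integrable_on {c..d}"
  shows "norm (p t) + norm (q t) \<le> K * (norm (p b) + norm (q b))
     + K * integral {c..d} (\<lambda>x. load x * (norm (p x) + norm (q x)) + \<rho> x)"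
proof -
  define N where "N x = norm (p x) + norm (q x)" for x
  define fp where "fp x = (pq0 x + k * pq1 x) * q x + k * pp1 x * p x + r1 x" for x
  define fq where "fq x = (qp0 x + k * qp1 x) * p x + k * qq1 x * q x + r2 x" for x
  define gp where "gp x = (norm (pq0 x) + 2 * norm (pq1 x)) * norm (q x) + 2 * norm (pp1 x) * norm (p x) + norm (r1 x)" for x
  define gq where "gq x = (norm (qp0 x) + 2 * norm (qp1 x)) * norm (p x) + 2 * norm (qq1 x) * norm (q x) + norm (r2 x)" for x
  have acp: "ac_deriv p fp" and acq: "ac_deriv q (\<lambda>x. rate k * q x + fq x)"
    using sol unfolding solves_def fp_def[abs_def] fq_def[abs_def] by blast+
  have mix: "norm ((u + k * v) * y + k * w * z + r) \<le> (norm u + 2 * norm v) * norm y + 2 * norm w * norm z + norm r"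
    for u v y w z r :: complex
  proof -
    have kk: "norm (k * v) \<le> 2 * norm v" for v unfolding norm_mult using k by (intro mult_right_mono) auto
    have "norm ((u + k * v) * y) \<le> (norm u + 2 * norm v) * norm y"
      unfolding norm_mult using norm_triangle_ineq[of u "k * v"] kk[of v] by (intro mult_right_mono) auto
    moreover have "norm (k * w * z) \<le> 2 * norm w * norm z"
      using mult_right_mono[OF kk[of w] norm_ge_zero[of z]] by (simp add: norm_mult)
    ultimately show ?thesis
      using norm_triangle_ineq[of "(u + k * v) * y + k * w * z" r] norm_triangle_ineq[of "(u + k * v) * y" "k * w * z"]
      by linarith
  qed
  have fpb: "norm (fp x) \<le> gp x" and fqb: "norm (fq x) \<le> gq x" for x
    unfolding fp_def gp_def fq_def gq_def by (rule mix)+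
  have gN: "gp x + gq x \<le> load x * N x + \<rho> x" if "x \<in> {c..d}" for x
  proof -
    have "(norm (pq0 x) + 2 * norm (pq1 x)) * norm (q x) + 2 * norm (pp1 x) * norm (p x)
      + ((norm (qp0 x) + 2 * norm (qp1 x)) * norm (p x) + 2 * norm (qq1 x) * norm (q x))
      = (norm (pq0 x) + 2 * norm (pq1 x) + 2 * norm (qq1 x)) * norm (q x) +
        (2 * norm (pp1 x) + norm (qp0 x) + 2 * norm (qp1 x)) * norm (p x)" by (simp add: algebra_simps)
    also have "\<dots> \<le> load x * norm (q x) + load x * norm (p x)"
      by (intro add_mono mult_right_mono) (auto simp: load_def)
    finally show ?thesis using r[OF that] unfolding gp_def gq_def N_def by (simp add: algebra_simps)
  qed
  have fp_ai: "fp absolutely_integrable_on {c..d}" "p d - p c = integral {c..d} fp"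
    using ac_deriv_increment[OF acp cd] by blast+
  define E where "E x = exp (- rate k * of_real x)" for x :: real
  have Eder: "(E has_vector_derivative (- rate k * E x)) (at x within {0..})" for x
    unfolding E_def[abs_def]
    by (rule has_vector_derivative_real_field) (auto intro!: derivative_eq_intros)
  have Econt: "continuous_on S E" for S unfolding E_def[abs_def] by (intro continuous_intros)
  have "ac_deriv E (\<lambda>x. - rate k * E x)"
    by (rule ac_derivI_continuous[OF Eder]) (intro continuous_intros Econt)
  from ac_deriv_mult[OF this acq]
  have "ac_deriv (\<lambda>x. E x * q x) (\<lambda>x. E x * fq x)"
    by (rule iffD1[OF ac_deriv_cong, rotated 2]) (simp_all add: algebra_simps)
  note Eq = ac_deriv_increment[OF this cd]
  have Et: "exp (rate k * of_real t) * E \<tau> = exp (rate k * of_real (t - \<tau>))" for \<tau>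
    unfolding E_def by (simp add: exp_add[symmetric] algebra_simps)
  have Et1: "exp (rate k * of_real t) * E t = 1" unfolding Et by simp
  have fq_ai: "fq absolutely_integrable_on {c..d}"
  proof -
    have "(\<lambda>x. (1 / E x) * (E x * fq x)) absolutely_integrable_on {c..d}"
      by (rule ai_mult_continuous_Icc[OF _ Eq(1)]) (intro continuous_intros Econt, simp add: E_def)
    moreover have "(1 / E x) * (E x * fq x) = fq x" for x by (simp add: E_def)
    ultimately show ?thesis by simp
  qed
  have qt: "norm (q t) \<le> K * norm (q b) + K * integral {c..d} (\<lambda>x. norm (fq x))"
  proof -
    have ai: "(\<lambda>x. exp (rate k * of_real t) * (E x * fq x)) absolutely_integrable_on {c..d}"
      using Eq(1) by (rule set_integrable_mult_right)
    have "norm (integral {c..d} (\<lambda>x. exp (rate k * of_real t) * (E x * fq x))) \<le> integral {c..d} (\<lambda>x. K * norm (fq x))"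
    proof (rule integral_norm_bound_integral)
      show "(\<lambda>x. exp (rate k * of_real t) * (E x * fq x)) integrable_on {c..d}"
        using ai unfolding absolutely_integrable_on_def by blast
      show "(\<lambda>x. K * norm (fq x)) integrable_on {c..d}"
        using fq_ai unfolding absolutely_integrable_on_def by (intro integrable_on_mult_right) blast
      show "norm (exp (rate k * of_real t) * (E x * fq x)) \<le> K * norm (fq x)" if "x \<in> {c..d}" for x
        unfolding mult.assoc[symmetric] Et norm_mult[of "exp _"]
        using K(2)[OF that] by (intro mult_right_mono) auto
    qed
    moreover have "integral {c..d} (\<lambda>x. exp (rate k * of_real t) * (E x * fq x)) = exp (rate k * of_real t) * (E d * q d - E c * q c)"
      unfolding Eq(2) by (rule integral_mult_right)
    ultimately have 1: "norm (exp (rate k * of_real t) * (E d * q d - E c * q c)) \<le> K * integral {c..d} (\<lambda>x. norm (fq x))"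
      by simp
    have "q t = exp (rate k * of_real t) * E t * q t" using Et1 by simp
    also have "\<dots> = exp (rate k * of_real t) * E b * q b + exp (rate k * of_real t) * (E t * q t - E b * q b)"
      by (simp add: algebra_simps)
    finally have "norm (q t) = norm (exp (rate k * of_real t) * E b * q b + exp (rate k * of_real t) * (E t * q t - E b * q b))"
      by (rule arg_cong)
    also have "\<dots> \<le> norm (exp (rate k * of_real t) * E b * q b) + norm (exp (rate k * of_real t) * (E t * q t - E b * q b))"
      by (rule norm_triangle_ineq)
    also have "norm (exp (rate k * of_real t) * E b * q b) = norm (exp (rate k * of_real t) * E b) * norm (q b)"
      by (rule norm_mult)
    also have "norm (exp (rate k * of_real t) * (E t * q t - E b * q b)) = norm (exp (rate k * of_real t) * (E d * q d - E c * q c))"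
      using tb by (auto simp: norm_mult norm_minus_commute)
    also have "norm (exp (rate k * of_real t) * E b) * norm (q b) \<le> K * norm (q b)"
      unfolding Et by (rule mult_right_mono[OF K(2)]) (use tb cd in auto)
    finally show ?thesis using 1 by linarith
  qed
  have pt: "norm (p t) \<le> K * norm (p b) + K * integral {c..d} (\<lambda>x. norm (fp x))"
  proof -
    have "norm (p t) \<le> norm (p b) + norm (p t - p b)" using norm_triangle_ineq[of "p b" "p t - p b"] by simp
    also have "norm (p t - p b) = norm (p d - p c)" using tb by (auto simp: norm_minus_commute)
    also have "\<dots> \<le> integral {c..d} (\<lambda>x. norm (fp x))" unfolding fp_ai(2) by (rule integral_norm_le[OF fp_ai(1)])
    finally have 1: "norm (p t) \<le> norm (p b) + integral {c..d} (\<lambda>x. norm (fp x))" by simp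
    have "0 \<le> integral {c..d} (\<lambda>x. norm (fp x))"
      using fp_ai(1) unfolding absolutely_integrable_on_def by (intro integral_nonneg) auto
    then show ?thesis using 1 mult_right_mono[OF K(1), of "norm (p b)"] mult_right_mono[OF K(1), of "integral {c..d} (\<lambda>x. norm (fp x))"]
      by auto
  qed
  have nfi: "(\<lambda>x. norm (fp x)) integrable_on {c..d}" "(\<lambda>x. norm (fq x)) integrable_on {c..d}"
    using fp_ai(1) fq_ai unfolding absolutely_integrable_on_def by blast+
  have Ni: "(\<lambda>x. load x * N x) integrable_on {c..d}"
    unfolding N_def[abs_def]
    by (intro integrable_continuous_real continuous_intros load_continuous solves_continuous[OF sol] cd)
  have "integral {c..d} (\<lambda>x. norm (fp x)) + integral {c..d} (\<lambda>x. norm (fq x)) =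
      integral {c..d} (\<lambda>x. norm (fp x) + norm (fq x))" by (rule integral_add[OF nfi, symmetric])
  also have "\<dots> \<le> integral {c..d} (\<lambda>x. load x * N x + \<rho> x)"
  proof (rule integral_le)
    show "norm (fp x) + norm (fq x) \<le> load x * N x + \<rho> x" if "x \<in> {c..d}" for x
      using fpb[of x] fqb[of x] gN[OF that] by linarith
  qed (intro integrable_add nfi Ni \<rho>)+
  finally have "K * (integral {c..d} (\<lambda>x. norm (fp x)) + integral {c..d} (\<lambda>x. norm (fq x))) \<le> K * integral {c..d} (\<lambda>x. load x * N x + \<rho> x)"
    using K(1) by (intro mult_left_mono) auto
  then show ?thesis using pt qt unfolding N_def by (simp add: algebra_simps)
qed

text \<open>Gronwall's inequality. The only information on the exponent is a bound \<open>K\<close> on its kernel.\<close>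
lemma solves_bound:
  assumes sol: "solves k p q r1 r2" and k: "norm k \<le> 2"
    and cd: "0 \<le> c" "c \<le> d" and K: "1 \<le> K"
    and r: "\<And>x. x \<in> {c..d} \<Longrightarrow> norm (r1 x) + norm (r2 x) \<le> \<rho> x" and \<rho>: "\<rho> integrable_on {c..d}"
  shows solves_forward_bound:
      "(\<And>t \<tau>. \<lbrakk>c \<le> \<tau>; \<tau> \<le> t; t \<le> d\<rbrakk> \<Longrightarrow> norm (exp (rate k * of_real (t - \<tau>))) \<le> K) \<Longrightarrow>
       norm (p d) + norm (q d) \<le> K * exp (K * total_load) * (norm (p c) + norm (q c) + integral {c..d} \<rho>)"
    and solves_backward_bound:
      "(\<And>t \<tau>. \<lbrakk>c \<le> t; t \<le> \<tau>; \<tau> \<le> d\<rbrakk> \<Longrightarrow> norm (exp (rate k * of_real (t - \<tau>))) \<le> K) \<Longrightarrow>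
       norm (p c) + norm (q c) \<le> K * exp (K * total_load) * (norm (p d) + norm (q d) + integral {c..d} \<rho>)"
proof -
  define N where "N x = norm (p x) + norm (q x)" for x
  have N0: "0 \<le> N x" for x by (simp add: N_def)
  have \<rho>0: "0 \<le> \<rho> x" if "x \<in> {c..d}" for x using r[OF that] by (smt (verit) norm_ge_zero)
  have Ncont: "continuous_on {c..d} N"
    unfolding N_def[abs_def] by (intro continuous_intros solves_continuous[OF sol] cd)
  have lcont: "continuous_on {c..d} (\<lambda>x. K * load x)" by (intro continuous_intros load_continuous cd)
  have l0: "0 \<le> K * load x" for x using K load_nonneg[of x] by simp
  have \<rho>sub: "\<rho> integrable_on {a..b}" "integral {a..b} \<rho> \<le> integral {c..d} \<rho>" if "c \<le> a" "b \<le> d" for a b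
  proof -
    show 1: "\<rho> integrable_on {a..b}" by (rule integrable_on_subinterval[OF \<rho>]) (use that in auto)
    show "integral {a..b} \<rho> \<le> integral {c..d} \<rho>"
      by (rule integral_subset_le) (use 1 \<rho> \<rho>0 that in auto)
  qed
  have split: "K * integral {a..b} (\<lambda>x. load x * N x + \<rho> x) \<le> K * integral {c..d} \<rho> + integral {a..b} (\<lambda>x. K * load x * N x)"
    if "c \<le> a" "a \<le> b" "b \<le> d" for a b
  proof -
    have i: "(\<lambda>x. load x * N x) integrable_on {a..b}"
      by (intro integrable_continuous_real continuous_intros load_continuous continuous_on_subset[OF Ncont])
        (use that cd in auto)
    have "integral {a..b} (\<lambda>x. load x * N x + \<rho> x) = integral {a..b} (\<lambda>x. load x * N x) + integral {a..b} \<rho>"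
      using that by (intro integral_add i \<rho>sub) auto
    moreover have "integral {a..b} (\<lambda>x. K * load x * N x) = K * integral {a..b} (\<lambda>x. load x * N x)"
      by (simp add: mult.assoc)
    moreover have "K * integral {a..b} \<rho> \<le> K * integral {c..d} \<rho>"
      using \<rho>sub(2)[of a b] that K by (intro mult_left_mono) auto
    ultimately show ?thesis by (simp add: distrib_left)
  qed
  have I: "0 \<le> integral {c..d} \<rho>" by (rule integral_nonneg[OF \<rho>]) (use \<rho>0 in auto)
  have fin: "K * (N x + integral {c..d} \<rho>) * exp (integral {c..d} (\<lambda>x. K * load x))
      \<le> K * exp (K * total_load) * (N x + integral {c..d} \<rho>)" for x
  proof -
    have "integral {c..d} (\<lambda>x. K * load x) \<le> K * total_load"
      using load_integral_le[OF cd(1), of d] K by (simp add: mult_left_mono)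
    then have "K * (N x + integral {c..d} \<rho>) * exp (integral {c..d} (\<lambda>x. K * load x))
        \<le> K * (N x + integral {c..d} \<rho>) * exp (K * total_load)"
      using K N0 I by (intro mult_left_mono) auto
    then show ?thesis by (simp add: ac_simps)
  qed
  {
    assume E: "\<And>t \<tau>. \<lbrakk>c \<le> \<tau>; \<tau> \<le> t; t \<le> d\<rbrakk> \<Longrightarrow> norm (exp (rate k * of_real (t - \<tau>))) \<le> K"
    have "N d \<le> K * (N c + integral {c..d} \<rho>) * exp (integral {c..d} (\<lambda>x. K * load x))"
    proof (rule gronwall_forward[OF cd(2) Ncont lcont l0])
      fix t assume t: "t \<in> {c..d}"
      have "N t \<le> K * N c + K * integral {c..t} (\<lambda>x. load x * N x + \<rho> x)"
        unfolding N_def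
      proof (rule solves_step_bound[OF sol k])
        show "\<rho> integrable_on {c..t}" by (rule \<rho>sub(1)) (use t in auto)
      qed (use t cd K E r in auto)
      also have "K * integral {c..t} (\<lambda>x. load x * N x + \<rho> x) \<le> K * integral {c..d} \<rho> + integral {c..t} (\<lambda>x. K * load x * N x)"
        by (rule split) (use t in auto)
      finally show "N t \<le> K * (N c + integral {c..d} \<rho>) + integral {c..t} (\<lambda>x. K * load x * N x)"
        by (simp add: distrib_left)
    qed
    with fin[of c] show "norm (p d) + norm (q d) \<le> K * exp (K * total_load) * (norm (p c) + norm (q c) + integral {c..d} \<rho>)"
      unfolding N_def by linarith
  next
    assume E: "\<And>t \<tau>. \<lbrakk>c \<le> t; t \<le> \<tau>; \<tau> \<le> d\<rbrakk> \<Longrightarrow> norm (exp (rate k * of_real (t - \<tau>))) \<le> K"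
    have "N c \<le> K * (N d + integral {c..d} \<rho>) * exp (integral {c..d} (\<lambda>x. K * load x))"
    proof (rule gronwall_backward[OF cd(2) Ncont lcont l0])
      fix t assume t: "t \<in> {c..d}"
      have "N t \<le> K * N d + K * integral {t..d} (\<lambda>x. load x * N x + \<rho> x)"
        unfolding N_def
      proof (rule solves_step_bound[OF sol k])
        show "\<rho> integrable_on {t..d}" by (rule \<rho>sub(1)) (use t in auto)
      qed (use t cd K E r in auto)
      also have "K * integral {t..d} (\<lambda>x. load x * N x + \<rho> x) \<le> K * integral {c..d} \<rho> + integral {t..d} (\<lambda>x. K * load x * N x)"
        by (rule split) (use t in auto)
      finally show "N t \<le> K * (N d + integral {c..d} \<rho>) + integral {t..d} (\<lambda>x. K * load x * N x)"
        by (simp add: distrib_left)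
    qed
    with fin[of d] show "norm (p c) + norm (q c) \<le> K * exp (K * total_load) * (norm (p d) + norm (q d) + integral {c..d} \<rho>)"
      unfolding N_def by linarith
  }
qed

section \<open>Formal solutions and their truncations\<close>

text \<open>The recursion for the formal series \<open>\<Sum> P j k^j\<close>, \<open>\<Sum> Q j k^j\<close>: the equation for \<open>q\<close> is solved for
  the coefficient in front of the \<open>1/k\<close> in the rate, which gives \<open>Q (j + 1)\<close> algebraically at the cost
  of one derivative, and the equation for \<open>p\<close> then gives the derivative of \<open>P (j + 1)\<close>.\<close>
definition formal :: "(int \<Rightarrow> real \<Rightarrow> complex) \<Rightarrow> (int \<Rightarrow> real \<Rightarrow> complex) \<Rightarrow> bool" where
  "formal P Q \<longleftrightarrow>
     (\<forall>x\<ge>0. P (-1) x = 0 \<and> Q (-1) x = 0 \<and> Q 0 x = 0 \<and> P 0 x = P 0 0) \<and>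
     (\<forall>j\<in>{0..int m}. \<forall>x\<ge>0.
        (\<exists>D. (Q j has_vector_derivative D) (at x within {0..}) \<and>
           Q (j + 1) x = 2 * \<i> * s * (- D - \<i> / 2 * s * Q (j - 1) x + qp0 x * P j x
              + qp1 x * P (j - 1) x + qq1 x * Q (j - 1) x)) \<and>
        (P (j + 1) has_vector_derivative (pq0 x * Q (j + 1) x + pq1 x * Q j x + pp1 x * P j x))
          (at x within {0..}))"

lemma formal_step:
  assumes f: "formal P Q" and i: "i \<le> m" and e: "e \<le> m"
    and reg: "wsob n (Suc (Suc e)) (Q (int i))" "bsob n (Suc (Suc e)) (P (int i))"
      "wsob n (Suc (Suc e)) (Q (int i - 1))" "bsob n (Suc (Suc e)) (P (int i - 1))"
  shows "wsob n (Suc e) (Q (int i + 1))" "bsob n (Suc e) (P (int i + 1))"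
proof -
  have ij: "int i \<in> {0..int m}" using i by simp
  have c: "wsob n (Suc e) pq0" "wsob n (Suc e) pq1" "wsob n (Suc e) pp1"
      "wsob n (Suc e) qp0" "wsob n (Suc e) qp1" "wsob n (Suc e) qq1"
    by (rule wsob_mono[OF _ Suc_le_mono[THEN iffD2, OF e]], rule coeffs)+
  have Q: "wsob n (Suc e) (Q (int i))" "wsob n (Suc e) (Q (int i - 1))"
    by (rule wsob_SucD[OF reg(1)], rule wsob_SucD[OF reg(3)])
  have P: "bsob n (Suc e) (P (int i))" "bsob n (Suc e) (P (int i - 1))"
    by (rule bsob_mono[OF reg(2)], simp, rule bsob_mono[OF reg(4)], simp)
  obtain g where g: "wsob n (Suc e) g" "ac_deriv (Q (int i)) g"
    using reg(1) unfolding wsob.simps(2)[of n "Suc e"] by blast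
  note gd = ac_deriv_imp_has_vector_derivative[OF g(2) wsob_Suc_continuous[OF g(1)]]
  have PP: "wsob n (Suc e) (\<lambda>x. f x * P j x)" if "wsob n (Suc e) f" "bsob n (Suc e) (P j)" for f j
    using wsob_bsob_mult[OF that(2,1)] by (simp only: mult.commute)
  have rhs: "wsob n (Suc e) (\<lambda>x. 2 * \<i> * s * (-1 * g x - \<i> / 2 * s * Q (int i - 1) x + qp0 x * P (int i) x
              + qp1 x * P (int i - 1) x + qq1 x * Q (int i - 1) x))"
    by (intro wsob_cmult wsob_add wsob_diff wsob_wsob_mult PP c P Q g)
  have Qeq: "Q (int i + 1) x = 2 * \<i> * s * (-1 * g x - \<i> / 2 * s * Q (int i - 1) x + qp0 x * P (int i) x
              + qp1 x * P (int i - 1) x + qq1 x * Q (int i - 1) x)" if x: "0 \<le> x" for x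
  proof -
    obtain D where D: "(Q (int i) has_vector_derivative D) (at x within {0..})"
      "Q (int i + 1) x = 2 * \<i> * s * (- D - \<i> / 2 * s * Q (int i - 1) x + qp0 x * P (int i) x
              + qp1 x * P (int i - 1) x + qq1 x * Q (int i - 1) x)"
      using f ij x unfolding formal_def by blast
    have "D = g x" by (rule has_vector_derivative_unique_nonneg[OF D(1) gd[OF x] x])
    with D(2) show ?thesis by simp
  qed
  show 1: "wsob n (Suc e) (Q (int i + 1))"
    by (rule iffD2[OF wsob_cong rhs]) (rule Qeq)
  have "wsob n (Suc e) (\<lambda>x. pq0 x * Q (int i + 1) x + pq1 x * Q (int i) x + pp1 x * P (int i) x)"
    by (intro wsob_add wsob_wsob_mult PP c P Q 1)
  moreover from this have "ac_deriv (P (int i + 1)) (\<lambda>x. pq0 x * Q (int i + 1) x + pq1 x * Q (int i) x + pp1 x * P (int i) x)"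
  proof (intro ac_derivI_continuous)
    show "(P (int i + 1) has_vector_derivative (pq0 x * Q (int i + 1) x + pq1 x * Q (int i) x + pp1 x * P (int i) x))
          (at x within {0..})" if "0 \<le> x" for x
      using f ij that unfolding formal_def by blast
  qed (rule wsob_Suc_continuous)
  ultimately show "bsob n (Suc e) (P (int i + 1))" unfolding bsob_def by blast
qed

text \<open>Every order costs one derivative. The coefficients of order \<open>j - 1\<close> are carried along because the
  recursion reaches back two orders.\<close>
lemma formal_regular:
  assumes f: "formal P Q" and j: "j \<le> Suc m"
  shows "wsob n (m + 2 - j) (Q (int j)) \<and> bsob n (m + 2 - j) (P (int j)) \<and>
    wsob n (m + 2 - j) (Q (int j - 1)) \<and> bsob n (m + 2 - j) (P (int j - 1))"
  using j
proof (induction j)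
  case 0
  have f0: "P (-1) x = 0" "Q (-1) x = 0" "Q 0 x = 0" "P 0 x = P 0 0" if "0 \<le> x" for x
    using f that unfolding formal_def by blast+
  have z: "wsob n p h" "bsob n p h" if "\<And>x. 0 \<le> x \<Longrightarrow> h x = 0" for h p
    by (rule iffD2[OF wsob_cong wsob_zero[of n p]], rule that, assumption,
        rule iffD2[OF bsob_cong bsob_const[of n p 0]], rule that, assumption)
  have b: "bsob n p (P 0)" for p
    by (rule iffD2[OF bsob_cong bsob_const[of n p "P 0 0"]]) (rule f0)
  have "wsob n (m+2) (Q 0)" "wsob n (m+2) (Q (-1))" "bsob n (m+2) (P (-1))"
    by (rule z, erule f0)+
  then show ?case using b by simp
next
  case (Suc i)
  define e where "e = m - i"
  have e: "e \<le> m" "m + 2 - i = Suc (Suc e)" "m + 2 - Suc i = Suc e" using Suc.prems by (auto simp: e_def)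
  have IH: "wsob n (Suc (Suc e)) (Q (int i))" "bsob n (Suc (Suc e)) (P (int i))"
      "wsob n (Suc (Suc e)) (Q (int i - 1))" "bsob n (Suc (Suc e)) (P (int i - 1))"
    using Suc.IH Suc.prems unfolding e by auto
  have i: "int (Suc i) = int i + 1" "int (Suc i) - 1 = int i" by auto
  have "bsob n (Suc e) (P (int i))" by (rule bsob_mono[OF IH(2)]) simp
  moreover have "i \<le> m" using Suc.prems by simp
  note st = formal_step[OF f this e(1) IH]
  ultimately show ?case unfolding e i add_diff_cancel_right'
    by (intro conjI st wsob_SucD[OF IH(1)])
qed

end

lemma shifted_power_sum:
  fixes F :: "int \<Rightarrow> complex"
  assumes "F (-1) = 0"
  shows "(\<Sum>j\<le>N. k ^ j * F (int j - 1)) = k * ((\<Sum>j\<le>N. k ^ j * F (int j)) - k ^ N * F (int N))"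
proof (induction N)
  case 0
  then show ?case using assms by simp
next
  case (Suc N)
  have i: "int (Suc N) - 1 = int N" by simp
  have "(\<Sum>j\<le>Suc N. k ^ j * F (int j - 1)) = (\<Sum>j\<le>N. k ^ j * F (int j - 1)) + k ^ Suc N * F (int N)"
    unfolding sum.atMost_Suc i ..
  then show ?case unfolding Suc sum.atMost_Suc by (simp add: algebra_simps)
qed

lemma unshifted_power_sum:
  fixes F :: "int \<Rightarrow> complex"
  assumes "F 0 = 0" "k \<noteq> 0"
  shows "(\<Sum>j\<le>N. k ^ j * F (int j + 1)) = (\<Sum>j\<le>Suc N. k ^ j * F (int j)) / k"
  unfolding sum.atMost_Suc_shift using assms
  by (simp add: sum_distrib_left sum_divide_distrib add.commute)

context lax_system
begin

definition trunc :: "(int \<Rightarrow> real \<Rightarrow> complex) \<Rightarrow> complex \<Rightarrow> real \<Rightarrow> complex" where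
  "trunc F k x = (\<Sum>j\<le>Suc m. k ^ j * F (int j) x)"

lemma trunc_bounded:
  assumes "\<And>j. j \<le> Suc m \<Longrightarrow> bsob n 0 (F (int j))"
  shows "\<exists>B. \<forall>k x. norm k \<le> 2 \<longrightarrow> 0 \<le> x \<longrightarrow> norm (trunc F k x) \<le> B"
proof -
  have "\<exists>b. \<forall>x\<ge>0. norm (F (int j) x) \<le> b" if "j \<le> Suc m" for j
    using bsob_bounded[OF assms[OF that]] by metis
  then obtain b where b: "\<And>j x. j \<le> Suc m \<Longrightarrow> 0 \<le> x \<Longrightarrow> norm (F (int j) x) \<le> b j" by metis
  have "norm (trunc F k x) \<le> (\<Sum>j\<le>Suc m. 2 ^ j * b j)" if "norm k \<le> 2" "0 \<le> x" for k x
    unfolding trunc_def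
  proof (rule sum_norm_le)
    fix j assume j: "j \<in> {..Suc m}"
    have "norm (k ^ j) \<le> 2 ^ j" unfolding norm_power using that(1) by (intro power_mono) auto
    then show "norm (k ^ j * F (int j) x) \<le> 2 ^ j * b j"
      unfolding norm_mult using b[of j x] j that by (intro mult_mono) (auto intro: order_trans)
  qed
  then show ?thesis by blast
qed

text \<open>All powers of \<open>k\<close> below \<open>m + 1\<close> cancel by the recursion. What is left over is
  \<open>k^(m+1)\<close> times functions built from the last coefficients; \<open>\<rho>\<close> dominates them for \<open>|k| \<le> 2\<close>.\<close>
lemma formal_trunc:
  assumes f: "formal P Q"
  obtains \<rho> B where "weighted_L1c n (\<lambda>x. of_real (\<rho> x))" "\<And>x. 0 \<le> \<rho> x"
    "\<And>k x. norm k \<le> 2 \<Longrightarrow> 0 \<le> x \<Longrightarrow> norm (trunc P k x) + norm (trunc Q k x) \<le> B"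
    "\<And>k. k \<noteq> 0 \<Longrightarrow> norm k \<le> 2 \<Longrightarrow> \<exists>r1 r2. solves k (trunc P k) (trunc Q k) r1 r2 \<and>
        (\<forall>x\<ge>0. norm (r1 x) + norm (r2 x) \<le> norm k ^ Suc m * \<rho> x)"
proof -
  have f0: "P (-1) x = 0" "Q (-1) x = 0" "Q 0 x = 0" "P 0 x = P 0 0" if "0 \<le> x" for x
    using f that unfolding formal_def by blast+
  have regQ: "wsob n (m + 2 - j) (Q (int j))" and regP: "bsob n (m + 2 - j) (P (int j))"
    and regQ': "wsob n (m + 2 - j) (Q (int j - 1))" and regP': "bsob n (m + 2 - j) (P (int j - 1))"
    if "j \<le> Suc m" for j
    using formal_regular[OF f that] by blast+
  have Q1: "wsob n 1 (Q (int j))" "wsob n 1 (Q (int j - 1))" if "j \<le> Suc m" for j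
    by (rule wsob_mono[OF regQ[OF that]], use that in simp, rule wsob_mono[OF regQ'[OF that]], use that in simp)
  have P1: "bsob n 1 (P (int j))" "bsob n 1 (P (int j - 1))" if "j \<le> Suc m" for j
    by (rule bsob_mono[OF regP[OF that]], use that in simp, rule bsob_mono[OF regP'[OF that]], use that in simp)
  have c1: "wsob n 1 pq0" "wsob n 1 pq1" "wsob n 1 pp1" "wsob n 1 qp0" "wsob n 1 qp1" "wsob n 1 qq1"
    by (rule wsob_mono[OF coeffs(1)], simp, rule wsob_mono[OF coeffs(2)], simp, rule wsob_mono[OF coeffs(3)], simp,
       rule wsob_mono[OF coeffs(4)], simp, rule wsob_mono[OF coeffs(5)], simp, rule wsob_mono[OF coeffs(6)], simp)
  have PP: "wsob n 1 (\<lambda>x. h x * P j x)" if "wsob n 1 h" "bsob n 1 (P j)" for h j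
    using wsob_bsob_mult[OF that(2,1)] by (simp only: mult.commute)
  have QQ: "wsob n 1 (\<lambda>x. h x * Q j x)" if "wsob n 1 h" "wsob n 1 (Q j)" for h j
    using wsob_wsob_mult[of n 0 h "Q j"] that by simp
  have cont1: "continuous_on {0..} h" if "wsob n 1 h" for h using that wsob_Suc_continuous[of n 0 h] by simp
  define dP where "dP j x = pq0 x * Q (int j) x + pq1 x * Q (int j - 1) x + pp1 x * P (int j - 1) x" for j x
  define dQ where "dQ j x = - (\<i> * s / 2) * Q (int j - 1) x + qp0 x * P (int j) x + qp1 x * P (int j - 1) x
      + qq1 x * Q (int j - 1) x + (\<i> * s / 2) * Q (int j + 1) x" for j x
  have acP: "ac_deriv (P (int j)) (dP j)" if j: "j \<le> Suc m" for j
  proof (rule ac_derivI_continuous)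
    have "wsob n 1 (dP j)" unfolding dP_def[abs_def]
      by (intro wsob_add PP QQ c1 P1 Q1 j)
    then show "continuous_on {0..} (dP j)" by (rule cont1)
    fix x :: real assume x: "0 \<le> x"
    show "(P (int j) has_vector_derivative dP j x) (at x within {0..})"
    proof (cases j)
      case 0
      have "((\<lambda>x. P 0 0) has_vector_derivative 0) (at x within {0..})" by (rule has_vector_derivative_const)
      then have "(P 0 has_vector_derivative 0) (at x within {0..})"
        by (rule has_vector_derivative_transform[rotated 2]) (use x in simp, rule f0(4), simp)
      then show ?thesis unfolding 0 dP_def using f0(1-3)[OF x] by simp
    next
      case (Suc i)
      have "int i \<in> {0..int m}" using j Suc by simp
      then have "(P (int i + 1) has_vector_derivative (pq0 x * Q (int i + 1) x + pq1 x * Q (int i) x + pp1 x * P (int i) x))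
          (at x within {0..})" using f x unfolding formal_def by blast
      moreover have e: "int j = int i + 1" "int j - 1 = int i" using Suc by auto
      ultimately show ?thesis unfolding dP_def e(2) unfolding e(1) by blast
    qed
  qed
  have acQ: "ac_deriv (Q (int j)) (dQ j)" if j: "j \<le> m" for j
  proof (rule ac_derivI_continuous)
    have i: "int j + 1 = int (Suc j)" by simp
    have "wsob n 1 (dQ j)" unfolding dQ_def[abs_def] i
      by (intro wsob_add wsob_cmult PP QQ c1 P1 Q1; use j in simp)
    then show "continuous_on {0..} (dQ j)" by (rule cont1)
    fix x :: real assume x: "0 \<le> x"
    have "int j \<in> {0..int m}" using j by simp
    then obtain D where D: "(Q (int j) has_vector_derivative D) (at x within {0..})"
      "Q (int j + 1) x = 2 * \<i> * s * (- D - \<i> / 2 * s * Q (int j - 1) x + qp0 x * P (int j) x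
              + qp1 x * P (int j - 1) x + qq1 x * Q (int j - 1) x)"
      using f x unfolding formal_def by blast
    have ss: "\<i> * s / 2 * (2 * \<i> * s * y) = - y" for y using s by auto
    have "\<i> * s / 2 * Q (int j + 1) x = - (- D - \<i> / 2 * s * Q (int j - 1) x + qp0 x * P (int j) x
              + qp1 x * P (int j - 1) x + qq1 x * Q (int j - 1) x)" unfolding D(2) by (rule ss)
    then have "D = dQ j x" unfolding dQ_def by (simp add: algebra_simps)
    then show "(Q (int j) has_vector_derivative dQ j x) (at x within {0..})" using D(1) by simp
  qed
  obtain g where g: "weighted_L1c n g" "ac_deriv (Q (int (Suc m))) g"
    using Q1(1)[OF order_refl] unfolding One_nat_def wsob.simps by blast
  define M where "M = int (Suc m)"
  have Mm: "M - 1 = int m" by (simp add: M_def)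
  define \<rho> where "\<rho> x = 2 * (norm (g x) + norm (Q (M - 1) x) + norm (Q M x) + norm (qp0 x * P M x)
     + norm (qp1 x * P (M - 1) x) + norm (qp1 x * P M x) + norm (qq1 x * Q (M - 1) x) + norm (qq1 x * Q M x)
     + norm (pq1 x * Q M x) + norm (pp1 x * P M x))" for x
  have W: "weighted_L1c n (\<lambda>x. of_real (norm (h x)))" if "wsob n 1 h" for h
    by (rule weighted_L1c_norm[OF wsob_imp_weighted_L1c[OF that]])
  have QM: "wsob n 1 (Q M)" "wsob n 1 (Q (M - 1))" and PM: "bsob n 1 (P M)" "bsob n 1 (P (M - 1))"
    unfolding M_def by (rule Q1 P1; simp)+
  have "weighted_L1c n (\<lambda>x. of_real (\<rho> x))"
    unfolding \<rho>_def of_real_mult of_real_add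
    by (intro weighted_L1c_cmult weighted_L1c_add weighted_L1c_norm[OF g(1)] W PP QQ c1 QM PM)
  moreover have "0 \<le> \<rho> x" for x by (simp add: \<rho>_def)
  moreover have "\<exists>B. \<forall>k x. norm k \<le> 2 \<longrightarrow> 0 \<le> x \<longrightarrow> norm (trunc P k x) + norm (trunc Q k x) \<le> B"
  proof -
    have b: "bsob n 0 (P (int j))" if "j \<le> Suc m" for j by (rule bsob_mono[OF P1(1)[OF that]]) simp
    obtain B1 where B1: "\<And>k x. norm k \<le> 2 \<Longrightarrow> 0 \<le> x \<Longrightarrow> norm (trunc P k x) \<le> B1"
      using trunc_bounded[of P, OF b] by blast
    have b': "bsob n 0 (Q (int j))" if "j \<le> Suc m" for j
      by (rule conjunct2[OF iffD1[OF wsob_Suc_iff]], fold One_nat_def) (rule Q1(1)[OF that])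
    obtain B2 where B2: "\<And>k x. norm k \<le> 2 \<Longrightarrow> 0 \<le> x \<Longrightarrow> norm (trunc Q k x) \<le> B2"
      using trunc_bounded[of Q, OF b'] by blast
    show ?thesis using B1 B2 by (intro exI[of _ "B1 + B2"]) (blast intro: add_mono)
  qed
  then obtain B where "\<And>k x. norm k \<le> 2 \<Longrightarrow> 0 \<le> x \<Longrightarrow> norm (trunc P k x) + norm (trunc Q k x) \<le> B" by blast
  moreover have "\<exists>r1 r2. solves k (trunc P k) (trunc Q k) r1 r2 \<and>
        (\<forall>x\<ge>0. norm (r1 x) + norm (r2 x) \<le> norm k ^ Suc m * \<rho> x)" if k: "k \<noteq> 0" "norm k \<le> 2" for k
  proof -
    define r1 where "r1 x = - (k ^ Suc m * k * (pq1 x * Q M x + pp1 x * P M x))" for x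
    define r2 where "r2 x = k ^ Suc m * (g x + \<i> * s / 2 * (Q (M - 1) x + k * Q M x) - qp0 x * P M x
       - (qp1 x * P (M - 1) x + k * (qp1 x * P M x)) - (qq1 x * Q (M - 1) x + k * (qq1 x * Q M x)))" for x
    have T: "trunc F k x = (\<Sum>j\<le>m. k ^ j * F (int j) x) + k ^ Suc m * F M x" for F x
      unfolding trunc_def M_def sum.atMost_Suc ..
    have sh: "(\<Sum>j\<le>Suc m. k ^ j * F (int j - 1) x) = k * (trunc F k x - k ^ Suc m * F M x)"
      "(\<Sum>j\<le>m. k ^ j * F (int j - 1) x) = k * ((\<Sum>j\<le>m. k ^ j * F (int j) x) - k ^ m * F (M - 1) x)"
      if "F (-1) x = 0" for F x
      unfolding trunc_def Mm unfolding M_def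
      by (rule shifted_power_sum[where F = "\<lambda>j. F j x", OF that])+
    have "ac_deriv (trunc P k) (\<lambda>x. \<Sum>j\<le>Suc m. k ^ j * dP j x)"
      unfolding trunc_def[abs_def] by (intro ac_deriv_sum ac_deriv_cmult acP) simp
    moreover have "(\<Sum>j\<le>Suc m. k ^ j * dP j x) = (pq0 x + k * pq1 x) * trunc Q k x + k * pp1 x * trunc P k x + r1 x"
      if x: "0 \<le> x" for x
    proof -
      have "(\<Sum>j\<le>Suc m. k ^ j * dP j x) = pq0 x * trunc Q k x + pq1 x * (\<Sum>j\<le>Suc m. k ^ j * Q (int j - 1) x)
         + pp1 x * (\<Sum>j\<le>Suc m. k ^ j * P (int j - 1) x)"
        unfolding dP_def trunc_def sum_distrib_left sum.distrib[symmetric]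
        by (rule sum.cong) (simp_all add: algebra_simps)
      also have "\<dots> = (pq0 x + k * pq1 x) * trunc Q k x + k * pp1 x * trunc P k x + r1 x"
        unfolding sh(1)[of Q x, OF f0(2)[OF x]] sh(1)[of P x, OF f0(1)[OF x]] r1_def by (simp add: algebra_simps)
      finally show ?thesis .
    qed
    ultimately have A: "ac_deriv (trunc P k) (\<lambda>x. (pq0 x + k * pq1 x) * trunc Q k x + k * pp1 x * trunc P k x + r1 x)"
      by (rule iffD1[OF ac_deriv_cong, rotated 2, OF _ refl])
    have eq: "trunc Q k = (\<lambda>x. (\<Sum>j\<le>m. k ^ j * Q (int j) x) + k ^ Suc m * Q (int (Suc m)) x)"
      unfolding T[abs_def] M_def ..
    have "ac_deriv (trunc Q k) (\<lambda>x. (\<Sum>j\<le>m. k ^ j * dQ j x) + k ^ Suc m * g x)"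
      unfolding eq by (intro ac_deriv_add ac_deriv_sum ac_deriv_cmult acQ g(2)) simp
    moreover have "(\<Sum>j\<le>m. k ^ j * dQ j x) + k ^ Suc m * g x =
        rate k * trunc Q k x + ((qp0 x + k * qp1 x) * trunc P k x + k * qq1 x * trunc Q k x + r2 x)"
      if x: "0 \<le> x" for x
    proof -
      define TQ TP where "TQ = (\<Sum>j\<le>m. k ^ j * Q (int j) x)" and "TP = (\<Sum>j\<le>m. k ^ j * P (int j) x)"
      have up: "(\<Sum>j\<le>m. k ^ j * Q (int j + 1) x) = (TQ + k ^ Suc m * Q M x) / k"
        using unshifted_power_sum[where F = "\<lambda>j. Q j x" and k = k and N = m, OF f0(3)[OF x] k(1)]
        unfolding trunc_def[symmetric] T TQ_def .
      have "(\<Sum>j\<le>m. k ^ j * dQ j x) = - (\<i> * s / 2) * (\<Sum>j\<le>m. k ^ j * Q (int j - 1) x) + qp0 x * TP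
         + qp1 x * (\<Sum>j\<le>m. k ^ j * P (int j - 1) x) + qq1 x * (\<Sum>j\<le>m. k ^ j * Q (int j - 1) x)
         + \<i> * s / 2 * (\<Sum>j\<le>m. k ^ j * Q (int j + 1) x)"
        unfolding dQ_def TP_def sum_distrib_left sum.distrib[symmetric]
        by (rule sum.cong) (simp_all add: algebra_simps)
      also have "\<dots> + k ^ Suc m * g x = rate k * (TQ + k ^ Suc m * Q M x) + ((qp0 x + k * qp1 x) * (TP + k ^ Suc m * P M x)
         + k * qq1 x * (TQ + k ^ Suc m * Q M x) + r2 x)"
        unfolding sh(2)[of Q x, OF f0(2)[OF x]] sh(2)[of P x, OF f0(1)[OF x]] up r2_def rate_def TQ_def[symmetric] TP_def[symmetric]
        using k(1) by (simp add: field_simps)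
      finally show ?thesis unfolding T TQ_def TP_def .
    qed
    ultimately have Bq: "ac_deriv (trunc Q k) (\<lambda>x. rate k * trunc Q k x + ((qp0 x + k * qp1 x) * trunc P k x + k * qq1 x * trunc Q k x + r2 x))"
      by (rule iffD1[OF ac_deriv_cong, rotated 2, OF _ refl])
    have "norm (r1 x) + norm (r2 x) \<le> norm k ^ Suc m * \<rho> x" for x
    proof -
      have kb: "norm (k * y) \<le> 2 * norm y" for y unfolding norm_mult using k(2) by (intro mult_right_mono) auto
      have sn: "norm (\<i> * s / 2 * y) \<le> norm y" for y using s by (auto simp: norm_mult)
      have e1: "norm (r1 x) = norm k ^ Suc m * norm (k * (pq1 x * Q M x + pp1 x * P M x))"
        unfolding r1_def norm_minus_cancel by (simp only: mult.assoc norm_mult norm_power)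
      have e2: "norm (r2 x) = norm k ^ Suc m * norm (g x + \<i> * s / 2 * (Q (M - 1) x + k * Q M x) - qp0 x * P M x
       - (qp1 x * P (M - 1) x + k * (qp1 x * P M x)) - (qq1 x * Q (M - 1) x + k * (qq1 x * Q M x)))"
        unfolding r2_def by (simp only: norm_mult norm_power)
      have i1: "norm (k * (pq1 x * Q M x + pp1 x * P M x)) \<le> 2 * (norm (pq1 x * Q M x) + norm (pp1 x * P M x))"
        by (rule order_trans[OF kb]) (intro mult_left_mono norm_triangle_ineq, simp)
      have i2: "norm (g x + \<i> * s / 2 * (Q (M - 1) x + k * Q M x) - qp0 x * P M x
       - (qp1 x * P (M - 1) x + k * (qp1 x * P M x)) - (qq1 x * Q (M - 1) x + k * (qq1 x * Q M x)))
        \<le> norm (g x) + (norm (Q (M - 1) x) + 2 * norm (Q M x)) + norm (qp0 x * P M x)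
          + (norm (qp1 x * P (M - 1) x) + 2 * norm (qp1 x * P M x)) + (norm (qq1 x * Q (M - 1) x) + 2 * norm (qq1 x * Q M x))"
      proof -
        have t: "norm (y + k * z) \<le> norm y + 2 * norm z" for y z
          using norm_triangle_ineq[of y "k * z"] kb[of z] by linarith
        have a: "norm (a + b - c - d - e) \<le> norm a + norm b + norm c + norm d + norm e" for a b c d e :: complex
          using norm_triangle_ineq4[of "a + b - c - d" e] norm_triangle_ineq4[of "a + b - c" d]
            norm_triangle_ineq4[of "a + b" c] norm_triangle_ineq[of a b] by linarith
        show ?thesis
          by (rule order_trans[OF a]) (intro add_mono order_refl t order_trans[OF sn t])
      qed
      have "norm (r1 x) + norm (r2 x) \<le> norm k ^ Suc m * (2 * (norm (pq1 x * Q M x) + norm (pp1 x * P M x)))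
         + norm k ^ Suc m * (norm (g x) + (norm (Q (M - 1) x) + 2 * norm (Q M x)) + norm (qp0 x * P M x)
          + (norm (qp1 x * P (M - 1) x) + 2 * norm (qp1 x * P M x)) + (norm (qq1 x * Q (M - 1) x) + 2 * norm (qq1 x * Q M x)))"
        unfolding e1 e2 by (intro add_mono mult_left_mono i1 i2) simp_all
      also have "\<dots> = norm k ^ Suc m * (2 * (norm (pq1 x * Q M x) + norm (pp1 x * P M x)) + (norm (g x) + (norm (Q (M - 1) x) + 2 * norm (Q M x)) + norm (qp0 x * P M x)
          + (norm (qp1 x * P (M - 1) x) + 2 * norm (qp1 x * P M x)) + (norm (qq1 x * Q (M - 1) x) + 2 * norm (qq1 x * Q M x))))"
        by (rule distrib_left[symmetric])
      also have "\<dots> \<le> norm k ^ Suc m * \<rho> x"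
      proof (rule mult_left_mono)
        show "2 * (norm (pq1 x * Q M x) + norm (pp1 x * P M x)) + (norm (g x) + (norm (Q (M - 1) x) + 2 * norm (Q M x)) + norm (qp0 x * P M x)
          + (norm (qp1 x * P (M - 1) x) + 2 * norm (qp1 x * P M x)) + (norm (qq1 x * Q (M - 1) x) + 2 * norm (qq1 x * Q M x))) \<le> \<rho> x"
          unfolding \<rho>_def using norm_ge_zero[of "g x"] norm_ge_zero[of "Q (M - 1) x"] norm_ge_zero[of "qp0 x * P M x"]
            norm_ge_zero[of "qp1 x * P (M - 1) x"] norm_ge_zero[of "qq1 x * Q (M - 1) x"] by (simp only: ring_distribs)
      qed simp
      finally show ?thesis .
    qed
    then show ?thesis
      by (intro exI[of _ r1] exI[of _ r2] conjI allI impI) (simp add: solves_def A Bq)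
  qed
  ultimately show thesis by (rule that)
qed

end

section \<open>Solutions that are holomorphic in the spectral parameter\<close>

text \<open>Finite sums of products of a function of \<open>k\<close> and a function of \<open>x\<close>. The class is closed under
  products and integration in \<open>x\<close>, so that all Picard iterates belong to it and are holomorphic in \<open>k\<close>
  for trivial reasons.\<close>
inductive separated :: "(real \<Rightarrow> complex \<Rightarrow> complex) \<Rightarrow> bool" where
  separated_product: "\<kappa> holomorphic_on - {0} \<Longrightarrow> continuous_on {0..} c \<Longrightarrow> separated (\<lambda>x k. \<kappa> k * c x)"
| separated_add: "separated f \<Longrightarrow> separated g \<Longrightarrow> separated (\<lambda>x k. f x k + g x k)"

lemma separated_holomorphic: "separated f \<Longrightarrow> f x holomorphic_on - {0}"
  by (induction rule: separated.induct) (auto intro!: holomorphic_intros)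

lemma separated_continuous: 
  assumes "separated f" shows "continuous_on {0..} (\<lambda>x. f x k)"
  using assms by (induction rule: separated.induct) (auto intro!: continuous_intros)

lemma separated_bounded:
  assumes "separated f" "compact C" "C \<subseteq> - {0}"
  shows "\<exists>M. \<forall>x\<in>{0..B}. \<forall>k\<in>C. norm (f x k) \<le> M"
  using assms(1)
proof (induction rule: separated.induct)
  case (separated_product \<kappa> c)
  have "continuous_on C \<kappa>"
    using separated_product(1) assms(3) holomorphic_on_imp_continuous_on continuous_on_subset by blast
  then have "bounded (\<kappa> ` C)" using assms(2) compact_continuous_image compact_imp_bounded by blast
  then obtain M1 where M1: "\<And>k. k \<in> C \<Longrightarrow> norm (\<kappa> k) \<le> M1" unfolding bounded_iff by blast
  have "continuous_on {0..B} c" by (rule continuous_on_subset[OF separated_product(2)]) auto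
  then have "bounded (c ` {0..B})" using compact_continuous_image compact_imp_bounded compact_Icc by blast
  then obtain M2 where M2: "\<And>x. x \<in> {0..B} \<Longrightarrow> norm (c x) \<le> M2" unfolding bounded_iff by blast
  have "norm (\<kappa> k * c x) \<le> M1 * M2" if "x \<in> {0..B}" "k \<in> C" for x k
    unfolding norm_mult using M1[OF that(2)] M2[OF that(1)] by (intro mult_mono) (auto intro: order_trans[OF norm_ge_zero])
  then show ?case by blast
next
  case (separated_add f g)
  then obtain M1 M2 where "\<And>x k. x \<in> {0..B} \<Longrightarrow> k \<in> C \<Longrightarrow> norm (f x k) \<le> M1"
    "\<And>x k. x \<in> {0..B} \<Longrightarrow> k \<in> C \<Longrightarrow> norm (g x k) \<le> M2" by blast
  then have "norm (f x k + g x k) \<le> M1 + M2" if "x \<in> {0..B}" "k \<in> C" for x k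
    using that by (meson norm_triangle_mono)
  then show ?case by blast
qed

lemma separated_product_mult:
  assumes "separated f" "\<kappa> holomorphic_on - {0}" "continuous_on {0..} c"
  shows "separated (\<lambda>x k. \<kappa> k * c x * f x k)"
  using assms(1)
proof (induction rule: separated.induct)
  case (separated_product \<kappa>' c')
  have "separated (\<lambda>x k. (\<kappa> k * \<kappa>' k) * (c x * c' x))"
    by (rule separated.separated_product) (intro holomorphic_intros continuous_intros assms separated_product)+
  then show ?case by (simp only: ac_simps)
next
  case (separated_add f g)
  then have "separated (\<lambda>x k. \<kappa> k * c x * f x k + \<kappa> k * c x * g x k)" by (intro separated.separated_add)
  then show ?case by (simp only: distrib_left)
qed

lemma separated_mult:
  assumes "separated f" "separated g" shows "separated (\<lambda>x k. f x k * g x k)"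
  using assms(1)
proof (induction rule: separated.induct)
  case (separated_product \<kappa> c)
  then show ?case by (intro separated_product_mult assms)
next
  case (separated_add f f')
  then have "separated (\<lambda>x k. f x k * g x k + f' x k * g x k)" by (intro separated.separated_add)
  then show ?case by (simp only: distrib_right)
qed

lemma separated_integral:
  assumes "separated f" shows "separated (\<lambda>x k. integral {0..x} (\<lambda>t. f t k))"
  using assms
proof (induction rule: separated.induct)
  case (separated_product \<kappa> c)
  have c: "c integrable_on {0..b}" for b
    by (rule integrable_continuous_real) (rule continuous_on_subset[OF separated_product(2)], auto)
  have "continuous_on {0..} (\<lambda>x. integral {0..x} c)"
    by (rule continuous_on_atLeast0I) (rule indefinite_integral_continuous_1[OF c])
  from separated.separated_product[OF separated_product(1) this]
  show ?case by simp
next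
  case (separated_add f g)
  have i: "(\<lambda>t. h t k) integrable_on {0..b}" if "separated h" for h k b
    by (rule integrable_continuous_real) (rule continuous_on_subset[OF separated_continuous[OF that]], auto)
  have "integral {0..x} (\<lambda>t. f t k + g t k) = integral {0..x} (\<lambda>t. f t k) + integral {0..x} (\<lambda>t. g t k)" for x k
    by (rule integral_add[OF i i]) (rule separated_add)+
  then show ?case using separated.separated_add[OF separated_add.IH] by simp
qed

text \<open>The \<open>N\<close>-th summand of the Picard series, that is, the difference of two successive iterates.\<close>
primrec picard_term :: "(real \<Rightarrow> complex \<Rightarrow> complex) \<Rightarrow> (real \<Rightarrow> complex \<Rightarrow> complex) \<Rightarrow>
    (real \<Rightarrow> complex \<Rightarrow> complex) \<Rightarrow> (real \<Rightarrow> complex \<Rightarrow> complex) \<Rightarrow> complex \<Rightarrow> complex \<Rightarrow> nat \<Rightarrow>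
    (real \<Rightarrow> complex \<Rightarrow> complex) \<times> (real \<Rightarrow> complex \<Rightarrow> complex)" where
  "picard_term a b c d v w 0 = ((\<lambda>x k. v), (\<lambda>x k. w))"
| "picard_term a b c d v w (Suc N) =
    ((\<lambda>x k. integral {0..x} (\<lambda>t. a t k * fst (picard_term a b c d v w N) t k + b t k * snd (picard_term a b c d v w N) t k)),
     (\<lambda>x k. integral {0..x} (\<lambda>t. c t k * fst (picard_term a b c d v w N) t k + d t k * snd (picard_term a b c d v w N) t k)))"

lemma separated_const: "separated (\<lambda>x k. v)"
  using separated_product[of "\<lambda>k. 1" "\<lambda>x. v"] by simp

lemma picard_term_separated:
  assumes "separated a" "separated b" "separated c" "separated d"
  shows "separated (fst (picard_term a b c d v w N)) \<and> separated (snd (picard_term a b c d v w N))"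
proof (induction N)
  case 0
  show ?case using separated_const by simp
next
  case (Suc N)
  then show ?case unfolding picard_term.simps fst_conv snd_conv
    by (intro conjI separated_integral separated_add separated_mult assms) auto
qed

lemma picard_term_bound:
  assumes sep: "separated a" "separated b" "separated c" "separated d"
    and M: "\<And>x. x \<in> {0..B} \<Longrightarrow> norm (a x k) + norm (b x k) + norm (c x k) + norm (d x k) \<le> M" and x: "x \<in> {0..B}"
  shows "norm (fst (picard_term a b c d v w N) x k) + norm (snd (picard_term a b c d v w N) x k)
     \<le> (norm v + norm w) * ((M * x) ^ N / fact N)"
  using x
proof (induction N arbitrary: x)
  case 0
  then show ?case by simp
next
  case (Suc N)
  define V where "V = norm v + norm w"
  define p where "p t = fst (picard_term a b c d v w N) t k" for t
  define q where "q t = snd (picard_term a b c d v w N) t k" for t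
  have IH: "norm (p t) + norm (q t) \<le> V * ((M * t) ^ N / fact N)" if "t \<in> {0..x}" for t
    unfolding p_def q_def V_def using Suc.IH[of t] Suc.prems that by auto
  have cont: "continuous_on {0..x} p" "continuous_on {0..x} q"
    "continuous_on {0..x} (\<lambda>t. a t k)" "continuous_on {0..x} (\<lambda>t. b t k)" "continuous_on {0..x} (\<lambda>t. c t k)" "continuous_on {0..x} (\<lambda>t. d t k)"
  proof -
    have sc: "continuous_on {0..x} (\<lambda>t. f t k)" if "separated f" for f
      by (rule continuous_on_subset[OF separated_continuous[OF that]]) auto
    show "continuous_on {0..x} p" "continuous_on {0..x} q"
      unfolding p_def[abs_def] q_def[abs_def]
      by (rule sc[OF conjunct1[OF picard_term_separated[OF sep]]], rule sc[OF conjunct2[OF picard_term_separated[OF sep]]])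
    show "continuous_on {0..x} (\<lambda>t. a t k)" "continuous_on {0..x} (\<lambda>t. b t k)"
      "continuous_on {0..x} (\<lambda>t. c t k)" "continuous_on {0..x} (\<lambda>t. d t k)"
      by (rule sc, fact sep)+
  qed
  have M0: "0 \<le> M" using M[OF Suc.prems] by (smt (verit) norm_ge_zero)
  have fund: "((\<lambda>t. M * (V * ((M * t) ^ N / fact N))) has_integral
      V * ((M * x) ^ Suc N / fact (Suc N)) - V * ((M * 0) ^ Suc N / fact (Suc N))) {0..x}"
  proof (rule fundamental_theorem_of_calculus)
    fix t :: real
    have "((\<lambda>t. V * ((M * t) ^ Suc N / fact (Suc N))) has_real_derivative
        V * (of_nat (Suc N) * (M * t) ^ N * M / fact (Suc N))) (at t within {0..x})"
    proof -
      have "((\<lambda>t. M * t) has_real_derivative M) (at t within {0..x})" by (auto intro!: derivative_eq_intros)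
      from DERIV_cmult[OF DERIV_cdivide[OF DERIV_power[OF this, of "Suc N"]]]
      show ?thesis by (simp only: diff_Suc_Suc diff_zero ac_simps)
    qed
    also have "V * (of_nat (Suc N) * (M * t) ^ N * M / fact (Suc N)) = M * (V * ((M * t) ^ N / fact N))"
      by (simp add: fact_Suc)
    finally show "((\<lambda>t. V * ((M * t) ^ Suc N / fact (Suc N))) has_vector_derivative M * (V * ((M * t) ^ N / fact N))) (at t within {0..x})"
      unfolding has_real_derivative_iff_has_vector_derivative .
  qed (use Suc.prems in auto)
  have fi: "(\<lambda>t. M * (V * ((M * t) ^ N / fact N))) integrable_on {0..x}"
    "integral {0..x} (\<lambda>t. M * (V * ((M * t) ^ N / fact N))) = V * ((M * x) ^ Suc N / fact (Suc N))"
    using has_integral_integrable[OF fund] integral_unique[OF fund] by simp_all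
  have cc: "continuous_on {0..x} (\<lambda>t. a t k * p t + b t k * q t)" "continuous_on {0..x} (\<lambda>t. c t k * p t + d t k * q t)"
    by (intro continuous_intros cont)+
  have ni: "(\<lambda>t. norm (a t k * p t + b t k * q t)) integrable_on {0..x}" "(\<lambda>t. norm (c t k * p t + d t k * q t)) integrable_on {0..x}"
    by (intro integrable_continuous_real continuous_on_norm cc)+
  have "norm (integral {0..x} (\<lambda>t. a t k * p t + b t k * q t)) + norm (integral {0..x} (\<lambda>t. c t k * p t + d t k * q t))
     \<le> integral {0..x} (\<lambda>t. norm (a t k * p t + b t k * q t)) + integral {0..x} (\<lambda>t. norm (c t k * p t + d t k * q t))"
    by (intro add_mono integral_norm_le absolutely_integrable_continuous_real cc)
  also have "\<dots> = integral {0..x} (\<lambda>t. norm (a t k * p t + b t k * q t) + norm (c t k * p t + d t k * q t))"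
    by (rule integral_add[OF ni, symmetric])
  also have "\<dots> \<le> integral {0..x} (\<lambda>t. M * (V * ((M * t) ^ N / fact N)))"
  proof (rule integral_le[OF integrable_add[OF ni] fi(1)])
    fix t assume t: "t \<in> {0..x}"
    have "norm (a t k * p t + b t k * q t) + norm (c t k * p t + d t k * q t)
       \<le> (norm (a t k) * norm (p t) + norm (b t k) * norm (q t)) + (norm (c t k) * norm (p t) + norm (d t k) * norm (q t))"
      by (intro add_mono order_trans[OF norm_triangle_ineq]) (simp_all add: norm_mult)
    also have "\<dots> = (norm (a t k) + norm (c t k)) * norm (p t) + (norm (b t k) + norm (d t k)) * norm (q t)"
      by (simp add: algebra_simps)
    also have "\<dots> \<le> M * norm (p t) + M * norm (q t)"
    proof (intro add_mono mult_right_mono)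
      have m: "norm (a t k) + norm (b t k) + norm (c t k) + norm (d t k) \<le> M" using M[of t] t Suc.prems by auto
      show "norm (a t k) + norm (c t k) \<le> M" "norm (b t k) + norm (d t k) \<le> M"
        using m norm_ge_zero[of "a t k"] norm_ge_zero[of "b t k"] norm_ge_zero[of "c t k"] norm_ge_zero[of "d t k"] by linarith+
    qed simp_all
    also have "\<dots> = M * (norm (p t) + norm (q t))" by (rule distrib_left[symmetric])
    also have "\<dots> \<le> M * (V * ((M * t) ^ N / fact N))" by (rule mult_left_mono[OF IH[OF t] M0])
    finally show "norm (a t k * p t + b t k * q t) + norm (c t k * p t + d t k * q t) \<le> M * (V * ((M * t) ^ N / fact N))" .
  qed
  also note fi(2)
  finally show ?case unfolding picard_term.simps fst_conv snd_conv p_def q_def V_def .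
qed

text \<open>The Picard series converges uniformly for \<open>x\<close> and \<open>k\<close> in compact sets, so its sum inherits
  holomorphy in \<open>k\<close> from the summands.\<close>
lemma linear_system_holomorphic:
  assumes sep: "separated a" "separated b" "separated c" "separated d"
  shows "\<exists>p q. (\<forall>x\<ge>0. p x holomorphic_on - {0} \<and> q x holomorphic_on - {0}) \<and>
    (\<forall>k. k \<noteq> 0 \<longrightarrow> p 0 k = v \<and> q 0 k = w \<and>
       ac_deriv (\<lambda>x. p x k) (\<lambda>x. a x k * p x k + b x k * q x k) \<and>
       ac_deriv (\<lambda>x. q x k) (\<lambda>x. c x k * p x k + d x k * q x k))"
proof -
  define dp where "dp N = fst (picard_term a b c d v w N)" for N
  define dq where "dq N = snd (picard_term a b c d v w N)" for N
  define p where "p x k = (\<Sum>N. dp N x k)" for x k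
  define q where "q x k = (\<Sum>N. dq N x k)" for x k
  have sepd: "separated (dp N)" "separated (dq N)" for N
    unfolding dp_def dq_def using picard_term_separated[OF sep] by blast+
  have unif: "uniform_limit ({0..B} \<times> C) (\<lambda>N (x, k). \<Sum>i<N. dp i x k) (\<lambda>(x, k). p x k) sequentially \<and>
      uniform_limit ({0..B} \<times> C) (\<lambda>N (x, k). \<Sum>i<N. dq i x k) (\<lambda>(x, k). q x k) sequentially"
    if C: "compact C" "C \<subseteq> - {0}" for B C
  proof -
    obtain Ma where Ma: "\<forall>x\<in>{0..B}. \<forall>k\<in>C. norm (a x k) \<le> Ma" using separated_bounded[OF sep(1) C] by blast
    obtain Mb where Mb: "\<forall>x\<in>{0..B}. \<forall>k\<in>C. norm (b x k) \<le> Mb" using separated_bounded[OF sep(2) C] by blast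
    obtain Mc where Mc: "\<forall>x\<in>{0..B}. \<forall>k\<in>C. norm (c x k) \<le> Mc" using separated_bounded[OF sep(3) C] by blast
    obtain Md where Md: "\<forall>x\<in>{0..B}. \<forall>k\<in>C. norm (d x k) \<le> Md" using separated_bounded[OF sep(4) C] by blast
    note Mi = Ma Mb Mc Md
    define M where "M = \<bar>Ma + Mb + Mc + Md\<bar>"
    have M: "norm (a x k) + norm (b x k) + norm (c x k) + norm (d x k) \<le> M" if "x \<in> {0..B}" "k \<in> C" for x k
    proof -
      have "norm (a x k) \<le> Ma" "norm (b x k) \<le> Mb" "norm (c x k) \<le> Mc" "norm (d x k) \<le> Md" using Mi that by blast+
      then show ?thesis unfolding M_def by linarith
    qed
    define T where "T N = (norm v + norm w) * ((M * \<bar>B\<bar>) ^ N / fact N)" for N :: nat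
    have Tsum: "summable T"
      unfolding T_def[abs_def] using summable_exp_generic[of "M * \<bar>B\<bar>"]
      by (intro summable_mult) (simp add: divide_inverse mult.commute)
    have "norm (dp N x k) + norm (dq N x k) \<le> T N" if "x \<in> {0..B}" "k \<in> C" for N x k
    proof -
      have "norm (dp N x k) + norm (dq N x k) \<le> (norm v + norm w) * ((M * x) ^ N / fact N)"
        unfolding dp_def dq_def by (rule picard_term_bound[OF sep _ that(1)]) (use M that in auto)
      also have "\<dots> \<le> T N" unfolding T_def
        by (intro mult_left_mono divide_right_mono power_mono) (use that in \<open>auto simp: M_def\<close>)
      finally show ?thesis .
    qed
    then have b: "norm (dp N x k) \<le> T N" "norm (dq N x k) \<le> T N" if "x \<in> {0..B}" "k \<in> C" for N x k
      using that norm_ge_zero[of "dp N x k"] norm_ge_zero[of "dq N x k"] by (smt (verit))+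
    have "uniform_limit ({0..B} \<times> C) (\<lambda>N z. \<Sum>i<N. dp i (fst z) (snd z)) (\<lambda>z. \<Sum>i. dp i (fst z) (snd z)) sequentially"
      "uniform_limit ({0..B} \<times> C) (\<lambda>N z. \<Sum>i<N. dq i (fst z) (snd z)) (\<lambda>z. \<Sum>i. dq i (fst z) (snd z)) sequentially"
      by (rule Weierstrass_m_test[OF _ Tsum], use b in force)+
    then show ?thesis unfolding p_def q_def case_prod_unfold by blast
  qed
  have hol: "p x holomorphic_on - {0}" "q x holomorphic_on - {0}" if x: "0 \<le> x" for x
  proof -
    have d: "\<exists>e. 0 < e \<and> cball k e \<subseteq> - {0}" if "k \<in> - {0}" for k :: complex
      by (rule exI[of _ "norm k / 2"]) (use that in \<open>auto simp: dist_norm\<close>)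
    have u: "uniform_limit C (\<lambda>N k. \<Sum>i<N. dp i x k) (p x) sequentially" "uniform_limit C (\<lambda>N k. \<Sum>i<N. dq i x k) (q x) sequentially"
      if "compact C" "C \<subseteq> - {0}" for C
      using uniform_limit_compose'[where h = "\<lambda>k. (x, k)" and B = C, OF conjunct1[OF unif[OF that, of x]]]
        uniform_limit_compose'[where h = "\<lambda>k. (x, k)" and B = C, OF conjunct2[OF unif[OF that, of x]]] x
      by simp_all
    have h: "g holomorphic_on - {0}"
      if f: "\<And>N. f N holomorphic_on - {0}" and ul: "\<And>C. compact C \<Longrightarrow> C \<subseteq> - {0} \<Longrightarrow> uniform_limit C f g sequentially"
      for f :: "nat \<Rightarrow> complex \<Rightarrow> complex" and g
    proof (rule holomorphic_uniform_sequence[OF _ f])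
      show "open (- {0::complex})" by auto
      fix k :: complex assume "k \<in> - {0}"
      from d[OF this] obtain e where e: "0 < e" "cball k e \<subseteq> - {0}" by blast
      then show "\<exists>e>0. cball k e \<subseteq> - {0} \<and> uniform_limit (cball k e) f g sequentially"
        using ul[OF compact_cball e(2)] by blast
    qed
    show "p x holomorphic_on - {0}"
      by (rule h[OF _ u(1)]) (intro holomorphic_on_sum separated_holomorphic[OF sepd(1)])
    show "q x holomorphic_on - {0}"
      by (rule h[OF _ u(2)]) (intro holomorphic_on_sum separated_holomorphic[OF sepd(2)])
  qed
  have sol: "p 0 k = v \<and> q 0 k = w \<and>
       ac_deriv (\<lambda>x. p x k) (\<lambda>x. a x k * p x k + b x k * q x k) \<and>
       ac_deriv (\<lambda>x. q x k) (\<lambda>x. c x k * p x k + d x k * q x k)" if k: "k \<noteq> 0" for k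
  proof -
    have ul: "uniform_limit {0..B} (\<lambda>N x. \<Sum>i<N. dp i x k) (\<lambda>x. p x k) sequentially"
      "uniform_limit {0..B} (\<lambda>N x. \<Sum>i<N. dq i x k) (\<lambda>x. q x k) sequentially" for B
      using uniform_limit_compose'[where h = "\<lambda>x. (x, k)" and B = "{0..B}", OF conjunct1[OF unif[of "{k}" B]]]
        uniform_limit_compose'[where h = "\<lambda>x. (x, k)" and B = "{0..B}", OF conjunct2[OF unif[of "{k}" B]]] k
      by simp_all
    have cd: "continuous_on {0..B} (\<lambda>x. dp i x k)" "continuous_on {0..B} (\<lambda>x. dq i x k)" for B i
      by (rule continuous_on_subset[OF separated_continuous[OF sepd(1)]], simp,
          rule continuous_on_subset[OF separated_continuous[OF sepd(2)]], simp)
    have cs: "continuous_on {0..B} (\<lambda>x. \<Sum>i<N. dp i x k)" "continuous_on {0..B} (\<lambda>x. \<Sum>i<N. dq i x k)" for B N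
      by (intro continuous_on_sum cd)+
    have pc: "continuous_on {0..B} (\<lambda>x. p x k)" "continuous_on {0..B} (\<lambda>x. q x k)" for B
      by (rule uniform_limit_theorem[OF _ ul(1)], use cs in simp, simp,
          rule uniform_limit_theorem[OF _ ul(2)], use cs in simp, simp)
    have lim: "(\<lambda>N. \<Sum>i<N. dp i x k) \<longlonglongrightarrow> p x k" "(\<lambda>N. \<Sum>i<N. dq i x k) \<longlonglongrightarrow> q x k" if "0 \<le> x" for x
      using tendsto_uniform_limitI[OF ul(1)[of x], of x] tendsto_uniform_limitI[OF ul(2)[of x], of x] that by auto
    have main: "integral {0..x} (\<lambda>x. f x k * p x k + g x k * q x k) = P x k - u \<and>
       (\<lambda>x. f x k * p x k + g x k * q x k) absolutely_integrable_on {0..x}"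
      if x: "0 \<le> x" and fg: "separated f" "separated g" and Pl: "(\<lambda>N. \<Sum>i<N. D i x k) \<longlonglongrightarrow> P x k"
        and D0: "D 0 x k = u" and DS: "\<And>i. D (Suc i) x k = integral {0..x} (\<lambda>t. f t k * dp i t k + g t k * dq i t k)"
      for f g D P x u
    proof -
      have fc: "continuous_on {0..x} (\<lambda>t. f t k)" "continuous_on {0..x} (\<lambda>t. g t k)"
        by (rule continuous_on_subset[OF separated_continuous[OF fg(1)]], simp,
            rule continuous_on_subset[OF separated_continuous[OF fg(2)]], simp)
      have ai: "(\<lambda>x. f x k * p x k + g x k * q x k) absolutely_integrable_on {0..x}"
        by (intro absolutely_integrable_continuous_real continuous_intros fc pc)
      have S: "(\<Sum>i<Suc N. D i x k) = u + integral {0..x} (\<lambda>t. f t k * (\<Sum>i<N. dp i t k) + g t k * (\<Sum>i<N. dq i t k))" for N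
      proof -
        have "(\<Sum>i<Suc N. D i x k) = u + (\<Sum>i<N. integral {0..x} (\<lambda>t. f t k * dp i t k + g t k * dq i t k))"
          unfolding sum.lessThan_Suc_shift by (simp add: D0 DS)
        also have "(\<Sum>i<N. integral {0..x} (\<lambda>t. f t k * dp i t k + g t k * dq i t k)) =
          integral {0..x} (\<lambda>t. \<Sum>i<N. (f t k * dp i t k + g t k * dq i t k))"
          by (rule integral_sum[symmetric]) (auto intro!: integrable_continuous_real continuous_intros fc cd)
        also have "(\<lambda>t. \<Sum>i<N. (f t k * dp i t k + g t k * dq i t k)) = (\<lambda>t. f t k * (\<Sum>i<N. dp i t k) + g t k * (\<Sum>i<N. dq i t k))"
          by (simp add: sum.distrib sum_distrib_left)
        finally show ?thesis .
      qed
      have ulm: "uniform_limit {0..x} (\<lambda>N t. f t k * (\<Sum>i<N. dp i t k) + g t k * (\<Sum>i<N. dq i t k))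
          (\<lambda>t. f t k * p t k + g t k * q t k) sequentially"
      proof -
        have bd: "bounded (h ` {0..x})" if "continuous_on {0..x} h" for h :: "real \<Rightarrow> complex"
          using that compact_continuous_image compact_imp_bounded compact_Icc by blast
        show ?thesis
          by (intro uniform_limit_add uniform_lim_mult uniform_limit_const ul bd fc pc)
      qed
      have "(\<lambda>N. integral {0..x} (\<lambda>t. f t k * (\<Sum>i<N. dp i t k) + g t k * (\<Sum>i<N. dq i t k)))
         \<longlonglongrightarrow> integral {0..x} (\<lambda>t. f t k * p t k + g t k * q t k)"
      proof -
        obtain I J where IJ: "\<And>N. ((\<lambda>t. f t k * (\<Sum>i<N. dp i t k) + g t k * (\<Sum>i<N. dq i t k)) has_integral I N) {0..x}"
          "((\<lambda>t. f t k * p t k + g t k * q t k) has_integral J) {0..x}" "I \<longlonglongrightarrow> J"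
          by (rule uniform_limit_integral[OF ulm]) (auto intro!: integrable_continuous_real continuous_intros fc cs)
        have "I = (\<lambda>N. integral {0..x} (\<lambda>t. f t k * (\<Sum>i<N. dp i t k) + g t k * (\<Sum>i<N. dq i t k)))"
          by (rule ext) (rule integral_unique[OF IJ(1), symmetric])
        with IJ(3) show ?thesis unfolding integral_unique[OF IJ(2)] by simp
      qed
      then have "(\<lambda>N. \<Sum>i<Suc N. D i x k) \<longlonglongrightarrow> u + integral {0..x} (\<lambda>t. f t k * p t k + g t k * q t k)"
        unfolding S by (intro tendsto_intros)
      moreover have "(\<lambda>N. \<Sum>i<Suc N. D i x k) \<longlonglongrightarrow> P x k" by (rule LIMSEQ_Suc[OF Pl])
      ultimately have "P x k = u + integral {0..x} (\<lambda>t. f t k * p t k + g t k * q t k)"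
        by (rule LIMSEQ_unique[rotated])
      then show ?thesis using ai by simp
    qed
    have P: "integral {0..x} (\<lambda>x. a x k * p x k + b x k * q x k) = p x k - v \<and>
       (\<lambda>x. a x k * p x k + b x k * q x k) absolutely_integrable_on {0..x}" if "0 \<le> x" for x
      by (rule main[where D = dp and P = p, OF that sep(1,2) lim(1)[OF that]]) (simp_all add: dp_def dq_def)
    have Q: "integral {0..x} (\<lambda>x. c x k * p x k + d x k * q x k) = q x k - w \<and>
       (\<lambda>x. c x k * p x k + d x k * q x k) absolutely_integrable_on {0..x}" if "0 \<le> x" for x
      by (rule main[where D = dq and P = q, OF that sep(3,4) lim(2)[OF that]]) (simp_all add: dp_def dq_def)
    have "p 0 k = v" "q 0 k = w" using P[of 0] Q[of 0] by simp_all
    then show ?thesis using P Q unfolding ac_deriv_def by simp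
  qed
  show ?thesis using hol sol by blast
qed

section \<open>The expansion of solutions with given initial values\<close>

lemma Cauchy_derivative_bound:
  assumes "f holomorphic_on S" "cball k r \<subseteq> S" "open S" "0 < r" "\<And>z. z \<in> cball k r \<Longrightarrow> norm (f z) \<le> B"
  shows "norm ((deriv ^^ j) f k) \<le> fact j * B / r ^ j"
proof (rule Cauchy_inequality)
  show "f holomorphic_on ball k r"
    by (rule holomorphic_on_subset[OF assms(1)]) (use assms(2) ball_subset_cball in blast)
  show "continuous_on (cball k r) f"
    by (rule holomorphic_on_imp_continuous_on[OF holomorphic_on_subset[OF assms(1,2)]])
  show "norm (f x) \<le> B" if "norm (k - x) = r" for x
    using that by (intro assms(5)) (simp add: dist_norm)
qed (fact assms(4))

text \<open>The scalar form of the differentiability up to the boundary in the theorem.\<close>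
definition boundary_derivs :: "complex set \<Rightarrow> nat \<Rightarrow> (complex \<Rightarrow> complex) \<Rightarrow> (nat \<Rightarrow> complex \<Rightarrow> complex) \<Rightarrow> bool" where
  "boundary_derivs S n f F \<longleftrightarrow> (\<forall>k\<in>S. F 0 k = f k) \<and> (\<forall>j\<le>n. continuous_on S (F j)) \<and>
     (\<forall>j<n. \<forall>k\<in>interior S. (F j has_field_derivative F (Suc j) k) (at k))"

lemma holomorphic_imp_boundary_derivs:
  assumes g: "g holomorphic_on - {0}" and S: "0 \<notin> S" and eq: "\<And>k. k \<in> S \<Longrightarrow> g k = f k"
  shows "boundary_derivs S n f (\<lambda>j. (deriv ^^ j) g)"
proof -
  have h: "(deriv ^^ j) g holomorphic_on - {0}" for j
    by (rule holomorphic_higher_deriv[OF g]) auto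
  have "continuous_on S ((deriv ^^ j) g)" for j
    by (rule continuous_on_subset[OF holomorphic_on_imp_continuous_on[OF h]]) (use S in auto)
  moreover have "((deriv ^^ j) g has_field_derivative (deriv ^^ Suc j) g k) (at k)" if "k \<in> interior S" for j k
  proof -
    have "k \<in> - {0}" using that interior_subset S by auto
    then show ?thesis using holomorphic_derivI[OF h, of k j UNIV] by (simp add: open_Compl)
  qed
  ultimately show ?thesis using eq unfolding boundary_derivs_def by simp
qed

context lax_system
begin

lemma rate_holomorphic: "rate holomorphic_on - {0}"
  unfolding rate_def[abs_def] by (intro holomorphic_intros) auto

lemma separated_coeff:
  assumes "continuous_on {0..} f" "continuous_on {0..} g" "h holomorphic_on - {0}"
  shows "separated (\<lambda>x k. h k + (f x + k * g x))"
proof -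
  have "separated (\<lambda>x k. h k * 1 + (1 * f x + k * g x))"
    by (intro separated_add separated_product assms holomorphic_intros continuous_intros)
  then show ?thesis by simp
qed

lemma fundamental_solution:
  "\<exists>p q. (\<forall>x\<ge>0. p x holomorphic_on - {0} \<and> q x holomorphic_on - {0}) \<and>
    (\<forall>k. k \<noteq> 0 \<longrightarrow> p 0 k = v \<and> q 0 k = w \<and> solves k (\<lambda>x. p x k) (\<lambda>x. q x k) (\<lambda>x. 0) (\<lambda>x. 0))"
proof -
  note c = coeffs_continuous
  have sep: "separated (\<lambda>x k. 0 + (0 + k * pp1 x))" "separated (\<lambda>x k. 0 + (pq0 x + k * pq1 x))"
    "separated (\<lambda>x k. 0 + (qp0 x + k * qp1 x))" "separated (\<lambda>x k. rate k + (0 + k * qq1 x))"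
    by (intro separated_coeff c rate_holomorphic holomorphic_intros continuous_intros)+
  obtain p q where hol: "\<forall>x\<ge>0. p x holomorphic_on - {0} \<and> q x holomorphic_on - {0}"
    and sol: "\<forall>k. k \<noteq> 0 \<longrightarrow> p 0 k = v \<and> q 0 k = w \<and>
       ac_deriv (\<lambda>x. p x k) (\<lambda>x. (0 + (0 + k * pp1 x)) * p x k + (0 + (pq0 x + k * pq1 x)) * q x k) \<and>
       ac_deriv (\<lambda>x. q x k) (\<lambda>x. (0 + (qp0 x + k * qp1 x)) * p x k + (rate k + (0 + k * qq1 x)) * q x k)"
    using linear_system_holomorphic[OF sep, of v w] by blast
  have "solves k (\<lambda>x. p x k) (\<lambda>x. q x k) (\<lambda>x. 0) (\<lambda>x. 0)" if "k \<noteq> 0" for k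
  proof -
    have e: "(\<lambda>x. (0 + (0 + k * pp1 x)) * p x k + (0 + (pq0 x + k * pq1 x)) * q x k) =
        (\<lambda>x. (pq0 x + k * pq1 x) * q x k + k * pp1 x * p x k + 0)"
      "(\<lambda>x. (0 + (qp0 x + k * qp1 x)) * p x k + (rate k + (0 + k * qq1 x)) * q x k) =
        (\<lambda>x. rate k * q x k + ((qp0 x + k * qp1 x) * p x k + k * qq1 x * q x k + 0))"
      by (simp_all add: fun_eq_iff algebra_simps)
    from sol that have "ac_deriv (\<lambda>x. p x k) (\<lambda>x. (0 + (0 + k * pp1 x)) * p x k + (0 + (pq0 x + k * pq1 x)) * q x k)"
       "ac_deriv (\<lambda>x. q x k) (\<lambda>x. (0 + (qp0 x + k * qp1 x)) * p x k + (rate k + (0 + k * qq1 x)) * q x k)"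
      by simp_all
    then show ?thesis unfolding solves_def e by (rule conjI)
  qed
  then show ?thesis using hol sol by (intro exI[of _ p] exI[of _ q]) simp
qed

lemma solves_lincomb:
  assumes "solves k p q (\<lambda>x. 0) (\<lambda>x. 0)" "solves k p' q' (\<lambda>x. 0) (\<lambda>x. 0)"
  shows "solves k (\<lambda>x. \<alpha> * p x + \<beta> * p' x) (\<lambda>x. \<alpha> * q x + \<beta> * q' x) (\<lambda>x. 0) (\<lambda>x. 0)"
proof -
  note a = assms[unfolded solves_def, THEN conjunct1] assms[unfolded solves_def, THEN conjunct2]
  have e: "(\<lambda>x. \<alpha> * ((pq0 x + k * pq1 x) * q x + k * pp1 x * p x + 0) + \<beta> * ((pq0 x + k * pq1 x) * q' x + k * pp1 x * p' x + 0))
     = (\<lambda>x. (pq0 x + k * pq1 x) * (\<alpha> * q x + \<beta> * q' x) + k * pp1 x * (\<alpha> * p x + \<beta> * p' x) + 0)"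
    "(\<lambda>x. \<alpha> * (rate k * q x + ((qp0 x + k * qp1 x) * p x + k * qq1 x * q x + 0)) + \<beta> * (rate k * q' x + ((qp0 x + k * qp1 x) * p' x + k * qq1 x * q' x + 0)))
     = (\<lambda>x. rate k * (\<alpha> * q x + \<beta> * q' x) + ((qp0 x + k * qp1 x) * (\<alpha> * p x + \<beta> * p' x) + k * qq1 x * (\<alpha> * q x + \<beta> * q' x) + 0))"
    by (simp_all add: fun_eq_iff algebra_simps)
  show ?thesis unfolding solves_def e[symmetric]
    by (intro conjI ac_deriv_add ac_deriv_cmult a)
qed

text \<open>The determinant of two solutions satisfies a scalar linear equation, so that it is an exponential times
  its initial value.\<close>
lemma wronskian_nonzero:
  assumes s1: "solves k p q (\<lambda>x. 0) (\<lambda>x. 0)" and s2: "solves k p' q' (\<lambda>x. 0) (\<lambda>x. 0)"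
    and w0: "p 0 * q' 0 - p' 0 * q 0 \<noteq> 0" and x: "0 \<le> x"
  shows "p x * q' x - p' x * q x \<noteq> 0"
proof -
  note a1 = s1[unfolded solves_def, THEN conjunct1] s1[unfolded solves_def, THEN conjunct2]
  note a2 = s2[unfolded solves_def, THEN conjunct1] s2[unfolded solves_def, THEN conjunct2]
  define tr where "tr t = rate k + k * (pp1 t + qq1 t)" for t
  define W where "W t = p t * q' t - p' t * q t" for t
  have "ac_deriv W (\<lambda>t. tr t * W t)"
    using ac_deriv_diff[OF ac_deriv_mult[OF a1(1) a2(2)] ac_deriv_mult[OF a2(1) a1(2)]]
    by (rule iffD1[OF ac_deriv_cong, rotated 2]) (simp_all add: W_def tr_def algebra_simps)
  have trc: "continuous_on {0..} tr" unfolding tr_def[abs_def] by (intro continuous_intros coeffs_continuous)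
  have trai: "tr absolutely_integrable_on {0..b}" for b
    by (rule absolutely_integrable_continuous_real) (rule continuous_on_subset[OF trc], auto)
  define T where "T t = 0 + integral {0..t} tr" for t
  have "ac_deriv T tr" unfolding T_def[abs_def] by (simp add: ac_deriv_def trai)
  note Td = ac_deriv_imp_has_vector_derivative[OF this trc]
  have Tc: "continuous_on {0..} T" by (rule ac_deriv_continuous) fact
  have E: "((\<lambda>t. exp (- T t)) has_vector_derivative (- tr t * exp (- T t))) (at t within {0..})" if "0 \<le> t" for t
  proof -
    have d: "((\<lambda>t. - T t) has_vector_derivative - tr t) (at t within {0..})"
      by (rule has_vector_derivative_minus[OF Td[OF that]])
    have g: "(exp has_field_derivative exp (- T t)) (at (- T t) within (\<lambda>t. - T t) ` {0..})"
      by (rule DERIV_subset[OF DERIV_exp]) simp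
    from field_vector_diff_chain_within[OF d g] show ?thesis unfolding o_def .
  qed
  have "ac_deriv (\<lambda>t. exp (- T t)) (\<lambda>t. - tr t * exp (- T t))"
    by (rule ac_derivI_continuous[OF E]) (assumption, intro continuous_intros trc Tc)
  from ac_deriv_mult[OF \<open>ac_deriv W _\<close> this]
  have ac0: "ac_deriv (\<lambda>t. W t * exp (- T t)) (\<lambda>t. 0)"
    by (rule iffD1[OF ac_deriv_cong, rotated 2]) (simp_all add: algebra_simps)
  have "W x * exp (- T x) = W 0 * exp (- T 0)" using ac_deriv_increment(2)[OF ac0 order_refl x] by simp
  also have "\<dots> \<noteq> 0" using w0 by (simp add: W_def)
  finally show ?thesis unfolding W_def by auto
qed

text \<open>Prescribing values at a point \<open>L\<close> instead of \<open>0\<close> amounts to Cramer's rule in terms of the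
  fundamental solutions, whose determinant at \<open>L\<close> is holomorphic and has no zero.\<close>
lemma solution_through:
  assumes L: "0 \<le> L" and hol: "v holomorphic_on - {0}" "w holomorphic_on - {0}"
  shows "\<exists>p q. (\<forall>x\<ge>0. p x holomorphic_on - {0} \<and> q x holomorphic_on - {0}) \<and>
    (\<forall>k. k \<noteq> 0 \<longrightarrow> p L k = v k \<and> q L k = w k \<and> solves k (\<lambda>x. p x k) (\<lambda>x. q x k) (\<lambda>x. 0) (\<lambda>x. 0))"
proof -
  obtain p1 q1 where h1: "\<And>x. 0 \<le> x \<Longrightarrow> p1 x holomorphic_on - {0}" "\<And>x. 0 \<le> x \<Longrightarrow> q1 x holomorphic_on - {0}"
    and s1: "\<And>k. k \<noteq> 0 \<Longrightarrow> p1 0 k = 1" "\<And>k. k \<noteq> 0 \<Longrightarrow> q1 0 k = 0"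
      "\<And>k. k \<noteq> 0 \<Longrightarrow> solves k (\<lambda>x. p1 x k) (\<lambda>x. q1 x k) (\<lambda>x. 0) (\<lambda>x. 0)"
    using fundamental_solution[of 1 0] by blast
  obtain p2 q2 where h2: "\<And>x. 0 \<le> x \<Longrightarrow> p2 x holomorphic_on - {0}" "\<And>x. 0 \<le> x \<Longrightarrow> q2 x holomorphic_on - {0}"
    and s2: "\<And>k. k \<noteq> 0 \<Longrightarrow> p2 0 k = 0" "\<And>k. k \<noteq> 0 \<Longrightarrow> q2 0 k = 1"
      "\<And>k. k \<noteq> 0 \<Longrightarrow> solves k (\<lambda>x. p2 x k) (\<lambda>x. q2 x k) (\<lambda>x. 0) (\<lambda>x. 0)"
    using fundamental_solution[of 0 1] by blast
  define D where "D k = p1 L k * q2 L k - p2 L k * q1 L k" for k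
  have D: "D k \<noteq> 0" if "k \<noteq> 0" for k
    unfolding D_def by (rule wronskian_nonzero[OF s1(3)[OF that] s2(3)[OF that] _ L]) (use s1 s2 that in simp)
  define \<alpha> where "\<alpha> k = (v k * q2 L k - p2 L k * w k) / D k" for k
  define \<beta> where "\<beta> k = (p1 L k * w k - q1 L k * v k) / D k" for k
  note h1' = h1[OF L] and h2' = h2[OF L]
  have "(\<lambda>k. p1 L k * q2 L k - p2 L k * q1 L k) holomorphic_on - {0}"
    by (intro holomorphic_on_diff holomorphic_on_mult h1' h2')
  then have Dh: "D holomorphic_on - {0}" unfolding D_def[abs_def] .
  have "\<alpha> holomorphic_on - {0}"
    unfolding \<alpha>_def[abs_def]
    by (intro holomorphic_on_divide holomorphic_on_diff holomorphic_on_mult hol h1' h2' Dh) (use D in simp)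
  moreover have "\<beta> holomorphic_on - {0}"
    unfolding \<beta>_def[abs_def]
    by (intro holomorphic_on_divide holomorphic_on_diff holomorphic_on_mult hol h1' h2' Dh) (use D in simp)
  ultimately have H: "(\<lambda>k. \<alpha> k * p1 x k + \<beta> k * p2 x k) holomorphic_on - {0} \<and> (\<lambda>k. \<alpha> k * q1 x k + \<beta> k * q2 x k) holomorphic_on - {0}"
    if x: "0 \<le> x" for x
    by (intro conjI holomorphic_on_add holomorphic_on_mult h1[OF x] h2[OF x])
  have S: "\<alpha> k * p1 L k + \<beta> k * p2 L k = v k \<and> \<alpha> k * q1 L k + \<beta> k * q2 L k = w k \<and>
     solves k (\<lambda>x. \<alpha> k * p1 x k + \<beta> k * p2 x k) (\<lambda>x. \<alpha> k * q1 x k + \<beta> k * q2 x k) (\<lambda>x. 0) (\<lambda>x. 0)"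
    if k: "k \<noteq> 0" for k
  proof -
    have "\<alpha> k * p1 L k + \<beta> k * p2 L k = v k * D k / D k" "\<alpha> k * q1 L k + \<beta> k * q2 L k = w k * D k / D k"
      unfolding \<alpha>_def \<beta>_def times_divide_eq_left add_divide_distrib[symmetric]
      by (rule arg_cong2[where f = "(/)"], simp_all add: D_def[of k] algebra_simps)+
    then show ?thesis using D[OF k] solves_lincomb[OF s1(3)[OF k] s2(3)[OF k]] by simp
  qed
  show ?thesis
    by (rule exI[of _ "\<lambda>x k. \<alpha> k * p1 x k + \<beta> k * p2 x k"], rule exI[of _ "\<lambda>x k. \<alpha> k * q1 x k + \<beta> k * q2 x k"])
      (use H S in blast)
qed

lemma solves_unique:
  assumes s: "solves k p q (\<lambda>x. 0) (\<lambda>x. 0)" "solves k p' q' (\<lambda>x. 0) (\<lambda>x. 0)" and k: "norm k \<le> 2"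
    and init: "p 0 = p' 0" "q 0 = q' 0" and x: "0 \<le> x"
  shows "p x = p' x \<and> q x = q' x"
proof -
  have d: "solves k (\<lambda>x. p x - p' x) (\<lambda>x. q x - q' x) (\<lambda>x. 0) (\<lambda>x. 0)"
    using solves_diff[OF s] by simp
  define K where "K = exp (norm (rate k) * x)"
  have "norm (p x - p' x) + norm (q x - q' x) \<le> K * exp (K * total_load) * (norm (p 0 - p' 0) + norm (q 0 - q' 0) + integral {0..x} (\<lambda>x. 0))"
  proof (rule solves_forward_bound[OF d k order_refl x])
    show "1 \<le> K" using x by (simp add: K_def)
    show "norm (exp (rate k * of_real (t - \<tau>))) \<le> K" if "0 \<le> \<tau>" "\<tau> \<le> t" "t \<le> x" for t \<tau>
    proof -
      have "norm (exp (rate k * of_real (t - \<tau>))) \<le> exp (norm (rate k * of_real (t - \<tau>)))" by (rule norm_exp)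
      also have "norm (rate k * of_real (t - \<tau>)) \<le> norm (rate k) * x"
        unfolding norm_mult norm_of_real using that by (intro mult_left_mono) auto
      finally show ?thesis by (simp add: K_def)
    qed
  qed (simp_all add: integrable_0)
  also have "\<dots> = 0" using init by simp
  finally have "norm (p x - p' x) + norm (q x - q' x) \<le> 0" .
  then have "norm (p x - p' x) = 0" "norm (q x - q' x) = 0"
    using norm_ge_zero[of "p x - p' x"] norm_ge_zero[of "q x - q' x"] by linarith+
  then show ?thesis by simp
qed

text \<open>The derivative of the rate is of size \<open>1/|k|^2\<close>. On a disc of radius \<open>|k0|^2 / (2 (1 + B))\<close> the
  rate therefore varies so little that a kernel that is at most \<open>1\<close> at the centre is at most \<open>3\<close> on
  the disc, for displacements up to \<open>B\<close>.\<close>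
lemma rate_disc:
  assumes k0: "k0 \<noteq> 0" "norm k0 \<le> 1" and B: "0 \<le> B" and k: "k \<in> cball k0 (norm k0 ^ 2 / (2 * (1 + B)))"
  shows "k \<noteq> 0" "norm k \<le> 2 * norm k0" "norm k \<le> 3 / 2"
    "\<bar>u\<bar> \<le> B \<Longrightarrow> Re (rate k0) * u \<le> 0 \<Longrightarrow> norm (exp (rate k * of_real u)) \<le> 3"
proof -
  define r where "r = norm k0"
  have r: "0 < r" "r \<le> 1" using k0 by (auto simp: r_def)
  have d: "norm (k - k0) \<le> r ^ 2 / (2 * (1 + B))" using k by (simp add: dist_norm norm_minus_commute r_def)
  also have "\<dots> \<le> r ^ 2 / 2" using B r by (intro divide_left_mono) auto
  also have "\<dots> \<le> r / 2" using r by (simp add: power2_eq_square mult_left_le)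
  finally have d2: "norm (k - k0) \<le> r / 2" .
  have lo: "r / 2 \<le> norm k" using d2 norm_triangle_ineq2[of k0 k] by (simp add: r_def norm_minus_commute)
  have hi: "norm k \<le> 3 / 2 * r" using d2 norm_triangle_ineq2[of k k0] by (simp add: r_def)
  show k1: "k \<noteq> 0" using lo r by auto
  show "norm k \<le> 2 * norm k0" using hi r unfolding r_def by linarith
  show "norm k \<le> 3 / 2" using hi r by simp
  have "rate k - rate k0 = - (\<i> * s / 2) * ((k - k0) * (1 + 1 / (k * k0)))"
    unfolding rate_def using k1 k0 by (simp add: field_simps)
  then have "norm (rate k - rate k0) = norm (k - k0) * norm (1 + 1 / (k * k0)) / 2"
    using s by (auto simp: norm_mult norm_divide)
  also have "\<dots> \<le> (r ^ 2 / (2 * (1 + B))) * (3 / r ^ 2) / 2"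
  proof (intro divide_right_mono mult_mono d)
    have "norm (1 + 1 / (k * k0)) \<le> 1 + norm (1 / (k * k0))" using norm_triangle_ineq[of 1 "1 / (k * k0)"] by simp
    also have "norm (1 / (k * k0)) = 1 / (norm k * r)" by (simp add: norm_divide norm_mult r_def)
    also have "\<dots> \<le> 1 / (r / 2 * r)" using lo r k1 by (intro divide_left_mono mult_right_mono mult_pos_pos) auto
    also have "1 + 1 / (r / 2 * r) = (r ^ 2 + 2) / r ^ 2" using r by (simp add: field_simps power2_eq_square)
    also have "\<dots> \<le> 3 / r ^ 2" using r by (intro divide_right_mono) (auto simp: power_le_one)
    finally show "norm (1 + 1 / (k * k0)) \<le> 3 / r ^ 2" by simp
  qed (use B r in auto)
  also have "\<dots> = 3 / 4 / (1 + B)" using r by (simp add: field_simps)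
  finally have rd: "norm (rate k - rate k0) \<le> 3 / 4 / (1 + B)" .
  assume u: "\<bar>u\<bar> \<le> B" "Re (rate k0) * u \<le> 0"
  have "Re (rate k) * u = Re (rate k0) * u + Re (rate k - rate k0) * u" by (simp add: algebra_simps)
  also have "Re (rate k - rate k0) * u \<le> norm (rate k - rate k0) * \<bar>u\<bar>"
  proof -
    have "Re (rate k - rate k0) * u \<le> \<bar>Re (rate k - rate k0)\<bar> * \<bar>u\<bar>" by (simp flip: abs_mult)
    also have "\<dots> \<le> norm (rate k - rate k0) * \<bar>u\<bar>" by (intro mult_right_mono abs_Re_le_cmod abs_ge_zero)
    finally show ?thesis .
  qed
  also have "\<dots> \<le> 3 / 4 / (1 + B) * B" by (rule mult_mono[OF rd u(1)]) (use B in auto)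
  also have "\<dots> \<le> 1" using B by (simp add: field_simps)
  finally have "Re (rate k) * u \<le> 1" using u(2) by simp
  then have "exp (Re (rate k) * u) \<le> exp 1" by simp
  also have "\<dots> \<le> 3" by (rule exp_le)
  finally show "norm (exp (rate k * of_real u)) \<le> 3" by simp
qed

lemma trunc_holomorphic: "(\<lambda>k. trunc F k x) holomorphic_on S"
  unfolding trunc_def by (intro holomorphic_intros)

text \<open>A formal solution of the system in which the two components have exchanged their roles.\<close>
definition dual_formal :: "(int \<Rightarrow> real \<Rightarrow> complex) \<Rightarrow> (int \<Rightarrow> real \<Rightarrow> complex) \<Rightarrow> bool" where
  "dual_formal P Q \<longleftrightarrow> lax_system.formal m (- s) qp0 qp1 qq1 pq0 pq1 pp1 P Q"

lemma dual_system: "lax_system n m (- s) qp0 qp1 qq1 pq0 pq1 pp1"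
  using s coeffs by unfold_locales auto

text \<open>Multiplication by \<open>exp (rate k x)\<close> moves the exponent from one component to the other. So the
  solutions of the exchanged system are the oscillating companions of the solutions of the given one.\<close>
lemma dual_solves:
  assumes r: "lax_system.solves (- s) qp0 qp1 qq1 pq0 pq1 pp1 k p q r1 r2"
  shows "solves k (\<lambda>x. exp (rate k * of_real x) * q x) (\<lambda>x. exp (rate k * of_real x) * p x)
          (\<lambda>x. exp (rate k * of_real x) * r2 x) (\<lambda>x. exp (rate k * of_real x) * r1 x)"
proof -
  interpret dual: lax_system n m "- s" qp0 qp1 qq1 pq0 pq1 pp1 by (rule dual_system)
  note a = r[unfolded dual.solves_def, THEN conjunct1] r[unfolded dual.solves_def, THEN conjunct2]
  define E where "E x = exp (rate k * of_real x)" for x :: real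
  have Ed: "(E has_vector_derivative (rate k * E x)) (at x within {0..})" for x
    unfolding E_def[abs_def] by (rule has_vector_derivative_real_field) (auto intro!: derivative_eq_intros)
  have "continuous_on {0..} (\<lambda>x. rate k * E x)" unfolding E_def by (intro continuous_intros)
  note Ea = ac_derivI_continuous[OF Ed this]
  have dr: "dual.rate k = - rate k" by (simp add: dual.rate_def rate_def)
  have "solves k (\<lambda>x. E x * q x) (\<lambda>x. E x * p x) (\<lambda>x. E x * r2 x) (\<lambda>x. E x * r1 x)"
    unfolding solves_def
  proof
    show "ac_deriv (\<lambda>x. E x * q x)
       (\<lambda>x. (pq0 x + k * pq1 x) * (E x * p x) + k * pp1 x * (E x * q x) + E x * r2 x)"
      using ac_deriv_mult[OF Ea a(2)] unfolding dr
      by (rule iffD1[OF ac_deriv_cong, rotated 2]) (simp_all add: algebra_simps)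
    show "ac_deriv (\<lambda>x. E x * p x)
       (\<lambda>x. rate k * (E x * p x) + ((qp0 x + k * qp1 x) * (E x * q x) + k * qq1 x * (E x * p x) + E x * r1 x))"
      using ac_deriv_mult[OF Ea a(1)]
      by (rule iffD1[OF ac_deriv_cong, rotated 2]) (simp_all add: algebra_simps)
  qed
  then show ?thesis unfolding E_def .
qed

lemma dual_trunc:
  assumes "dual_formal P Q"
  obtains \<rho> B where "weighted_L1c n (\<lambda>x. of_real (\<rho> x))" "\<And>x. 0 \<le> \<rho> x"
    "\<And>k x. norm k \<le> 2 \<Longrightarrow> 0 \<le> x \<Longrightarrow> norm (trunc P k x) + norm (trunc Q k x) \<le> B"
    "\<And>k. k \<noteq> 0 \<Longrightarrow> norm k \<le> 2 \<Longrightarrow> \<exists>r1 r2.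
        solves k (\<lambda>x. exp (rate k * of_real x) * trunc Q k x) (\<lambda>x. exp (rate k * of_real x) * trunc P k x)
          (\<lambda>x. exp (rate k * of_real x) * r2 x) (\<lambda>x. exp (rate k * of_real x) * r1 x) \<and>
        (\<forall>x\<ge>0. norm (r1 x) + norm (r2 x) \<le> norm k ^ Suc m * \<rho> x)"
proof -
  interpret dual: lax_system n m "- s" qp0 qp1 qq1 pq0 pq1 pp1 by (rule dual_system)
  have "dual.formal P Q" using assms unfolding dual_formal_def .
  note ft = dual.formal_trunc[OF this]
  obtain \<rho> B where \<rho>: "weighted_L1c n (\<lambda>x. of_real (\<rho> x))" "\<And>x. 0 \<le> \<rho> x"
    and B: "\<And>k x. norm k \<le> 2 \<Longrightarrow> 0 \<le> x \<Longrightarrow> norm (trunc P k x) + norm (trunc Q k x) \<le> B"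
    and sol: "\<And>k. k \<noteq> 0 \<Longrightarrow> norm k \<le> 2 \<Longrightarrow> \<exists>r1 r2. dual.solves k (trunc P k) (trunc Q k) r1 r2 \<and>
        (\<forall>x\<ge>0. norm (r1 x) + norm (r2 x) \<le> norm k ^ Suc m * \<rho> x)"
    by (rule ft, rule that)
  have "\<exists>r1 r2. solves k (\<lambda>x. exp (rate k * of_real x) * trunc Q k x) (\<lambda>x. exp (rate k * of_real x) * trunc P k x)
          (\<lambda>x. exp (rate k * of_real x) * r2 x) (\<lambda>x. exp (rate k * of_real x) * r1 x) \<and>
        (\<forall>x\<ge>0. norm (r1 x) + norm (r2 x) \<le> norm k ^ Suc m * \<rho> x)" if k: "k \<noteq> 0" "norm k \<le> 2" for k
  proof -
    obtain r1 r2 where r: "dual.solves k (trunc P k) (trunc Q k) r1 r2"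
        "\<forall>x\<ge>0. norm (r1 x) + norm (r2 x) \<le> norm k ^ Suc m * \<rho> x" using sol[OF k] by blast
    with dual_solves[OF r(1)] show ?thesis by blast
  qed
  with \<rho> B show thesis by (rule that)
qed

lemma solves_homogeneous_diff:
  assumes "solves k p q (\<lambda>x. 0) (\<lambda>x. 0)" "solves k p1 q1 r1 r2" "solves k p2 q2 t1 t2"
  shows "solves k (\<lambda>x. p x - p1 x - p2 x) (\<lambda>x. q x - q1 x - q2 x) (\<lambda>x. 0 - r1 x - t1 x) (\<lambda>x. 0 - r2 x - t2 x)"
  by (rule solves_diff[OF solves_diff[OF assms(1,2)] assms(3)])

lemma weighted_integrable:
  assumes "weighted_L1c n (\<lambda>x. of_real (\<rho> x))" "j \<le> n"
  shows "(\<lambda>x. (1 + x) ^ j * \<rho> x) integrable_on {0..}"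
proof -
  have "(\<lambda>x. of_real ((1 + x) ^ j) * complex_of_real (\<rho> x)) absolutely_integrable_on {0..}"
    using weighted_L1c_mono[OF assms] unfolding weighted_L1c_def .
  from absolutely_integrable_linear[OF this bounded_linear_Re]
  have "(\<lambda>x. (1 + x) ^ j * \<rho> x) absolutely_integrable_on {0..}" unfolding o_def by (simp flip: of_real_mult)
  then show ?thesis unfolding absolutely_integrable_on_def by blast
qed

text \<open>Each derivative costs \<open>(1 + B) / |k0|^2\<close>, the reciprocal of the radius up to a constant.\<close>
lemma derivative_bound_from_disc:
  assumes hol: "f holomorphic_on - {0}" and k0: "k0 \<noteq> 0" "norm k0 \<le> 1" and B: "0 \<le> B"
    and A: "0 \<le> A" and bd: "\<And>k. k \<in> cball k0 (norm k0 ^ 2 / (2 * (1 + B))) \<Longrightarrow> norm (f k) \<le> norm k ^ Suc m * A"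
    and j: "j \<le> n"
  shows "norm ((deriv ^^ j) f k0) \<le> fact n * 2 ^ Suc m * 2 ^ n * A * (1 + B) ^ j * (norm k0 ^ Suc m / norm k0 ^ (2 * j))"
proof -
  define r where "r = norm k0 ^ 2 / (2 * (1 + B))"
  have r: "r > 0" using k0 B by (simp add: r_def)
  have "norm ((deriv ^^ j) f k0) \<le> fact j * ((2 * norm k0) ^ Suc m * A) / r ^ j"
  proof (rule Cauchy_derivative_bound[OF hol _ _ r])
    show "cball k0 r \<subseteq> - {0}" using rate_disc(1)[OF k0 B] unfolding r_def by blast
    fix z assume z: "z \<in> cball k0 r"
    have "norm (f z) \<le> norm z ^ Suc m * A" using bd z unfolding r_def by blast
    also have "\<dots> \<le> (2 * norm k0) ^ Suc m * A"
      using rate_disc(2)[OF k0 B] z A unfolding r_def by (intro mult_right_mono power_mono) auto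
    finally show "norm (f z) \<le> (2 * norm k0) ^ Suc m * A" .
  qed auto
  also have "\<dots> = fact j * 2 ^ j * (2 ^ Suc m * A * (1 + B) ^ j * (norm k0 ^ Suc m / norm k0 ^ (2 * j)))"
  proof -
    have rj: "r ^ j = norm k0 ^ (2 * j) / (2 ^ j * (1 + B) ^ j)"
      unfolding r_def power_divide power_mult_distrib[of 2 "1 + B"] power_mult ..
    show ?thesis unfolding rj power_mult_distrib[of 2 "norm k0"] by simp
  qed
  also have "\<dots> \<le> fact n * 2 ^ n * (2 ^ Suc m * A * (1 + B) ^ j * (norm k0 ^ Suc m / norm k0 ^ (2 * j)))"
    using A B j by (intro mult_right_mono mult_mono fact_mono power_increasing) auto
  finally show ?thesis by (simp add: ac_simps)
qed

lemma exp_rate_holomorphic: "(\<lambda>k. exp (rate k * of_real x)) holomorphic_on - {0}"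
  by (intro holomorphic_intros rate_holomorphic)

text \<open>The truncations of the formal solution and of its oscillating companion together match the initial
  values, so the error starts at zero and is driven by the two residuals only. The Gronwall estimate
  holds on the discs of \<open>rate_disc\<close> and the Cauchy estimate yields the derivatives.\<close>
lemma forward_expansion:
  assumes P: "formal P Q" and D: "dual_formal P' Q'"
    and sol: "\<And>k. k \<noteq> 0 \<Longrightarrow> norm k \<le> 2 \<Longrightarrow> solves k (\<lambda>x. Fp x k) (\<lambda>x. Fq x k) (\<lambda>x. 0) (\<lambda>x. 0)"
    and init: "\<And>k. k \<noteq> 0 \<Longrightarrow> norm k \<le> 2 \<Longrightarrow> Fp 0 k = v \<and> Fq 0 k = w"
    and match: "\<And>k. trunc P k 0 + trunc Q' k 0 = v \<and> trunc Q k 0 + trunc P' k 0 = w"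
  defines "S \<equiv> {k. k \<noteq> 0 \<and> norm k \<le> 1 \<and> Re (rate k) \<le> 0}"
  shows "\<exists>C>0. \<forall>x\<ge>0. \<exists>Gp Gq.
      boundary_derivs S n (\<lambda>k. Fp x k - trunc P k x - exp (rate k * of_real x) * trunc Q' k x) Gp \<and>
      boundary_derivs S n (\<lambda>k. Fq x k - trunc Q k x - exp (rate k * of_real x) * trunc P' k x) Gq \<and>
      (\<forall>j\<le>n. \<forall>k\<in>S. norm (Gp j k) + norm (Gq j k) \<le> C * (1 + x) ^ j * (norm k ^ Suc m / norm k ^ (2 * j)))"
proof -
  obtain \<rho> B where \<rho>: "weighted_L1c n (\<lambda>x. of_real (\<rho> x))" "\<And>x. 0 \<le> \<rho> x"
    and B: "\<And>k x. norm k \<le> 2 \<Longrightarrow> 0 \<le> x \<Longrightarrow> norm (trunc P k x) + norm (trunc Q k x) \<le> B"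
    and res: "\<And>k. k \<noteq> 0 \<Longrightarrow> norm k \<le> 2 \<Longrightarrow> \<exists>r1 r2. solves k (trunc P k) (trunc Q k) r1 r2 \<and>
        (\<forall>x\<ge>0. norm (r1 x) + norm (r2 x) \<le> norm k ^ Suc m * \<rho> x)"
    by (rule formal_trunc[OF P], rule that)
  obtain \<rho>' B' where \<rho>': "weighted_L1c n (\<lambda>x. of_real (\<rho>' x))" "\<And>x. 0 \<le> \<rho>' x"
    and B': "\<And>k x. norm k \<le> 2 \<Longrightarrow> 0 \<le> x \<Longrightarrow> norm (trunc P' k x) + norm (trunc Q' k x) \<le> B'"
    and res': "\<And>k. k \<noteq> 0 \<Longrightarrow> norm k \<le> 2 \<Longrightarrow> \<exists>r1 r2.
        solves k (\<lambda>x. exp (rate k * of_real x) * trunc Q' k x) (\<lambda>x. exp (rate k * of_real x) * trunc P' k x)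
          (\<lambda>x. exp (rate k * of_real x) * r2 x) (\<lambda>x. exp (rate k * of_real x) * r1 x) \<and>
        (\<forall>x\<ge>0. norm (r1 x) + norm (r2 x) \<le> norm k ^ Suc m * \<rho>' x)"
    by (rule dual_trunc[OF D], rule that)
  obtain p q where pq: "\<forall>x\<ge>0. p x holomorphic_on - {0} \<and> q x holomorphic_on - {0}"
    "\<forall>k. k \<noteq> 0 \<longrightarrow> p 0 k = v \<and> q 0 k = w \<and> solves k (\<lambda>x. p x k) (\<lambda>x. q x k) (\<lambda>x. 0) (\<lambda>x. 0)"
    using fundamental_solution[of v w] by blast
  \<comment> \<open>The given solution is the holomorphic one of Picard, since both have the same initial values.\<close>
  have pq_eq: "p x k = Fp x k" "q x k = Fq x k" if "k \<noteq> 0" "norm k \<le> 2" "0 \<le> x" for x k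
  proof -
    have "solves k (\<lambda>x. p x k) (\<lambda>x. q x k) (\<lambda>x. 0) (\<lambda>x. 0)" "p 0 k = Fp 0 k" "q 0 k = Fq 0 k"
      using pq(2) init[OF that(1,2)] that(1) by simp_all
    from solves_unique[OF this(1) sol[OF that(1,2)] that(2) this(2,3) that(3)]
    show "p x k = Fp x k" "q x k = Fq x k" by blast+
  qed
  define ep where "ep x k = p x k - trunc P k x - exp (rate k * of_real x) * trunc Q' k x" for x k
  define eq where "eq x k = q x k - trunc Q k x - exp (rate k * of_real x) * trunc P' k x" for x k
  have hol: "ep x holomorphic_on - {0}" "eq x holomorphic_on - {0}" if "0 \<le> x" for x
    unfolding ep_def[abs_def] eq_def[abs_def]
    by (intro holomorphic_on_diff holomorphic_on_mult trunc_holomorphic exp_rate_holomorphic, use pq(1) that in blast)+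
  define I where "I = integral {0..} (\<lambda>x. \<rho> x + 3 * \<rho>' x)"
  have int: "(\<lambda>x. \<rho> x + 3 * \<rho>' x) integrable_on {0..}"
    using weighted_integrable[OF \<rho>(1), of 0] weighted_integrable[OF \<rho>'(1), of 0]
    by (intro integrable_add integrable_on_mult_right) auto
  have nn: "0 \<le> \<rho> x + 3 * \<rho>' x" for x using \<rho>(2)[of x] \<rho>'(2)[of x] by simp
  have int': "(\<lambda>x. \<rho> x + 3 * \<rho>' x) integrable_on {0..b}" "integral {0..b} (\<lambda>x. \<rho> x + 3 * \<rho>' x) \<le> I" for b
  proof -
    show 1: "(\<lambda>x. \<rho> x + 3 * \<rho>' x) integrable_on {0..b}" by (rule integrable_on_subinterval[OF int]) auto
    show "integral {0..b} (\<lambda>x. \<rho> x + 3 * \<rho>' x) \<le> I"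
      unfolding I_def by (rule integral_subset_le[OF _ 1 int]) (use nn in auto)
  qed
  have I0: "0 \<le> I" unfolding I_def by (rule integral_nonneg[OF int nn])
  define A where "A = 3 * exp (3 * total_load) * I"
  have A0: "0 \<le> A" using I0 by (simp add: A_def)
  \<comment> \<open>The point \<open>k0\<close> lies in the region of decay, the points \<open>k\<close> of the disc need not.\<close>
  have bound: "norm (ep x k) + norm (eq x k) \<le> norm k ^ Suc m * A"
    if x: "0 \<le> x" and k0: "k0 \<in> S" and k: "k \<in> cball k0 (norm k0 ^ 2 / (2 * (1 + x)))" for x k0 k
  proof -
    have k0': "k0 \<noteq> 0" "norm k0 \<le> 1" "Re (rate k0) \<le> 0" using k0 unfolding S_def by auto
    note disc = rate_disc[OF k0'(1,2) x k]
    have k2: "norm k \<le> 2" using disc(3) by simp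
    have E: "norm (exp (rate k * of_real u)) \<le> 3" if "0 \<le> u" "u \<le> x" for u
      by (rule disc(4)) (use that k0'(3) in \<open>auto simp: mult_nonpos_nonneg\<close>)
    obtain r1 r2 where r: "solves k (trunc P k) (trunc Q k) r1 r2"
      "\<forall>x\<ge>0. norm (r1 x) + norm (r2 x) \<le> norm k ^ Suc m * \<rho> x" using res[OF disc(1) k2] by blast
    obtain t1 t2 where t: "solves k (\<lambda>x. exp (rate k * of_real x) * trunc Q' k x) (\<lambda>x. exp (rate k * of_real x) * trunc P' k x)
          (\<lambda>x. exp (rate k * of_real x) * t2 x) (\<lambda>x. exp (rate k * of_real x) * t1 x)"
       "\<forall>x\<ge>0. norm (t1 x) + norm (t2 x) \<le> norm k ^ Suc m * \<rho>' x"
      using res'[OF disc(1) k2] by blast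
    have sp: "solves k (\<lambda>x. p x k) (\<lambda>x. q x k) (\<lambda>x. 0) (\<lambda>x. 0)" using pq(2) disc(1) by blast
    have se: "solves k (\<lambda>x. ep x k) (\<lambda>x. eq x k) (\<lambda>x. 0 - r1 x - exp (rate k * of_real x) * t2 x)
       (\<lambda>x. 0 - r2 x - exp (rate k * of_real x) * t1 x)"
      unfolding ep_def eq_def by (rule solves_homogeneous_diff[OF sp r(1) t(1)])
    have "norm (ep x k) + norm (eq x k) \<le> 3 * exp (3 * total_load) * (norm (ep 0 k) + norm (eq 0 k)
       + integral {0..x} (\<lambda>x. norm k ^ Suc m * (\<rho> x + 3 * \<rho>' x)))"
    proof (rule solves_forward_bound[OF se k2 order_refl x])
      show "norm (exp (rate k * of_real (t - \<tau>))) \<le> 3" if "0 \<le> \<tau>" "\<tau> \<le> t" "t \<le> x" for t \<tau>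
        by (rule E) (use that in auto)
      show "(\<lambda>x. norm k ^ Suc m * (\<rho> x + 3 * \<rho>' x)) integrable_on {0..x}"
        by (rule integrable_on_mult_right[OF int'(1)])
      fix y assume y: "y \<in> {0..x}"
      let ?E = "exp (rate k * of_real y)"
      have "norm (0 - r1 y - ?E * t2 y) + norm (0 - r2 y - ?E * t1 y)
        \<le> (norm (r1 y) + norm ?E * norm (t2 y)) + (norm (r2 y) + norm ?E * norm (t1 y))"
        by (intro add_mono order_trans[OF norm_triangle_ineq4]) (simp_all add: norm_mult)
      also have "\<dots> = (norm (r1 y) + norm (r2 y)) + norm ?E * (norm (t1 y) + norm (t2 y))" by (simp add: algebra_simps)
      also have "\<dots> \<le> norm k ^ Suc m * \<rho> y + 3 * (norm k ^ Suc m * \<rho>' y)"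
        using r(2) t(2) y E[of y] by (intro add_mono mult_mono) auto
      also have "\<dots> = norm k ^ Suc m * (\<rho> y + 3 * \<rho>' y)" by (simp add: algebra_simps)
      finally show "norm (0 - r1 y - ?E * t2 y) + norm (0 - r2 y - ?E * t1 y) \<le> norm k ^ Suc m * (\<rho> y + 3 * \<rho>' y)" .
    qed simp
    also have "norm (ep 0 k) + norm (eq 0 k) + integral {0..x} (\<lambda>x. norm k ^ Suc m * (\<rho> x + 3 * \<rho>' x))
        = norm k ^ Suc m * integral {0..x} (\<lambda>x. \<rho> x + 3 * \<rho>' x)"
    proof -
      have "ep 0 k = 0" "eq 0 k = 0" using match[of k] pq(2) disc(1) by (auto simp: ep_def eq_def algebra_simps)
      then show ?thesis by simp
    qed
    also have "3 * exp (3 * total_load) * (norm k ^ Suc m * integral {0..x} (\<lambda>x. \<rho> x + 3 * \<rho>' x))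
        \<le> 3 * exp (3 * total_load) * (norm k ^ Suc m * I)"
      by (intro mult_left_mono int'(2)) auto
    finally show ?thesis by (simp add: A_def ac_simps)
  qed
  define C where "C = 2 * (fact n * 2 ^ Suc m * 2 ^ n * A) + 1"
  have C: "C > 0" using A0 by (auto simp: C_def intro!: add_nonneg_pos)
  have S0: "0 \<notin> S" by (simp add: S_def)
  have "\<exists>Gp Gq.
      boundary_derivs S n (\<lambda>k. Fp x k - trunc P k x - exp (rate k * of_real x) * trunc Q' k x) Gp \<and>
      boundary_derivs S n (\<lambda>k. Fq x k - trunc Q k x - exp (rate k * of_real x) * trunc P' k x) Gq \<and>
      (\<forall>j\<le>n. \<forall>k\<in>S. norm (Gp j k) + norm (Gq j k) \<le> C * (1 + x) ^ j * (norm k ^ Suc m / norm k ^ (2 * j)))"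
    if x: "0 \<le> x" for x
  proof (rule exI[of _ "\<lambda>j. (deriv ^^ j) (ep x)"], rule exI[of _ "\<lambda>j. (deriv ^^ j) (eq x)"], intro conjI allI impI ballI)
    have Sk: "k \<noteq> 0" "norm k \<le> 2" if "k \<in> S" for k using that by (auto simp: S_def)
    show "boundary_derivs S n (\<lambda>k. Fp x k - trunc P k x - exp (rate k * of_real x) * trunc Q' k x) (\<lambda>j. (deriv ^^ j) (ep x))"
      by (rule holomorphic_imp_boundary_derivs[OF hol(1)[OF x] S0]) (use pq_eq Sk x in \<open>simp add: ep_def\<close>)
    show "boundary_derivs S n (\<lambda>k. Fq x k - trunc Q k x - exp (rate k * of_real x) * trunc P' k x) (\<lambda>j. (deriv ^^ j) (eq x))"
      by (rule holomorphic_imp_boundary_derivs[OF hol(2)[OF x] S0]) (use pq_eq Sk x in \<open>simp add: eq_def\<close>)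
    fix j k assume j: "j \<le> n" and k: "k \<in> S"
    have k': "k \<noteq> 0" "norm k \<le> 1" using k by (auto simp: S_def)
    have b: "norm (ep x z) \<le> norm z ^ Suc m * A" "norm (eq x z) \<le> norm z ^ Suc m * A"
      if "z \<in> cball k (norm k ^ 2 / (2 * (1 + x)))" for z
      using bound[OF x k that] norm_ge_zero[of "ep x z"] norm_ge_zero[of "eq x z"] by linarith+
    let ?R = "(1 + x) ^ j * (norm k ^ Suc m / norm k ^ (2 * j))"
    have "norm ((deriv ^^ j) (ep x) k) + norm ((deriv ^^ j) (eq x) k) \<le>
        fact n * 2 ^ Suc m * 2 ^ n * A * (1 + x) ^ j * (norm k ^ Suc m / norm k ^ (2 * j)) +
        fact n * 2 ^ Suc m * 2 ^ n * A * (1 + x) ^ j * (norm k ^ Suc m / norm k ^ (2 * j))"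
      by (intro add_mono derivative_bound_from_disc hol k' x A0 b j)
    also have "\<dots> = (2 * (fact n * 2 ^ Suc m * 2 ^ n * A)) * ?R" by (simp add: algebra_simps)
    also have "\<dots> \<le> C * ?R" unfolding C_def using x by (intro mult_right_mono) auto
    finally show "norm ((deriv ^^ j) (ep x) k) + norm ((deriv ^^ j) (eq x) k) \<le> C * (1 + x) ^ j * (norm k ^ Suc m / norm k ^ (2 * j))"
      by (simp only: mult.assoc)
  qed
  with C show ?thesis by blast
qed

end

section \<open>The expansion of solutions with given limits at infinity\<close>

text \<open>Bounds on the derivatives of the summands that are uniform on \<open>S\<close> away from the origin allow
  termwise differentiation in the interior and pass continuity up to the boundary.\<close>
lemma series_boundary_derivs:
  fixes D :: "nat \<Rightarrow> complex \<Rightarrow> complex"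
  assumes D: "\<And>l. D l holomorphic_on - {0}" and S: "\<And>k. k \<in> S \<Longrightarrow> k \<noteq> 0 \<and> norm k \<le> 1"
    and bd: "\<And>l j k. \<lbrakk>j \<le> n; k \<in> S\<rbrakk> \<Longrightarrow> norm ((deriv ^^ j) (D l) k) \<le> c l * (norm k ^ M / norm k ^ (2 * j) * w j)"
    and c: "summable c" "\<And>l. 0 \<le> c l" and w: "\<And>j. 0 \<le> w j"
    and f: "\<And>k. k \<in> S \<Longrightarrow> (\<lambda>l. D l k) sums f k"
  defines "F \<equiv> \<lambda>j k. \<Sum>l. (deriv ^^ j) (D l) k"
  shows "boundary_derivs S n f F"
    and "\<And>j k. \<lbrakk>j \<le> n; k \<in> S\<rbrakk> \<Longrightarrow> norm (F j k) \<le> suminf c * (norm k ^ M / norm k ^ (2 * j) * w j)"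
proof -
  have h: "(deriv ^^ j) (D l) holomorphic_on - {0}" for j l
    by (rule holomorphic_higher_deriv[OF D]) auto
  have Sbd: "norm ((deriv ^^ j) (D l) k) \<le> c l * (1 / \<epsilon> ^ (2 * j) * w j)"
    if "j \<le> n" "k \<in> S" "\<epsilon> < norm k" "0 < \<epsilon>" for j l k \<epsilon>
  proof -
    have "norm k ^ M / norm k ^ (2 * j) \<le> 1 / \<epsilon> ^ (2 * j)"
      using that S[OF that(2)] by (intro frac_le power_mono) (auto simp: power_le_one)
    then have "c l * (norm k ^ M / norm k ^ (2 * j) * w j) \<le> c l * (1 / \<epsilon> ^ (2 * j) * w j)"
      using c(2) w by (intro mult_left_mono mult_right_mono)
    with bd[OF that(1,2), of l] show ?thesis by linarith
  qed
  have ul: "uniform_limit (S \<inter> {k. \<epsilon> < norm k}) (\<lambda>N k. \<Sum>l<N. (deriv ^^ j) (D l) k) (F j) sequentially"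
    if "j \<le> n" "0 < \<epsilon>" for j \<epsilon>
    unfolding F_def
  proof (rule Weierstrass_m_test)
    show "norm ((deriv ^^ j) (D l) k) \<le> c l * (1 / \<epsilon> ^ (2 * j) * w j)" if "k \<in> S \<inter> {k. \<epsilon> < norm k}" for l k
      using that \<open>j \<le> n\<close> \<open>0 < \<epsilon>\<close> by (intro Sbd) auto
    show "summable (\<lambda>l. c l * (1 / \<epsilon> ^ (2 * j) * w j))" by (rule summable_mult2[OF c(1)])
  qed
  have cont: "continuous_on S (F j)" if j: "j \<le> n" for j
    unfolding continuous_on_eq_continuous_within
  proof
    fix k0 assume k0: "k0 \<in> S"
    define \<epsilon> where "\<epsilon> = norm k0 / 2"
    have \<epsilon>: "0 < \<epsilon>" "\<epsilon> < norm k0" using S[OF k0] by (auto simp: \<epsilon>_def)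
    have "continuous_on (S \<inter> {k. \<epsilon> < norm k}) (F j)"
    proof (rule uniform_limit_theorem[OF _ ul[OF j \<epsilon>(1)]])
      have "continuous_on (S \<inter> {k. \<epsilon> < norm k}) (\<lambda>k. \<Sum>l<N. (deriv ^^ j) (D l) k)" for N
        by (intro continuous_on_sum continuous_on_subset[OF holomorphic_on_imp_continuous_on[OF h]]) (use S in auto)
      then show "\<forall>\<^sub>F N in sequentially. continuous_on (S \<inter> {k. \<epsilon> < norm k}) (\<lambda>k. \<Sum>l<N. (deriv ^^ j) (D l) k)" by simp
    qed simp
    then have "continuous (at k0 within S \<inter> {k. \<epsilon> < norm k}) (F j)"
      using k0 \<epsilon> by (simp add: continuous_on_eq_continuous_within)
    moreover have "at k0 within S = at k0 within S \<inter> {k. \<epsilon> < norm k}"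
      by (rule at_within_nhd[of k0 "{k. \<epsilon> < norm k}"]) (use \<epsilon> in \<open>auto intro!: open_Collect_less continuous_intros\<close>)
    ultimately show "continuous (at k0 within S) (F j)" by simp
  qed
  have der: "(F j has_field_derivative F (Suc j) k0) (at k0)" if j: "j < n" and k0: "k0 \<in> interior S" for j k0
  proof -
    have k0S: "k0 \<in> S" using k0 interior_subset by blast
    define \<epsilon> where "\<epsilon> = norm k0 / 2"
    have \<epsilon>: "0 < \<epsilon>" "\<epsilon> < norm k0" using S[OF k0S] by (auto simp: \<epsilon>_def)
    have "open (interior S \<inter> {k. \<epsilon> < norm k})" by (intro open_Int open_interior open_Collect_less continuous_intros)
    then obtain r where r: "0 < r" "ball k0 r \<subseteq> interior S \<inter> {k. \<epsilon> < norm k}"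
      using k0 \<epsilon>(2) unfolding open_contains_ball by blast
    have sub: "ball k0 r \<subseteq> S \<inter> {k. \<epsilon> < norm k}" using r(2) interior_subset by blast
    show ?thesis
      unfolding F_def
    proof (rule has_field_derivative_series'(2)[where S = "ball k0 r" and ?x0.0 = k0])
      show "((deriv ^^ j) (D l) has_field_derivative (deriv ^^ Suc j) (D l) z) (at z within ball k0 r)"
        if "z \<in> ball k0 r" for l z
      proof -
        have "z \<in> S" using that sub by blast
        then have "z \<in> - {0}" using S by blast
        then have "((deriv ^^ j) (D l) has_field_derivative (deriv ^^ Suc j) (D l) z) (at z)"
          using holomorphic_derivI[OF h, of z j l UNIV] by (simp add: open_Compl)
        then show ?thesis by (rule has_field_derivative_at_within)
      qed
      show "uniformly_convergent_on (ball k0 r) (\<lambda>N z. \<Sum>l<N. (deriv ^^ Suc j) (D l) z)"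
        using uniform_limit_on_subset[OF ul[OF _ \<epsilon>(1), of "Suc j"] sub] j
        unfolding uniformly_convergent_on_def by auto
      show "summable (\<lambda>l. (deriv ^^ j) (D l) k0)"
      proof (rule summable_comparison_test'[OF summable_mult2[OF c(1), of "1 / \<epsilon> ^ (2 * j) * w j"]])
        show "norm ((deriv ^^ j) (D l) k0) \<le> c l * (1 / \<epsilon> ^ (2 * j) * w j)" for l
          by (rule Sbd) (use j k0S \<epsilon> in auto)
      qed
    qed (use r in auto)
  qed
  show "boundary_derivs S n f F"
    unfolding boundary_derivs_def
    using cont der sums_unique[OF f] by (auto simp: F_def)
  show "norm (F j k) \<le> suminf c * (norm k ^ M / norm k ^ (2 * j) * w j)" if "j \<le> n" "k \<in> S" for j k
  proof -
    note sm = summable_mult2[OF c(1), of "norm k ^ M / norm k ^ (2 * j) * w j"]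
    have "norm (F j k) \<le> (\<Sum>l. c l * (norm k ^ M / norm k ^ (2 * j) * w j))"
      unfolding F_def by (rule norm_suminf_le[OF bd[OF that] sm])
    also have "\<dots> = suminf c * (norm k ^ M / norm k ^ (2 * j) * w j)" by (rule suminf_mult2[OF c(1), symmetric])
    finally show ?thesis .
  qed
qed

context lax_system
begin

text \<open>The dyadic decomposition of the error. The limits at infinity ensure that the solutions \<open>p l\<close>,
  \<open>q l\<close> through the truncation at \<open>L l\<close> converge to the given solution, so that the error at \<open>x\<close> is the
  sum of the differences of two successive ones.\<close>
lemma backward_expansion:
  assumes P: "formal P Q"
  defines "S \<equiv> {k. k \<noteq> 0 \<and> norm k \<le> 1 \<and> 0 \<le> Re (rate k)}"
  assumes sol: "\<And>k. k \<in> S \<Longrightarrow> solves k (\<lambda>x. Fp x k) (\<lambda>x. Fq x k) (\<lambda>x. 0) (\<lambda>x. 0)"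
    and lim: "\<And>k. k \<in> S \<Longrightarrow> ((\<lambda>x. Fp x k - trunc P k x) \<longlongrightarrow> 0) at_top"
      "\<And>k. k \<in> S \<Longrightarrow> ((\<lambda>x. Fq x k - trunc Q k x) \<longlongrightarrow> 0) at_top"
  shows "\<exists>C>0. \<forall>x\<ge>0. \<exists>Gp Gq.
      boundary_derivs S n (\<lambda>k. Fp x k - trunc P k x) Gp \<and>
      boundary_derivs S n (\<lambda>k. Fq x k - trunc Q k x) Gq \<and>
      (\<forall>j\<le>n. \<forall>k\<in>S. norm (Gp j k) + norm (Gq j k) \<le> C * (norm k ^ Suc m / norm k ^ (2 * j) * (1 / (1 + x) ^ (n - j))))"
proof -
  obtain \<rho> B where \<rho>: "weighted_L1c n (\<lambda>x. of_real (\<rho> x))" "\<And>x. 0 \<le> \<rho> x"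
    and B: "\<And>k x. norm k \<le> 2 \<Longrightarrow> 0 \<le> x \<Longrightarrow> norm (trunc P k x) + norm (trunc Q k x) \<le> B"
    and res: "\<And>k. k \<noteq> 0 \<Longrightarrow> norm k \<le> 2 \<Longrightarrow> \<exists>r1 r2. solves k (trunc P k) (trunc Q k) r1 r2 \<and>
        (\<forall>x\<ge>0. norm (r1 x) + norm (r2 x) \<le> norm k ^ Suc m * \<rho> x)"
    by (rule formal_trunc[OF P], rule that)
  define g where "g x = (1 + x) ^ n * \<rho> x" for x
  have gi: "g integrable_on {0..}" unfolding g_def[abs_def] by (rule weighted_integrable[OF \<rho>(1)]) simp
  have g0: "0 \<le> g x" if "0 \<le> x" for x using that \<rho>(2)[of x] by (simp add: g_def)
  have \<rho>i: "\<rho> integrable_on {a..b}" if "0 \<le> a" for a b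
  proof (rule integrable_on_subinterval)
    show "\<rho> integrable_on {0..}" using weighted_integrable[OF \<rho>(1), of 0] by simp
  qed (use that in auto)
  have gi': "g integrable_on {a..b}" if "0 \<le> a" for a b
    by (rule integrable_on_subinterval[OF gi]) (use that in auto)
  define R where "R = integral {0..} g"
  have R0: "0 \<le> R" unfolding R_def by (rule integral_nonneg[OF gi]) (use g0 in auto)
  \<comment> \<open>Two Gronwall steps: from \<open>L (l + 1)\<close> to \<open>L l\<close>, where the residual enters, and on to \<open>x\<close>.\<close>
  define A where "A = 3 * exp (3 * total_load) * (3 * exp (3 * total_load))"
  have A0: "0 \<le> A" by (simp add: A_def)
  define C1 where "C1 = fact n * 2 ^ Suc m * 2 ^ n * A * 2 ^ n"
  have C10: "0 \<le> C1" using A0 by (simp add: C1_def)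
  have main: "\<exists>Gp Gq.
      boundary_derivs S n (\<lambda>k. Fp x k - trunc P k x) Gp \<and>
      boundary_derivs S n (\<lambda>k. Fq x k - trunc Q k x) Gq \<and>
      (\<forall>j\<le>n. \<forall>k\<in>S. norm (Gp j k) + norm (Gq j k) \<le> (2 * (C1 * R) + 1) * (norm k ^ Suc m / norm k ^ (2 * j) * (1 / (1 + x) ^ (n - j))))"
    if x: "0 \<le> x" for x
  proof -
    define L where "L l = 2 ^ l * (1 + x) - 1" for l :: nat
    have L0: "L 0 = x" by (simp add: L_def)
    have LS: "1 + L (Suc l) = 2 * (1 + L l)" for l by (simp add: L_def)
    have Lx: "x \<le> L l" for l
    proof -
      have "1 * (1 + x) \<le> 2 ^ l * (1 + x)" by (rule mult_right_mono) (use x in auto)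
      then show ?thesis by (simp add: L_def)
    qed
    have Lnn: "0 \<le> L l" for l using Lx[of l] x by simp
    have Lmono: "L l \<le> L (Suc l)" for l using LS[of l] Lnn[of l] by simp
    have Llim: "filterlim L at_top sequentially"
    proof (rule filterlim_at_top_mono)
      show "filterlim (\<lambda>l. real l) at_top sequentially" by (rule filterlim_real_sequentially)
      have "real l \<le> L l" for l
      proof -
        have "real l + 1 \<le> 2 ^ l" by (induction l) auto
        also have "\<dots> \<le> 2 ^ l * (1 + x)" using x by (simp add: distrib_left)
        finally show ?thesis by (simp add: L_def)
      qed
      then show "\<forall>\<^sub>F l in sequentially. real l \<le> L l" by simp
    qed
    define \<Phi> where "\<Phi> l z \<longleftrightarrow> (\<forall>y\<ge>0. fst z y holomorphic_on - {0} \<and> snd z y holomorphic_on - {0}) \<and>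
      (\<forall>k. k \<noteq> 0 \<longrightarrow> fst z (L l) k = trunc P k (L l) \<and> snd z (L l) k = trunc Q k (L l) \<and>
         solves k (\<lambda>x. fst z x k) (\<lambda>x. snd z x k) (\<lambda>x. 0) (\<lambda>x. 0))"
      for l and z :: "(real \<Rightarrow> complex \<Rightarrow> complex) \<times> (real \<Rightarrow> complex \<Rightarrow> complex)"
    have "\<forall>l. \<exists>z. \<Phi> l z"
    proof
      fix l
      obtain p q where "(\<forall>x\<ge>0. p x holomorphic_on - {0} \<and> q x holomorphic_on - {0}) \<and>
        (\<forall>k. k \<noteq> 0 \<longrightarrow> p (L l) k = trunc P k (L l) \<and> q (L l) k = trunc Q k (L l) \<and> solves k (\<lambda>x. p x k) (\<lambda>x. q x k) (\<lambda>x. 0) (\<lambda>x. 0))"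
        using solution_through[OF Lnn[of l] trunc_holomorphic[of P "L l"] trunc_holomorphic[of Q "L l"]] by blast
      then show "\<exists>z. \<Phi> l z" unfolding \<Phi>_def by (intro exI[of _ "(p, q)"]) simp
    qed
    then obtain z where z: "\<forall>l. \<Phi> l (z l)" using choice by blast
    define p q where "p l = fst (z l)" and "q l = snd (z l)" for l
    have ph: "p l y holomorphic_on - {0}" "q l y holomorphic_on - {0}" if "0 \<le> y" for l y
      using z that unfolding \<Phi>_def p_def q_def by blast+
    have pL: "p l (L l) k = trunc P k (L l)" "q l (L l) k = trunc Q k (L l)" if "k \<noteq> 0" for l k
      using z that unfolding \<Phi>_def p_def q_def by blast+
    have ps: "solves k (\<lambda>x. p l x k) (\<lambda>x. q l x k) (\<lambda>x. 0) (\<lambda>x. 0)" if "k \<noteq> 0" for l k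
      using z that unfolding \<Phi>_def p_def q_def by blast
    define Dp where "Dp l k = p (Suc l) x k - p l x k" for l k
    define Dq where "Dq l k = q (Suc l) x k - q l x k" for l k
    have Dh: "Dp l holomorphic_on - {0}" "Dq l holomorphic_on - {0}" for l
      unfolding Dp_def[abs_def] Dq_def[abs_def] by (intro holomorphic_on_diff ph x)+
    define I where "I l = integral {L l..L (Suc l)} \<rho>" for l
    have I0: "0 \<le> I l" for l unfolding I_def by (rule integral_nonneg[OF \<rho>i[OF Lnn]]) (use \<rho>(2) in auto)
    have Dbound: "norm (Dp l k) + norm (Dq l k) \<le> norm k ^ Suc m * (A * I l)"
      if k0: "k0 \<in> S" and k: "k \<in> cball k0 (norm k0 ^ 2 / (2 * (1 + L (Suc l))))" for l k0 k
    proof -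
      have k0': "k0 \<noteq> 0" "norm k0 \<le> 1" "0 \<le> Re (rate k0)" using k0 unfolding S_def by auto
      note disc = rate_disc[OF k0'(1,2) Lnn k]
      have k2: "norm k \<le> 2" using disc(3) by simp
      have E: "norm (exp (rate k * of_real (t - \<tau>))) \<le> 3" if "0 \<le> t" "t \<le> \<tau>" "\<tau> \<le> L (Suc l)" for t \<tau>
        by (rule disc(4)) (use that k0'(3) in \<open>auto simp: mult_nonneg_nonpos\<close>)
      obtain r1 r2 where r: "solves k (trunc P k) (trunc Q k) r1 r2"
        "\<forall>x\<ge>0. norm (r1 x) + norm (r2 x) \<le> norm k ^ Suc m * \<rho> x" using res[OF disc(1) k2] by blast
      have s1: "solves k (\<lambda>x. p (Suc l) x k - trunc P k x) (\<lambda>x. q (Suc l) x k - trunc Q k x) (\<lambda>x. 0 - r1 x) (\<lambda>x. 0 - r2 x)"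
        by (rule solves_diff[OF ps[OF disc(1)] r(1)])
      have "norm (p (Suc l) (L l) k - trunc P k (L l)) + norm (q (Suc l) (L l) k - trunc Q k (L l)) \<le>
          3 * exp (3 * total_load) * (norm (p (Suc l) (L (Suc l)) k - trunc P k (L (Suc l))) + norm (q (Suc l) (L (Suc l)) k - trunc Q k (L (Suc l)))
            + integral {L l..L (Suc l)} (\<lambda>y. norm k ^ Suc m * \<rho> y))"
      proof (rule solves_backward_bound[OF s1 k2 Lnn Lmono])
        show "norm (exp (rate k * of_real (t - \<tau>))) \<le> 3" if "L l \<le> t" "t \<le> \<tau>" "\<tau> \<le> L (Suc l)" for t \<tau>
          by (rule E) (use that Lnn[of l] in auto)
        show "norm (0 - r1 y) + norm (0 - r2 y) \<le> norm k ^ Suc m * \<rho> y" if "y \<in> {L l..L (Suc l)}" for y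
          using r(2) that Lnn[of l] by auto
        show "(\<lambda>y. norm k ^ Suc m * \<rho> y) integrable_on {L l..L (Suc l)}"
          by (rule integrable_on_mult_right[OF \<rho>i[OF Lnn]])
      qed simp
      also have "\<dots> = 3 * exp (3 * total_load) * (norm k ^ Suc m * I l)"
        using pL[OF disc(1)] by (simp add: I_def)
      finally have b1: "norm (p (Suc l) (L l) k - p l (L l) k) + norm (q (Suc l) (L l) k - q l (L l) k)
         \<le> 3 * exp (3 * total_load) * (norm k ^ Suc m * I l)" using pL[OF disc(1)] by simp
      have s2: "solves k (\<lambda>x. p (Suc l) x k - p l x k) (\<lambda>x. q (Suc l) x k - q l x k) (\<lambda>x. 0) (\<lambda>x. 0)"
        using solves_diff[OF ps[OF disc(1), of "Suc l"] ps[OF disc(1), of l]] by simp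
      have "norm (p (Suc l) x k - p l x k) + norm (q (Suc l) x k - q l x k) \<le> 3 * exp (3 * total_load) *
         (norm (p (Suc l) (L l) k - p l (L l) k) + norm (q (Suc l) (L l) k - q l (L l) k) + integral {x..L l} (\<lambda>y. 0))"
      proof (rule solves_backward_bound[OF s2 k2 x Lx])
        show "norm (exp (rate k * of_real (t - \<tau>))) \<le> 3" if "x \<le> t" "t \<le> \<tau>" "\<tau> \<le> L l" for t \<tau>
          by (rule E) (use that x Lmono[of l] in auto)
      qed (simp_all add: integrable_0)
      also have "\<dots> \<le> 3 * exp (3 * total_load) * (3 * exp (3 * total_load) * (norm k ^ Suc m * I l))"
        using b1 by (intro mult_left_mono) auto
      finally show ?thesis unfolding Dp_def Dq_def A_def by (simp only: ac_simps)
    qed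
    define c where "c l = integral {L l..L (Suc l)} g" for l
    have c0: "0 \<le> c l" for l unfolding c_def
      by (rule integral_nonneg[OF gi'[OF Lnn]]) (use g0 Lnn[of l] in auto)
    have csum: "(\<Sum>l<N. c l) = integral {x..L N} g" for N
    proof (induction N)
      case (Suc N)
      have "integral {x..L N} g + integral {L N..L (Suc N)} g = integral {x..L (Suc N)} g"
        by (rule Henstock_Kurzweil_Integration.integral_combine[OF Lx Lmono gi'[OF x]])
      with Suc show ?case by (simp add: c_def)
    qed (simp add: L0)
    have cR: "(\<Sum>l<N. c l) \<le> R" for N
      unfolding csum R_def by (rule integral_subset_le[OF _ gi'[OF x] gi]) (use x g0 in auto)
    have c_summable: "summable c" by (rule summableI_nonneg_bounded[OF c0 cR])
    have c_suminf: "suminf c \<le> R" by (rule suminf_le_const[OF c_summable cR])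
    \<comment> \<open>On \<open>[L l, L (l + 1)]\<close> the weight \<open>(1 + t)^n\<close> pays for \<open>(1 + L l)^j\<close> and leaves \<open>(1 + x)^(n - j)\<close>.\<close>
    have cI: "(1 + L (Suc l)) ^ j * I l \<le> 2 ^ n * c l * (1 / (1 + x) ^ (n - j))" if j: "j \<le> n" for l j
    proof -
      have "(1 + L l) ^ j * (1 + x) ^ (n - j) * I l = integral {L l..L (Suc l)} (\<lambda>t. (1 + L l) ^ j * (1 + x) ^ (n - j) * \<rho> t)"
        by (simp add: I_def)
      also have "\<dots> \<le> c l"
        unfolding c_def
      proof (rule integral_le[OF integrable_on_mult_right[OF \<rho>i[OF Lnn]] gi'[OF Lnn]])
        fix t assume t: "t \<in> {L l..L (Suc l)}"
        have "(1 + L l) ^ j * (1 + x) ^ (n - j) \<le> (1 + t) ^ j * (1 + t) ^ (n - j)"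
          using t Lnn[of l] Lx[of l] x by (intro mult_mono power_mono) auto
        also have "\<dots> = (1 + t) ^ n" using j by (simp flip: power_add)
        finally show "(1 + L l) ^ j * (1 + x) ^ (n - j) * \<rho> t \<le> g t"
          unfolding g_def by (rule mult_right_mono[OF _ \<rho>(2)])
      qed
      finally have 1: "(1 + L l) ^ j * I l \<le> c l * (1 / (1 + x) ^ (n - j))" using x by (simp add: field_simps)
      have "(1 + L (Suc l)) ^ j * I l = 2 ^ j * ((1 + L l) ^ j * I l)" unfolding LS power_mult_distrib by (simp only: mult.assoc)
      also have "\<dots> \<le> 2 ^ n * (c l * (1 / (1 + x) ^ (n - j)))"
        by (rule mult_mono[OF _ 1]) (use j I0[of l] Lnn[of l] in auto)
      finally show ?thesis by (simp only: mult.assoc)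
    qed
    have db: "norm ((deriv ^^ j) (D l) k) \<le> C1 * c l * (norm k ^ Suc m / norm k ^ (2 * j) * (1 / (1 + x) ^ (n - j)))"
      if j: "j \<le> n" and k: "k \<in> S" and Dl: "D l holomorphic_on - {0}"
        and b: "\<And>z. z \<in> cball k (norm k ^ 2 / (2 * (1 + L (Suc l)))) \<Longrightarrow> norm (D l z) \<le> norm z ^ Suc m * (A * I l)"
      for D :: "nat \<Rightarrow> complex \<Rightarrow> complex" and l j k
    proof -
      have k': "k \<noteq> 0" "norm k \<le> 1" using k by (auto simp: S_def)
      let ?R = "norm k ^ Suc m / norm k ^ (2 * j)"
      have "norm ((deriv ^^ j) (D l) k) \<le> fact n * 2 ^ Suc m * 2 ^ n * (A * I l) * (1 + L (Suc l)) ^ j * ?R"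
        by (rule derivative_bound_from_disc[OF Dl k' Lnn _ b j]) (use A0 I0 in auto)
      also have "\<dots> = (fact n * 2 ^ Suc m * 2 ^ n * A * ?R) * ((1 + L (Suc l)) ^ j * I l)" by (simp add: ac_simps)
      also have "\<dots> \<le> (fact n * 2 ^ Suc m * 2 ^ n * A * ?R) * (2 ^ n * c l * (1 / (1 + x) ^ (n - j)))"
        using A0 by (intro mult_left_mono cI j) auto
      also have "\<dots> = C1 * c l * (?R * (1 / (1 + x) ^ (n - j)))" unfolding C1_def by (simp only: ac_simps)
      finally show ?thesis .
    qed
    have Db: "norm (Dp l z) \<le> norm z ^ Suc m * (A * I l)" "norm (Dq l z) \<le> norm z ^ Suc m * (A * I l)"
      if "k \<in> S" "z \<in> cball k (norm k ^ 2 / (2 * (1 + L (Suc l))))" for k z l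
      using Dbound[OF that] norm_ge_zero[of "Dp l z"] norm_ge_zero[of "Dq l z"] by linarith+
    \<comment> \<open>At \<open>L N\<close> the two solutions differ by the error of the truncation, which tends to zero.\<close>
    have lims: "(\<lambda>N. p N x k) \<longlonglongrightarrow> Fp x k" "(\<lambda>N. q N x k) \<longlonglongrightarrow> Fq x k" if k: "k \<in> S" for k
    proof -
      have k': "k \<noteq> 0" "norm k \<le> 2" "0 \<le> Re (rate k)" using k by (auto simp: S_def)
      have b: "norm (Fp x k - p N x k) + norm (Fq x k - q N x k) \<le> exp total_load *
         (norm (Fp (L N) k - trunc P k (L N)) + norm (Fq (L N) k - trunc Q k (L N)))" for N
      proof -
        have s: "solves k (\<lambda>x. Fp x k - p N x k) (\<lambda>x. Fq x k - q N x k) (\<lambda>x. 0) (\<lambda>x. 0)"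
          using solves_diff[OF sol[OF k] ps[OF k'(1), of N]] by simp
        have "norm (Fp x k - p N x k) + norm (Fq x k - q N x k) \<le> 1 * exp (1 * total_load) *
          (norm (Fp (L N) k - p N (L N) k) + norm (Fq (L N) k - q N (L N) k) + integral {x..L N} (\<lambda>y. 0))"
        proof (rule solves_backward_bound[OF s k'(2) x Lx])
          show "norm (exp (rate k * of_real (t - \<tau>))) \<le> 1" if "x \<le> t" "t \<le> \<tau>" "\<tau> \<le> L N" for t \<tau>
            using that k'(3) by (simp add: mult_nonneg_nonpos)
        qed (simp_all add: integrable_0)
        then show ?thesis using pL[OF k'(1)] by simp
      qed
      have "((\<lambda>N. exp total_load * (norm (Fp (L N) k - trunc P k (L N)) + norm (Fq (L N) k - trunc Q k (L N)))) \<longlonglongrightarrow> exp total_load * (norm (0::complex) + norm (0::complex)))"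
        by (intro tendsto_intros filterlim_compose[OF lim(1)[OF k] Llim] filterlim_compose[OF lim(2)[OF k] Llim])
      then have z: "(\<lambda>N. exp total_load * (norm (Fp (L N) k - trunc P k (L N)) + norm (Fq (L N) k - trunc Q k (L N)))) \<longlonglongrightarrow> 0" by simp
      have bb: "norm (p N x k - Fp x k) \<le> exp total_load * (norm (Fp (L N) k - trunc P k (L N)) + norm (Fq (L N) k - trunc Q k (L N)))"
        "norm (q N x k - Fq x k) \<le> exp total_load * (norm (Fp (L N) k - trunc P k (L N)) + norm (Fq (L N) k - trunc Q k (L N)))" for N
        using b[of N] norm_ge_zero[of "Fp x k - p N x k"] norm_ge_zero[of "Fq x k - q N x k"]
        unfolding norm_minus_commute[of "p N x k"] norm_minus_commute[of "q N x k"] by linarith+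
      have "(\<lambda>N. p N x k - Fp x k) \<longlonglongrightarrow> 0" "(\<lambda>N. q N x k - Fq x k) \<longlonglongrightarrow> 0"
        by (rule Lim_null_comparison[OF _ z], use bb in simp)+
      then show "(\<lambda>N. p N x k) \<longlonglongrightarrow> Fp x k" "(\<lambda>N. q N x k) \<longlonglongrightarrow> Fq x k" by (simp_all add: LIM_zero_iff)
    qed
    have sums: "(\<lambda>l. Dp l k) sums (Fp x k - trunc P k x)" "(\<lambda>l. Dq l k) sums (Fq x k - trunc Q k x)" if k: "k \<in> S" for k
    proof -
      have k0: "k \<noteq> 0" using k by (simp add: S_def)
      have "p 0 x k = trunc P k x" "q 0 x k = trunc Q k x" using pL[OF k0, of 0] by (simp_all add: L0)
      then show "(\<lambda>l. Dp l k) sums (Fp x k - trunc P k x)" "(\<lambda>l. Dq l k) sums (Fq x k - trunc Q k x)"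
        unfolding Dp_def Dq_def
        using telescope_sums[OF lims(1)[OF k]] telescope_sums[OF lims(2)[OF k]] by simp_all
    qed
    have Sd: "\<And>k. k \<in> S \<Longrightarrow> k \<noteq> 0 \<and> norm k \<le> 1" by (simp add: S_def)
    have C1c: "summable (\<lambda>l. C1 * c l)" "\<And>l. 0 \<le> C1 * c l" using summable_mult[OF c_summable] C10 c0 by auto
    have w0: "0 \<le> 1 / (1 + x) ^ (n - j)" for j using x by simp
    have suC: "suminf (\<lambda>l. C1 * c l) \<le> C1 * R"
      unfolding suminf_mult[OF c_summable] by (rule mult_left_mono[OF c_suminf C10])
    have dbp: "norm ((deriv ^^ j) (Dp l) k) \<le> C1 * c l * (norm k ^ Suc m / norm k ^ (2 * j) * (1 / (1 + x) ^ (n - j)))"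
      if "j \<le> n" "k \<in> S" for l j k
      by (rule db[where D = Dp, OF that Dh(1) Db(1)[OF that(2)]])
    have dbq: "norm ((deriv ^^ j) (Dq l) k) \<le> C1 * c l * (norm k ^ Suc m / norm k ^ (2 * j) * (1 / (1 + x) ^ (n - j)))"
      if "j \<le> n" "k \<in> S" for l j k
      by (rule db[where D = Dq, OF that Dh(2) Db(2)[OF that(2)]])
    note sp = series_boundary_derivs[where D = Dp and c = "\<lambda>l. C1 * c l" and f = "\<lambda>k. Fp x k - trunc P k x" and M = "Suc m" and n = n and S = S and w = "\<lambda>j. 1 / (1 + x) ^ (n - j)",
      OF Dh(1) Sd dbp C1c w0 sums(1)]
    note sq = series_boundary_derivs[where D = Dq and c = "\<lambda>l. C1 * c l" and f = "\<lambda>k. Fq x k - trunc Q k x" and M = "Suc m" and n = n and S = S and w = "\<lambda>j. 1 / (1 + x) ^ (n - j)",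
      OF Dh(2) Sd dbq C1c w0 sums(2)]
    show ?thesis
    proof (rule exI[of _ "\<lambda>j k. \<Sum>l. (deriv ^^ j) (Dp l) k"], rule exI[of _ "\<lambda>j k. \<Sum>l. (deriv ^^ j) (Dq l) k"], intro conjI allI impI ballI)
      show "boundary_derivs S n (\<lambda>k. Fp x k - trunc P k x) (\<lambda>j k. \<Sum>l. (deriv ^^ j) (Dp l) k)" by (rule sp(1))
      show "boundary_derivs S n (\<lambda>k. Fq x k - trunc Q k x) (\<lambda>j k. \<Sum>l. (deriv ^^ j) (Dq l) k)" by (rule sq(1))
      fix j k assume j: "j \<le> n" and k: "k \<in> S"
      let ?R = "norm k ^ Suc m / norm k ^ (2 * j) * (1 / (1 + x) ^ (n - j))"
      have R0: "0 \<le> ?R" using x by simp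
      have "norm (\<Sum>l. (deriv ^^ j) (Dp l) k) + norm (\<Sum>l. (deriv ^^ j) (Dq l) k) \<le> suminf (\<lambda>l. C1 * c l) * ?R + suminf (\<lambda>l. C1 * c l) * ?R"
        by (intro add_mono sp(2) sq(2) j k)
      also have "\<dots> \<le> C1 * R * ?R + C1 * R * ?R" by (intro add_mono mult_right_mono suC R0)
      also have "\<dots> = (2 * (C1 * R)) * ?R" by (simp only: mult_2 distrib_right)
      also have "\<dots> \<le> (2 * (C1 * R) + 1) * ?R" by (rule mult_right_mono[OF _ R0]) simp
      finally show "norm (\<Sum>l. (deriv ^^ j) (Dp l) k) + norm (\<Sum>l. (deriv ^^ j) (Dq l) k) \<le> (2 * (C1 * R) + 1) * ?R" .
    qed
  qed
  have "0 < 2 * (C1 * R) + 1" using C10 R0 by (auto intro!: add_nonneg_pos)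
  with main show ?thesis by blast
qed

end

section \<open>Limits at infinity and boundedness of solutions\<close>

lemma integral_atLeast_tail:
  fixes f :: "real \<Rightarrow> 'a::euclidean_space"
  assumes f: "f absolutely_integrable_on {0..}" and x: "0 \<le> x"
  shows "integral {x..} f = integral {0..} f - integral {0..x} f"
proof -
  have i: "f integrable_on {0..x}" "f integrable_on {x..}"
    using set_integrable_subset[OF f, of "{0..x}"] set_integrable_subset[OF f, of "{x..}"] x
    by (auto simp: absolutely_integrable_on_def)
  have "(f has_integral integral {0..x} f + integral {x..} f) ({0..x} \<union> {x..})"
  proof (rule has_integral_Un)
    have "{0..x} \<inter> {x..} = {x}" using x by auto
    then show "negligible ({0..x} \<inter> {x..})" by simp
  qed (use i in \<open>auto intro: integrable_integral\<close>)
  moreover have "{0..x} \<union> {x..} = {0..}" using x by auto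
  ultimately show ?thesis by (simp add: integral_unique algebra_simps)
qed

lemma integral_tail_tendsto_0:
  fixes f :: "real \<Rightarrow> 'a::euclidean_space"
  assumes f: "f absolutely_integrable_on {0..}"
  shows "((\<lambda>x. integral {x..} f) \<longlongrightarrow> 0) at_top"
proof (rule tendsto_at_topI_sequentially)
  fix X :: "nat \<Rightarrow> real" assume X: "filterlim X at_top sequentially"
  have fi: "f integrable_on {0..}" "(\<lambda>x. norm (f x)) integrable_on {0..}" using f by (auto simp: absolutely_integrable_on_def)
  have "(\<lambda>k. integral {0..} (\<lambda>x. if x \<in> {X k..} then f x else 0)) \<longlonglongrightarrow> integral {0..} (\<lambda>x::real. 0)"
  proof (rule Equivalence_Lebesgue_Henstock_Integration.dominated_convergence(2)[where S = "{0..}"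
        and f = "\<lambda>k x. if x \<in> {X k..} then f x else 0" and g = "\<lambda>x. 0" and h = "\<lambda>x. norm (f x)"])
    fix k
    have "f integrable_on {max 0 (X k)..}"
      using set_integrable_subset[OF f, of "{max 0 (X k)..}"] by (auto simp: absolutely_integrable_on_def)
    moreover have "{max 0 (X k)..} = {X k..} \<inter> {0..}" by auto
    ultimately show "(\<lambda>x. if x \<in> {X k..} then f x else 0) integrable_on {0..}"
      unfolding integrable_restrict_Int by simp
  next
    show "(\<lambda>k. if x \<in> {X k..} then f x else 0) \<longlonglongrightarrow> 0" for x
    proof (rule tendsto_eventually)
      have "\<forall>\<^sub>F k in sequentially. x < X k" using X unfolding filterlim_at_top_dense by blast
      then show "\<forall>\<^sub>F k in sequentially. (if x \<in> {X k..} then f x else 0) = 0" by eventually_elim auto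
    qed
  qed (use fi in auto)
  moreover have "\<forall>\<^sub>F k in sequentially. integral {0..} (\<lambda>x. if x \<in> {X k..} then f x else 0) = integral {X k..} f"
  proof -
    have "\<forall>\<^sub>F k in sequentially. 0 < X k" using X unfolding filterlim_at_top_dense by blast
    then show ?thesis
    proof eventually_elim
      case (elim k)
      then have "{X k..} \<inter> {0..} = {X k..}" by auto
      then show ?case unfolding integral_restrict_Int by simp
    qed
  qed
  ultimately have "(\<lambda>k. integral {X k..} f) \<longlonglongrightarrow> integral {0..} (\<lambda>x::real. 0)"
    by (rule Lim_transform_eventually)
  then show "(\<lambda>k. integral {X k..} f) \<longlonglongrightarrow> 0" by simp
qed

lemma tail_primitive:
  assumes g: "g absolutely_integrable_on {0..}" and h: "\<And>x. 0 \<le> x \<Longrightarrow> h x = c - integral {x..} g"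
  shows "ac_deriv h g" "(h \<longlongrightarrow> c) at_top"
proof -
  show "ac_deriv h g"
    unfolding ac_deriv_def
  proof (intro allI impI conjI)
    fix x :: real assume x: "0 \<le> x"
    show "g absolutely_integrable_on {0..x}" by (rule set_integrable_subset[OF g]) auto
    show "integral {0..x} g = h x - h 0"
      unfolding h[OF x] h[OF order_refl] integral_atLeast_tail[OF g x] by simp
  qed
  have "((\<lambda>x. c - integral {x..} g) \<longlongrightarrow> c - 0) at_top"
    by (intro tendsto_intros integral_tail_tendsto_0 g)
  then have l: "((\<lambda>x. c - integral {x..} g) \<longlongrightarrow> c) at_top" by simp
  have e: "\<forall>\<^sub>F x in at_top. c - integral {x..} g = h x"
    using eventually_ge_at_top[of 0] by eventually_elim (simp add: h)
  show "(h \<longlongrightarrow> c) at_top" by (rule Lim_transform_eventually[OF l e])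
qed

lemma wsob_tendsto_0:
  assumes "wsob n (Suc p) f" shows "(f \<longlongrightarrow> 0) at_top"
proof -
  obtain g where g: "wsob n p g" "ac_deriv f g" using assms unfolding wsob.simps(2) by blast
  have gL: "g absolutely_integrable_on {0..}" by (rule weighted_L1c_imp_L1[OF wsob_imp_weighted_L1c[OF g(1)]])
  have fL: "f absolutely_integrable_on {0..}" by (rule weighted_L1c_imp_L1[OF wsob_imp_weighted_L1c[OF assms]])
  define c where "c = f 0 + integral {0..} g"
  have fx: "f x = c - integral {x..} g" if "0 \<le> x" for x
    using ac_deriv_increment(2)[OF g(2) order_refl that] integral_atLeast_tail[OF gL that] by (simp add: c_def algebra_simps)
  have lim: "(f \<longlongrightarrow> c) at_top" by (rule tail_primitive(2)[OF gL fx])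
  have "c = 0"
  proof (rule ccontr)
    assume "c \<noteq> 0"
    then have d: "0 < norm c / 2" by simp
    have nL: "(\<lambda>x. norm (f x)) absolutely_integrable_on {0..}" using fL by (rule set_integrable_norm)
    have "\<forall>\<^sub>F x in at_top. dist (f x) c < norm c / 2" using lim d by (rule tendstoD)
    then obtain a where a: "\<And>x. a \<le> x \<Longrightarrow> dist (f x) c < norm c / 2" unfolding eventually_at_top_linorder by blast
    have big: "norm c / 2 \<le> norm (f x)" if "a \<le> x" for x
      using a[OF that] norm_triangle_ineq2[of c "c - f x"] by (simp add: dist_norm norm_minus_commute)
    have "\<forall>\<^sub>F x in at_top. dist (integral {x..} (\<lambda>x. norm (f x))) 0 < norm c / 2"
      using integral_tail_tendsto_0[OF nL] d by (rule tendstoD)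
    then obtain b where b: "\<And>x. b \<le> x \<Longrightarrow> dist (integral {x..} (\<lambda>x. norm (f x))) 0 < norm c / 2"
      unfolding eventually_at_top_linorder by blast
    define x where "x = max 0 (max a b)"
    have ni: "(\<lambda>x. norm (f x)) integrable_on {x..x+1}" "(\<lambda>x. norm (f x)) integrable_on {x..}"
      using set_integrable_subset[OF nL, of "{x..x+1}"] set_integrable_subset[OF nL, of "{x..}"]
      by (auto simp: x_def absolutely_integrable_on_def)
    have "norm c / 2 = integral {x..x+1} (\<lambda>t. norm c / 2)" by simp
    also have "\<dots> \<le> integral {x..x+1} (\<lambda>t. norm (f t))"
      by (rule integral_le[OF _ ni(1)]) (use big in \<open>auto simp: x_def\<close>)
    also have "\<dots> \<le> integral {x..} (\<lambda>t. norm (f t))"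
      by (rule integral_subset_le[OF _ ni]) auto
    also have "\<dots> < norm c / 2" proof -
      have "b \<le> x" by (simp add: x_def)
      from b[OF this] show ?thesis by (simp add: abs_less_iff)
    qed
    finally show False by simp
  qed
  with lim show ?thesis by simp
qed

context lax_system
begin

lemma formal_lincomb:
  assumes f: "formal P Q" "formal P' Q'"
  shows "formal (\<lambda>j x. \<alpha> * P j x + \<beta> * P' j x) (\<lambda>j x. \<alpha> * Q j x + \<beta> * Q' j x)"
proof -
  have f0: "P (-1) x = 0 \<and> Q (-1) x = 0 \<and> Q 0 x = 0 \<and> P 0 x = P 0 0"
    "P' (-1) x = 0 \<and> Q' (-1) x = 0 \<and> Q' 0 x = 0 \<and> P' 0 x = P' 0 0" if "0 \<le> x" for x
    using f that unfolding formal_def by blast+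
  show ?thesis
    unfolding formal_def
  proof (intro conjI ballI allI impI)
    fix x :: real assume x: "0 \<le> x"
    show "\<alpha> * P (-1) x + \<beta> * P' (-1) x = 0" "\<alpha> * Q (-1) x + \<beta> * Q' (-1) x = 0" "\<alpha> * Q 0 x + \<beta> * Q' 0 x = 0"
      using f0[OF x] by simp_all
    have "P 0 x = P 0 0" "P' 0 x = P' 0 0" using f0[OF x] by blast+
    then show "\<alpha> * P 0 x + \<beta> * P' 0 x = \<alpha> * P 0 0 + \<beta> * P' 0 0" by (simp only:)
  next
    fix j x assume j: "j \<in> {0..int m}" and x: "0 \<le> (x::real)"
    obtain D where D: "(Q j has_vector_derivative D) (at x within {0..})"
      "Q (j + 1) x = 2 * \<i> * s * (- D - \<i> / 2 * s * Q (j - 1) x + qp0 x * P j x + qp1 x * P (j - 1) x + qq1 x * Q (j - 1) x)"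
      using f(1) j x unfolding formal_def by blast
    obtain D' where D': "(Q' j has_vector_derivative D') (at x within {0..})"
      "Q' (j + 1) x = 2 * \<i> * s * (- D' - \<i> / 2 * s * Q' (j - 1) x + qp0 x * P' j x + qp1 x * P' (j - 1) x + qq1 x * Q' (j - 1) x)"
      using f(2) j x unfolding formal_def by blast
    have lin: "((\<lambda>x. \<alpha> * u x + \<beta> * v x) has_vector_derivative \<alpha> * a + \<beta> * b) (at x within {0..})"
      if "(u has_vector_derivative a) (at x within {0..})" "(v has_vector_derivative b) (at x within {0..})"
      for u v :: "real \<Rightarrow> complex" and a b
      by (intro has_vector_derivative_add has_vector_derivative_mult_right that)
    show "\<exists>D. ((\<lambda>x. \<alpha> * Q j x + \<beta> * Q' j x) has_vector_derivative D) (at x within {0..}) \<and>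
        \<alpha> * Q (j + 1) x + \<beta> * Q' (j + 1) x = 2 * \<i> * s * (- D - \<i> / 2 * s * (\<alpha> * Q (j - 1) x + \<beta> * Q' (j - 1) x)
          + qp0 x * (\<alpha> * P j x + \<beta> * P' j x) + qp1 x * (\<alpha> * P (j - 1) x + \<beta> * P' (j - 1) x) + qq1 x * (\<alpha> * Q (j - 1) x + \<beta> * Q' (j - 1) x))"
      by (rule exI[of _ "\<alpha> * D + \<beta> * D'"], rule conjI[OF lin[OF D(1) D'(1)]])
        (unfold D(2) D'(2), simp add: algebra_simps)
    have d: "(P (j + 1) has_vector_derivative (pq0 x * Q (j + 1) x + pq1 x * Q j x + pp1 x * P j x)) (at x within {0..})"
      "(P' (j + 1) has_vector_derivative (pq0 x * Q' (j + 1) x + pq1 x * Q' j x + pp1 x * P' j x)) (at x within {0..})"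
      using f j x unfolding formal_def by blast+
    have e: "pq0 x * (\<alpha> * Q (j + 1) x + \<beta> * Q' (j + 1) x) + pq1 x * (\<alpha> * Q j x + \<beta> * Q' j x) + pp1 x * (\<alpha> * P j x + \<beta> * P' j x)
       = \<alpha> * (pq0 x * Q (j + 1) x + pq1 x * Q j x + pp1 x * P j x) + \<beta> * (pq0 x * Q' (j + 1) x + pq1 x * Q' j x + pp1 x * P' j x)"
      by (simp add: algebra_simps)
    show "((\<lambda>x. \<alpha> * P (j + 1) x + \<beta> * P' (j + 1) x) has_vector_derivative
        pq0 x * (\<alpha> * Q (j + 1) x + \<beta> * Q' (j + 1) x) + pq1 x * (\<alpha> * Q j x + \<beta> * Q' j x) + pp1 x * (\<alpha> * P j x + \<beta> * P' j x)) (at x within {0..})"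
      unfolding e by (rule lin[OF d])
  qed
qed

lemma norm_exp_le_1:
  "Re z * u \<le> 0 \<Longrightarrow> norm (exp (z * of_real u)) \<le> 1"
  by simp

lemma forward_bounded:
  assumes "solves k p q (\<lambda>x. 0) (\<lambda>x. 0)" "norm k \<le> 2" "Re (rate k) \<le> 0" "0 \<le> x"
  shows "norm (p x) + norm (q x) \<le> exp total_load * (norm (p 0) + norm (q 0))"
proof -
  have "norm (p x) + norm (q x) \<le> 1 * exp (1 * total_load) * (norm (p 0) + norm (q 0) + integral {0..x} (\<lambda>x. 0))"
  proof (rule solves_forward_bound[OF assms(1,2) order_refl assms(4)])
    show "norm (exp (rate k * of_real (t - \<tau>))) \<le> 1" if "0 \<le> \<tau>" "\<tau> \<le> t" "t \<le> x" for t \<tau>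
      by (rule norm_exp_le_1) (use that assms(3) in \<open>auto simp: mult_nonpos_nonneg\<close>)
  qed (simp_all add: integrable_0)
  then show ?thesis by simp
qed

text \<open>The estimate between \<open>x\<close> and \<open>T\<close>, in the limit \<open>T \<rightarrow> \<infinity>\<close>.\<close>
lemma backward_bounded:
  assumes "solves k p q (\<lambda>x. 0) (\<lambda>x. 0)" "norm k \<le> 2" "0 \<le> Re (rate k)" "0 \<le> x"
    and lim: "(p \<longlongrightarrow> a) at_top" "(q \<longlongrightarrow> b) at_top"
  shows "norm (p x) + norm (q x) \<le> exp total_load * (norm a + norm b)"
proof (rule tendsto_lowerbound)
  show "((\<lambda>T. exp total_load * (norm (p T) + norm (q T))) \<longlongrightarrow> exp total_load * (norm a + norm b)) at_top"
    by (intro tendsto_intros lim)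
  show "\<forall>\<^sub>F T in at_top. norm (p x) + norm (q x) \<le> exp total_load * (norm (p T) + norm (q T))"
    using eventually_ge_at_top[of x]
  proof eventually_elim
    case (elim T)
    have "norm (p x) + norm (q x) \<le> 1 * exp (1 * total_load) * (norm (p T) + norm (q T) + integral {x..T} (\<lambda>x. 0))"
    proof (rule solves_backward_bound[OF assms(1,2,4) elim])
      show "norm (exp (rate k * of_real (t - \<tau>))) \<le> 1" if "x \<le> t" "t \<le> \<tau>" "\<tau> \<le> T" for t \<tau>
        by (rule norm_exp_le_1) (use that assms(3) in \<open>auto simp: mult_nonneg_nonpos\<close>)
    qed (simp_all add: integrable_0)
    then show ?case by simp
  qed
qed simp

text \<open>The Volterra equation only tells that \<open>exp (-rate k x) q\<close> tends to zero, which is weaker than the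
  claim if the exponential decays. Gronwall's inequality for \<open>h = exp (-rate k x) q\<close>, run backward from
  infinity, bounds \<open>h\<close> at \<open>y\<close> by the kernel at \<open>y\<close> times a tail of the integral of the coefficients.\<close>
lemma decaying_component:
  assumes sol: "solves k p q (\<lambda>x. 0) (\<lambda>x. 0)" and re: "0 \<le> Re (rate k)"
    and pb: "\<And>x. 0 \<le> x \<Longrightarrow> norm (p x) \<le> M"
    and lim: "((\<lambda>x. exp (- rate k * of_real x) * q x) \<longlongrightarrow> 0) at_top"
  shows "(q \<longlongrightarrow> 0) at_top"
proof -
  define h where "h x = exp (- rate k * of_real x) * q x" for x
  define \<omega> where "\<omega> x = norm (qp0 x) + norm k * norm (qp1 x) + norm k * norm (qq1 x)" for x
  have \<omega>0: "0 \<le> \<omega> x" for x by (simp add: \<omega>_def)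
  have M0: "0 \<le> M" using pb[of 0] by (auto intro: order_trans[OF norm_ge_zero])
  have \<omega>c: "continuous_on {0..} \<omega>" unfolding \<omega>_def[abs_def] by (intro continuous_intros coeffs_continuous)
  have n: "(\<lambda>x. norm (f x)) absolutely_integrable_on {0..}" if "wsob n (Suc m) f" for f
    by (rule set_integrable_norm[OF weighted_L1c_imp_L1[OF wsob_imp_weighted_L1c[OF that]]])
  have \<omega>L: "\<omega> absolutely_integrable_on {0..}" unfolding \<omega>_def[abs_def]
    by (intro set_integral_add set_integrable_mult_right n coeffs)
  have \<omega>i: "\<omega> integrable_on {y..}" "\<omega> integrable_on {y..T}" if "0 \<le> y" for y T
    using set_integrable_subset[OF \<omega>L, of "{y..}"] set_integrable_subset[OF \<omega>L, of "{y..T}"] that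
    by (auto simp: absolutely_integrable_on_def)
  define \<Omega> where "\<Omega> = integral {0..} \<omega>"
  have \<Omega>: "integral {y..T} \<omega> \<le> \<Omega>" if "0 \<le> y" for y T
    unfolding \<Omega>_def by (rule integral_subset_le) (use that \<omega>i[of 0] \<omega>i[of y] \<omega>0 in auto)
  define E where "E x = exp (- rate k * of_real x)" for x :: real
  have Ed: "(E has_vector_derivative (- rate k * E x)) (at x within {0..})" for x
    unfolding E_def[abs_def] by (rule has_vector_derivative_real_field) (auto intro!: derivative_eq_intros)
  have "continuous_on {0..} (\<lambda>x. - rate k * E x)" unfolding E_def by (intro continuous_intros)
  note Ea = ac_derivI_continuous[OF Ed this]
  define f where "f x = (qp0 x + k * qp1 x) * p x + k * qq1 x * q x" for x
  have qd: "ac_deriv q (\<lambda>x. rate k * q x + f x)" using sol unfolding solves_def f_def by simp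
  have hd: "ac_deriv h (\<lambda>x. E x * f x)"
    using ac_deriv_mult[OF Ea qd]
    by (rule iffD1[OF ac_deriv_cong, rotated 2]) (simp_all add: h_def E_def algebra_simps)
  have hc: "continuous_on {y..T} h" if "0 \<le> y" for y T
    by (rule continuous_on_subset[OF ac_deriv_continuous[OF hd]]) (use that in auto)
  have nE: "norm (E x) = exp (- Re (rate k) * x)" for x by (simp add: E_def)
  have fb: "norm (E t * f t) \<le> exp (- Re (rate k) * y) * M * \<omega> t + \<omega> t * norm (h t)" if "0 \<le> y" "y \<le> t" for y t
  proof -
    have "norm (f t) \<le> (norm (qp0 t) + norm k * norm (qp1 t)) * norm (p t) + norm k * norm (qq1 t) * norm (q t)"
      unfolding f_def
      by (intro order_trans[OF norm_triangle_ineq] add_mono, simp add: norm_mult, intro mult_right_mono order_trans[OF norm_triangle_ineq])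
        (simp_all add: norm_mult)
    also have "\<dots> \<le> \<omega> t * norm (p t) + \<omega> t * norm (q t)"
      by (intro add_mono mult_right_mono) (simp_all add: \<omega>_def)
    finally have "norm (E t) * norm (f t) \<le> norm (E t) * (\<omega> t * norm (p t) + \<omega> t * norm (q t))"
      by (rule mult_left_mono) simp
    also have "\<dots> = norm (E t) * norm (p t) * \<omega> t + \<omega> t * norm (h t)" by (simp add: h_def E_def norm_mult algebra_simps)
    also have "\<dots> \<le> exp (- Re (rate k) * y) * M * \<omega> t + \<omega> t * norm (h t)"
    proof (intro add_mono mult_right_mono mult_mono)
      show "norm (E t) \<le> exp (- Re (rate k) * y)" unfolding nE using re that by (simp add: mult_left_mono)
      show "norm (p t) \<le> M" by (rule pb) (use that in simp)
    qed (use \<omega>0 in auto)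
    finally show ?thesis by (simp add: norm_mult)
  qed
  have key: "norm (h y) \<le> (norm (h T) + exp (- Re (rate k) * y) * M * integral {y..} \<omega>) * exp \<Omega>"
    if y: "0 \<le> y" "y \<le> T" for y T
  proof -
    define Cc where "Cc = norm (h T) + exp (- Re (rate k) * y) * M * integral {y..} \<omega>"
    have Iy: "0 \<le> integral {y..} \<omega>" by (rule integral_nonneg[OF \<omega>i(1)[OF y(1)]]) (rule \<omega>0)
    have C0: "0 \<le> Cc" using Iy M0 by (simp add: Cc_def)
    have "norm (h y) \<le> Cc * exp (integral {y..T} \<omega>)"
    proof (rule gronwall_backward[OF y(2)])
      show "continuous_on {y..T} (\<lambda>t. norm (h t))" by (intro continuous_on_norm hc y)
      show wc: "continuous_on {y..T} \<omega>" by (rule continuous_on_subset[OF \<omega>c]) (use y in auto)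
      show "0 \<le> \<omega> t" for t by (rule \<omega>0)
      fix t assume t: "t \<in> {y..T}"
      then have t0: "0 \<le> t" "t \<le> T" using y by auto
      note inc = ac_deriv_increment[OF hd t0]
      have wh: "(\<lambda>x. \<omega> x * norm (h x)) integrable_on {t..T}"
        by (intro integrable_continuous_real continuous_intros hc t0 continuous_on_subset[OF \<omega>c]) (use t0 in auto)
      have wi: "(\<lambda>x. exp (- Re (rate k) * y) * M * \<omega> x) integrable_on {t..T}"
        by (rule integrable_on_mult_right[OF \<omega>i(2)[OF t0(1)]])
      have "norm (h T - h t) \<le> integral {t..T} (\<lambda>x. exp (- Re (rate k) * y) * M * \<omega> x + \<omega> x * norm (h x))"
        unfolding inc(2)
      proof (rule integral_norm_bound_integral)
        show "(\<lambda>x. E x * f x) integrable_on {t..T}" using inc(1) by (simp add: absolutely_integrable_on_def)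
        show "(\<lambda>x. exp (- Re (rate k) * y) * M * \<omega> x + \<omega> x * norm (h x)) integrable_on {t..T}"
          by (rule integrable_add[OF wi wh])
      qed (use fb y t in auto)
      also have "\<dots> = exp (- Re (rate k) * y) * M * integral {t..T} \<omega> + integral {t..T} (\<lambda>x. \<omega> x * norm (h x))"
        unfolding integral_add[OF wi wh] by simp
      also have "exp (- Re (rate k) * y) * M * integral {t..T} \<omega> \<le> exp (- Re (rate k) * y) * M * integral {y..} \<omega>"
        by (intro mult_left_mono integral_subset_le) (use t y \<omega>i[of y] \<omega>i[of t] t0 \<omega>0 M0 in auto)
      finally have "norm (h T - h t) \<le> exp (- Re (rate k) * y) * M * integral {y..} \<omega> + integral {t..T} (\<lambda>x. \<omega> x * norm (h x))" by simp
      then show "norm (h t) \<le> Cc + integral {t..T} (\<lambda>x. \<omega> x * norm (h x))"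
        using norm_triangle_ineq2[of "h t" "h T"] unfolding Cc_def by (simp add: norm_minus_commute)
    qed
    also have "\<dots> \<le> Cc * exp \<Omega>" using \<Omega>[OF y(1), of T] C0 by (intro mult_left_mono) auto
    finally show ?thesis unfolding Cc_def .
  qed
  have qb: "norm (q y) \<le> M * integral {y..} \<omega> * exp \<Omega>" if y: "0 \<le> y" for y
  proof -
    have "norm (h y) \<le> (norm (0::complex) + exp (- Re (rate k) * y) * M * integral {y..} \<omega>) * exp \<Omega>"
    proof (rule tendsto_lowerbound)
      show "((\<lambda>T. (norm (h T) + exp (- Re (rate k) * y) * M * integral {y..} \<omega>) * exp \<Omega>) \<longlongrightarrow>
        (norm (0::complex) + exp (- Re (rate k) * y) * M * integral {y..} \<omega>) * exp \<Omega>) at_top"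
        using lim unfolding h_def by (intro tendsto_intros)
      show "\<forall>\<^sub>F T in at_top. norm (h y) \<le> (norm (h T) + exp (- Re (rate k) * y) * M * integral {y..} \<omega>) * exp \<Omega>"
        using eventually_ge_at_top[of y] by eventually_elim (rule key[OF y])
    qed simp
    then have "exp (Re (rate k) * y) * norm (h y) \<le> exp (Re (rate k) * y) * (exp (- Re (rate k) * y) * M * integral {y..} \<omega> * exp \<Omega>)"
      by (intro mult_left_mono) auto
    also have "\<dots> = (exp (Re (rate k) * y) * exp (- Re (rate k) * y)) * (M * integral {y..} \<omega> * exp \<Omega>)" by (simp only: ac_simps)
    also have "exp (Re (rate k) * y) * exp (- Re (rate k) * y) = 1" by (simp flip: exp_add)
    also have "exp (Re (rate k) * y) * norm (h y) = (exp (Re (rate k) * y) * exp (- Re (rate k) * y)) * norm (q y)"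
      by (simp add: h_def norm_mult)
    also have "exp (Re (rate k) * y) * exp (- Re (rate k) * y) = 1" by (simp flip: exp_add)
    finally show ?thesis by simp
  qed
  have "((\<lambda>y. M * integral {y..} \<omega> * exp \<Omega>) \<longlongrightarrow> M * 0 * exp \<Omega>) at_top"
    by (intro tendsto_intros integral_tail_tendsto_0 \<omega>L)
  then have z: "((\<lambda>y. M * integral {y..} \<omega> * exp \<Omega>) \<longlongrightarrow> 0) at_top" by simp
  have "\<forall>\<^sub>F y in at_top. norm (q y) \<le> M * integral {y..} \<omega> * exp \<Omega>"
    using eventually_ge_at_top[of 0] by eventually_elim (rule qb)
  then show ?thesis by (rule Lim_null_comparison[OF _ z])
qed

end

section \<open>The columns of the Lax system\<close>

text \<open>Both columns are treated at once: an index \<open>c\<close> of type \<^typ>\<open>2\<close> names the column, \<open>other c\<close> the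
  remaining index and \<open>sg c\<close> the entry of \<open>\<sigma>\<^sub>3\<close>. In this notation the formulas for the two columns
  coincide.\<close>
definition other :: "2 \<Rightarrow> 2" where "other c = (if c = 1 then 2 else 1)"
definition sg :: "2 \<Rightarrow> complex" where "sg c = (if c = 1 then 1 else -1)"

lemma other_simps [simp]: "other 1 = 2" "other 2 = 1" "sg 1 = 1" "sg 2 = -1"
  by (simp_all add: other_def sg_def)

lemma other_other [simp]: "other (other c) = c" and sg_other: "sg (other c) = - sg c"
  and other_neq: "other c \<noteq> c" and sg_cases: "sg c = 1 \<or> sg c = -1"
  using exhaust_2[of c] by auto

lemma cases_other: "i = c \<or> i = other c"
  using exhaust_2[of c] exhaust_2[of i] by auto

lemma sum_other: "(\<Sum>i\<in>UNIV. f i) = f c + f (other c)"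
  using exhaust_2[of c] by (auto simp: sum_2 add.commute)

lemma matrix_mult_entry:
  "(A ** B) $ i $ j = A $ i $ c * B $ c $ j + A $ i $ other c * (B :: cmat) $ other c $ j"
  unfolding matrix_matrix_mult_def by (simp add: sum_other[of _ c])

lemma mat_scale_entry: "(a *k A) $ i $ j = a * A $ i $ j"
  by (simp add: mat_scale_def)

lemma exp_s3_entry: "exp_s3 a $ i $ j = (if i = j then exp (sg i * a) else 0)"
  using exhaust_2[of i] exhaust_2[of j] by (auto simp: exp_s3_def)

lemma exp_s3_mult_right: "(A ** exp_s3 a) $ i $ j = A $ i $ j * exp (sg j * a)"
  unfolding matrix_mult_entry[where c = j] by (simp add: exp_s3_entry other_neq)

lemma exp_s3_mult_left: "(exp_s3 a ** (A::cmat)) $ i $ j = exp (sg i * a) * A $ i $ j"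
proof -
  have "i \<noteq> other i" using other_neq[of i] by metis
  then show ?thesis unfolding matrix_mult_entry[where c = i] by (simp add: exp_s3_entry)
qed

lemma exp_s3_hat_entry: "exp_s3_hat a A $ i $ j = exp ((sg i - sg j) * a) * A $ i $ j"
proof -
  have "exp ((sg i - sg j) * a) = exp (sg i * a) * exp (sg j * - a)"
    unfolding exp_add[symmetric] by (simp add: left_diff_distrib)
  then show ?thesis unfolding exp_s3_hat_def exp_s3_mult_right exp_s3_mult_left by simp
qed

lemma sigma_entries:
  "sigma1 $ c $ c = 0" "sigma1 $ c $ other c = 1" "sigma1 $ other c $ c = 1"
  "sigma2 $ c $ c = 0" "sigma2 $ c $ other c = - \<i> * sg c" "sigma2 $ other c $ c = \<i> * sg c"
  "sigma3 $ c $ c = sg c" "sigma3 $ c $ other c = 0" "sigma3 $ other c $ c = 0"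
  using exhaust_2[of c] by (auto simp: sigma1_def sigma2_def sigma3_def)

lemma weighted_L1c_bounded_by:
  assumes "weighted_L1c n h" "continuous_on {0..} f" "\<And>x. 0 \<le> x \<Longrightarrow> norm (f x) \<le> norm (h x)"
  shows "weighted_L1c n f"
  unfolding weighted_L1c_def
proof (rule measurable_bounded_by_integrable_imp_absolutely_integrable)
  show "(\<lambda>x. of_real ((1 + x) ^ n) * f x) \<in> borel_measurable (lebesgue_on {0..})"
    by (intro continuous_imp_measurable_on_sets_lebesgue continuous_intros assms(2)) auto
  show "(\<lambda>x. norm (of_real ((1 + x) ^ n) * h x)) integrable_on {0..}"
    using assms(1) unfolding weighted_L1c_def absolutely_integrable_on_def by blast
  show "norm (of_real ((1 + x) ^ n) * f x) \<le> norm (of_real ((1 + x) ^ n) * h x)" if "x \<in> {0..}" for x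
    unfolding norm_mult using assms(3) that by (intro mult_left_mono) auto
qed auto

text \<open>The coefficients of \<open>U\<close> with respect to the powers \<open>1\<close> and \<open>1/k\<close>.\<close>
definition U_regular :: "(real \<Rightarrow> real) \<Rightarrow> (real \<Rightarrow> real) \<Rightarrow> real \<Rightarrow> cmat" where
  "U_regular u0 u1 x = (- \<i> * of_real (dx u0 x + u1 x) / 4) *k sigma2"

definition U_singular :: "(real \<Rightarrow> real) \<Rightarrow> real \<Rightarrow> cmat" where
  "U_singular u0 x = (\<i> * of_real (sin (u0 x)) / 4) *k sigma1 + (\<i> * of_real (cos (u0 x) - 1) / 4) *k sigma3"

lemma U_entry: "U u0 u1 x k $ i $ j = U_regular u0 u1 x $ i $ j + 1 / k * U_singular u0 x $ i $ j"
  by (simp add: U_def U_regular_def U_singular_def mat_scale_entry)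

lemma column_entry: "column c A $ i = A $ i $ c" by (simp add: column_def)

text \<open>The regularity of the initial data that the analysis uses.\<close>
locale potential =
  fixes m n :: nat and N :: int and u0 u1 :: "real \<Rightarrow> real"
  assumes u0_wsob: "wsob n (Suc (Suc m)) (\<lambda>x. of_real (u0 x - 2 * pi * of_int N))"
    and u1_wsob: "wsob n (Suc m) (\<lambda>x. of_real (u1 x))"
begin

lemma u0_deriv: 
  shows "0 \<le> x \<Longrightarrow> (u0 has_vector_derivative dx u0 x) (at x within {0..})"
    and "wsob n (Suc m) (\<lambda>x. of_real (dx u0 x))"
proof -
  define a where "a = 2 * pi * of_int N"
  obtain v where v: "wsob n (Suc m) v" "ac_deriv (\<lambda>x. complex_of_real (u0 x - a)) v"
    using u0_wsob unfolding wsob.simps(2)[of n "Suc m"] a_def by blast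
  note vc = wsob_Suc_continuous[OF v(1)]
  have d: "(u0 has_vector_derivative Re (v x)) (at x within {0..})" "v x = of_real (Re (v x))" if x: "0 \<le> x" for x
  proof -
    note vd = ac_deriv_imp_has_vector_derivative[OF v(2) vc x]
    have r: "((\<lambda>x. u0 x - a) has_vector_derivative Re (v x)) (at x within {0..})"
      using bounded_linear.has_vector_derivative[OF bounded_linear_Re vd] by simp
    have "((\<lambda>x. (u0 x - a) + a) has_vector_derivative Re (v x) + 0) (at x within {0..})"
      by (rule has_vector_derivative_add[OF r has_vector_derivative_const])
    then show "(u0 has_vector_derivative Re (v x)) (at x within {0..})" by simp
    have "((\<lambda>x. complex_of_real (u0 x - a)) has_vector_derivative of_real (Re (v x))) (at x within {0..})"
      by (rule bounded_linear.has_vector_derivative[OF bounded_linear_of_real r])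
    from has_vector_derivative_unique_nonneg[OF vd this x] show "v x = of_real (Re (v x))" .
  qed
  have dx: "dx u0 x = Re (v x)" if x: "0 \<le> x" for x
  proof -
    have "at x within {0..x+1} \<noteq> bot" using x by (simp add: trivial_limit_within islimpt_Icc)
    then have "at x within {0..} \<noteq> bot" using at_within_nonneg[of x "x+1"] x by simp
    from vector_derivative_within[OF this d(1)[OF x]] show ?thesis unfolding dx_def .
  qed
  show "(u0 has_vector_derivative dx u0 x) (at x within {0..})" if "0 \<le> x"
    unfolding dx[OF that] by (rule d(1)[OF that])
  show "wsob n (Suc m) (\<lambda>x. of_real (dx u0 x))"
  proof (rule iffD2[OF wsob_cong v(1)])
    show "of_real (dx u0 x) = v x" if "0 \<le> x" for x unfolding dx[OF that] by (rule d(2)[OF that, symmetric])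
  qed
qed

lemma dx_u0_continuous: "continuous_on {0..} (\<lambda>x. complex_of_real (dx u0 x))"
  by (rule wsob_Suc_continuous[OF u0_deriv(2)])

lemma u0_continuous: "continuous_on {0..} u0"
  by (rule continuous_on_vector_derivative) (use u0_deriv(1) in auto)

lemma ac_deriv_compose_u0:
  assumes f: "\<And>y. (f has_real_derivative f' y) (at y)" and f': "continuous_on UNIV f'"
  shows "ac_deriv (\<lambda>x. complex_of_real (f (u0 x))) (\<lambda>x. complex_of_real (f' (u0 x)) * of_real (dx u0 x))"
proof (rule ac_derivI_continuous)
  show "continuous_on {0..} (\<lambda>x. complex_of_real (f' (u0 x)) * of_real (dx u0 x))"
    by (intro continuous_intros dx_u0_continuous continuous_on_compose2[OF f' u0_continuous]) auto
  fix x :: real assume x: "0 \<le> x"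
  have "((\<lambda>x. f (u0 x)) has_real_derivative f' (u0 x) * dx u0 x) (at x within {0..})"
    by (rule DERIV_chain2[OF f]) (use u0_deriv(1)[OF x] in \<open>simp add: has_real_derivative_iff_has_vector_derivative\<close>)
  then have "((\<lambda>x. f (u0 x)) has_vector_derivative f' (u0 x) * dx u0 x) (at x within {0..})"
    by (simp add: has_real_derivative_iff_has_vector_derivative)
  from bounded_linear.has_vector_derivative[OF bounded_linear_of_real[where 'a = complex] this]
  show "((\<lambda>x. complex_of_real (f (u0 x))) has_vector_derivative complex_of_real (f' (u0 x)) * of_real (dx u0 x)) (at x within {0..})"
    by simp
qed

lemma sin_cos_deriv:
  "ac_deriv (\<lambda>x. complex_of_real (sin (u0 x))) (\<lambda>x. complex_of_real (cos (u0 x)) * of_real (dx u0 x))"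
  "ac_deriv (\<lambda>x. complex_of_real (cos (u0 x))) (\<lambda>x. complex_of_real (- sin (u0 x)) * of_real (dx u0 x))"
  by (rule ac_deriv_compose_u0[where f = sin and f' = cos], rule DERIV_sin, intro continuous_intros,
      rule ac_deriv_compose_u0[where f = cos and f' = "\<lambda>y. - sin y"], rule DERIV_cos, intro continuous_intros)

text \<open>The composition with sine and cosine inherits derivatives by the chain rule, each derivative being a
  product of a bounded function and the decaying \<open>u0'\<close>.\<close>
lemma sin_cos_bsob:
  assumes "p \<le> Suc m"
  shows "bsob n p (\<lambda>x. complex_of_real (sin (u0 x))) \<and> bsob n p (\<lambda>x. complex_of_real (cos (u0 x)))"
  using assms
proof (induction p)
  case 0
  have v: "weighted_L1c n (\<lambda>x. complex_of_real (dx u0 x))" by (rule wsob_imp_weighted_L1c[OF u0_deriv(2)])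
  have c: "continuous_on {0..} (\<lambda>x. complex_of_real (cos (u0 x)))" "continuous_on {0..} (\<lambda>x. complex_of_real (- sin (u0 x)))"
    by (intro continuous_intros u0_continuous)+
  have b: "norm (complex_of_real (cos (u0 x))) \<le> 1" "norm (complex_of_real (- sin (u0 x))) \<le> 1" for x
    unfolding norm_of_real by (rule abs_cos_le_one, simp)
  have "wsob n 0 (\<lambda>x. complex_of_real (cos (u0 x)) * of_real (dx u0 x))"
    "wsob n 0 (\<lambda>x. complex_of_real (- sin (u0 x)) * of_real (dx u0 x))"
    unfolding wsob.simps(1)
    by (rule weighted_L1c_mult_bounded[OF c(1) b(1) v], rule weighted_L1c_mult_bounded[OF c(2) b(2) v])
  then show ?case unfolding bsob_def using sin_cos_deriv by blast
next
  case (Suc p)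
  then have IH: "bsob n p (\<lambda>x. complex_of_real (sin (u0 x)))" "bsob n p (\<lambda>x. complex_of_real (cos (u0 x)))" by simp_all
  have v: "wsob n (Suc p) (\<lambda>x. complex_of_real (dx u0 x))" by (rule wsob_mono[OF u0_deriv(2) Suc.prems])
  have s: "wsob n (Suc p) (\<lambda>x. complex_of_real (cos (u0 x)) * of_real (dx u0 x))"
    by (rule wsob_Suc_bsob_mult[OF IH(2) v])
  have "wsob n (Suc p) (\<lambda>x. (-1) * (complex_of_real (sin (u0 x)) * of_real (dx u0 x)))"
    by (rule wsob_cmult[OF wsob_Suc_bsob_mult[OF IH(1) v]])
  then have c: "wsob n (Suc p) (\<lambda>x. complex_of_real (- sin (u0 x)) * of_real (dx u0 x))" by simp
  show ?case unfolding bsob_def using s c sin_cos_deriv by blast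
qed

lemma sin_sub_period: "sin (u0 x) = sin (u0 x - 2 * pi * of_int N)" "cos (u0 x) = cos (u0 x - 2 * pi * of_int N)"
  using sin.periodic_simps cos_int_2pin[of N] sin_int_2pin[of N] by (simp_all add: sin_diff cos_diff mult.commute)

lemma abs_cos_minus_1_le: "\<bar>cos y - 1\<bar> \<le> \<bar>y::real\<bar>"
proof -
  have "\<bar>cos y - 1\<bar> = 2 * (\<bar>sin (y/2)\<bar> * \<bar>sin (y/2)\<bar>)"
    using cos_double_sin[of "y/2"] by (simp add: power2_eq_square)
  also have "\<dots> \<le> 2 * (\<bar>y/2\<bar> * 1)"
    by (intro mult_left_mono mult_mono abs_sin_x_le_abs_x) auto
  finally show ?thesis by simp
qed

text \<open>Decay of \<open>sin u0\<close> and \<open>cos u0 - 1\<close> comes from that of \<open>u0 - 2 \<pi> N\<close>, by periodicity.\<close>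
lemma sin_wsob: "wsob n (Suc m) (\<lambda>x. complex_of_real (sin (u0 x)))"
  and cos_wsob: "wsob n (Suc m) (\<lambda>x. complex_of_real (cos (u0 x) - 1))"
proof -
  note w = wsob_imp_weighted_L1c[OF u0_wsob]
  note b = sin_cos_bsob[of m]
  have "weighted_L1c n (\<lambda>x. complex_of_real (sin (u0 x)))"
  proof (rule weighted_L1c_bounded_by[OF w])
    show "norm (complex_of_real (sin (u0 x))) \<le> norm (complex_of_real (u0 x - 2 * pi * of_int N))" for x
      unfolding norm_of_real sin_sub_period[of x] by (rule abs_sin_x_le_abs_x)
  qed (intro continuous_intros u0_continuous)
  then show "wsob n (Suc m) (\<lambda>x. complex_of_real (sin (u0 x)))" using b unfolding wsob_Suc_iff by simp
  have "weighted_L1c n (\<lambda>x. complex_of_real (cos (u0 x) - 1))"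
  proof (rule weighted_L1c_bounded_by[OF w])
    show "norm (complex_of_real (cos (u0 x) - 1)) \<le> norm (complex_of_real (u0 x - 2 * pi * of_int N))" for x
      unfolding norm_of_real sin_sub_period(2)[of x] by (rule abs_cos_minus_1_le)
  qed (intro continuous_intros u0_continuous)
  moreover have "bsob n m (\<lambda>x. complex_of_real (cos (u0 x)) + (-1))"
    by (rule bsob_add) (use b in auto)
  ultimately show "wsob n (Suc m) (\<lambda>x. complex_of_real (cos (u0 x) - 1))" unfolding wsob_Suc_iff by simp
qed

lemma U_entries_wsob:
  "wsob n (Suc m) (\<lambda>x. U0_hat u0 u1 x $ i $ j)" "wsob n (Suc m) (\<lambda>x. U1_hat u0 x $ i $ j)"
  "wsob n (Suc m) (\<lambda>x. U_regular u0 u1 x $ i $ j)" "wsob n (Suc m) (\<lambda>x. U_singular u0 x $ i $ j)"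
proof -
  have "wsob n (Suc m) (\<lambda>x. (\<i> / 4 * sigma2 $ i $ j) * (of_real (dx u0 x) - of_real (u1 x)))"
    by (intro wsob_cmult wsob_diff u0_deriv(2) u1_wsob)
  also have "(\<lambda>x. (\<i> / 4 * sigma2 $ i $ j) * (of_real (dx u0 x) - of_real (u1 x))) = (\<lambda>x. U0_hat u0 u1 x $ i $ j)"
    by (simp add: fun_eq_iff U0_hat_def mat_scale_entry algebra_simps)
  finally show "wsob n (Suc m) (\<lambda>x. U0_hat u0 u1 x $ i $ j)" .
  have "wsob n (Suc m) (\<lambda>x. (- \<i> / 4 * sigma2 $ i $ j) * (of_real (dx u0 x) + of_real (u1 x)))"
    by (intro wsob_cmult wsob_add u0_deriv(2) u1_wsob)
  also have "(\<lambda>x. (- \<i> / 4 * sigma2 $ i $ j) * (of_real (dx u0 x) + of_real (u1 x))) = (\<lambda>x. U_regular u0 u1 x $ i $ j)"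
    by (simp add: fun_eq_iff U_regular_def mat_scale_entry algebra_simps)
  finally show "wsob n (Suc m) (\<lambda>x. U_regular u0 u1 x $ i $ j)" .
  have "wsob n (Suc m) (\<lambda>x. (\<i> / 4 * sigma1 $ i $ j) * of_real (sin (u0 x)) - (\<i> / 4 * sigma3 $ i $ j) * of_real (cos (u0 x) - 1))"
    by (intro wsob_cmult wsob_diff sin_wsob cos_wsob)
  also have "(\<lambda>x. (\<i> / 4 * sigma1 $ i $ j) * of_real (sin (u0 x)) - (\<i> / 4 * sigma3 $ i $ j) * of_real (cos (u0 x) - 1)) = (\<lambda>x. U1_hat u0 x $ i $ j)"
    by (simp add: fun_eq_iff U1_hat_def mat_scale_entry ac_simps)
  finally show "wsob n (Suc m) (\<lambda>x. U1_hat u0 x $ i $ j)" .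
  have "wsob n (Suc m) (\<lambda>x. (\<i> / 4 * sigma1 $ i $ j) * of_real (sin (u0 x)) + (\<i> / 4 * sigma3 $ i $ j) * of_real (cos (u0 x) - 1))"
    by (intro wsob_cmult wsob_add sin_wsob cos_wsob)
  also have "(\<lambda>x. (\<i> / 4 * sigma1 $ i $ j) * of_real (sin (u0 x)) + (\<i> / 4 * sigma3 $ i $ j) * of_real (cos (u0 x) - 1)) = (\<lambda>x. U_singular u0 x $ i $ j)"
    by (simp add: fun_eq_iff U_singular_def mat_scale_entry ac_simps)
  finally show "wsob n (Suc m) (\<lambda>x. U_singular u0 x $ i $ j)" .
qed

text \<open>The new gauge: the equation for \<open>G\<^sub>0\<^sup>-\<^sup>1 X\<close> has the coefficient matrices \<open>U0_hat\<close> and \<open>k U1_hat\<close>.\<close>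
lemma hat_system:
  "lax_system n m (sg (other c)) (\<lambda>x. U0_hat u0 u1 x $ c $ other c) (\<lambda>x. U1_hat u0 x $ c $ other c)
     (\<lambda>x. U1_hat u0 x $ c $ c) (\<lambda>x. U0_hat u0 u1 x $ other c $ c) (\<lambda>x. U1_hat u0 x $ other c $ c)
     (\<lambda>x. U1_hat u0 x $ other c $ other c)"
  by (rule lax_system.intro[OF sg_cases U_entries_wsob(1) U_entries_wsob(2) U_entries_wsob(2) U_entries_wsob(1) U_entries_wsob(2) U_entries_wsob(2)])

text \<open>The original gauge, with the parameter \<open>\<kappa> = 1/k\<close>: the substitution changes the sign of
  \<open>k - 1/k\<close>, which is why the sign here is \<open>sg c\<close>.\<close>
lemma orig_system:
  "lax_system n m (sg c) (\<lambda>x. U_regular u0 u1 x $ c $ other c) (\<lambda>x. U_singular u0 x $ c $ other c)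
     (\<lambda>x. U_singular u0 x $ c $ c) (\<lambda>x. U_regular u0 u1 x $ other c $ c) (\<lambda>x. U_singular u0 x $ other c $ c)
     (\<lambda>x. U_singular u0 x $ other c $ other c)"
  by (rule lax_system.intro[OF sg_cases U_entries_wsob(3) U_entries_wsob(4) U_entries_wsob(4) U_entries_wsob(3) U_entries_wsob(4) U_entries_wsob(4)])

end

section \<open>The Volterra solutions and the gauge transformation\<close>

lemma theta1_exponent: "(sg (other c) - sg c) * (\<i> * theta1 k * of_real t) = - (\<i> * sg c / 2 * (k - 1 / k)) * of_real t"
proof -
  have "(- sg c - sg c) * (\<i> * (y / 4) * of_real t) = - (\<i> * sg c / 2 * y) * of_real t" for y
    by (simp add: field_simps)
  then show ?thesis unfolding theta1_def sg_other .
qed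

lemma absolutely_integrable_vec_nth:
  fixes f :: "real \<Rightarrow> complex^2"
  assumes "f absolutely_integrable_on S"
  shows "(\<lambda>x. f x $ i) absolutely_integrable_on S" "integral S f $ i = integral S (\<lambda>x. f x $ i)"
proof -
  show "(\<lambda>x. f x $ i) absolutely_integrable_on S"
    using absolutely_integrable_linear[OF assms bounded_linear_vec_nth[of i]] by (simp add: o_def)
  have "f integrable_on S" using assms by (simp add: absolutely_integrable_on_def)
  from integral_linear[OF this bounded_linear_vec_nth[of i]]
  show "integral S f $ i = integral S (\<lambda>x. f x $ i)" by (simp add: o_def)
qed

lemma absolutely_integrable_mat_nth:
  fixes f :: "real \<Rightarrow> cmat"
  assumes "f absolutely_integrable_on S"
  shows "(\<lambda>x. f x $ i $ j) absolutely_integrable_on S" "integral S f $ i $ j = integral S (\<lambda>x. f x $ i $ j)"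
proof -
  have 1: "(\<lambda>x. f x $ i) absolutely_integrable_on S"
    using absolutely_integrable_linear[OF assms bounded_linear_vec_nth[of i]] by (simp add: o_def)
  have "f integrable_on S" using assms by (simp add: absolutely_integrable_on_def)
  from integral_linear[OF this bounded_linear_vec_nth[of i]]
  have 2: "integral S f $ i = integral S (\<lambda>x. f x $ i)" by (simp add: o_def)
  show "(\<lambda>x. f x $ i $ j) absolutely_integrable_on S" by (rule absolutely_integrable_vec_nth[OF 1])
  show "integral S f $ i $ j = integral S (\<lambda>x. f x $ i $ j)"
    unfolding 2 by (rule absolutely_integrable_vec_nth[OF 1])
qed

text \<open>The integrating factor of the Volterra equation undone.\<close>
lemma ac_deriv_exp_weight:
  assumes "ac_deriv (\<lambda>x. exp (- lam * of_real x) * q x) (\<lambda>x. exp (- lam * of_real x) * f x)"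
  shows "ac_deriv q (\<lambda>x. lam * q x + f x)"
proof -
  define E where "E x = exp (lam * of_real x)" for x :: real
  have Ed: "(E has_vector_derivative (lam * E x)) (at x within {0..})" for x
    unfolding E_def[abs_def] by (rule has_vector_derivative_real_field) (auto intro!: derivative_eq_intros)
  have "continuous_on {0..} (\<lambda>x. lam * E x)" unfolding E_def by (intro continuous_intros)
  note Ea = ac_derivI_continuous[OF Ed this]
  have c: "E x * (exp (- lam * of_real x) * y) = y" "lam * E x * (exp (- lam * of_real x) * y) = lam * y" for x y
    by (simp_all add: E_def exp_minus)
  from ac_deriv_mult[OF Ea assms] show ?thesis unfolding c .
qed

lemma Re_rate_sign:
  assumes "k \<noteq> 0"
  shows "Re (\<i> * sg c / 2 * (k - 1 / k)) = - Re (sg c) * (Im k * (1 + 1 / (norm k)\<^sup>2) / 2)"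
proof -
  have "Im (1 / k) = - Im k / (norm k)\<^sup>2" by (simp add: Im_divide cmod_power2)
  then have i: "Im (k - 1 / k) = Im k * (1 + 1 / (norm k)\<^sup>2)" by (simp add: algebra_simps)
  have "Re (\<i> * sg c / 2 * (k - 1 / k)) = - Re (sg c) * Im (k - 1 / k) / 2"
    using sg_cases[of c] by auto
  then show ?thesis unfolding i by simp
qed

lemma mult_im_sign: "0 \<le> Im k \<Longrightarrow> 0 \<le> Im k * (1 + 1 / (norm k)\<^sup>2) / 2"
  "Im k \<le> 0 \<Longrightarrow> Im k * (1 + 1 / (norm k)\<^sup>2) / 2 \<le> 0"
  by (simp_all add: mult_nonpos_nonneg)

lemma rate_inverse: "- (a :: complex) * (1 / k - 1 / (1 / k)) = a * (k - 1 / k)"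
  by (simp add: right_diff_distrib)

text \<open>The two sides of either identity differ by a multiple of \<open>C^2 + S^2 - 1\<close>. Here \<open>C\<close>, \<open>S\<close> are the cosine
  and sine of \<open>u0/2\<close>, \<open>v\<close> is \<open>u0'\<close>, \<open>w\<close> is \<open>u1\<close> and \<open>r\<close> is \<open>1/k\<close>.\<close>
lemma gauge_algebra:
  fixes e C S p q v w k r \<sigma> :: complex
  assumes e: "e = 1 \<or> e = -1" and CS: "C * C + S * S = 1"
  shows "\<sigma> * (- v / 2 * S * p + C * ((- e * (v + w) / 4 + r * (\<i> * S * C / 2)) * q
          + r * (- \<i> * e * S * S / 2) * p + 0) +
         e * (v / 2 * C * q + S * (\<i> * e / 2 * (k - r) * q + ((e * (v + w) / 4 + r * (\<i> * S * C / 2)) * p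
          + r * (\<i> * e * S * S / 2) * q + 0)))) =
       (e * (v - w) / 4 + k * (\<i> * S * C / 2)) * (\<sigma> * (C * q - e * (S * p)))
         + k * (\<i> * e * S * S / 2) * (\<sigma> * (C * p + e * (S * q))) + 0" (is "?L1 = ?R1")
    and "\<sigma> * (- v / 2 * S * q + C * (\<i> * e / 2 * (k - r) * q + ((e * (v + w) / 4 + r * (\<i> * S * C / 2)) * p
          + r * (\<i> * e * S * S / 2) * q + 0)) -
         e * (v / 2 * C * p + S * ((- e * (v + w) / 4 + r * (\<i> * S * C / 2)) * q
          + r * (- \<i> * e * S * S / 2) * p + 0))) =
        \<i> * e / 2 * (k - r) * (\<sigma> * (C * q - e * (S * p))) +
         ((- e * (v - w) / 4 + k * (\<i> * S * C / 2)) * (\<sigma> * (C * p + e * (S * q)))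
         + k * (- \<i> * e * S * S / 2) * (\<sigma> * (C * q - e * (S * p))) + 0)" (is "?L2 = ?R2")
proof -
  have "?L1 - ?R1 = \<sigma> * \<i> / 2 * S * q * (r - k) * (C * C + S * S - 1)"
    using e by (elim disjE; simp add: field_simps)
  then show "?L1 = ?R1" unfolding CS by simp
  have "?L2 - ?R2 = \<sigma> * \<i> / 2 * S * p * (r - k) * (C * C + S * S - 1)"
    using e by (elim disjE; simp add: field_simps)
  then show "?L2 = ?R2" unfolding CS by simp
qed

context potential
begin

text \<open>The Volterra equation exhibits \<open>p\<close> and \<open>exp (-rate x) q\<close> as tails of integrals, hence as
  primitives with limits \<open>1\<close> and \<open>0\<close> at infinity.\<close>
lemma volterra_X_solves:
  assumes V: "volterra_X u0 u1 X" and k: "k \<in> col_dom C_lower C_upper c"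
  shows "lax_system.solves (sg c) (\<lambda>x. U_regular u0 u1 x $ c $ other c) (\<lambda>x. U_singular u0 x $ c $ other c)
     (\<lambda>x. U_singular u0 x $ c $ c) (\<lambda>x. U_regular u0 u1 x $ other c $ c) (\<lambda>x. U_singular u0 x $ other c $ c)
     (\<lambda>x. U_singular u0 x $ other c $ other c) (1 / k) (\<lambda>x. X x k $ c $ c) (\<lambda>x. X x k $ other c $ c) (\<lambda>x. 0) (\<lambda>x. 0)"
    and "((\<lambda>x. X x k $ c $ c) \<longlongrightarrow> 1) at_top" "((\<lambda>x. X x k $ other c $ c) \<longlongrightarrow> 0) at_top"
proof -
  interpret orig: lax_system n m "sg c" "\<lambda>x. U_regular u0 u1 x $ c $ other c" "\<lambda>x. U_singular u0 x $ c $ other c"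
     "\<lambda>x. U_singular u0 x $ c $ c" "\<lambda>x. U_regular u0 u1 x $ other c $ c" "\<lambda>x. U_singular u0 x $ other c $ c"
     "\<lambda>x. U_singular u0 x $ other c $ other c" by (rule orig_system)
  have k0: "k \<noteq> 0" using k by (auto simp: col_dom_def)
  define lam where "lam = \<i> * sg c / 2 * (k - 1 / k)"
  have rate: "orig.rate (1 / k) = lam" unfolding orig.rate_def lam_def by (rule rate_inverse)
  have re: "0 \<le> Re lam"
  proof (cases "c = 1")
    case True
    then have "Im k \<le> 0" using k by (auto simp: col_dom_def C_lower_def)
    then show ?thesis unfolding lam_def Re_rate_sign[OF k0] using mult_im_sign(2)[of k] True by simp
  next
    case False
    then have c2: "c = 2" using exhaust_2[of c] by auto
    then have "Im k \<ge> 0" using k by (auto simp: col_dom_def C_upper_def)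
    then show ?thesis unfolding lam_def Re_rate_sign[OF k0] using mult_im_sign(1)[of k] c2 by simp
  qed
  define p where "p x = X x k $ c $ c" for x
  define q where "q x = X x k $ other c $ c" for x
  define g where "g i x = U u0 u1 x k $ i $ c * p x + U u0 u1 x k $ i $ other c * q x" for i x
  have UX: "(U u0 u1 x k ** X x k) $ i $ c = g i x" for i x
    unfolding matrix_mult_entry[where c = c] g_def p_def q_def ..
  have V': "(\<lambda>x'. column c (volterra_integrand u0 u1 X x k x')) absolutely_integrable_on {x..}"
    "column c (X x k) = column c (mat 1) - integral {x..} (\<lambda>x'. column c (volterra_integrand u0 u1 X x k x'))"
    if "0 \<le> x" for x
    using V k that unfolding volterra_X_def by blast+
  have comp: "column c (volterra_integrand u0 u1 X x k x') $ i = exp ((sg i - sg c) * (\<i> * theta1 k * of_real (x' - x))) * g i x'" for i x x'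
    unfolding column_entry volterra_integrand_def exp_s3_hat_entry UX ..
  note A = absolutely_integrable_vec_nth[OF V'(1), unfolded comp]
  have val: "X x k $ i $ c = mat 1 $ i $ c - integral {x..} (\<lambda>x'. exp ((sg i - sg c) * (\<i> * theta1 k * of_real (x' - x))) * g i x')"
    if "0 \<le> x" for x i
    using arg_cong[OF V'(2)[OF that], of "\<lambda>v. v $ i"] A(2)[OF that, of i] unfolding column_entry vector_minus_component by simp
  have gc: "g c absolutely_integrable_on {0..}" using A(1)[of 0 c] by simp
  have p: "p x = 1 - integral {x..} (g c)" if "0 \<le> x" for x using val[OF that, of c] by (simp add: p_def mat_def)
  have tp: "ac_deriv p (g c)" "(p \<longlongrightarrow> 1) at_top"
    by (rule tail_primitive[OF gc p], assumption)+
  have ge: "(\<lambda>x. exp (- lam * of_real x) * g (other c) x) absolutely_integrable_on {0..}"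
    using A(1)[of 0 "other c"] unfolding theta1_exponent lam_def[symmetric] by simp
  have h: "exp (- lam * of_real x) * q x = 0 - integral {x..} (\<lambda>x. exp (- lam * of_real x) * g (other c) x)" if x: "0 \<le> x" for x
  proof -
    have "exp (- lam * of_real x) * integral {x..} (\<lambda>x'. exp (- lam * of_real (x' - x)) * g (other c) x')
       = integral {x..} (\<lambda>x'. exp (- lam * of_real x) * (exp (- lam * of_real (x' - x)) * g (other c) x'))"
      by (rule integral_mult_right[symmetric])
    also have "(\<lambda>x'. exp (- lam * of_real x) * (exp (- lam * of_real (x' - x)) * g (other c) x')) = (\<lambda>x'. exp (- lam * of_real x') * g (other c) x')"
      unfolding mult.assoc[symmetric] exp_add[symmetric] by (simp add: algebra_simps)
    finally have 1: "exp (- lam * of_real x) * integral {x..} (\<lambda>x'. exp (- lam * of_real (x' - x)) * g (other c) x')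
       = integral {x..} (\<lambda>x'. exp (- lam * of_real x') * g (other c) x')" .
    have "q x = - integral {x..} (\<lambda>x'. exp (- lam * of_real (x' - x)) * g (other c) x')"
      using val[OF x, of "other c"] unfolding theta1_exponent lam_def[symmetric] by (simp add: q_def mat_def other_neq)
    then show ?thesis using 1 by simp
  qed
  have te: "ac_deriv (\<lambda>x. exp (- lam * of_real x) * q x) (\<lambda>x. exp (- lam * of_real x) * g (other c) x)"
    "((\<lambda>x. exp (- lam * of_real x) * q x) \<longlongrightarrow> 0) at_top"
    by (rule tail_primitive[OF ge h], assumption)+
  have e: "g c x = (U_regular u0 u1 x $ c $ other c + 1 / k * U_singular u0 x $ c $ other c) * q x + 1 / k * U_singular u0 x $ c $ c * p x + 0"
    "g (other c) x = (U_regular u0 u1 x $ other c $ c + 1 / k * U_singular u0 x $ other c $ c) * p x + 1 / k * U_singular u0 x $ other c $ other c * q x + 0" for x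
    using sigma_entries(4)[of c] sigma_entries(4)[of "other c"]
    by (simp_all add: g_def U_entry) (simp_all add: U_regular_def mat_scale_entry)
  have sol: "orig.solves (1 / k) p q (\<lambda>x. 0) (\<lambda>x. 0)"
    unfolding orig.solves_def rate e[symmetric] using tp(1) ac_deriv_exp_weight[OF te(1)] by (rule conjI)
  then show "orig.solves (1 / k) (\<lambda>x. X x k $ c $ c) (\<lambda>x. X x k $ other c $ c) (\<lambda>x. 0) (\<lambda>x. 0)"
    unfolding p_def q_def .
  show "((\<lambda>x. X x k $ c $ c) \<longlongrightarrow> 1) at_top" using tp(2) unfolding p_def .
  have "(q \<longlongrightarrow> 0) at_top"
  proof (rule orig.decaying_component[OF sol])
    show "0 \<le> Re (orig.rate (1 / k))" unfolding rate by (rule re)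
    show "((\<lambda>x. exp (- orig.rate (1 / k) * of_real x) * q x) \<longlongrightarrow> 0) at_top" unfolding rate by (rule te(2))
    show "norm (p x) \<le> 1 + integral {0..} (\<lambda>x. norm (g c x))" if x: "0 \<le> x" for x
    proof -
      have s: "g c absolutely_integrable_on {x..}" by (rule set_integrable_subset[OF gc]) (use x in auto)
      have "norm (p x) \<le> 1 + norm (integral {x..} (g c))" unfolding p[OF x] using norm_triangle_ineq4[of 1 "integral {x..} (g c)"] by simp
      also have "norm (integral {x..} (g c)) \<le> integral {x..} (\<lambda>x. norm (g c x))" by (rule integral_norm_le[OF s])
      also have "\<dots> \<le> integral {0..} (\<lambda>x. norm (g c x))"
        by (rule integral_subset_le) (use s gc x in \<open>auto simp: absolutely_integrable_on_def\<close>)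
      finally show ?thesis by simp
    qed
  qed
  then show "((\<lambda>x. X x k $ other c $ c) \<longlongrightarrow> 0) at_top" unfolding q_def .
qed

lemma volterra_Y_solves:
  assumes V: "volterra_Y u0 u1 Y" and k0: "k \<noteq> 0"
  shows "lax_system.solves (sg c) (\<lambda>x. U_regular u0 u1 x $ c $ other c) (\<lambda>x. U_singular u0 x $ c $ other c)
     (\<lambda>x. U_singular u0 x $ c $ c) (\<lambda>x. U_regular u0 u1 x $ other c $ c) (\<lambda>x. U_singular u0 x $ other c $ c)
     (\<lambda>x. U_singular u0 x $ other c $ other c) (1 / k) (\<lambda>x. Y x k $ c $ c) (\<lambda>x. Y x k $ other c $ c) (\<lambda>x. 0) (\<lambda>x. 0)"
    and "Y 0 k = mat 1"
proof -
  interpret orig: lax_system n m "sg c" "\<lambda>x. U_regular u0 u1 x $ c $ other c" "\<lambda>x. U_singular u0 x $ c $ other c"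
     "\<lambda>x. U_singular u0 x $ c $ c" "\<lambda>x. U_regular u0 u1 x $ other c $ c" "\<lambda>x. U_singular u0 x $ other c $ c"
     "\<lambda>x. U_singular u0 x $ other c $ other c" by (rule orig_system)
  define lam where "lam = \<i> * sg c / 2 * (k - 1 / k)"
  have rate: "orig.rate (1 / k) = lam" unfolding orig.rate_def lam_def by (rule rate_inverse)
  define p where "p x = Y x k $ c $ c" for x
  define q where "q x = Y x k $ other c $ c" for x
  define g where "g i x = U u0 u1 x k $ i $ c * p x + U u0 u1 x k $ i $ other c * q x" for i x
  have UY: "(U u0 u1 x k ** Y x k) $ i $ c = g i x" for i x
    unfolding matrix_mult_entry[where c = c] g_def p_def q_def ..
  have V': "volterra_integrand u0 u1 Y x k absolutely_integrable_on {0..x}"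
    "Y x k = mat 1 + integral {0..x} (volterra_integrand u0 u1 Y x k)" if "0 \<le> x" for x
    using V k0 that unfolding volterra_Y_def by blast+
  have comp: "volterra_integrand u0 u1 Y x k x' $ i $ c = exp ((sg i - sg c) * (\<i> * theta1 k * of_real (x' - x))) * g i x'" for i x x'
    unfolding volterra_integrand_def exp_s3_hat_entry UY ..
  note A = absolutely_integrable_mat_nth[OF V'(1), where j = c, unfolded comp]
  have val: "Y x k $ i $ c = mat 1 $ i $ c + integral {0..x} (\<lambda>x'. exp ((sg i - sg c) * (\<i> * theta1 k * of_real (x' - x))) * g i x')"
    if "0 \<le> x" for x i
    using arg_cong[OF V'(2)[OF that], of "\<lambda>v. v $ i $ c"] A(2)[OF that, of i] unfolding vector_add_component by simp
  show Y0: "Y 0 k = mat 1" using V'(2)[of 0] by simp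
  have ap: "ac_deriv p (g c)"
    unfolding ac_deriv_def using A(1)[of _ c] val[of _ c] by (simp add: p_def Y0)
  have "ac_deriv (\<lambda>x. exp (- lam * of_real x) * q x) (\<lambda>x. exp (- lam * of_real x) * g (other c) x)"
    unfolding ac_deriv_def
  proof (intro allI impI)
    fix x :: real assume x: "0 \<le> x"
    have e: "(\<lambda>x'. exp (- lam * of_real x) * (exp (- lam * of_real (x' - x)) * g (other c) x')) = (\<lambda>x'. exp (- lam * of_real x') * g (other c) x')"
      unfolding mult.assoc[symmetric] exp_add[symmetric] by (simp add: algebra_simps)
    have ai: "(\<lambda>x'. exp (- lam * of_real (x' - x)) * g (other c) x') absolutely_integrable_on {0..x}"
      using A(1)[OF x, of "other c"] unfolding theta1_exponent lam_def[symmetric] .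
    have "(\<lambda>x'. exp (- lam * of_real x) * (exp (- lam * of_real (x' - x)) * g (other c) x')) absolutely_integrable_on {0..x}"
      by (rule set_integrable_mult_right) (rule ai)
    then have 1: "(\<lambda>x'. exp (- lam * of_real x') * g (other c) x') absolutely_integrable_on {0..x}" unfolding e .
    have "q x = integral {0..x} (\<lambda>x'. exp (- lam * of_real (x' - x)) * g (other c) x')"
      using val[OF x, of "other c"] unfolding theta1_exponent lam_def[symmetric] by (simp add: q_def mat_def other_neq)
    then have "exp (- lam * of_real x) * q x = integral {0..x} (\<lambda>x'. exp (- lam * of_real x) * (exp (- lam * of_real (x' - x)) * g (other c) x'))"
      by simp
    then have 2: "exp (- lam * of_real x) * q x = integral {0..x} (\<lambda>x'. exp (- lam * of_real x') * g (other c) x')" unfolding e .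
    have q0: "q 0 = 0" by (simp add: q_def Y0 mat_def other_neq)
    show "(\<lambda>x. exp (- lam * of_real x) * g (other c) x) absolutely_integrable_on {0..x} \<and>
       integral {0..x} (\<lambda>x. exp (- lam * of_real x) * g (other c) x) = exp (- lam * of_real x) * q x - exp (- lam * of_real 0) * q 0"
      using 1 2 q0 by simp
  qed
  note aq = ac_deriv_exp_weight[OF this]
  have e: "g c x = (U_regular u0 u1 x $ c $ other c + 1 / k * U_singular u0 x $ c $ other c) * q x + 1 / k * U_singular u0 x $ c $ c * p x + 0"
    "g (other c) x = (U_regular u0 u1 x $ other c $ c + 1 / k * U_singular u0 x $ other c $ c) * p x + 1 / k * U_singular u0 x $ other c $ other c * q x + 0" for x
    using sigma_entries(4)[of c] sigma_entries(4)[of "other c"]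
    by (simp_all add: g_def U_entry) (simp_all add: U_regular_def mat_scale_entry)
  have "orig.solves (1 / k) p q (\<lambda>x. 0) (\<lambda>x. 0)"
    unfolding orig.solves_def rate e[symmetric] using ap aq by (rule conjI)
  then show "orig.solves (1 / k) (\<lambda>x. Y x k $ c $ c) (\<lambda>x. Y x k $ other c $ c) (\<lambda>x. 0) (\<lambda>x. 0)"
    unfolding p_def q_def .
qed

text \<open>The entries of the rotation in \<open>G\<^sub>0\<close>.\<close>
definition gC :: "real \<Rightarrow> complex" where "gC x = of_real (cos (u0 x / 2))"
definition gS :: "real \<Rightarrow> complex" where "gS x = of_real (sin (u0 x / 2))"

lemma gauge_deriv:
  "ac_deriv gC (\<lambda>x. - of_real (dx u0 x) / 2 * gS x)" "ac_deriv gS (\<lambda>x. of_real (dx u0 x) / 2 * gC x)"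
proof -
  have 1: "((\<lambda>y. cos (y / 2)) has_real_derivative - sin (y / 2) / 2) (at y)"
    "((\<lambda>y. sin (y / 2)) has_real_derivative cos (y / 2) / 2) (at y)" for y :: real
    by (auto intro!: derivative_eq_intros)
  have "ac_deriv gC (\<lambda>x. complex_of_real (- sin (u0 x / 2) / 2) * of_real (dx u0 x))"
    unfolding gC_def[abs_def] by (rule ac_deriv_compose_u0[OF 1(1)]) (intro continuous_intros; simp)
  then show "ac_deriv gC (\<lambda>x. - of_real (dx u0 x) / 2 * gS x)" by (simp add: gS_def mult.commute)
  have "ac_deriv gS (\<lambda>x. complex_of_real (cos (u0 x / 2) / 2) * of_real (dx u0 x))"
    unfolding gS_def[abs_def] by (rule ac_deriv_compose_u0[OF 1(2)]) (intro continuous_intros; simp)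
  then show "ac_deriv gS (\<lambda>x. of_real (dx u0 x) / 2 * gC x)" by (simp add: gC_def mult.commute)
qed

lemma gauge_identities:
  "gC x * gC x + gS x * gS x = 1" "of_real (sin (u0 x)) = 2 * gS x * gC x" "of_real (cos (u0 x)) - 1 = - 2 * gS x * gS x"
proof -
  have "cos (u0 x / 2) * cos (u0 x / 2) + sin (u0 x / 2) * sin (u0 x / 2) = 1"
    using sin_cos_squared_add2[of "u0 x / 2"] by (simp add: power2_eq_square)
  then show "gC x * gC x + gS x * gS x = 1" unfolding gC_def gS_def by (metis of_real_1 of_real_add of_real_mult)
  have "sin (u0 x) = 2 * sin (u0 x / 2) * cos (u0 x / 2)" using sin_double[of "u0 x / 2"] by simp
  then show "of_real (sin (u0 x)) = 2 * gS x * gC x" unfolding gC_def gS_def by simp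
  have "cos (u0 x) - 1 = - 2 * sin (u0 x / 2) * sin (u0 x / 2)" using cos_double_sin[of "u0 x / 2"] by (simp add: power2_eq_square)
  then have "complex_of_real (cos (u0 x) - 1) = complex_of_real (- 2 * sin (u0 x / 2) * sin (u0 x / 2))" by simp
  then show "of_real (cos (u0 x)) - 1 = - 2 * gS x * gS x" unfolding gC_def gS_def by simp
qed

text \<open>The rotation by \<open>u0/2\<close> removes the \<open>1/k\<close> from the coefficients: by the double angle formulas it
  turns \<open>sin u0 \<sigma>\<^sub>1 + cos u0 \<sigma>\<^sub>3\<close>, the coefficient of \<open>1/k\<close>, into \<open>\<sigma>\<^sub>3\<close>. Its derivative changes
  \<open>u0' + u1\<close> into \<open>u0' - u1\<close>. The \<open>\<sigma>\<^sub>3\<close> in the term of order \<open>k\<close> is rotated in turn, which is the origin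
  of \<open>U1_hat\<close>.\<close>
lemma gauge_transform:
  assumes sol: "lax_system.solves (sg c) (\<lambda>x. U_regular u0 u1 x $ c $ other c) (\<lambda>x. U_singular u0 x $ c $ other c)
     (\<lambda>x. U_singular u0 x $ c $ c) (\<lambda>x. U_regular u0 u1 x $ other c $ c) (\<lambda>x. U_singular u0 x $ other c $ c)
     (\<lambda>x. U_singular u0 x $ other c $ other c) (1 / k) p q (\<lambda>x. 0) (\<lambda>x. 0)" and k: "k \<noteq> 0"
  shows "lax_system.solves (sg (other c)) (\<lambda>x. U0_hat u0 u1 x $ c $ other c) (\<lambda>x. U1_hat u0 x $ c $ other c)
     (\<lambda>x. U1_hat u0 x $ c $ c) (\<lambda>x. U0_hat u0 u1 x $ other c $ c) (\<lambda>x. U1_hat u0 x $ other c $ c)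
     (\<lambda>x. U1_hat u0 x $ other c $ other c) k
     (\<lambda>x. \<sigma> * (gC x * p x + sg c * (gS x * q x))) (\<lambda>x. \<sigma> * (gC x * q x - sg c * (gS x * p x))) (\<lambda>x. 0) (\<lambda>x. 0)"
proof -
  interpret orig: lax_system n m "sg c" "\<lambda>x. U_regular u0 u1 x $ c $ other c" "\<lambda>x. U_singular u0 x $ c $ other c"
     "\<lambda>x. U_singular u0 x $ c $ c" "\<lambda>x. U_regular u0 u1 x $ other c $ c" "\<lambda>x. U_singular u0 x $ other c $ c"
     "\<lambda>x. U_singular u0 x $ other c $ other c" by (rule orig_system)
  interpret hat: lax_system n m "sg (other c)" "\<lambda>x. U0_hat u0 u1 x $ c $ other c" "\<lambda>x. U1_hat u0 x $ c $ other c"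
     "\<lambda>x. U1_hat u0 x $ c $ c" "\<lambda>x. U0_hat u0 u1 x $ other c $ c" "\<lambda>x. U1_hat u0 x $ other c $ c"
     "\<lambda>x. U1_hat u0 x $ other c $ other c" by (rule hat_system)
  define v w where "v x = complex_of_real (dx u0 x)" and "w x = complex_of_real (u1 x)" for x
  note se = sigma_entries[of c] sigma_entries[of "other c", unfolded other_other]
  have eo: "U_regular u0 u1 x $ c $ other c = - sg c * (v x + w x) / 4" "U_regular u0 u1 x $ other c $ c = sg c * (v x + w x) / 4"
    "U_singular u0 x $ c $ other c = \<i> * gS x * gC x / 2" "U_singular u0 x $ other c $ c = \<i> * gS x * gC x / 2"
    "U_singular u0 x $ c $ c = - \<i> * sg c * gS x * gS x / 2" "U_singular u0 x $ other c $ other c = \<i> * sg c * gS x * gS x / 2"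
    "U0_hat u0 u1 x $ c $ other c = sg c * (v x - w x) / 4" "U0_hat u0 u1 x $ other c $ c = - sg c * (v x - w x) / 4"
    "U1_hat u0 x $ c $ other c = \<i> * gS x * gC x / 2" "U1_hat u0 x $ other c $ c = \<i> * gS x * gC x / 2"
    "U1_hat u0 x $ c $ c = \<i> * sg c * gS x * gS x / 2" "U1_hat u0 x $ other c $ other c = - \<i> * sg c * gS x * gS x / 2" for x
    unfolding U_regular_def U_singular_def U0_hat_def U1_hat_def
    by (simp_all add: mat_scale_entry se gauge_identities sg_other v_def w_def field_simps)
  have ro: "orig.rate (1 / k) = \<i> * sg c / 2 * (k - 1 / k)" unfolding orig.rate_def by (rule rate_inverse)
  have rh: "hat.rate k = \<i> * sg c / 2 * (k - 1 / k)" unfolding hat.rate_def unfolding sg_other by simp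
  have ap: "ac_deriv p (\<lambda>x. (- sg c * (v x + w x) / 4 + 1 / k * (\<i> * gS x * gC x / 2)) * q x + 1 / k * (- \<i> * sg c * gS x * gS x / 2) * p x + 0)"
    and aq: "ac_deriv q (\<lambda>x. \<i> * sg c / 2 * (k - 1 / k) * q x + ((sg c * (v x + w x) / 4 + 1 / k * (\<i> * gS x * gC x / 2)) * p x
       + 1 / k * (\<i> * sg c * gS x * gS x / 2) * q x + 0))"
    by (rule conjunct1[OF sol[unfolded orig.solves_def, unfolded eo ro]],
        rule conjunct2[OF sol[unfolded orig.solves_def, unfolded eo ro]])
  note gd = gauge_deriv[folded v_def]
  show ?thesis
    unfolding hat.solves_def
    unfolding eo rh
  proof
    show "ac_deriv (\<lambda>x. \<sigma> * (gC x * p x + sg c * (gS x * q x)))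
       (\<lambda>x. (sg c * (v x - w x) / 4 + k * (\<i> * gS x * gC x / 2)) * (\<sigma> * (gC x * q x - sg c * (gS x * p x)))
         + k * (\<i> * sg c * gS x * gS x / 2) * (\<sigma> * (gC x * p x + sg c * (gS x * q x))) + 0)"
    proof (rule iffD1[OF ac_deriv_cong ac_deriv_cmult[OF ac_deriv_add[OF ac_deriv_mult[OF gd(1) ap] ac_deriv_cmult[OF ac_deriv_mult[OF gd(2) aq]]]]])
      fix x :: real
      show "\<sigma> * (- v x / 2 * gS x * p x + gC x * ((- sg c * (v x + w x) / 4 + 1 / k * (\<i> * gS x * gC x / 2)) * q x
          + 1 / k * (- \<i> * sg c * gS x * gS x / 2) * p x + 0) +
         sg c * (v x / 2 * gC x * q x + gS x * (\<i> * sg c / 2 * (k - 1 / k) * q x + ((sg c * (v x + w x) / 4 + 1 / k * (\<i> * gS x * gC x / 2)) * p x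
          + 1 / k * (\<i> * sg c * gS x * gS x / 2) * q x + 0)))) =
       (sg c * (v x - w x) / 4 + k * (\<i> * gS x * gC x / 2)) * (\<sigma> * (gC x * q x - sg c * (gS x * p x)))
         + k * (\<i> * sg c * gS x * gS x / 2) * (\<sigma> * (gC x * p x + sg c * (gS x * q x))) + 0"
        by (rule gauge_algebra(1)[OF sg_cases gauge_identities(1)])
    qed simp
    show "ac_deriv (\<lambda>x. \<sigma> * (gC x * q x - sg c * (gS x * p x)))
       (\<lambda>x. \<i> * sg c / 2 * (k - 1 / k) * (\<sigma> * (gC x * q x - sg c * (gS x * p x))) +
         ((- sg c * (v x - w x) / 4 + k * (\<i> * gS x * gC x / 2)) * (\<sigma> * (gC x * p x + sg c * (gS x * q x)))
         + k * (- \<i> * sg c * gS x * gS x / 2) * (\<sigma> * (gC x * q x - sg c * (gS x * p x))) + 0))"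
    proof (rule iffD1[OF ac_deriv_cong ac_deriv_cmult[OF ac_deriv_diff[OF ac_deriv_mult[OF gd(1) aq] ac_deriv_cmult[OF ac_deriv_mult[OF gd(2) ap]]]]])
      fix x :: real
      show "\<sigma> * (- v x / 2 * gS x * q x + gC x * (\<i> * sg c / 2 * (k - 1 / k) * q x + ((sg c * (v x + w x) / 4 + 1 / k * (\<i> * gS x * gC x / 2)) * p x
          + 1 / k * (\<i> * sg c * gS x * gS x / 2) * q x + 0)) -
         sg c * (v x / 2 * gC x * p x + gS x * ((- sg c * (v x + w x) / 4 + 1 / k * (\<i> * gS x * gC x / 2)) * q x
          + 1 / k * (- \<i> * sg c * gS x * gS x / 2) * p x + 0))) =
        \<i> * sg c / 2 * (k - 1 / k) * (\<sigma> * (gC x * q x - sg c * (gS x * p x))) +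
         ((- sg c * (v x - w x) / 4 + k * (\<i> * gS x * gC x / 2)) * (\<sigma> * (gC x * p x + sg c * (gS x * q x)))
         + k * (- \<i> * sg c * gS x * gS x / 2) * (\<sigma> * (gC x * q x - sg c * (gS x * p x))) + 0)"
        by (rule gauge_algebra(2)[OF sg_cases gauge_identities(1)])
    qed simp
  qed
qed

end

section \<open>The expansions in terms of matrices\<close>

lemma column_norm_le: "norm (v :: complex^2) \<le> norm (v $ c) + norm (v $ other c)"
proof -
  have "norm v \<le> (\<Sum>i\<in>UNIV. norm (v $ i))" unfolding norm_vec_def by (rule L2_set_le_sum) simp
  then show ?thesis unfolding sum_other[of _ c] .
qed

lemma part_entries:
  "diag_part A $ c $ c = A $ c $ c" "diag_part A $ c $ other c = 0" "diag_part A $ other c $ c = 0"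
  "offdiag_part A $ c $ c = 0" "offdiag_part A $ c $ other c = A $ c $ other c"
  "offdiag_part A $ other c $ c = A $ other c $ c"
  using other_neq[of c] by (simp_all add: diag_part_def offdiag_part_def)

lemma part_mult_entries:
  "(B ** diag_part A) $ i $ c = B $ i $ c * A $ c $ c"
  "(B ** offdiag_part A) $ i $ c = B $ i $ other c * A $ other c $ c"
  "(((2 * \<i>) *k sigma3) ** B) $ c $ l = 2 * \<i> * sg c * B $ c $ l"
  "(sigma3 ** B) $ c $ l = sg c * B $ c $ l"
  unfolding matrix_mult_entry[where c = c] by (simp_all add: part_entries mat_scale_entry sigma_entries)

lemma has_vector_derivative_entry:
  assumes "(f has_vector_derivative D) F"
  shows "((\<lambda>x. f x $ i $ j :: complex) has_vector_derivative D $ i $ j) F"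
  using bounded_linear.has_vector_derivative[OF bounded_linear_vec_nth[of j]
      bounded_linear.has_vector_derivative[OF bounded_linear_vec_nth[of i] assms]] .

text \<open>Multiplication by \<open>G\<^sub>0\<close> does not involve \<open>k\<close> and its entries are at most \<open>1\<close>, so that it transports
  derivatives and bounds from the pair of scalar functions back to the column.\<close>
lemma column_derivs_from_components:
  assumes p: "boundary_derivs S n fp Gp" and q: "boundary_derivs S n fq Gq" and D: "D \<subseteq> S"
    and E: "\<And>i k. k \<in> D \<Longrightarrow> E k $ i $ c = a i * fp k + b i * fq k"
    and ab: "\<And>i. norm (a i) \<le> 1" "\<And>i. norm (b i) \<le> (1::real)"
    and B: "\<forall>j\<le>n. \<forall>k\<in>S. norm (Gp j k) + norm (Gq j k) \<le> B j k"
  shows "\<exists>F. derivs_upto_boundary D n (\<lambda>k. column c (E k)) F \<and> (\<forall>j\<le>n. \<forall>k\<in>D. norm (F j k) \<le> 2 * B j k)"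
proof (intro exI conjI)
  define F where "F j k = (\<chi> i. a i * Gp j k + b i * Gq j k)" for j k
  have Fi: "F j k $ i = a i * Gp j k + b i * Gq j k" for i j k by (simp add: F_def)
  have i: "interior D \<subseteq> interior S" by (rule interior_mono[OF D])
  show "derivs_upto_boundary D n (\<lambda>k. column c (E k)) F"
    unfolding derivs_upto_boundary_def
  proof (intro conjI ballI allI impI)
    fix k assume k: "k \<in> D"
    note kS = subsetD[OF D this]
    have "Gp 0 k = fp k" "Gq 0 k = fq k"
      using p[unfolded boundary_derivs_def, THEN conjunct1, rule_format, OF kS]
        q[unfolded boundary_derivs_def, THEN conjunct1, rule_format, OF kS] .
    then show "F 0 k = column c (E k)" unfolding vec_eq_iff Fi column_entry E[OF k] by simp
  next
    fix j assume j: "j \<le> n"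
    have "continuous_on S (Gp j)" "continuous_on S (Gq j)"
      using p[unfolded boundary_derivs_def, THEN conjunct2, THEN conjunct1, rule_format, OF j]
        q[unfolded boundary_derivs_def, THEN conjunct2, THEN conjunct1, rule_format, OF j] .
    note this[THEN continuous_on_subset[OF _ D]]
    then show "continuous_on D (F j)" unfolding F_def[abs_def] by (intro continuous_on_vec_lambda continuous_intros)
  next
    fix j k l assume j: "j < n" and "k \<in> interior D"
    then have k: "k \<in> interior S" using i by blast
    have "(Gp j has_field_derivative Gp (Suc j) k) (at k)" "(Gq j has_field_derivative Gq (Suc j) k) (at k)"
      using p[unfolded boundary_derivs_def, THEN conjunct2, THEN conjunct2, rule_format, OF j k]
        q[unfolded boundary_derivs_def, THEN conjunct2, THEN conjunct2, rule_format, OF j k] .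
    then show "((\<lambda>z. F j z $ l) has_field_derivative F (Suc j) k $ l) (at k)"
      unfolding Fi by (intro DERIV_add DERIV_cmult)
  qed
  show "\<forall>j\<le>n. \<forall>k\<in>D. norm (F j k) \<le> 2 * B j k"
  proof (intro allI impI ballI)
    fix j k assume j: "j \<le> n" and k: "k \<in> D"
    have 1: "norm (F j k $ i) \<le> norm (Gp j k) + norm (Gq j k)" for i
    proof -
      have "norm (F j k $ i) \<le> norm (a i) * norm (Gp j k) + norm (b i) * norm (Gq j k)"
        unfolding Fi by (rule order_trans[OF norm_triangle_ineq]) (simp add: norm_mult)
      also have "\<dots> \<le> 1 * norm (Gp j k) + 1 * norm (Gq j k)" by (intro add_mono mult_right_mono ab norm_ge_zero)
      finally show ?thesis by simp
    qed
    have "norm (F j k) \<le> norm (F j k $ 1) + norm (F j k $ 2)" using column_norm_le[of "F j k" 1] by simp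
    also have "\<dots> \<le> 2 * (norm (Gp j k) + norm (Gq j k))" using 1[of 1] 1[of 2] by simp
    also have "\<dots> \<le> 2 * B j k" using B[rule_format, OF j subsetD[OF D k]] by simp
    finally show "norm (F j k) \<le> 2 * B j k" .
  qed
qed

lemma uniform_column_constant:
  fixes D :: "2 \<Rightarrow> complex set"
  assumes ex: "\<And>c. \<exists>C>0. \<forall>x\<ge>(0::real). \<exists>F. derivs_upto_boundary (D c) n (f c x) F \<and>
      (\<forall>j\<le>n. \<forall>k\<in>D c. norm (F j k) \<le> C * b x j k)"
    and b: "\<And>x j k. 0 \<le> x \<Longrightarrow> 0 \<le> (b x j k :: real)"
  shows "\<exists>C>0. \<forall>x\<ge>0. \<forall>c. \<exists>F. derivs_upto_boundary (D c) n (f c x) F \<and>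
      (\<forall>j\<le>n. \<forall>k\<in>D c. norm (F j k) \<le> C * b x j k)"
proof -
  from choice[OF allI[OF ex]] obtain K where K0: "\<forall>c. 0 < K c \<and> (\<forall>x\<ge>0. \<exists>F. derivs_upto_boundary (D c) n (f c x) F \<and>
      (\<forall>j\<le>n. \<forall>k\<in>D c. norm (F j k) \<le> K c * b x j k))" ..
  note K = K0[rule_format, THEN conjunct1] K0[rule_format, THEN conjunct2, rule_format]
  have le: "K c \<le> K 1 + K 2" for c using exhaust_2[of c] K(1)[of 1] K(1)[of 2] by auto
  show ?thesis
  proof (intro exI[of _ "K 1 + K 2"] conjI allI impI)
    show "0 < K 1 + K 2" using K(1)[of 1] K(1)[of 2] by simp
    fix x :: real and c :: 2 assume x: "0 \<le> x"
    from K(2)[OF x, of c] obtain F where F: "derivs_upto_boundary (D c) n (f c x) F \<and>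
      (\<forall>j\<le>n. \<forall>k\<in>D c. norm (F j k) \<le> K c * b x j k)" ..
    have "norm (F j k) \<le> (K 1 + K 2) * b x j k" if j: "j \<le> n" and k: "k \<in> D c" for j k
      by (rule order_trans[OF F[THEN conjunct2, rule_format, OF j k] mult_right_mono[OF le b[OF x]]])
    then show "\<exists>F. derivs_upto_boundary (D c) n (f c x) F \<and> (\<forall>j\<le>n. \<forall>k\<in>D c. norm (F j k) \<le> (K 1 + K 2) * b x j k)"
      by (intro exI[of _ F] conjI F[THEN conjunct1] allI impI ballI)
  qed
qed

definition hat_rate :: "2 \<Rightarrow> complex \<Rightarrow> complex" where "hat_rate c k = \<i> * sg c / 2 * (k - 1 / k)"

lemma hat_rate_other: "hat_rate (other c) k = - hat_rate c k"
  by (simp add: hat_rate_def sg_other)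

lemma Re_hat_rate:
  assumes "k \<noteq> 0"
  shows "k \<in> col_dom C_lower C_upper c \<Longrightarrow> 0 \<le> Re (hat_rate c k)"
    and "k \<in> col_dom C_upper C_lower c \<Longrightarrow> Re (hat_rate c k) \<le> 0"
  unfolding hat_rate_def Re_rate_sign[OF assms] using exhaust_2[of c] mult_im_sign[of k]
  by (auto simp: col_dom_def C_lower_def C_upper_def)

lemma closure_D_subset:
  "closure D2 \<subseteq> C_upper \<inter> cball 0 1" "closure D3 \<subseteq> C_lower \<inter> cball 0 1"
proof -
  have "closed C_upper" "closed C_lower" unfolding C_upper_def C_lower_def
    by (intro closed_Collect_le continuous_intros)+
  then have c: "closed (C_upper \<inter> cball 0 1)" "closed (C_lower \<inter> cball 0 1)" by auto
  show "closure D2 \<subseteq> C_upper \<inter> cball 0 1"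
    by (rule closure_minimal[OF _ c(1)]) (auto simp: D2_def C_upper_def)
  show "closure D3 \<subseteq> C_lower \<inter> cball 0 1"
    by (rule closure_minimal[OF _ c(2)]) (auto simp: D3_def C_lower_def)
qed

lemma col_dom_closure:
  "col_dom (closure D3) (closure D2) c \<subseteq> col_dom C_lower C_upper c \<inter> {k. k \<noteq> 0 \<and> norm k \<le> 1 \<and> 0 \<le> Re (hat_rate c k)}"
  "col_dom (closure D2) (closure D3) c \<subseteq> col_dom C_upper C_lower c \<inter> {k. k \<noteq> 0 \<and> norm k \<le> 1 \<and> Re (hat_rate c k) \<le> 0}"
proof -
  have 1: "col_dom (closure D3) (closure D2) c \<subseteq> col_dom C_lower C_upper c \<inter> (cball 0 1 - {0})"
    "col_dom (closure D2) (closure D3) c \<subseteq> col_dom C_upper C_lower c \<inter> (cball 0 1 - {0})"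
    using closure_D_subset unfolding col_dom_def by auto
  have n: "k \<noteq> 0 \<and> norm k \<le> 1" if "k \<in> cball 0 1 - {0}" for k :: complex using that by simp
  show "col_dom (closure D3) (closure D2) c \<subseteq> col_dom C_lower C_upper c \<inter> {k. k \<noteq> 0 \<and> norm k \<le> 1 \<and> 0 \<le> Re (hat_rate c k)}"
    by (rule subsetI, drule subsetD[OF 1(1)], elim IntE, drule n, intro IntI CollectI conjI, assumption)
      (elim conjE, assumption, elim conjE, assumption, elim conjE, rule Re_hat_rate(1))
  show "col_dom (closure D2) (closure D3) c \<subseteq> col_dom C_upper C_lower c \<inter> {k. k \<noteq> 0 \<and> norm k \<le> 1 \<and> Re (hat_rate c k) \<le> 0}"
    by (rule subsetI, drule subsetD[OF 1(2)], elim IntE, drule n, intro IntI CollectI conjI, assumption)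
      (elim conjE, assumption, elim conjE, assumption, elim conjE, rule Re_hat_rate(2))
qed

lemma powi_split:
  assumes "k \<noteq> 0"
  shows "cmod k powi (int m + 1 - 2 * int j) = norm k ^ Suc m / norm k ^ (2 * j)"
proof -
  have "cmod k powi (int m + 1 - 2 * int j) = cmod k powi (int (Suc m) - int (2 * j))" by (simp add: add.commute)
  also have "\<dots> = cmod k powi int (Suc m) / cmod k powi int (2 * j)" by (rule power_int_diff) (use assms in simp)
  finally show ?thesis unfolding power_int_of_nat .
qed

context potential
begin

abbreviation "\<sigma> \<equiv> ((-1) powi N :: complex)"
abbreviation "tr \<equiv> lax_system.trunc m"

definition hat_solves :: "2 \<Rightarrow> complex \<Rightarrow> (real \<Rightarrow> complex) \<Rightarrow> (real \<Rightarrow> complex) \<Rightarrow> bool" where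
  "hat_solves c k p q \<longleftrightarrow> lax_system.solves (sg (other c)) (\<lambda>x. U0_hat u0 u1 x $ c $ other c) (\<lambda>x. U1_hat u0 x $ c $ other c)
     (\<lambda>x. U1_hat u0 x $ c $ c) (\<lambda>x. U0_hat u0 u1 x $ other c $ c) (\<lambda>x. U1_hat u0 x $ other c $ c)
     (\<lambda>x. U1_hat u0 x $ other c $ other c) k p q (\<lambda>x. 0) (\<lambda>x. 0)"

definition hat_formal :: "2 \<Rightarrow> (int \<Rightarrow> real \<Rightarrow> complex) \<Rightarrow> (int \<Rightarrow> real \<Rightarrow> complex) \<Rightarrow> bool" where
  "hat_formal c P Q \<longleftrightarrow> lax_system.formal m (sg (other c)) (\<lambda>x. U0_hat u0 u1 x $ c $ other c) (\<lambda>x. U1_hat u0 x $ c $ other c)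
     (\<lambda>x. U1_hat u0 x $ c $ c) (\<lambda>x. U0_hat u0 u1 x $ other c $ c) (\<lambda>x. U1_hat u0 x $ other c $ c)
     (\<lambda>x. U1_hat u0 x $ other c $ other c) P Q"

definition orig_solves :: "2 \<Rightarrow> complex \<Rightarrow> (real \<Rightarrow> complex) \<Rightarrow> (real \<Rightarrow> complex) \<Rightarrow> bool" where
  "orig_solves c k p q \<longleftrightarrow> lax_system.solves (sg c) (\<lambda>x. U_regular u0 u1 x $ c $ other c) (\<lambda>x. U_singular u0 x $ c $ other c)
     (\<lambda>x. U_singular u0 x $ c $ c) (\<lambda>x. U_regular u0 u1 x $ other c $ c) (\<lambda>x. U_singular u0 x $ other c $ c)
     (\<lambda>x. U_singular u0 x $ other c $ other c) (1 / k) p q (\<lambda>x. 0) (\<lambda>x. 0)"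

lemma rate_hat: "lax_system.rate (sg (other c)) k = hat_rate c k"
  unfolding lax_system.rate_def[OF hat_system] hat_rate_def unfolding sg_other by simp

lemma rate_orig: "lax_system.rate (sg c) (1 / k) = hat_rate c k"
  unfolding lax_system.rate_def[OF orig_system] hat_rate_def by (rule rate_inverse)

lemma trunc_sum: "tr F k x = (\<Sum>j\<le>Suc m. k ^ j * F (int j) x)"
  by (rule lax_system.trunc_def[OF hat_system])

lemma trunc_lincomb: "tr (\<lambda>j x. \<alpha> * F j x + \<beta> * G j x) k x = \<alpha> * tr F k x + \<beta> * tr G k x"
  unfolding trunc_sum by (simp add: sum.distrib sum_distrib_left algebra_simps del: sum.atMost_Suc)

lemma trunc_split: "tr F k x = F 0 x + (\<Sum>j=1..m+1. k ^ j * F (int j) x)"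
  unfolding trunc_sum atMost_atLeast0 by (subst sum.atLeast_Suc_atMost) simp_all

lemma matrix_trunc_entry:
  assumes "A 0 x = B"
  shows "(B + (\<Sum>j=1..m+1. (k ^ j) *k A (int j) x)) $ i $ l = tr (\<lambda>j x. A j x $ i $ l) k x"
  unfolding trunc_split vector_add_component sum_component mat_scale_entry assms ..

text \<open>The entries of a column of the matrix recursion are the scalar recursion.\<close>
lemma hat_formal_XZ:
  assumes A: "recursion_XZ m u0 u1 A"
  shows "hat_formal c (\<lambda>j x. A j x $ c $ c) (\<lambda>j x. A j x $ other c $ c)"
proof -
  define d where "d = other c"
  have cd: "other d = c" by (simp add: d_def)
  note pe = part_entries[where c = c, folded d_def] part_entries[where c = d, unfolded cd]
  note me = part_mult_entries[where c = c, folded d_def] part_mult_entries[where c = d, unfolded cd]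
  have A0: "A (-1) x = 0" "A 0 x = mat 1" if "0 \<le> x" for x using A that unfolding recursion_XZ_def by blast+
  have dc: "d \<noteq> c" using other_neq[of c] by (simp add: d_def)
  show ?thesis
    unfolding hat_formal_def lax_system.formal_def[OF hat_system] unfolding d_def[symmetric]
  proof (intro conjI allI impI ballI)
    fix j :: int and x :: real assume j: "j \<in> {0..int m}" and x: "0 \<le> x"
    from A j x obtain D where D: "((\<lambda>y. offdiag_part (A j y)) has_vector_derivative D) (at x within {0..})"
      and R: "offdiag_part (A (j + 1) x) = ((2 * \<i>) *k sigma3) **
                 (- D - (\<i> / 2) *k (sigma3 ** offdiag_part (A (j - 1) x))
                  + U0_hat u0 u1 x ** diag_part (A j x)
                  + offdiag_part (U1_hat u0 x) ** diag_part (A (j - 1) x)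
                  + diag_part (U1_hat u0 x) ** offdiag_part (A (j - 1) x))"
      and P: "((\<lambda>y. diag_part (A (j + 1) y)) has_vector_derivative
            (U0_hat u0 u1 x ** offdiag_part (A (j + 1) x)
             + offdiag_part (U1_hat u0 x) ** offdiag_part (A j x)
             + diag_part (U1_hat u0 x) ** diag_part (A j x))) (at x within {0..})"
      unfolding recursion_XZ_def by blast
    show "\<exists>D. ((\<lambda>x. A j x $ d $ c) has_vector_derivative D) (at x within {0..}) \<and>
        A (j + 1) x $ d $ c = 2 * \<i> * sg d * (- D - \<i> / 2 * sg d * A (j - 1) x $ d $ c
           + U0_hat u0 u1 x $ d $ c * A j x $ c $ c + U1_hat u0 x $ d $ c * A (j - 1) x $ c $ c
           + U1_hat u0 x $ d $ d * A (j - 1) x $ d $ c)"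
      using has_vector_derivative_entry[OF D, of d c] arg_cong[OF R, of "\<lambda>M. M $ d $ c"]
      by (intro exI[of _ "D $ d $ c"] conjI) (simp_all add: pe me mat_scale_entry sigma_entries(7))
    show "((\<lambda>x. A (j + 1) x $ c $ c) has_vector_derivative
        U0_hat u0 u1 x $ c $ d * A (j + 1) x $ d $ c + U1_hat u0 x $ c $ d * A j x $ d $ c + U1_hat u0 x $ c $ c * A j x $ c $ c)
        (at x within {0..})"
      using has_vector_derivative_entry[OF P, of c c] by (simp add: pe me)
  qed (use A0 dc in \<open>simp_all add: mat_def\<close>)
qed

text \<open>The diagonal entries of \<open>W\<close> play the part of the off-diagonal entries of \<open>Z\<close>, so that column
  \<open>other c\<close> of \<open>W\<close> is a formal solution for column \<open>c\<close>.\<close>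
lemma hat_formal_W:
  assumes A: "recursion_W m u0 u1 W"
  shows "hat_formal c (\<lambda>j x. W j x $ c $ other c) (\<lambda>j x. W j x $ other c $ other c)"
proof -
  define d where "d = other c"
  have cd: "other d = c" by (simp add: d_def)
  note pe = part_entries[where c = c, folded d_def] part_entries[where c = d, unfolded cd]
  note me = part_mult_entries[where c = c, folded d_def] part_mult_entries[where c = d, unfolded cd]
  have W0: "W (-1) x = 0" "W 0 x = 0" if "0 \<le> x" for x using A that unfolding recursion_W_def by blast+
  show ?thesis
    unfolding hat_formal_def lax_system.formal_def[OF hat_system] unfolding d_def[symmetric]
  proof (intro conjI allI impI ballI)
    fix j :: int and x :: real assume j: "j \<in> {0..int m}" and x: "0 \<le> x"
    from A j x obtain D where D: "((\<lambda>y. diag_part (W j y)) has_vector_derivative D) (at x within {0..})"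
      and R: "diag_part (W (j + 1) x) = ((2 * \<i>) *k sigma3) **
                 (- D - (\<i> / 2) *k (sigma3 ** diag_part (W (j - 1) x))
                  + U0_hat u0 u1 x ** offdiag_part (W j x)
                  + offdiag_part (U1_hat u0 x) ** offdiag_part (W (j - 1) x)
                  + diag_part (U1_hat u0 x) ** diag_part (W (j - 1) x))"
      and P: "((\<lambda>y. offdiag_part (W (j + 1) y)) has_vector_derivative
            (U0_hat u0 u1 x ** diag_part (W (j + 1) x)
             + offdiag_part (U1_hat u0 x) ** diag_part (W j x)
             + diag_part (U1_hat u0 x) ** offdiag_part (W j x))) (at x within {0..})"
      unfolding recursion_W_def by blast
    show "\<exists>D. ((\<lambda>x. W j x $ d $ d) has_vector_derivative D) (at x within {0..}) \<and>
        W (j + 1) x $ d $ d = 2 * \<i> * sg d * (- D - \<i> / 2 * sg d * W (j - 1) x $ d $ d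
           + U0_hat u0 u1 x $ d $ c * W j x $ c $ d + U1_hat u0 x $ d $ c * W (j - 1) x $ c $ d
           + U1_hat u0 x $ d $ d * W (j - 1) x $ d $ d)"
      using has_vector_derivative_entry[OF D, of d d] arg_cong[OF R, of "\<lambda>M. M $ d $ d"]
      by (intro exI[of _ "D $ d $ d"] conjI) (simp_all add: pe me mat_scale_entry sigma_entries(7))
    show "((\<lambda>x. W (j + 1) x $ c $ d) has_vector_derivative
        U0_hat u0 u1 x $ c $ d * W (j + 1) x $ d $ d + U1_hat u0 x $ c $ d * W j x $ d $ d + U1_hat u0 x $ c $ c * W j x $ c $ d)
        (at x within {0..})"
      using has_vector_derivative_entry[OF P, of c d] by (simp add: pe me)
  qed (use W0 in simp_all)
qed

lemma hat_formal_lincomb: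
  assumes "hat_formal c P Q" "hat_formal c P' Q'"
  shows "hat_formal c (\<lambda>j x. \<alpha> * P j x + \<beta> * P' j x) (\<lambda>j x. \<alpha> * Q j x + \<beta> * Q' j x)"
  using lax_system.formal_lincomb[OF hat_system assms[unfolded hat_formal_def]] unfolding hat_formal_def .

text \<open>Multiplication by \<open>exp (-2 i \<theta>\<^sub>1 x \<sigma>\<^sub>3)\<close> turns a solution for one column into a solution for the other
  one with exchanged components.\<close>
lemma hat_solves_swap:
  assumes "hat_solves c k p q"
  shows "hat_solves (other c) k (\<lambda>x. exp (- hat_rate c k * of_real x) * q x) (\<lambda>x. exp (- hat_rate c k * of_real x) * p x)"
proof -
  have s: "- sg c = sg (other c)" by (simp add: sg_other)
  have r: "lax_system.rate (sg c) k = - hat_rate c k"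
    using rate_hat[of "other c" k] unfolding other_other hat_rate_other .
  note d = lax_system.dual_solves[OF hat_system[of "other c"], unfolded other_other s, OF assms[unfolded hat_solves_def]]
  show ?thesis using d unfolding hat_solves_def other_other r mult_zero_right .
qed

lemma orig_solves_swap:
  assumes "orig_solves c k p q"
  shows "orig_solves (other c) k (\<lambda>x. exp (- hat_rate c k * of_real x) * q x) (\<lambda>x. exp (- hat_rate c k * of_real x) * p x)"
proof -
  have s: "- sg (other c) = sg c" by (simp add: sg_other)
  note d = lax_system.dual_solves[OF orig_system[of "other c"], unfolded other_other s, OF assms[unfolded orig_solves_def]]
  show ?thesis using d unfolding orig_solves_def other_other rate_orig hat_rate_other mult_zero_right .
qed

lemma hat_forward_expansion:
  assumes P: "hat_formal c P Q" and D: "hat_formal (other c) P' Q'"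
    and sol: "\<And>k. k \<noteq> 0 \<Longrightarrow> hat_solves c k (\<lambda>x. Fp x k) (\<lambda>x. Fq x k)"
    and init: "\<And>k. k \<noteq> 0 \<Longrightarrow> Fp 0 k = v \<and> Fq 0 k = w"
    and match: "\<And>k. tr P k 0 + tr Q' k 0 = v \<and> tr Q k 0 + tr P' k 0 = w"
  defines "S \<equiv> {k. k \<noteq> 0 \<and> norm k \<le> 1 \<and> Re (hat_rate c k) \<le> 0}"
  shows "\<exists>C>0. \<forall>x\<ge>0. \<exists>Gp Gq.
      boundary_derivs S n (\<lambda>k. Fp x k - tr P k x - exp (hat_rate c k * of_real x) * tr Q' k x) Gp \<and>
      boundary_derivs S n (\<lambda>k. Fq x k - tr Q k x - exp (hat_rate c k * of_real x) * tr P' k x) Gq \<and>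
      (\<forall>j\<le>n. \<forall>k\<in>S. norm (Gp j k) + norm (Gq j k) \<le> C * (1 + x) ^ j * (norm k ^ Suc m / norm k ^ (2 * j)))"
  unfolding S_def
proof (rule lax_system.forward_expansion[OF hat_system[of c] P[unfolded hat_formal_def], unfolded rate_hat])
  have s: "- sg (other c) = sg (other (other c))" by (simp add: sg_other)
  show "lax_system.dual_formal m (sg (other c)) (\<lambda>x. U0_hat u0 u1 x $ c $ other c) (\<lambda>x. U1_hat u0 x $ c $ other c)
     (\<lambda>x. U1_hat u0 x $ c $ c) (\<lambda>x. U0_hat u0 u1 x $ other c $ c) (\<lambda>x. U1_hat u0 x $ other c $ c)
     (\<lambda>x. U1_hat u0 x $ other c $ other c) P' Q'"
    using D unfolding lax_system.dual_formal_def[OF hat_system] hat_formal_def s other_other .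
qed (rule sol[unfolded hat_solves_def], assumption, rule init, assumption, rule match)

lemma hat_backward_expansion:
  assumes P: "hat_formal c P Q"
  defines "S \<equiv> {k. k \<noteq> 0 \<and> norm k \<le> 1 \<and> 0 \<le> Re (hat_rate c k)}"
  assumes sol: "\<And>k. k \<in> S \<Longrightarrow> hat_solves c k (\<lambda>x. Fp x k) (\<lambda>x. Fq x k)"
    and lim: "\<And>k. k \<in> S \<Longrightarrow> ((\<lambda>x. Fp x k - tr P k x) \<longlongrightarrow> 0) at_top"
      "\<And>k. k \<in> S \<Longrightarrow> ((\<lambda>x. Fq x k - tr Q k x) \<longlongrightarrow> 0) at_top"
  shows "\<exists>C>0. \<forall>x\<ge>0. \<exists>Gp Gq.
      boundary_derivs S n (\<lambda>k. Fp x k - tr P k x) Gp \<and> boundary_derivs S n (\<lambda>k. Fq x k - tr Q k x) Gq \<and>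
      (\<forall>j\<le>n. \<forall>k\<in>S. norm (Gp j k) + norm (Gq j k) \<le> C * (norm k ^ Suc m / norm k ^ (2 * j) * (1 / (1 + x) ^ (n - j))))"
  unfolding S_def
  by (rule lax_system.backward_expansion[OF hat_system[of c] P[unfolded hat_formal_def], unfolded rate_hat])
     (fact sol[unfolded hat_solves_def S_def] lim[unfolded S_def])+

lemma hat_forward_bounded:
  obtains B where "0 < B" "\<And>k p q x. hat_solves c k p q \<Longrightarrow> norm k \<le> 1 \<Longrightarrow> Re (hat_rate c k) \<le> 0 \<Longrightarrow> 0 \<le> x \<Longrightarrow>
     norm (p x) + norm (q x) \<le> B * (norm (p 0) + norm (q 0))"
  by (rule that[OF exp_gt_zero])
    (rule lax_system.forward_bounded[OF hat_system[of c], unfolded rate_hat, folded hat_solves_def]; simp)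

lemma orig_forward_bounded:
  obtains B where "0 < B" "\<And>k p q x. orig_solves c k p q \<Longrightarrow> 1 \<le> norm k \<Longrightarrow> Re (hat_rate c k) \<le> 0 \<Longrightarrow> 0 \<le> x \<Longrightarrow>
     norm (p x) + norm (q x) \<le> B * (norm (p 0) + norm (q 0))"
proof -
  have k: "norm (1 / k) \<le> 2" if "1 \<le> norm k" for k :: complex
    using that by (simp add: norm_divide divide_le_eq)
  note F = lax_system.forward_bounded[OF orig_system[of c], where k = "1 / k" for k, unfolded rate_orig, folded orig_solves_def]
  show ?thesis by (rule that[OF exp_gt_zero]) (rule F; use k in simp)
qed

lemma hat_backward_bounded:
  obtains B where "0 < B" "\<And>k p q x a b. hat_solves c k p q \<Longrightarrow> norm k \<le> 1 \<Longrightarrow> 0 \<le> Re (hat_rate c k) \<Longrightarrow> 0 \<le> x \<Longrightarrow>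
     (p \<longlongrightarrow> a) at_top \<Longrightarrow> (q \<longlongrightarrow> b) at_top \<Longrightarrow> norm (p x) + norm (q x) \<le> B * (norm a + norm b)"
  by (rule that[OF exp_gt_zero])
    (rule lax_system.backward_bounded[OF hat_system[of c], unfolded rate_hat, folded hat_solves_def]; simp)

lemma orig_backward_bounded:
  obtains B where "0 < B" "\<And>k p q x a b. orig_solves c k p q \<Longrightarrow> 1 \<le> norm k \<Longrightarrow> 0 \<le> Re (hat_rate c k) \<Longrightarrow> 0 \<le> x \<Longrightarrow>
     (p \<longlongrightarrow> a) at_top \<Longrightarrow> (q \<longlongrightarrow> b) at_top \<Longrightarrow> norm (p x) + norm (q x) \<le> B * (norm a + norm b)"
proof -
  have k: "norm (1 / k) \<le> 2" if "1 \<le> norm k" for k :: complex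
    using that by (simp add: norm_divide divide_le_eq)
  note F = lax_system.backward_bounded[OF orig_system[of c], where k = "1 / k" for k, unfolded rate_orig, folded orig_solves_def]
  show ?thesis by (rule that[OF exp_gt_zero]) (rule F; use k in simp)
qed

lemma \<sigma>_square: "\<sigma> * \<sigma> = 1" and norm_\<sigma>: "norm \<sigma> = 1" and \<sigma>_cases: "\<sigma> = (if even N then 1 else -1)"
proof -
  show c: "\<sigma> = (if even N then 1 else -1)"
    using power_int_minus_left_even[of N "1::complex"] power_int_minus_left_odd[of N "1::complex"] by auto
  show "\<sigma> * \<sigma> = 1" "norm \<sigma> = 1" unfolding c by auto
qed

lemma G0_entries:
  "G0 N u0 x $ c $ c = \<sigma> * gC x" "G0 N u0 x $ c $ other c = - \<sigma> * sg c * gS x" "G0 N u0 x $ other c $ c = \<sigma> * sg c * gS x"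
  using exhaust_2[of c] by (auto simp: G0_def mat_scale_entry gC_def gS_def)

lemma G0_entry_le_1: "norm (G0 N u0 x $ i $ l) \<le> 1"
proof -
  have g: "norm (gC x) \<le> 1" "norm (gS x) \<le> 1" unfolding gC_def gS_def norm_of_real by simp_all
  have e: "norm (sg i) = 1" using sg_cases[of i] by auto
  consider "l = i" | "l = other i" using cases_other[of l i] by blast
  then show ?thesis
  proof cases
    case 1 then show ?thesis unfolding 1 G0_entries norm_mult norm_\<sigma> using g by simp
  next
    case 2 then show ?thesis unfolding 2 G0_entries norm_mult norm_minus_cancel norm_\<sigma> e using g by simp
  qed
qed

text \<open>The entries of \<open>G\<^sub>0\<^sup>-\<^sup>1 A\<close> in column \<open>c\<close>, on and off the diagonal.\<close>
definition gauged :: "(real \<Rightarrow> complex \<Rightarrow> cmat) \<Rightarrow> 2 \<Rightarrow> complex \<Rightarrow> real \<Rightarrow> complex" where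
  "gauged A c k x = \<sigma> * (gC x * A x k $ c $ c + sg c * (gS x * A x k $ other c $ c))"

definition gauged_off :: "(real \<Rightarrow> complex \<Rightarrow> cmat) \<Rightarrow> 2 \<Rightarrow> complex \<Rightarrow> real \<Rightarrow> complex" where
  "gauged_off A c k x = \<sigma> * (gC x * A x k $ other c $ c - sg c * (gS x * A x k $ c $ c))"

lemma ungauge: "A x k $ i $ c = G0 N u0 x $ i $ c * gauged A c k x + G0 N u0 x $ i $ other c * gauged_off A c k x"
proof -
  have e: "sg c * sg c = 1" using sg_cases[of c] by auto
  define p q where "p = A x k $ c $ c" and "q = A x k $ other c $ c"
  note CS = gauge_identities(1)[of x]
  consider "i = c" | "i = other c" using cases_other[of i c] by blast
  then show ?thesis
  proof cases
    case 1
    have "\<sigma> * gC x * (\<sigma> * (gC x * p + sg c * (gS x * q))) + - \<sigma> * sg c * gS x * (\<sigma> * (gC x * q - sg c * (gS x * p)))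
      = (\<sigma> * \<sigma>) * ((gC x * gC x + (sg c * sg c) * (gS x * gS x)) * p)" by (simp add: algebra_simps)
    then show ?thesis unfolding 1 G0_entries gauged_def gauged_off_def p_def[symmetric] q_def[symmetric] e \<sigma>_square using CS by simp
  next
    case 2
    have "\<sigma> * sg c * gS x * (\<sigma> * (gC x * p + sg c * (gS x * q))) + \<sigma> * gC x * (\<sigma> * (gC x * q - sg c * (gS x * p)))
      = (\<sigma> * \<sigma>) * ((gC x * gC x + (sg c * sg c) * (gS x * gS x)) * q)" by (simp add: algebra_simps)
    then show ?thesis unfolding 2 G0_entries G0_entries(1)[of x "other c"] gauged_def gauged_off_def p_def[symmetric] q_def[symmetric] e \<sigma>_square
      using CS by simp
  qed
qed

lemma gauge_limits: "((\<lambda>x. \<sigma> * gC x) \<longlongrightarrow> 1) at_top" "(gS \<longlongrightarrow> 0) at_top"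
proof -
  have "((\<lambda>x. complex_of_real (u0 x - 2 * pi * of_int N)) \<longlongrightarrow> 0) at_top" by (rule wsob_tendsto_0[OF u0_wsob])
  from tendsto_Re[OF this] have "((\<lambda>x. u0 x - 2 * pi * of_int N) \<longlongrightarrow> 0) at_top" by simp
  then have "((\<lambda>x. (u0 x - 2 * pi * of_int N) / 2 + pi * of_int N) \<longlongrightarrow> 0 / 2 + pi * of_int N) at_top"
    by (intro tendsto_intros; simp)
  then have u: "((\<lambda>x. u0 x / 2) \<longlongrightarrow> pi * of_int N) at_top" by (simp add: diff_divide_distrib)
  have "((\<lambda>x. complex_of_real (sin (u0 x / 2))) \<longlongrightarrow> of_real (sin (pi * of_int N))) at_top"
    by (intro tendsto_intros u)
  then show "(gS \<longlongrightarrow> 0) at_top" unfolding gS_def[abs_def] by (simp add: sin_npi_int)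
  have "((\<lambda>x. \<sigma> * complex_of_real (cos (u0 x / 2))) \<longlongrightarrow> \<sigma> * of_real (cos (pi * of_int N))) at_top"
    by (intro tendsto_intros u)
  also have "\<sigma> * of_real (cos (pi * of_int N)) = 1" unfolding cos_npi_int \<sigma>_cases by simp
  finally show "((\<lambda>x. \<sigma> * gC x) \<longlongrightarrow> 1) at_top" unfolding gC_def[abs_def] .
qed

end

text \<open>On the half-planes the sign of \<open>Re (rate k)\<close> is that of \<open>\<plusminus> Im k\<close>, since
  \<open>Im (k - 1/k) = Im k (1 + 1/|k|^2)\<close>.\<close>
lemma hat_rate_cols:
  assumes "k \<noteq> 0" "0 \<le> Re (hat_rate c k)"
  shows "k \<in> col_dom C_lower C_upper c"
proof -
  have t: "0 < 1 + 1 / (norm k)\<^sup>2" by (simp add: add_pos_nonneg)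
  have z: "0 \<le> - Re (sg c) * (Im k * (1 + 1 / (norm k)\<^sup>2) / 2)"
    using assms(2) unfolding hat_rate_def Re_rate_sign[OF assms(1)] .
  consider "c = 1" | "c = 2" using exhaust_2[of c] by blast
  then show ?thesis
  proof cases
    case 1
    then have "Im k * (1 + 1 / (norm k)\<^sup>2) \<le> 0" using z by simp
    then have "Im k \<le> 0" using t by (simp add: mult_le_0_iff)
    then show ?thesis using 1 assms(1) by (simp add: col_dom_def C_lower_def)
  next
    case 2
    then have "0 \<le> Im k * (1 + 1 / (norm k)\<^sup>2)" using z by simp
    then have "0 \<le> Im k" using t by (simp add: zero_le_mult_iff)
    then show ?thesis using 2 assms(1) by (simp add: col_dom_def C_upper_def)
  qed
qed

lemma hat_rate_theta1: "sg c * (2 * \<i> * theta1 k * of_real x) = hat_rate c k * of_real x"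
proof -
  have "sg c * (2 * \<i> * (y / 4) * of_real x) = \<i> * sg c / 2 * y * of_real x" for y by simp
  then show ?thesis unfolding theta1_def hat_rate_def .
qed

lemma hat_rate_theta1_minus: "sg c * (- 2 * \<i> * theta1 k * of_real x) = - hat_rate c k * of_real x"
proof -
  have "sg c * (- 2 * \<i> * theta1 k * of_real x) = - (sg c * (2 * \<i> * theta1 k * of_real x))" by simp
  then show ?thesis unfolding hat_rate_theta1 by simp
qed

lemma bounded_columnI:
  fixes A :: "complex \<Rightarrow> cmat"
  assumes "\<And>k i. k \<in> D \<Longrightarrow> norm (A k $ i $ c) \<le> B"
  shows "bounded ((\<lambda>k. column c (A k)) ` D)"
proof (rule boundedI[of _ "B + B"])
  fix v assume "v \<in> (\<lambda>k. column c (A k)) ` D"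
  then obtain k where k: "k \<in> D" "v = column c (A k)" by (rule imageE)
  show "norm v \<le> B + B"
    using column_norm_le[of v c] assms[OF k(1), of c] assms[OF k(1), of "other c"] unfolding k(2) column_entry by simp
qed

context potential
begin

lemma gauged_solves:
  assumes "orig_solves c k (\<lambda>x. A x k $ c $ c) (\<lambda>x. A x k $ other c $ c)" "k \<noteq> 0"
  shows "hat_solves c k (gauged A c k) (gauged_off A c k)"
  using gauge_transform[OF assms(1)[unfolded orig_solves_def] assms(2), of \<sigma>]
  unfolding hat_solves_def gauged_def[abs_def] gauged_off_def[abs_def] .

lemma X_solves:
  assumes V: "volterra_X u0 u1 X" and k: "k \<in> col_dom C_lower C_upper c"
  shows "orig_solves c k (\<lambda>x. X x k $ c $ c) (\<lambda>x. X x k $ other c $ c)"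
    and "((\<lambda>x. X x k $ c $ c) \<longlongrightarrow> 1) at_top" and "((\<lambda>x. X x k $ other c $ c) \<longlongrightarrow> 0) at_top"
    and "hat_solves c k (gauged X c k) (gauged_off X c k)"
    and "(gauged X c k \<longlongrightarrow> 1) at_top" "(gauged_off X c k \<longlongrightarrow> 0) at_top"
proof -
  show o: "orig_solves c k (\<lambda>x. X x k $ c $ c) (\<lambda>x. X x k $ other c $ c)"
    unfolding orig_solves_def by (rule volterra_X_solves(1)[OF V k])
  show l: "((\<lambda>x. X x k $ c $ c) \<longlongrightarrow> 1) at_top" "((\<lambda>x. X x k $ other c $ c) \<longlongrightarrow> 0) at_top"
    by (rule volterra_X_solves(2)[OF V k], rule volterra_X_solves(3)[OF V k])
  show "hat_solves c k (gauged X c k) (gauged_off X c k)"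
    by (rule gauged_solves[where A = X, OF o]) (use k in \<open>simp add: col_dom_def\<close>)
  have "((\<lambda>x. \<sigma> * gC x * X x k $ c $ c + \<sigma> * sg c * (gS x * X x k $ other c $ c)) \<longlongrightarrow> 1 * 1 + \<sigma> * sg c * (0 * 0)) at_top"
    by (intro tendsto_add tendsto_mult tendsto_const gauge_limits l)
  then show "(gauged X c k \<longlongrightarrow> 1) at_top" unfolding gauged_def[abs_def] by (simp add: algebra_simps)
  have "((\<lambda>x. \<sigma> * gC x * X x k $ other c $ c - \<sigma> * sg c * (gS x * X x k $ c $ c)) \<longlongrightarrow> 1 * 0 - \<sigma> * sg c * (0 * 1)) at_top"
    by (intro tendsto_diff tendsto_mult tendsto_const gauge_limits l)
  then show "(gauged_off X c k \<longlongrightarrow> 0) at_top" unfolding gauged_off_def[abs_def] by (simp add: algebra_simps)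
qed

lemma X_trunc_tendsto:
  assumes X: "X_formal_coeffs m u0 u1 Xh"
  shows "((\<lambda>x. tr (\<lambda>j x. Xh j x $ i $ l) k x) \<longlongrightarrow> mat 1 $ i $ l) at_top"
proof -
  have 0: "Xh 0 x = mat 1" if "0 \<le> x" for x
    using X that unfolding X_formal_coeffs_def recursion_XZ_def by blast
  have L: "((\<lambda>x. Xh (int j) x $ i $ l) \<longlongrightarrow> 0) at_top" if "j \<in> {1..m+1}" for j
  proof -
    have "int j \<in> {1..int m + 1}" using that by auto
    then have "(Xh (int j) \<longlongrightarrow> 0) at_top" using X unfolding X_formal_coeffs_def by blast
    from tendsto_vec_nth[OF tendsto_vec_nth[OF this, of i], of l] show ?thesis by simp
  qed
  have "((\<lambda>x. mat 1 $ i $ l + (\<Sum>j=1..m+1. k ^ j * Xh (int j) x $ i $ l)) \<longlongrightarrow> mat 1 $ i $ l + (\<Sum>j=1..m+1. k ^ j * 0)) at_top"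
    by (intro tendsto_add tendsto_const tendsto_sum tendsto_mult L)
  then have "((\<lambda>x. mat 1 $ i $ l + (\<Sum>j=1..m+1. k ^ j * Xh (int j) x $ i $ l)) \<longlongrightarrow> mat 1 $ i $ l) at_top" by simp
  then show ?thesis
  proof (rule Lim_transform_eventually)
    show "\<forall>\<^sub>F x in at_top. mat 1 $ i $ l + (\<Sum>j=1..m+1. k ^ j * Xh (int j) x $ i $ l) = tr (\<lambda>j x. Xh j x $ i $ l) k x"
      using eventually_ge_at_top[of 0]
    proof (rule eventually_mono)
      fix x :: real assume "0 \<le> x"
      from 0[OF this] show "mat 1 $ i $ l + (\<Sum>j=1..m+1. k ^ j * Xh (int j) x $ i $ l) = tr (\<lambda>j x. Xh j x $ i $ l) k x"
        unfolding trunc_split by simp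
    qed
  qed
qed

lemma X_error_entry:
  assumes X: "X_formal_coeffs m u0 u1 Xh" and x: "0 \<le> x"
  shows "X_error m N u0 X Xh x k $ i $ c = G0 N u0 x $ i $ c * (gauged X c k x - tr (\<lambda>j x. Xh j x $ c $ c) k x)
     + G0 N u0 x $ i $ other c * (gauged_off X c k x - tr (\<lambda>j x. Xh j x $ other c $ c) k x)"
proof -
  have "Xh 0 x = mat 1" using X x unfolding X_formal_coeffs_def recursion_XZ_def by blast
  from matrix_trunc_entry[of Xh x, OF this]
  have t: "X_trunc m Xh x k $ i $ l = tr (\<lambda>j x. Xh j x $ i $ l) k x" for i l unfolding X_trunc_def .
  show ?thesis
    unfolding X_error_def vector_minus_component matrix_mult_entry[where c = c] t ungauge[of X x k i c]
    by (simp add: algebra_simps)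
qed

lemma X_expansion:
  assumes V: "volterra_X u0 u1 X" and X: "X_formal_coeffs m u0 u1 Xh"
  shows "\<exists>C>0. \<forall>x\<ge>0. \<exists>F. derivs_upto_boundary (col_dom (closure D3) (closure D2) c) n (\<lambda>k. column c (X_error m N u0 X Xh x k)) F \<and>
      (\<forall>j\<le>n. \<forall>k\<in>col_dom (closure D3) (closure D2) c. norm (F j k) \<le> C * (norm k ^ Suc m / norm k ^ (2 * j) * (1 / (1 + x) ^ (n - j))))"
proof -
  let ?S = "{k. k \<noteq> 0 \<and> norm k \<le> 1 \<and> 0 \<le> Re (hat_rate c k)}"
  have dom: "k \<in> col_dom C_lower C_upper c" if "k \<in> ?S" for k using that by (intro hat_rate_cols) auto
  have f: "hat_formal c (\<lambda>j x. Xh j x $ c $ c) (\<lambda>j x. Xh j x $ other c $ c)"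
    by (rule hat_formal_XZ) (use X in \<open>simp add: X_formal_coeffs_def\<close>)
  have lim: "((\<lambda>x. gauged X c k x - tr (\<lambda>j x. Xh j x $ c $ c) k x) \<longlongrightarrow> 0) at_top"
    "((\<lambda>x. gauged_off X c k x - tr (\<lambda>j x. Xh j x $ other c $ c) k x) \<longlongrightarrow> 0) at_top" if "k \<in> ?S" for k
    using tendsto_diff[OF X_solves(5)[OF V dom[OF that]] X_trunc_tendsto[OF X, of c c k]]
      tendsto_diff[OF X_solves(6)[OF V dom[OF that]] X_trunc_tendsto[OF X, of "other c" c k]]
    by (simp_all add: mat_def other_neq)
  obtain C where C: "0 < C" and E: "\<forall>x\<ge>0. \<exists>Gp Gq.
      boundary_derivs ?S n (\<lambda>k. gauged X c k x - tr (\<lambda>j x. Xh j x $ c $ c) k x) Gp \<and>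
      boundary_derivs ?S n (\<lambda>k. gauged_off X c k x - tr (\<lambda>j x. Xh j x $ other c $ c) k x) Gq \<and>
      (\<forall>j\<le>n. \<forall>k\<in>?S. norm (Gp j k) + norm (Gq j k) \<le> C * (norm k ^ Suc m / norm k ^ (2 * j) * (1 / (1 + x) ^ (n - j))))"
    by (rule hat_backward_expansion[OF f X_solves(4)[OF V dom] lim, THEN exE], assumption+, erule conjE, rule that)
  show ?thesis
  proof (intro exI[of _ "2 * C"] conjI allI impI)
    show "0 < 2 * C" using C by simp
    fix x :: real assume x: "0 \<le> x"
    from E[rule_format, OF x] obtain Gp Gq where
      G: "boundary_derivs ?S n (\<lambda>k. gauged X c k x - tr (\<lambda>j x. Xh j x $ c $ c) k x) Gp"
        "boundary_derivs ?S n (\<lambda>k. gauged_off X c k x - tr (\<lambda>j x. Xh j x $ other c $ c) k x) Gq"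
      and B: "\<forall>j\<le>n. \<forall>k\<in>?S. norm (Gp j k) + norm (Gq j k) \<le> C * (norm k ^ Suc m / norm k ^ (2 * j) * (1 / (1 + x) ^ (n - j)))"
      by (elim exE conjE) (rule that)
    show "\<exists>F. derivs_upto_boundary (col_dom (closure D3) (closure D2) c) n (\<lambda>k. column c (X_error m N u0 X Xh x k)) F \<and>
      (\<forall>j\<le>n. \<forall>k\<in>col_dom (closure D3) (closure D2) c. norm (F j k) \<le> 2 * C * (norm k ^ Suc m / norm k ^ (2 * j) * (1 / (1 + x) ^ (n - j))))"
      unfolding mult.assoc[of 2]
      by (rule column_derivs_from_components[OF G order_trans[OF col_dom_closure(1) Int_lower2]
            X_error_entry[OF X x] G0_entry_le_1 G0_entry_le_1 B])
  qed
qed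

lemma matrix_inv_G0_entries:
  "matrix_inv (G0 N u0 x) $ c $ c = \<sigma> * gC x" "matrix_inv (G0 N u0 x) $ other c $ c = - \<sigma> * sg c * gS x"
proof -
  define H where "H = transpose (G0 N u0 x)"
  have H: "H $ i $ l = G0 N u0 x $ l $ i" for i l by (simp add: H_def transpose_def)
  have "(H ** G0 N u0 x) $ i $ l = mat 1 $ i $ l" for i l
  proof -
    have e: "sg i * sg i = 1" using sg_cases[of i] by auto
    note g = G0_entries[of x i] G0_entries(1)[of x "other i"]
    consider "l = i" | "l = other i" using cases_other[of l i] by blast
    then show ?thesis
    proof cases
      case 1
      have "\<sigma> * gC x * (\<sigma> * gC x) + \<sigma> * sg i * gS x * (\<sigma> * sg i * gS x) = (\<sigma> * \<sigma>) * (gC x * gC x + (sg i * sg i) * (gS x * gS x))"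
        by (simp add: algebra_simps)
      then show ?thesis unfolding 1 matrix_mult_entry[where c = i] H g e \<sigma>_square using gauge_identities(1)[of x] by (simp add: mat_def)
    next
      case 2
      have "i \<noteq> other i" using other_neq[of i] by metis
      then show ?thesis unfolding 2 matrix_mult_entry[where c = i] H g by (simp add: mat_def)
    qed
  qed
  then have l: "H ** G0 N u0 x = mat 1" by (simp add: vec_eq_iff)
  then have r: "G0 N u0 x ** H = mat 1" using matrix_left_right_inverse by blast
  have "\<exists>A'. G0 N u0 x ** A' = mat 1 \<and> A' ** G0 N u0 x = mat 1" using l r by blast
  then have i: "G0 N u0 x ** matrix_inv (G0 N u0 x) = mat 1" unfolding matrix_inv_def by (rule someI2_ex) blast
  have "matrix_inv (G0 N u0 x) = (H ** G0 N u0 x) ** matrix_inv (G0 N u0 x)" unfolding l by simp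
  also have "\<dots> = H" unfolding matrix_mul_assoc[symmetric] i by simp
  finally have "matrix_inv (G0 N u0 x) = H" .
  then show "matrix_inv (G0 N u0 x) $ c $ c = \<sigma> * gC x" "matrix_inv (G0 N u0 x) $ other c $ c = - \<sigma> * sg c * gS x"
    unfolding H G0_entries by (simp_all add: H G0_entries)
qed

text \<open>The entries of \<open>G\<^sub>0(0)\<^sup>-\<^sup>1\<close> in a column; they are the initial values of \<open>G\<^sub>0\<^sup>-\<^sup>1 Y\<close>.\<close>
definition v_diag :: complex where "v_diag = \<sigma> * gC 0"
definition v_off :: "2 \<Rightarrow> complex" where "v_off c = - \<sigma> * sg c * gS 0"

lemma v_norms: "norm v_diag \<le> 1" "norm (v_off c) \<le> 1"
  using G0_entry_le_1[of 0 c c] G0_entry_le_1[of 0 c "other c"] unfolding G0_entries v_diag_def v_off_def .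

lemma Y_solves:
  assumes V: "volterra_Y u0 u1 Y" and k: "k \<noteq> 0"
  shows "orig_solves c k (\<lambda>x. Y x k $ c $ c) (\<lambda>x. Y x k $ other c $ c)"
    and "hat_solves c k (gauged Y c k) (gauged_off Y c k)"
    and "gauged Y c k 0 = v_diag" "gauged_off Y c k 0 = v_off c"
    and "Y 0 k $ c $ c = 1" "Y 0 k $ other c $ c = 0"
proof -
  show o: "orig_solves c k (\<lambda>x. Y x k $ c $ c) (\<lambda>x. Y x k $ other c $ c)"
    unfolding orig_solves_def by (rule volterra_Y_solves(1)[OF V k])
  show "hat_solves c k (gauged Y c k) (gauged_off Y c k)" by (rule gauged_solves[where A = Y, OF o k])
  note Y0 = volterra_Y_solves(2)[OF V k]
  show "gauged Y c k 0 = v_diag" "gauged_off Y c k 0 = v_off c" "Y 0 k $ c $ c = 1" "Y 0 k $ other c $ c = 0"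
    unfolding gauged_def gauged_off_def Y0 v_diag_def v_off_def by (simp_all add: mat_def other_neq)
qed

text \<open>The coefficients of \<open>Y_formal e^{-i \<theta>\<^sub>1 x \<sigma>\<^sub>3} G\<^sub>0(0)\<^sup>-\<^sup>1 e^{i \<theta>\<^sub>1 x \<sigma>\<^sub>3}\<close> in entry \<open>(i, c)\<close> without
  exponential factor. They mix the column \<open>c\<close> of \<open>Z\<close> with the other column of \<open>W\<close>, whose exponential is
  cancelled by the one of the conjugated \<open>G\<^sub>0(0)\<^sup>-\<^sup>1\<close>.\<close>
definition Y_direct :: "(int \<Rightarrow> real \<Rightarrow> cmat) \<Rightarrow> (int \<Rightarrow> real \<Rightarrow> cmat) \<Rightarrow> 2 \<Rightarrow> 2 \<Rightarrow> int \<Rightarrow> real \<Rightarrow> complex" where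
  "Y_direct Z W c i = (\<lambda>j x. v_diag * Z j x $ i $ c + v_off c * W j x $ i $ other c)"
text \<open>The coefficients of the terms with the factor \<open>exp (rate x)\<close>.\<close>
definition Y_osc :: "(int \<Rightarrow> real \<Rightarrow> cmat) \<Rightarrow> (int \<Rightarrow> real \<Rightarrow> cmat) \<Rightarrow> 2 \<Rightarrow> 2 \<Rightarrow> int \<Rightarrow> real \<Rightarrow> complex" where
  "Y_osc Z W c i = (\<lambda>j x. v_off c * Z j x $ i $ other c + v_diag * W j x $ i $ c)"

text \<open>By \<open>Z j 0 + W j 0 = 0\<close> only the orders zero survive at \<open>x = 0\<close>, and these give the initial values.\<close>
lemma Y_formal_pieces:
  assumes F: "Y_formal_coeffs m u0 u1 Zh Wh"
  shows "hat_formal c (Y_direct Zh Wh c c) (Y_direct Zh Wh c (other c))"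
    and "hat_formal (other c) (Y_osc Zh Wh c (other c)) (Y_osc Zh Wh c c)"
    and "tr (Y_direct Zh Wh c c) k 0 + tr (Y_osc Zh Wh c c) k 0 = v_diag"
    and "tr (Y_direct Zh Wh c (other c)) k 0 + tr (Y_osc Zh Wh c (other c)) k 0 = v_off c"
proof -
  have ZW: "recursion_XZ m u0 u1 Zh" "recursion_W m u0 u1 Wh" "\<forall>j\<in>{1..int m + 1}. Zh j 0 + Wh j 0 = 0"
    using F unfolding Y_formal_coeffs_def by blast+
  show "hat_formal c (Y_direct Zh Wh c c) (Y_direct Zh Wh c (other c))"
    unfolding Y_direct_def by (rule hat_formal_lincomb[OF hat_formal_XZ[OF ZW(1)] hat_formal_W[OF ZW(2)]])
  show "hat_formal (other c) (Y_osc Zh Wh c (other c)) (Y_osc Zh Wh c c)"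
    unfolding Y_osc_def
    using hat_formal_lincomb[OF hat_formal_XZ[OF ZW(1), of "other c"] hat_formal_W[OF ZW(2), of "other c"], of "v_off c" v_diag]
    unfolding other_other .
  have Z0: "Zh 0 0 = mat 1" "Wh 0 0 = 0" using ZW(1,2) unfolding recursion_XZ_def recursion_W_def by auto
  have zw: "tr (\<lambda>j x. Zh j x $ i $ l) k 0 + tr (\<lambda>j x. Wh j x $ i $ l) k 0 = mat 1 $ i $ l" for i l
  proof -
    have z: "k ^ j * Zh (int j) 0 $ i $ l + k ^ j * Wh (int j) 0 $ i $ l = 0" if "j \<in> {1..m+1}" for j
    proof -
      have "int j \<in> {1..int m + 1}" using that by auto
      with ZW(3) have "Zh (int j) 0 + Wh (int j) 0 = 0" by blast
      then have "(Zh (int j) 0 + Wh (int j) 0) $ i $ l = 0" by simp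
      then have "Zh (int j) 0 $ i $ l + Wh (int j) 0 $ i $ l = 0" by simp
      then show ?thesis unfolding distrib_left[symmetric] by simp
    qed
    have "(\<Sum>j=1..m+1. k ^ j * Zh (int j) 0 $ i $ l) + (\<Sum>j=1..m+1. k ^ j * Wh (int j) 0 $ i $ l) = 0"
      unfolding sum.distrib[symmetric] by (rule sum.neutral) (use z in blast)
    then show ?thesis unfolding trunc_split Z0 by (simp add: algebra_simps del: sum.cl_ivl_Suc)
  qed
  have s: "(a * tr (\<lambda>j x. Zh j x $ i $ l) k 0 + b * tr (\<lambda>j x. Wh j x $ i $ l') k 0)
      + (b * tr (\<lambda>j x. Zh j x $ i $ l') k 0 + a * tr (\<lambda>j x. Wh j x $ i $ l) k 0) = a * mat 1 $ i $ l + b * mat 1 $ i $ l'" for a b i l l'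
    unfolding zw[symmetric] by (simp add: algebra_simps)
  have "c \<noteq> other c" using other_neq[of c] by metis
  then show "tr (Y_direct Zh Wh c c) k 0 + tr (Y_osc Zh Wh c c) k 0 = v_diag"
    "tr (Y_direct Zh Wh c (other c)) k 0 + tr (Y_osc Zh Wh c (other c)) k 0 = v_off c"
    unfolding Y_direct_def Y_osc_def trunc_lincomb s by (simp_all add: mat_def other_neq)
qed

lemma Y_error_entry:
  assumes F: "Y_formal_coeffs m u0 u1 Zh Wh" and x: "0 \<le> x"
  shows "Y_error m N u0 Y Zh Wh x k $ i $ c =
     G0 N u0 x $ i $ c * (gauged Y c k x - tr (Y_direct Zh Wh c c) k x - exp (hat_rate c k * of_real x) * tr (Y_osc Zh Wh c c) k x)
     + G0 N u0 x $ i $ other c * (gauged_off Y c k x - tr (Y_direct Zh Wh c (other c)) k x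
           - exp (hat_rate c k * of_real x) * tr (Y_osc Zh Wh c (other c)) k x)"
proof -
  define E where "E = exp (hat_rate c k * of_real x)"
  have ZW: "recursion_XZ m u0 u1 Zh" "recursion_W m u0 u1 Wh" using F unfolding Y_formal_coeffs_def by blast+
  have Z0: "Zh 0 x = mat 1" and W0: "Wh 0 x = 0" using ZW x unfolding recursion_XZ_def recursion_W_def by auto
  define z w where "z i l = tr (\<lambda>j x. Zh j x $ i $ l) k x" and "w i l = tr (\<lambda>j x. Wh j x $ i $ l) k x" for i l
  have T: "Y_trunc m Zh Wh x k $ i $ l = z i l + w i l * exp (hat_rate l k * of_real x)" for i l
  proof -
    have "(\<Sum>j=1..m+1. (k ^ j) *k Wh (int j) x) $ i $ l = w i l"
      using matrix_trunc_entry[of Wh x 0 k i l, OF W0] unfolding w_def by simp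
    note Ws = this
    have "Y_trunc m Zh Wh x k $ i $ l = (mat 1 + (\<Sum>j=1..m+1. (k ^ j) *k Zh (int j) x)) $ i $ l
        + ((\<Sum>j=1..m+1. (k ^ j) *k Wh (int j) x) ** exp_s3 (2 * \<i> * theta1 k * of_real x)) $ i $ l"
      unfolding Y_trunc_def by (simp only: vector_add_component)
    then show ?thesis
      unfolding exp_s3_mult_right hat_rate_theta1 matrix_trunc_entry[of Zh x, OF Z0] Ws z_def .
  qed
  define H where "H = exp_s3_hat (- \<i> * theta1 k * of_real x) (matrix_inv (G0 N u0 0))"
  have Hc: "H $ c $ c = v_diag" unfolding H_def exp_s3_hat_entry matrix_inv_G0_entries v_diag_def by simp
  have "(sg (other c) - sg c) * (- \<i> * theta1 k * of_real x) = - ((sg (other c) - sg c) * (\<i> * theta1 k * of_real x))" by simp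
  also have "\<dots> = hat_rate c k * of_real x" unfolding theta1_exponent hat_rate_def by simp
  finally have Hd: "H $ other c $ c = E * v_off c" unfolding H_def exp_s3_hat_entry matrix_inv_G0_entries v_off_def E_def by simp
  have E1: "exp (hat_rate (other c) k * of_real x) * E = 1"
    unfolding E_def hat_rate_other exp_add[symmetric] by simp
  have P: "(Y_trunc m Zh Wh x k ** H) $ l $ c = tr (Y_direct Zh Wh c l) k x + E * tr (Y_osc Zh Wh c l) k x" for l
  proof -
    have "(Y_trunc m Zh Wh x k ** H) $ l $ c = (z l c + w l c * E) * v_diag + (z l (other c) + w l (other c) * exp (hat_rate (other c) k * of_real x)) * (E * v_off c)"
      unfolding matrix_mult_entry[where c = c] T Hc Hd E_def[symmetric] ..
    also have "\<dots> = (z l c + w l c * E) * v_diag + z l (other c) * E * v_off c + w l (other c) * (exp (hat_rate (other c) k * of_real x) * E) * v_off c"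
      by (simp add: algebra_simps)
    also have "\<dots> = (v_diag * z l c + v_off c * w l (other c)) + E * (v_off c * z l (other c) + v_diag * w l c)"
      unfolding E1 by (simp add: algebra_simps)
    finally show ?thesis unfolding Y_direct_def Y_osc_def trunc_lincomb z_def w_def .
  qed
  show ?thesis
    unfolding Y_error_def H_def[symmetric] matrix_mul_assoc[symmetric] vector_minus_component
      matrix_mult_entry[of "G0 N u0 x", where c = c] P ungauge[of Y x k i c] E_def[symmetric]
    by (simp add: algebra_simps)
qed

lemma Y_expansion:
  assumes V: "volterra_Y u0 u1 Y" and F: "Y_formal_coeffs m u0 u1 Zh Wh"
  shows "\<exists>C>0. \<forall>x\<ge>0. \<exists>F. derivs_upto_boundary (col_dom (closure D2) (closure D3) c) n (\<lambda>k. column c (Y_error m N u0 Y Zh Wh x k)) F \<and>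
      (\<forall>j\<le>n. \<forall>k\<in>col_dom (closure D2) (closure D3) c. norm (F j k) \<le> C * ((1 + x) ^ j * (norm k ^ Suc m / norm k ^ (2 * j))))"
proof -
  let ?S = "{k. k \<noteq> 0 \<and> norm k \<le> 1 \<and> Re (hat_rate c k) \<le> 0}"
  note yf = Y_formal_pieces[OF F, of c]
  obtain C where C: "0 < C" and E: "\<forall>x\<ge>0. \<exists>Gp Gq.
      boundary_derivs ?S n (\<lambda>k. gauged Y c k x - tr (Y_direct Zh Wh c c) k x - exp (hat_rate c k * of_real x) * tr (Y_osc Zh Wh c c) k x) Gp \<and>
      boundary_derivs ?S n (\<lambda>k. gauged_off Y c k x - tr (Y_direct Zh Wh c (other c)) k x - exp (hat_rate c k * of_real x) * tr (Y_osc Zh Wh c (other c)) k x) Gq \<and>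
      (\<forall>j\<le>n. \<forall>k\<in>?S. norm (Gp j k) + norm (Gq j k) \<le> C * (1 + x) ^ j * (norm k ^ Suc m / norm k ^ (2 * j)))"
    by (rule hat_forward_expansion[OF yf(1,2) Y_solves(2)[OF V] conjI[OF Y_solves(3)[OF V] Y_solves(4)[OF V]] conjI[OF yf(3,4)], THEN exE],
        assumption+, erule conjE, rule that)
  show ?thesis
  proof (intro exI[of _ "2 * C"] conjI allI impI)
    show "0 < 2 * C" using C by simp
    fix x :: real assume x: "0 \<le> x"
    from E[rule_format, OF x] obtain Gp Gq where
      G: "boundary_derivs ?S n (\<lambda>k. gauged Y c k x - tr (Y_direct Zh Wh c c) k x - exp (hat_rate c k * of_real x) * tr (Y_osc Zh Wh c c) k x) Gp"
        "boundary_derivs ?S n (\<lambda>k. gauged_off Y c k x - tr (Y_direct Zh Wh c (other c)) k x - exp (hat_rate c k * of_real x) * tr (Y_osc Zh Wh c (other c)) k x) Gq"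
      and B: "\<forall>j\<le>n. \<forall>k\<in>?S. norm (Gp j k) + norm (Gq j k) \<le> C * (1 + x) ^ j * (norm k ^ Suc m / norm k ^ (2 * j))"
      by (elim exE conjE) (rule that)
    show "\<exists>F. derivs_upto_boundary (col_dom (closure D2) (closure D3) c) n (\<lambda>k. column c (Y_error m N u0 Y Zh Wh x k)) F \<and>
      (\<forall>j\<le>n. \<forall>k\<in>col_dom (closure D2) (closure D3) c. norm (F j k) \<le> 2 * C * ((1 + x) ^ j * (norm k ^ Suc m / norm k ^ (2 * j))))"
      unfolding mult.assoc[of 2]
      by (rule column_derivs_from_components[OF G order_trans[OF col_dom_closure(2) Int_lower2]
            Y_error_entry[OF F x] G0_entry_le_1 G0_entry_le_1 B[unfolded mult.assoc]])
  qed
qed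

text \<open>Multiplied by \<open>exp (-rate x)\<close>, the error of column \<open>c\<close> is the error of a solution for the other
  column in which \<open>Y_direct\<close> and \<open>Y_osc\<close> have changed places.\<close>
lemma Y_expansion_opposite:
  assumes V: "volterra_Y u0 u1 Y" and F: "Y_formal_coeffs m u0 u1 Zh Wh"
  shows "\<exists>C>0. \<forall>x\<ge>0. \<exists>F. derivs_upto_boundary (col_dom (closure D3) (closure D2) c) n
        (\<lambda>k. column c (Y_error m N u0 Y Zh Wh x k ** exp_s3 (- 2 * \<i> * theta1 k * of_real x))) F \<and>
      (\<forall>j\<le>n. \<forall>k\<in>col_dom (closure D3) (closure D2) c. norm (F j k) \<le> C * ((1 + x) ^ j * (norm k ^ Suc m / norm k ^ (2 * j))))"
proof -
  let ?S = "{k. k \<noteq> 0 \<and> norm k \<le> 1 \<and> Re (hat_rate (other c) k) \<le> 0}"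
  note yf = Y_formal_pieces[OF F, of c]
  have sol: "hat_solves (other c) k (\<lambda>x. exp (- hat_rate c k * of_real x) * gauged_off Y c k x)
      (\<lambda>x. exp (- hat_rate c k * of_real x) * gauged Y c k x)" if "k \<noteq> 0" for k
    by (rule hat_solves_swap[OF Y_solves(2)[OF V that]])
  have init: "exp (- hat_rate c k * of_real 0) * gauged_off Y c k 0 = v_off c \<and> exp (- hat_rate c k * of_real 0) * gauged Y c k 0 = v_diag"
    if "k \<noteq> 0" for k using Y_solves(3,4)[OF V that, of c] by simp
  have match: "tr (Y_osc Zh Wh c (other c)) k 0 + tr (Y_direct Zh Wh c (other c)) k 0 = v_off c \<and>
      tr (Y_osc Zh Wh c c) k 0 + tr (Y_direct Zh Wh c c) k 0 = v_diag" for k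
    using yf(3,4)[of k] by (simp add: add.commute)
  have yf1: "hat_formal (other (other c)) (Y_direct Zh Wh c c) (Y_direct Zh Wh c (other c))" using yf(1) by simp
  obtain C where C: "0 < C" and E: "\<forall>x\<ge>0. \<exists>Gp Gq.
      boundary_derivs ?S n (\<lambda>k. exp (- hat_rate c k * of_real x) * gauged_off Y c k x - tr (Y_osc Zh Wh c (other c)) k x
          - exp (hat_rate (other c) k * of_real x) * tr (Y_direct Zh Wh c (other c)) k x) Gp \<and>
      boundary_derivs ?S n (\<lambda>k. exp (- hat_rate c k * of_real x) * gauged Y c k x - tr (Y_osc Zh Wh c c) k x
          - exp (hat_rate (other c) k * of_real x) * tr (Y_direct Zh Wh c c) k x) Gq \<and>
      (\<forall>j\<le>n. \<forall>k\<in>?S. norm (Gp j k) + norm (Gq j k) \<le> C * (1 + x) ^ j * (norm k ^ Suc m / norm k ^ (2 * j)))"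
    by (rule hat_forward_expansion[OF yf(2) yf1 sol init match, THEN exE], assumption+, erule conjE, rule that)
  show ?thesis
  proof (intro exI[of _ "2 * C"] conjI allI impI)
    show "0 < 2 * C" using C by simp
    fix x :: real assume x: "0 \<le> x"
    from E[rule_format, OF x] obtain Gp Gq where
      G: "boundary_derivs ?S n (\<lambda>k. exp (- hat_rate c k * of_real x) * gauged_off Y c k x - tr (Y_osc Zh Wh c (other c)) k x
          - exp (hat_rate (other c) k * of_real x) * tr (Y_direct Zh Wh c (other c)) k x) Gp"
        "boundary_derivs ?S n (\<lambda>k. exp (- hat_rate c k * of_real x) * gauged Y c k x - tr (Y_osc Zh Wh c c) k x
          - exp (hat_rate (other c) k * of_real x) * tr (Y_direct Zh Wh c c) k x) Gq"
      and B: "\<forall>j\<le>n. \<forall>k\<in>?S. norm (Gp j k) + norm (Gq j k) \<le> C * (1 + x) ^ j * (norm k ^ Suc m / norm k ^ (2 * j))"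
      by (elim exE conjE) (rule that)
    have e: "(Y_error m N u0 Y Zh Wh x k ** exp_s3 (- 2 * \<i> * theta1 k * of_real x)) $ i $ c
       = G0 N u0 x $ i $ other c * (exp (- hat_rate c k * of_real x) * gauged_off Y c k x - tr (Y_osc Zh Wh c (other c)) k x
          - exp (hat_rate (other c) k * of_real x) * tr (Y_direct Zh Wh c (other c)) k x)
       + G0 N u0 x $ i $ c * (exp (- hat_rate c k * of_real x) * gauged Y c k x - tr (Y_osc Zh Wh c c) k x
          - exp (hat_rate (other c) k * of_real x) * tr (Y_direct Zh Wh c c) k x)" for k i
    proof -
      define e e' where "e = exp (hat_rate c k * of_real x)" and "e' = exp (- hat_rate c k * of_real x)"
      have ee: "e * e' = 1" unfolding e_def e'_def exp_add[symmetric] by simp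
      have 1: "exp (sg c * (- 2 * \<i> * theta1 k * of_real x)) = e'" unfolding hat_rate_theta1_minus e'_def ..
      have "(g * (y - d - e * w) + g' * (y' - d' - e * w')) * e' = g' * (e' * y' - w' * (e * e') - e' * d') + g * (e' * y - w * (e * e') - e' * d)"
        for g g' y y' d d' w w' by (simp add: algebra_simps)
      then show ?thesis
        unfolding exp_s3_mult_right 1 Y_error_entry[OF F x] hat_rate_other e_def[symmetric] e'_def[symmetric] ee by simp
    qed
    have dom: "col_dom (closure D3) (closure D2) c \<subseteq> ?S"
      using col_dom_closure(1)[of c] unfolding hat_rate_other by auto
    show "\<exists>F. derivs_upto_boundary (col_dom (closure D3) (closure D2) c) n
        (\<lambda>k. column c (Y_error m N u0 Y Zh Wh x k ** exp_s3 (- 2 * \<i> * theta1 k * of_real x))) F \<and>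
      (\<forall>j\<le>n. \<forall>k\<in>col_dom (closure D3) (closure D2) c. norm (F j k) \<le> 2 * C * ((1 + x) ^ j * (norm k ^ Suc m / norm k ^ (2 * j))))"
      unfolding mult.assoc[of 2]
      by (rule column_derivs_from_components[OF G dom e G0_entry_le_1 G0_entry_le_1 B[unfolded mult.assoc]])
  qed
qed

lemma ungauged_entry_le: "norm (A x k $ i $ c) \<le> norm (gauged A c k x) + norm (gauged_off A c k x)"
proof -
  have "norm (A x k $ i $ c) \<le> norm (G0 N u0 x $ i $ c) * norm (gauged A c k x) + norm (G0 N u0 x $ i $ other c) * norm (gauged_off A c k x)"
    unfolding ungauge[of A x k i c] by (rule order_trans[OF norm_triangle_ineq]) (simp add: norm_mult)
  also have "\<dots> \<le> 1 * norm (gauged A c k x) + 1 * norm (gauged_off A c k x)"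
    by (intro add_mono mult_right_mono G0_entry_le_1 norm_ge_zero)
  finally show ?thesis by simp
qed

lemma entry_le_sum: "norm ((A::cmat) $ i $ c) \<le> norm (A $ c $ c) + norm (A $ other c $ c)"
  using cases_other[of i c] by auto

text \<open>In either gauge the spectral parameter of the system (\<open>k\<close> or \<open>1/k\<close>) lies in the unit disc, where the
  Gronwall bound is uniform.\<close>
lemma X_bounded:
  assumes V: "volterra_X u0 u1 X" and x: "0 \<le> x"
  shows "columns_bounded C_lower C_upper (X x)"
  unfolding columns_bounded_def
proof
  fix c
  obtain B1 where B1: "0 < B1" "\<And>k p q x a b. hat_solves c k p q \<Longrightarrow> norm k \<le> 1 \<Longrightarrow> 0 \<le> Re (hat_rate c k) \<Longrightarrow> 0 \<le> x \<Longrightarrow>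
     (p \<longlongrightarrow> a) at_top \<Longrightarrow> (q \<longlongrightarrow> b) at_top \<Longrightarrow> norm (p x) + norm (q x) \<le> B1 * (norm a + norm b)"
    by (fact hat_backward_bounded[where c = c])
  obtain B2 where B2: "0 < B2" "\<And>k p q x a b. orig_solves c k p q \<Longrightarrow> 1 \<le> norm k \<Longrightarrow> 0 \<le> Re (hat_rate c k) \<Longrightarrow> 0 \<le> x \<Longrightarrow>
     (p \<longlongrightarrow> a) at_top \<Longrightarrow> (q \<longlongrightarrow> b) at_top \<Longrightarrow> norm (p x) + norm (q x) \<le> B2 * (norm a + norm b)"
    by (fact orig_backward_bounded[where c = c])
  show "bounded ((\<lambda>k. column c (X x k)) ` col_dom C_lower C_upper c)"
  proof (rule bounded_columnI)
    fix k i assume k: "k \<in> col_dom C_lower C_upper c"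
    then have k0: "k \<noteq> 0" by (simp add: col_dom_def)
    note s = X_solves[OF V k] and re = Re_hat_rate(1)[OF k0 k]
    show "norm (X x k $ i $ c) \<le> B1 + B2"
    proof (cases "norm k \<le> 1")
      case True
      show ?thesis using ungauged_entry_le[of X x k i c] B1(2)[OF s(4) True re x s(5,6)] B2(1) by simp
    next
      case False
      then have "1 \<le> norm k" by simp
      from B2(2)[OF s(1) this re x s(2,3)] show ?thesis using entry_le_sum[of "X x k" i c] B1(1) by simp
    qed
  qed
qed

lemma Y_bounded:
  assumes V: "volterra_Y u0 u1 Y" and x: "0 \<le> x"
  shows "columns_bounded C_upper C_lower (Y x)"
  unfolding columns_bounded_def
proof
  fix c
  obtain B1 where B1: "0 < B1" "\<And>k p q x. hat_solves c k p q \<Longrightarrow> norm k \<le> 1 \<Longrightarrow> Re (hat_rate c k) \<le> 0 \<Longrightarrow> 0 \<le> x \<Longrightarrow>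
     norm (p x) + norm (q x) \<le> B1 * (norm (p 0) + norm (q 0))" by (fact hat_forward_bounded[where c = c])
  obtain B2 where B2: "0 < B2" "\<And>k p q x. orig_solves c k p q \<Longrightarrow> 1 \<le> norm k \<Longrightarrow> Re (hat_rate c k) \<le> 0 \<Longrightarrow> 0 \<le> x \<Longrightarrow>
     norm (p x) + norm (q x) \<le> B2 * (norm (p 0) + norm (q 0))" by (fact orig_forward_bounded[where c = c])
  have v: "B1 * (norm v_diag + norm (v_off c)) \<le> B1 * 2" by (rule mult_left_mono) (use v_norms(1) v_norms(2)[of c] B1(1) in simp_all)
  show "bounded ((\<lambda>k. column c (Y x k)) ` col_dom C_upper C_lower c)"
  proof (rule bounded_columnI)
    fix k i assume k: "k \<in> col_dom C_upper C_lower c"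
    then have k0: "k \<noteq> 0" by (simp add: col_dom_def)
    note s = Y_solves[OF V k0, of c] and re = Re_hat_rate(2)[OF k0 k]
    show "norm (Y x k $ i $ c) \<le> B1 * 2 + B2"
    proof (cases "norm k \<le> 1")
      case True
      show ?thesis using ungauged_entry_le[of Y x k i c] B1(2)[OF s(2) True re x, unfolded s(3,4)] v B2(1) by simp
    next
      case False
      then have "1 \<le> norm k" by simp
      from B2(2)[OF s(1) this re x, unfolded s(5,6)] show ?thesis using entry_le_sum[of "Y x k" i c] B1(1) by simp
    qed
  qed
qed

lemma Y_bounded_opposite:
  assumes V: "volterra_Y u0 u1 Y" and x: "0 \<le> x"
  shows "columns_bounded C_lower C_upper (\<lambda>k. Y x k ** exp_s3 (- 2 * \<i> * theta1 k * of_real x))"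
  unfolding columns_bounded_def
proof
  fix c
  obtain B1 where B1: "0 < B1" "\<And>k p q x. hat_solves (other c) k p q \<Longrightarrow> norm k \<le> 1 \<Longrightarrow> Re (hat_rate (other c) k) \<le> 0 \<Longrightarrow> 0 \<le> x \<Longrightarrow>
     norm (p x) + norm (q x) \<le> B1 * (norm (p 0) + norm (q 0))" by (fact hat_forward_bounded[where c = "other c"])
  obtain B2 where B2: "0 < B2" "\<And>k p q x. orig_solves (other c) k p q \<Longrightarrow> 1 \<le> norm k \<Longrightarrow> Re (hat_rate (other c) k) \<le> 0 \<Longrightarrow> 0 \<le> x \<Longrightarrow>
     norm (p x) + norm (q x) \<le> B2 * (norm (p 0) + norm (q 0))" by (fact orig_forward_bounded[where c = "other c"])
  have v: "B1 * (norm v_diag + norm (v_off c)) \<le> B1 * 2" by (rule mult_left_mono) (use v_norms(1) v_norms(2)[of c] B1(1) in simp_all)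
  show "bounded ((\<lambda>k. column c (Y x k ** exp_s3 (- 2 * \<i> * theta1 k * of_real x))) ` col_dom C_lower C_upper c)"
  proof (rule bounded_columnI)
    fix k i assume k: "k \<in> col_dom C_lower C_upper c"
    then have k0: "k \<noteq> 0" by (simp add: col_dom_def)
    define e where "e = norm (exp (- hat_rate c k * of_real x))"
    note s = Y_solves[OF V k0, of c]
    have re: "Re (hat_rate (other c) k) \<le> 0" using Re_hat_rate(1)[OF k0 k] unfolding hat_rate_other by simp
    have n: "norm ((Y x k ** exp_s3 (- 2 * \<i> * theta1 k * of_real x)) $ i $ c) = e * norm (Y x k $ i $ c)"
      unfolding exp_s3_mult_right hat_rate_theta1_minus e_def norm_mult by (rule mult.commute)
    have e0: "0 \<le> e" by (simp add: e_def)
    show "norm ((Y x k ** exp_s3 (- 2 * \<i> * theta1 k * of_real x)) $ i $ c) \<le> B1 * 2 + B2"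
    proof (cases "norm k \<le> 1")
      case True
      have "e * norm (gauged_off Y c k x) + e * norm (gauged Y c k x) \<le> B1 * (norm v_diag + norm (v_off c))"
        using B1(2)[OF hat_solves_swap[OF s(2)] True re x] unfolding s(3,4) norm_mult e_def[symmetric]
        by (simp add: add.commute)
      moreover have "e * norm (Y x k $ i $ c) \<le> e * (norm (gauged Y c k x) + norm (gauged_off Y c k x))"
        by (rule mult_left_mono[OF ungauged_entry_le e0])
      ultimately show ?thesis unfolding n using v B2(1) by (simp add: distrib_left)
    next
      case False
      then have k1: "1 \<le> norm k" by simp
      have "e * norm (Y x k $ other c $ c) + e * norm (Y x k $ c $ c) \<le> B2"
        using B2(2)[OF orig_solves_swap[OF s(1)] k1 re x] unfolding s(5,6) norm_mult e_def[symmetric] by simp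
      moreover have "e * norm (Y x k $ i $ c) \<le> e * (norm (Y x k $ c $ c) + norm (Y x k $ other c $ c))"
        by (rule mult_left_mono[OF entry_le_sum e0])
      ultimately show ?thesis unfolding n using B1(1) by (simp add: distrib_left)
    qed
  qed
qed

end

section \<open>The theorem\<close>

lemma column_derivs_boundedI:
  assumes "\<forall>c. \<exists>F. derivs_upto_boundary (col_dom A B c) n (\<lambda>k. column c (E k)) F \<and> (\<forall>j\<le>n. \<forall>k\<in>col_dom A B c. norm (F j k) \<le> b j k)"
    and le: "\<And>j k. k \<noteq> 0 \<Longrightarrow> b j k \<le> b' j k"
  shows "column_derivs_bounded A B n E b'"
  unfolding column_derivs_bounded_def
proof
  fix c
  from assms(1)[rule_format, of c] obtain F where F: "derivs_upto_boundary (col_dom A B c) n (\<lambda>k. column c (E k)) F"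
    "\<forall>j\<le>n. \<forall>k\<in>col_dom A B c. norm (F j k) \<le> b j k" by (elim exE conjE) (rule that)
  have "norm (F j k) \<le> b' j k" if j: "j \<le> n" and k: "k \<in> col_dom A B c" for j k
    by (rule order_trans[OF F(2)[rule_format, OF j k] le]) (use k in \<open>simp add: col_dom_def\<close>)
  then show "\<exists>F. derivs_upto_boundary (col_dom A B c) n (\<lambda>k. column c (E k)) F \<and> (\<forall>j\<le>n. \<forall>k\<in>col_dom A B c. norm (F j k) \<le> b' j k)"
    by (intro exI[of _ F] conjI F(1) allI impI ballI)
qed

lemma growing_bound_le:
  assumes "0 \<le> C'" "C' \<le> C" "0 \<le> (x::real)" "k \<noteq> 0"
  shows "C' * ((1 + x) ^ j * (norm k ^ Suc m / norm k ^ (2 * j)))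
    \<le> C * (1 + x) ^ (j + 2) * cmod k powi (int m + 1 - 2 * int j) * exp (C * x * cmod k ^ (m + 1))"
proof -
  have p: "(1 + x) ^ j \<le> (1 + x) ^ (j + 2)" by (rule power_increasing) (use assms in auto)
  have e: "1 \<le> exp (C * x * cmod k ^ (m + 1))" using assms by simp
  have "C' * (1 + x) ^ j \<le> C * (1 + x) ^ (j + 2)" by (rule mult_mono) (use assms p in auto)
  then have "C' * (1 + x) ^ j * (norm k ^ Suc m / norm k ^ (2 * j)) \<le> C * (1 + x) ^ (j + 2) * (norm k ^ Suc m / norm k ^ (2 * j))"
    by (rule mult_right_mono) simp
  also have "\<dots> = C * (1 + x) ^ (j + 2) * (norm k ^ Suc m / norm k ^ (2 * j)) * 1" by simp
  also have "\<dots> \<le> C * (1 + x) ^ (j + 2) * (norm k ^ Suc m / norm k ^ (2 * j)) * exp (C * x * cmod k ^ (m + 1))"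
    by (rule mult_left_mono[OF e]) (use assms in simp)
  finally show ?thesis unfolding powi_split[OF assms(4)] by (simp add: mult.assoc)
qed

theorem corollary3p23:
  fixes m n :: nat and Nx :: int
    and u0 u1 :: "real \<Rightarrow> real"
    and X Y :: "real \<Rightarrow> complex \<Rightarrow> complex^2^2"
    and Xh Zh Wh :: "int \<Rightarrow> real \<Rightarrow> complex^2^2"
  assumes "m \<ge> 1" and "n \<ge> 1"
    and "continuous_on {0..} u0" and "continuous_on {0..} u1"
    and "weighted_L1 n (\<lambda>x. u0 x - 2 * pi * of_int Nx)"
    and "\<And>i. i \<in> {1..m+2} \<Longrightarrow> weak_deriv_weighted_L1 n i u0"
    and "weighted_L1 n u1"
    and "\<And>i. i \<in> {1..m+1} \<Longrightarrow> weak_deriv_weighted_L1 n i u1"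
    and "volterra_X u0 u1 X"
    and "volterra_Y u0 u1 Y"
    and "X_formal_coeffs m u0 u1 Xh"
    and "Y_formal_coeffs m u0 u1 Zh Wh"
  shows
    "(\<exists>C>0.
       (\<forall>x\<ge>0. column_derivs_bounded (closure D3) (closure D2) n
          (X_error m Nx u0 X Xh x)
          (\<lambda>j k. C * cmod k powi (int m + 1 - 2 * int j) / (1 + x) ^ (n - j))) \<and>
       (\<forall>x\<ge>0. column_derivs_bounded (closure D2) (closure D3) n
          (Y_error m Nx u0 Y Zh Wh x)
          (\<lambda>j k. C * (1 + x) ^ (j + 2) * cmod k powi (int m + 1 - 2 * int j)
                   * exp (C * x * cmod k ^ (m + 1)))) \<and>
       (\<forall>x\<ge>0. column_derivs_bounded (closure D3) (closure D2) n
          (\<lambda>k. Y_error m Nx u0 Y Zh Wh x k ** exp_s3 (- 2 * \<i> * theta1 k * of_real x))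
          (\<lambda>j k. C * (1 + x) ^ (j + 2) * cmod k powi (int m + 1 - 2 * int j)
                   * exp (C * x * cmod k ^ (m + 1)))))
     \<and> (\<forall>x\<ge>0. columns_bounded C_lower C_upper (X x))
     \<and> (\<forall>x\<ge>0. columns_bounded C_upper C_lower (Y x))
     \<and> (\<forall>x\<ge>0. columns_bounded C_lower C_upper
            (\<lambda>k. Y x k ** exp_s3 (- 2 * \<i> * theta1 k * of_real x)))"
proof -
  have "wsob n (m + 2) (\<lambda>x. of_real (u0 x - 2 * pi * of_int Nx))"
    by (rule weak_derivs_imp_wsob[OF assms(3,5) _ assms(6)]) simp_all
  moreover have "wsob n (m + 1) (\<lambda>x. of_real (u1 x - 0))"
    by (rule weak_derivs_imp_wsob[OF assms(4) _ _ assms(8)]) (use assms(7) in simp_all)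
  ultimately interpret potential m n Nx u0 u1 by unfold_locales simp_all
  obtain CX where CX: "0 < CX" "\<forall>x\<ge>0. \<forall>c. \<exists>F. derivs_upto_boundary (col_dom (closure D3) (closure D2) c) n (\<lambda>k. column c (X_error m Nx u0 X Xh x k)) F \<and>
      (\<forall>j\<le>n. \<forall>k\<in>col_dom (closure D3) (closure D2) c. norm (F j k) \<le> CX * (norm k ^ Suc m / norm k ^ (2 * j) * (1 / (1 + x) ^ (n - j))))"
    by (rule exE[OF uniform_column_constant], rule X_expansion[OF assms(9,11)], simp, erule conjE, rule that)
  obtain CY where CY: "0 < CY" "\<forall>x\<ge>0. \<forall>c. \<exists>F. derivs_upto_boundary (col_dom (closure D2) (closure D3) c) n (\<lambda>k. column c (Y_error m Nx u0 Y Zh Wh x k)) F \<and>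
      (\<forall>j\<le>n. \<forall>k\<in>col_dom (closure D2) (closure D3) c. norm (F j k) \<le> CY * ((1 + x) ^ j * (norm k ^ Suc m / norm k ^ (2 * j))))"
    by (rule exE[OF uniform_column_constant], rule Y_expansion[OF assms(10,12)], simp, erule conjE, rule that)
  obtain CZ where CZ: "0 < CZ" "\<forall>x\<ge>0. \<forall>c. \<exists>F. derivs_upto_boundary (col_dom (closure D3) (closure D2) c) n
        (\<lambda>k. column c (Y_error m Nx u0 Y Zh Wh x k ** exp_s3 (- 2 * \<i> * theta1 k * of_real x))) F \<and>
      (\<forall>j\<le>n. \<forall>k\<in>col_dom (closure D3) (closure D2) c. norm (F j k) \<le> CZ * ((1 + x) ^ j * (norm k ^ Suc m / norm k ^ (2 * j))))"
    by (rule exE[OF uniform_column_constant], rule Y_expansion_opposite[OF assms(10,12)], simp, erule conjE, rule that)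
  define C where "C = CX + CY + CZ"
  have C: "0 < C" "CX \<le> C" "CY \<le> C" "CZ \<le> C" using CX(1) CY(1) CZ(1) by (simp_all add: C_def)
  show ?thesis
  proof (intro conjI exI[of _ C] allI impI)
    fix x :: real assume x: "0 \<le> x"
    show "column_derivs_bounded (closure D3) (closure D2) n (X_error m Nx u0 X Xh x)
          (\<lambda>j k. C * cmod k powi (int m + 1 - 2 * int j) / (1 + x) ^ (n - j))"
    proof (rule column_derivs_boundedI[OF CX(2)[rule_format, OF x, THEN allI]])
      fix j and k :: complex assume k: "k \<noteq> 0"
      have "CX * (norm k ^ Suc m / norm k ^ (2 * j) * (1 / (1 + x) ^ (n - j))) \<le> C * (norm k ^ Suc m / norm k ^ (2 * j) * (1 / (1 + x) ^ (n - j)))"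
        by (rule mult_right_mono[OF C(2)]) (use x in simp)
      then show "CX * (norm k ^ Suc m / norm k ^ (2 * j) * (1 / (1 + x) ^ (n - j))) \<le> C * cmod k powi (int m + 1 - 2 * int j) / (1 + x) ^ (n - j)"
        unfolding powi_split[OF k] by simp
    qed
    show "column_derivs_bounded (closure D2) (closure D3) n (Y_error m Nx u0 Y Zh Wh x)
          (\<lambda>j k. C * (1 + x) ^ (j + 2) * cmod k powi (int m + 1 - 2 * int j) * exp (C * x * cmod k ^ (m + 1)))"
      by (rule column_derivs_boundedI[OF CY(2)[rule_format, OF x, THEN allI]], rule growing_bound_le) (use CY(1) C x in simp_all)
    show "column_derivs_bounded (closure D3) (closure D2) n (\<lambda>k. Y_error m Nx u0 Y Zh Wh x k ** exp_s3 (- 2 * \<i> * theta1 k * of_real x))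
          (\<lambda>j k. C * (1 + x) ^ (j + 2) * cmod k powi (int m + 1 - 2 * int j) * exp (C * x * cmod k ^ (m + 1)))"
      by (rule column_derivs_boundedI[OF CZ(2)[rule_format, OF x, THEN allI]], rule growing_bound_le) (use CZ(1) C x in simp_all)
    show "columns_bounded C_lower C_upper (X x)" by (rule X_bounded[OF assms(9) x])
    show "columns_bounded C_upper C_lower (Y x)" by (rule Y_bounded[OF assms(10) x])
    show "columns_bounded C_lower C_upper (\<lambda>k. Y x k ** exp_s3 (- 2 * \<i> * theta1 k * of_real x))"
      by (rule Y_bounded_opposite[OF assms(10) x])
  qed (rule C(1))
qed

end
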